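(* Let $E$ be a number field and let $M$ be a Betti--de Rham system of realizations over $\mathbb{Q}$ of weight $w$ with coefficients in $E$. Let $\mathsf{s}$ be a multilinear algebra structure on $M$ of which the $E$-module structure $E\to\mathrm{End}(M)$ is part. If $w$ is even, assume moreover that $M^{w/2,w/2}=0$. Let $G(\mathsf{s})_{\mathrm B}$, $Z(\mathsf{F}_\infty)$, $\chi^{\pm}_E$, $T$, $\mathsf{c}\in T(\mathbb{C})$, $P_{\mathrm{dR}}$, $K_0$ and $K_1$ be as in the context. (i) If the restrictions of $\chi^+_E$ and $\chi^-_E$ to the identity component $Z(\mathsf{F}_\infty)^0$ are equal, then $c^+_E(M)/c^-_E(M)$ is algebraic. More precisely, its class in $(E\otimes\mathbb{C})^*/E^*$ is represented by an element of $(E\otimes K_0)^*\subset(E\otimes\mathbb{C})^*$. (ii) If $\chi^+_E=\chi^-_E$ on all of $Z(\mathsf{F}_\infty)$, then the class of $c^+_E(M)/c^-_E(M)$ is represented by an element of $(E\otimes K_1)^*$. Moreover, if $G(\mathsf{s})_{\mathrm B}$ is connected, then $c^+_E(M)/c^-_E(M)\in E^*$, i.e. its class in $(E\otimes\mathbb{C})^*/E^*$ is trivial.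
   Context: Betti--de Rham systems. A Betti--de Rham system of realizations $M$ over $\mathbb{Q}$ of weight $w$ with coefficients in a number field $E$ consists of the following data: - a finite-dimensional $E$-vector space $M_{\mathrm B}$ with an $E$-linear involution $\mathsf{F}_\infty$ (the Frobenius at infinity), with $\pm1$-eigenspaces $M^{\pm}$, so that $M_{\mathrm B}=M^+\oplus M^-$; - a finite-dimensional $E$-vector space $M_{\mathrm{dR}}$ with a finite decreasing filtration $\mathcal{F}^\bullet$ by $E$-subspaces (the Hodge filtration); - an $E\otimes\mathbb{C}$-linear comparison isomorphism $\mathrm{comp}:M_{\mathrm B}\otimes_{\mathbb{Q}}\mathbb{C}\to M_{\mathrm{dR}}\otimes_{\mathbb{Q}}\mathbb{C}$ carrying $\mathsf{F}_\infty\circ\sigma_{\mathrm B}$ to $\sigma_{\mathrm{dR}}$, where $\sigma_{\mathrm B},\sigma_{\mathrm{dR}}$ denote complex conjugation on the second tensor factor. The data must satisfy one condition: after transporting $\mathcal{F}$ to $M_{\mathrm B}\otimes\mathbb{C}$ via $\mathrm{comp}$, the filtration $\mathcal{F}$ and its complex conjugate are $w$-opposite, i.e. $M_{\mathrm B}\otimes\mathbb{C}=\bigoplus_{p+q=w}M^{p,q}$ with $M^{p,q}=\mathcal{F}^p\cap\overline{\mathcal{F}}^q$. Morphisms, tensor products (over $\mathbb{Q}$) and duals $M^\vee$ are defined componentwise. The unit object is $\mathbb{Q}(0)$, given by $\mathrm B=\mathrm{dR}=\mathbb{Q}$, $\mathsf{F}_\infty=1$, $\mathcal{F}^0=\mathbb{Q}$,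 $\mathcal{F}^1=0$, with the identity comparison. Periods. When $w$ is odd, or $w=2k$ and $M^{k,k}=0$ ("vanishing middle Hodge number"), put $a=\lfloor w/2\rfloor+1$. Then the composites $M^{\pm}\otimes\mathbb{C}\to M_{\mathrm B}\otimes\mathbb{C}\xrightarrow{\mathrm{comp}}M_{\mathrm{dR}}\otimes\mathbb{C}\to(M_{\mathrm{dR}}/\mathcal{F}^a)\otimes\mathbb{C}$ are $E\otimes\mathbb{C}$-linear isomorphisms. $c^{\pm}_E(M)\in(E\otimes\mathbb{C})^*$ is defined as their determinant, computed with respect to $E$-bases of $M^{\pm}$ and $M_{\mathrm{dR}}/\mathcal{F}^a$. It is well defined in $(E\otimes\mathbb{C})^*/E^*$. Multilinear algebra structures. A multilinear algebra structure $\mathsf{s}$ on $M$ consists of two families: - morphisms of systems $t_i:\mathbb{Q}(0)\to M^{\otimes r_i}\otimes (M^\vee)^{\otimes s_i}$; - sub-objects of direct sums of such tensor systems of a common weight. The $E$-module structure is encoded by the morphisms $\mathbb{Q}(0)\to M^\vee\otimes M$ given by the actions of a $\mathbb{Q}$-basis of $E$. Groups. For $v\in\{\mathrm B,\mathrm{dR}\}$, $G(\mathsf{s})_v\subset\mathrm{GL}(M_v)$ is the algebraic subgroup fixing all $t_{i,v}(1)$ and stabilizing the $v$-realizations of the given sub-objects. Since the $E$-structure is part of $\mathsf{s}$, we have $G(\mathsf{s})_{\mathrm B}\subset\mathrm{GL}_E(M_{\mathrm B})$, and $\mathsf{F}_\infty\in G(\mathsf{s})_{\mathrm B}(\mathbb{Q})$.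 $Z(\mathsf{F}_\infty)$ is the centralizer of $\mathsf{F}_\infty$ in $G(\mathsf{s})_{\mathrm B}$; it preserves $M^{\pm}$. $\chi^{\pm}_E:Z(\mathsf{F}_\infty)\to\mathrm{Res}_{E/\mathbb{Q}}\mathbb{G}_m$ are the $E$-determinants of its actions on $M^{\pm}$. $P_{\mathrm{dR}}\subset G(\mathsf{s})_{\mathrm{dR}}$ is the subgroup respecting $\mathcal{F}$. Torsor and fields of definition. $T$ is the $\mathbb{Q}$-scheme of isomorphisms from $(M_{\mathrm B},\mathsf{s}_{\mathrm B})$ to $(M_{\mathrm{dR}},\mathsf{s}_{\mathrm{dR}})$, i.e. linear isomorphisms carrying each $t_{i,\mathrm B}(1)$ to $t_{i,\mathrm{dR}}(1)$ and each sub-object's Betti realization onto its de Rham realization. The comparison isomorphism gives $\mathsf{c}\in T(\mathbb{C})$. $G(\mathsf{s})_{\mathrm B}$ acts on $T$ by right composition and $G(\mathsf{s})_{\mathrm{dR}}$ by left composition. Let $\overline{\mathbb{Q}}$ be the algebraic closure of $\mathbb{Q}$ in $\mathbb{C}$; $\mathrm{Gal}(\overline{\mathbb{Q}}/\mathbb{Q})$ acts on the set of connected components of $T(\mathbb{C})$. $K_0\subset\mathbb{C}$ is the field of definition of the component $T(\mathbb{C})_0$ containing $\mathsf{c}$, i.e. the fixed field of its stabilizer. $K_1\subset K_0$ is the field of definition of the union of components $P_{\mathrm{dR}}(\mathbb{C})\,T(\mathbb{C})_0\,Z(\mathsf{F}_\infty)(\mathbb{C})$. *)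

theory Defs
  imports
    "HOL-Analysis.Abstract_Topological_Spaces"
    "HOL-Computational_Algebra.Polynomial"
    "HOL-Library.Function_Algebras"
    "Jordan_Normal_Form.Determinant"
begin

section \<open>Tensor products over the rationals\<close>

text \<open>
  For fields \<open>A\<close>, \<open>B\<close> of characteristic 0, the ring \<open>A \<otimes> B\<close> over the rational
  numbers is the set of formal sums of pairs (lists), modulo the congruence generated by the
  usual relations.
\<close>

inductive tens_rel ::
    "('a::field_char_0 \<times> 'b::field_char_0) list \<Rightarrow> ('a \<times> 'b) list \<Rightarrow> bool" where
  refl: "tens_rel xs xs"
| sym: "tens_rel xs ys \<Longrightarrow> tens_rel ys xs"
| trans: "tens_rel xs ys \<Longrightarrow> tens_rel ys zs \<Longrightarrow> tens_rel xs zs"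
| append: "tens_rel xs ys \<Longrightarrow> tens_rel us vs \<Longrightarrow> tens_rel (xs @ us) (ys @ vs)"
| swap: "tens_rel (xs @ ys) (ys @ xs)"
| zero: "tens_rel [(0, b)] []"
| add_left: "tens_rel [(a + a', b)] [(a, b), (a', b)]"
| add_right: "tens_rel [(a, b + b')] [(a, b), (a, b')]"
| scale: "tens_rel [(of_rat q * a, b)] [(a, of_rat q * b)]"

quotient_type (overloaded) ('a, 'b) qtensor = "('a::field_char_0 \<times> 'b::field_char_0) list" / tens_rel
  by (intro equivpI reflpI sympI transpI) (fact tens_rel.refl, erule tens_rel.sym, erule tens_rel.trans)

definition list_times :: "('a::times \<times> 'b::times) list \<Rightarrow> ('a \<times> 'b) list \<Rightarrow> ('a \<times> 'b) list" where
  "list_times xs ys = concat (map (\<lambda>(a, b). map (\<lambda>(c, d). (a * c, b * d)) ys) xs)"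

lemma tens_rel_map:
  assumes "tens_rel xs ys"
  shows "tens_rel (map (\<lambda>(a, b). (c * a, d * b)) xs) (map (\<lambda>(a, b). (c * a, d * b)) ys)"
  using assms
proof (induction rule: tens_rel.induct)
  case (refl xs)
  show ?case by (rule tens_rel.refl)
next
  case (sym xs ys)
  from sym.IH show ?case by (rule tens_rel.sym)
next
  case (trans xs ys zs)
  from trans.IH show ?case by (rule tens_rel.trans)
next
  case (append xs ys us vs)
  from append.IH show ?case unfolding map_append by (rule tens_rel.append)
next
  case (swap xs ys)
  show ?case unfolding map_append by (rule tens_rel.swap)
next
  case (zero b)
  show ?case using tens_rel.zero[of "d * b"] by (simp only: list.map prod.case mult_zero_right)
next
  case (add_left a a' b)
  show ?case
    using tens_rel.add_left[of "c * a" "c * a'" "d * b"]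
    by (simp only: list.map prod.case distrib_left)
next
  case (add_right a b b')
  show ?case
    using tens_rel.add_right[of "c * a" "d * b" "d * b'"]
    by (simp only: list.map prod.case distrib_left)
next
  case (scale q a b)
  show ?case
    using tens_rel.scale[of q "c * a" "d * b"]
    by (simp only: list.map prod.case mult.left_commute)
qed

lemma list_times_Nil [simp]: "list_times [] ys = []" "list_times xs [] = []"
  by (induction xs) (auto simp: list_times_def)

lemma list_times_Cons:
  "list_times ((a, b) # xs) ys = map (\<lambda>(c, d). (a * c, b * d)) ys @ list_times xs ys"
  by (simp add: list_times_def)

lemma list_times_append: "list_times (xs @ us) ys = list_times xs ys @ list_times us ys"
  by (simp add: list_times_def)

lemma list_times_Cons_right:
  "tens_rel (list_times xs ((c, d) # ys)) (map (\<lambda>(a, b). (c * a, d * b)) xs @ list_times xs ys)"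
proof (induction xs)
  case Nil
  show ?case by (simp add: tens_rel.refl)
next
  case (Cons x xs)
  obtain a b where x: "x = (a, b)" by fastforce
  let ?m = "map (\<lambda>(c, d). (a * c, b * d)) ys"
  let ?n = "map (\<lambda>(a, b). (c * a, d * b)) xs"
  have "tens_rel (?m @ list_times xs ((c, d) # ys)) (?m @ (?n @ list_times xs ys))"
    by (intro tens_rel.append tens_rel.refl Cons.IH)
  moreover have "tens_rel (?m @ (?n @ list_times xs ys)) (?n @ ?m @ list_times xs ys)"
    using tens_rel.append[OF tens_rel.swap[of ?m ?n] tens_rel.refl[of "list_times xs ys"]] by simp
  ultimately have "tens_rel (?m @ list_times xs ((c, d) # ys)) (?n @ ?m @ list_times xs ys)"
    by (rule tens_rel.trans)
  then have "tens_rel ([(a * c, b * d)] @ ?m @ list_times xs ((c, d) # ys))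
      ([(a * c, b * d)] @ ?n @ ?m @ list_times xs ys)"
    by (rule tens_rel.append[OF tens_rel.refl])
  then show ?case by (simp add: x list_times_Cons mult.commute)
qed

lemma list_times_commute: "tens_rel (list_times xs ys) (list_times ys xs)"
proof (induction xs)
  case Nil
  show ?case by (simp add: tens_rel.refl)
next
  case (Cons x xs)
  obtain a b where x: "x = (a, b)" by fastforce
  have "tens_rel (list_times (x # xs) ys) (map (\<lambda>(c, d). (a * c, b * d)) ys @ list_times ys xs)"
    unfolding x list_times_Cons by (intro tens_rel.append tens_rel.refl Cons.IH)
  then show ?case
    unfolding x by (rule tens_rel.trans) (rule tens_rel.sym, rule list_times_Cons_right)
qed

lemma list_times_right_cong:
  assumes "tens_rel ys ys'"
  shows "tens_rel (list_times xs ys) (list_times xs ys')"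
proof (induction xs)
  case Nil
  show ?case by (simp add: tens_rel.refl)
next
  case (Cons x xs)
  then show ?case
    using tens_rel_map[OF assms] by (cases x) (auto simp: list_times_Cons intro: tens_rel.append)
qed

lemma list_times_cong:
  assumes "tens_rel xs xs'" "tens_rel ys ys'"
  shows "tens_rel (list_times xs ys) (list_times xs' ys')"
  by (rule tens_rel.trans[OF list_times_commute], rule tens_rel.trans[OF list_times_right_cong],
      rule assms(1), rule tens_rel.trans[OF list_times_commute], rule list_times_right_cong,
      rule assms(2))

lemma list_times_map:
  "list_times (map (\<lambda>(c, d). (a * c, b * d)) ys) zs =
     map (\<lambda>(c, d). ((a :: 'a :: semigroup_mult) * c, (b :: 'b :: semigroup_mult) * d))
       (list_times ys zs)"
  by (induction ys) (auto simp: list_times_Cons mult.assoc)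

lemma list_times_assoc:
  "list_times (list_times xs ys) zs =
     list_times xs (list_times ys (zs :: ('a :: semigroup_mult \<times> 'b :: semigroup_mult) list))"
  by (induction xs) (auto simp: list_times_Cons list_times_append list_times_map)

lemma tens_rel_neg: "tens_rel (map (\<lambda>(a, b). (- a, b)) xs @ xs) []"
proof (induction xs)
  case Nil
  show ?case by (simp add: tens_rel.refl)
next
  case (Cons x xs)
  obtain a b where x: "x = (a, b)" by fastforce
  let ?n = "map (\<lambda>(a, b). (- a, b)) xs"
  have "tens_rel [(- a + a, b)] []"
    using tens_rel.zero[of b] by (simp only: add.left_inverse)
  from tens_rel.trans[OF tens_rel.sym[OF tens_rel.add_left] this]
  have 1: "tens_rel [(- a, b), (a, b)] []" .
  have "tens_rel ([(- a, b)] @ (?n @ [(a, b)]) @ xs) ([(- a, b)] @ ([(a, b)] @ ?n) @ xs)"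
    by (rule tens_rel.append[OF tens_rel.refl tens_rel.append[OF tens_rel.swap tens_rel.refl]])
  moreover have "tens_rel ([(- a, b), (a, b)] @ (?n @ xs)) ([] @ [])"
    by (rule tens_rel.append[OF 1 Cons.IH])
  ultimately have "tens_rel ([(- a, b)] @ (?n @ [(a, b)]) @ xs) []"
    by (simp only: append_assoc append_Cons append_Nil) (erule tens_rel.trans)
  then show ?case by (simp add: x)
qed

interpretation rat_vs: vector_space "\<lambda>q x. of_rat q * (x :: 'a :: field_char_0)"
  by unfold_locales (simp_all add: algebra_simps of_rat_add of_rat_mult)

lemma rat_functional_exists:
  "\<exists>l :: 'a :: field_char_0 \<Rightarrow> rat.
     (\<forall>x y. l (x + y) = l x + l y) \<and> (\<forall>q x. l (of_rat q * x) = q * l x) \<and> l 1 = 1"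
proof -
  interpret p: vector_space_pair
    "\<lambda>q x. of_rat q * (x :: 'a)" "\<lambda>q x. q * (x :: rat)"
    by unfold_locales (simp_all add: algebra_simps)
  have "\<not> rat_vs.dependent {1 :: 'a}" by (simp add: rat_vs.dependent_single)
  from p.linear_independent_extend[OF this, of "\<lambda>_. 1"]
  obtain g where g: "Vector_Spaces.linear (\<lambda>q x. of_rat q * (x :: 'a)) (*) g" "g 1 = (1 :: rat)"
    by auto
  interpret l: Vector_Spaces.linear "\<lambda>q x. of_rat q * (x :: 'a)" "(*)" g by (fact g(1))
  show ?thesis using g(2) l.add l.scale by blast
qed

lemma tens_rel_functional:
  assumes "tens_rel xs ys"
    and "\<And>x y. l (x + y) = l x + l y" and l: "\<And>q x. l (of_rat q * x) = q * l x"
  shows "(\<Sum>(a, b)\<leftarrow>xs. of_rat (l a) * b) = (\<Sum>(a, b)\<leftarrow>ys. of_rat (l a) * b)"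
proof -
  have "l 0 = 0" using l[of 0 0] by simp
  with assms show ?thesis
    by induction (auto simp: algebra_simps of_rat_add of_rat_mult)
qed

lemma tens_rel_nontrivial: "\<not> tens_rel [] [(1 :: 'a :: field_char_0, 1 :: 'b :: field_char_0)]"
proof
  assume *: "tens_rel [] [(1 :: 'a, 1 :: 'b)]"
  obtain l :: "'a \<Rightarrow> rat" where "\<And>x y. l (x + y) = l x + l y" "\<And>q x. l (of_rat q * x) = q * l x"
    "l 1 = 1"
    using rat_functional_exists by blast
  with tens_rel_functional[OF *, of l] show False by simp
qed

instantiation qtensor :: (field_char_0, field_char_0) comm_ring_1
begin

lift_definition zero_qtensor :: "('a, 'b) qtensor" is "[]" .
lift_definition one_qtensor :: "('a, 'b) qtensor" is "[(1, 1)]" .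
lift_definition plus_qtensor :: "('a, 'b) qtensor \<Rightarrow> ('a, 'b) qtensor \<Rightarrow> ('a, 'b) qtensor"
  is "(@)" by (rule tens_rel.append)
lift_definition uminus_qtensor :: "('a, 'b) qtensor \<Rightarrow> ('a, 'b) qtensor"
  is "map (\<lambda>(a, b). (- a, b))"
  using tens_rel_map[of _ _ "- 1" 1] by simp
definition minus_qtensor :: "('a, 'b) qtensor \<Rightarrow> ('a, 'b) qtensor \<Rightarrow> ('a, 'b) qtensor"
  where "minus_qtensor x y = x + - y"
lift_definition times_qtensor :: "('a, 'b) qtensor \<Rightarrow> ('a, 'b) qtensor \<Rightarrow> ('a, 'b) qtensor"
  is list_times by (rule list_times_cong)

instance
proof
  fix x y z :: "('a, 'b) qtensor"
  show "x + y + z = x + (y + z)" by transfer (simp add: tens_rel.refl)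
  show "x + y = y + x" by transfer (rule tens_rel.swap)
  show "0 + x = x" by transfer (simp add: tens_rel.refl)
  show "- x + x = 0" by transfer (rule tens_rel_neg)
  show "x - y = x + - y" by (fact minus_qtensor_def)
  show "x * y * z = x * (y * z)" by transfer (simp add: list_times_assoc tens_rel.refl)
  show "x * y = y * x" by transfer (rule list_times_commute)
  show "1 * x = x" by transfer (simp add: list_times_Cons tens_rel.refl)
  show "(x + y) * z = x * z + y * z" by transfer (simp add: list_times_append tens_rel.refl)
  show "(0 :: ('a, 'b) qtensor) \<noteq> 1" by transfer (rule tens_rel_nontrivial)
qed

end

lift_definition pure_tensor ::
  "'a::field_char_0 \<Rightarrow> 'b::field_char_0 \<Rightarrow> ('a, 'b) qtensor" is "\<lambda>a b. [(a, b)]" .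

text \<open>For a subfield \<open>K\<close> of \<open>B\<close>: the subring \<open>A \<otimes> K\<close> of \<open>A \<otimes> B\<close>, and its units.\<close>

definition tensor_sub :: "'b::field_char_0 set \<Rightarrow> ('a::field_char_0, 'b) qtensor set" where
  "tensor_sub K = {\<Sum>(a, b)\<leftarrow>xs. pure_tensor a b | xs. snd ` set xs \<subseteq> K}"

definition tensor_sub_units :: "'b::field_char_0 set \<Rightarrow> ('a::field_char_0, 'b) qtensor set" where
  "tensor_sub_units K = {x \<in> tensor_sub K. \<exists>y\<in>tensor_sub K. x * y = 1}"


section \<open>Coordinate spaces\<close>

text \<open>
  A vector with coordinates in a finite set \<open>I\<close> is a function vanishing off \<open>I\<close>.
  Vectors over the rationals are viewed inside the complexification through \<open>of_rat\<close>.
\<close>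

definition coord_space :: "'i set \<Rightarrow> ('i \<Rightarrow> 'k::zero) set" where
  "coord_space I = {v. \<forall>i. i \<notin> I \<longrightarrow> v i = 0}"

definition fscale :: "'k::times \<Rightarrow> ('i \<Rightarrow> 'k) \<Rightarrow> 'i \<Rightarrow> 'k" where
  "fscale c v = (\<lambda>i. c * v i)"

definition cvec :: "('i \<Rightarrow> rat) \<Rightarrow> 'i \<Rightarrow> complex" where
  "cvec v = (\<lambda>i. of_rat (v i))"

definition cspan :: "('i \<Rightarrow> rat) set \<Rightarrow> ('i \<Rightarrow> complex) set" where
  "cspan W = module.span fscale (cvec ` W)"

definition vconj :: "('i \<Rightarrow> complex) \<Rightarrow> 'i \<Rightarrow> complex" where
  "vconj v = (\<lambda>i. cnj (v i))"

abbreviation cmat :: "rat mat \<Rightarrow> complex mat" where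
  "cmat \<equiv> map_mat of_rat"

definition mapply :: "'k::semiring_0 mat \<Rightarrow> (nat \<Rightarrow> 'k) \<Rightarrow> nat \<Rightarrow> 'k" where
  "mapply A v = (\<lambda>i. if i < dim_row A then \<Sum>j<dim_col A. A $$ (i, j) * v j else 0)"

definition GL :: "nat \<Rightarrow> 'k::field mat set" where
  "GL n = {g \<in> carrier_mat n n. invertible_mat g}"

definition minv :: "'k::field mat \<Rightarrow> 'k mat" where
  "minv g = (THE h. h \<in> carrier_mat (dim_row g) (dim_row g) \<and> inverts_mat g h \<and> inverts_mat h g)"


section \<open>Hodge decompositions\<close>

text \<open>
  \<open>VB\<close> is the Betti space, \<open>F\<close> a filtration of the de Rham space, and \<open>c\<close> the comparison map
  on complex vectors. \<open>hodge_fil\<close> is the filtration transported to the complexification of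
  \<open>VB\<close>.
\<close>

definition hodge_fil ::
  "(('i \<Rightarrow> complex) \<Rightarrow> 'i \<Rightarrow> complex) \<Rightarrow> ('i \<Rightarrow> rat) set \<Rightarrow> (int \<Rightarrow> ('i \<Rightarrow> rat) set) \<Rightarrow> int
     \<Rightarrow> ('i \<Rightarrow> complex) set" where
  "hodge_fil c VB F p = {v \<in> cspan VB. c v \<in> cspan (F p)}"

definition hodge_piece ::
  "(('i \<Rightarrow> complex) \<Rightarrow> 'i \<Rightarrow> complex) \<Rightarrow> ('i \<Rightarrow> rat) set \<Rightarrow> (int \<Rightarrow> ('i \<Rightarrow> rat) set) \<Rightarrow> int
     \<Rightarrow> int \<Rightarrow> ('i \<Rightarrow> complex) set" where
  "hodge_piece c VB F p q = hodge_fil c VB F p \<inter> vconj ` hodge_fil c VB F q"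

definition opposite_fil ::
  "int \<Rightarrow> (('i \<Rightarrow> complex) \<Rightarrow> 'i \<Rightarrow> complex) \<Rightarrow> ('i \<Rightarrow> rat) set \<Rightarrow> (int \<Rightarrow> ('i \<Rightarrow> rat) set)
     \<Rightarrow> bool" where
  "opposite_fil w c VB F \<longleftrightarrow>
     (\<forall>v\<in>cspan VB. \<exists>!h :: int \<Rightarrow> 'i \<Rightarrow> complex.
        (\<forall>p. h p \<in> hodge_piece c VB F p (w - p)) \<and> finite {p. h p \<noteq> 0} \<and>
        v = (\<Sum>p\<in>{p. h p \<noteq> 0}. h p))"


section \<open>Betti--de Rham systems\<close>

definition rat_basis :: "'e::field_char_0 set \<Rightarrow> bool" where
  "rat_basis B \<longleftrightarrow> \<not> rat_vs.dependent B \<and> rat_vs.span B = UNIV"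

definition number_field :: "'e::field_char_0 itself \<Rightarrow> bool" where
  "number_field _ \<longleftrightarrow> (\<exists>B :: 'e set. finite B \<and> rat_basis B)"

text \<open>
  Bases over the rationals of \<open>M\<^sub>B\<close> and \<open>M\<^sub>d\<^sub>R\<close> (which have the same dimension) are fixed, so
  that both spaces are coordinate spaces of dimension \<open>dim M\<close>; the \<open>E\<close>-structures are then
  given by matrices, and the comparison isomorphism is a complex matrix. The dimension may be 0.
\<close>

record 'e bdr_system =
  dim :: nat
  weight :: int
  actB :: "'e \<Rightarrow> rat mat"
  frob :: "rat mat"
  actdR :: "'e \<Rightarrow> rat mat"
  fil :: "int \<Rightarrow> (nat \<Rightarrow> rat) set"
  cmp :: "complex mat"

definition field_action :: "nat \<Rightarrow> ('e::field_char_0 \<Rightarrow> rat mat) \<Rightarrow> bool" where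
  "field_action n \<rho> \<longleftrightarrow>
     (\<forall>e. \<rho> e \<in> carrier_mat n n) \<and> \<rho> 1 = 1\<^sub>m n \<and>
     (\<forall>d e. \<rho> (d + e) = \<rho> d + \<rho> e) \<and> (\<forall>d e. \<rho> (d * e) = \<rho> d * \<rho> e)"

abbreviation Mspace :: "('e, 'm) bdr_system_scheme \<Rightarrow> (nat \<Rightarrow> 'k::zero) set" where
  "Mspace M \<equiv> coord_space {..<dim M}"

definition bdr_system :: "'e::field_char_0 bdr_system \<Rightarrow> bool" where
  "bdr_system M \<longleftrightarrow>
     field_action (dim M) (actB M) \<and>
     frob M \<in> carrier_mat (dim M) (dim M) \<and>
     frob M * frob M = 1\<^sub>m (dim M) \<and>
     (\<forall>e. frob M * actB M e = actB M e * frob M) \<and>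
     field_action (dim M) (actdR M) \<and>
     (\<forall>p. module.subspace fscale (fil M p) \<and> fil M p \<subseteq> Mspace M \<and>
          (\<forall>e. mapply (actdR M e) ` fil M p \<subseteq> fil M p)) \<and>
     (\<forall>p q. p \<le> q \<longrightarrow> fil M q \<subseteq> fil M p) \<and>
     (\<exists>p. fil M p = Mspace M) \<and> (\<exists>p. fil M p = {0}) \<and>
     cmp M \<in> GL (dim M) \<and>
     (\<forall>e. cmp M * cmat (actB M e) = cmat (actdR M e) * cmp M) \<and>
     (\<forall>v\<in>Mspace M. mapply (cmp M) (mapply (cmat (frob M)) (vconj v)) =
                     vconj (mapply (cmp M) v)) \<and>
     opposite_fil (weight M) (mapply (cmp M)) (Mspace M) (fil M)"

definition hodgeM :: "'e bdr_system \<Rightarrow> int \<Rightarrow> int \<Rightarrow> (nat \<Rightarrow> complex) set" where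
  "hodgeM M p q = hodge_piece (mapply (cmp M)) (Mspace M) (fil M) p q"

text \<open>\<open>eigenM M 1\<close> and \<open>eigenM M (- 1)\<close> are \<open>M\<^sup>+\<close> and \<open>M\<^sup>-\<close>.\<close>

definition eigenM :: "'e bdr_system \<Rightarrow> rat \<Rightarrow> (nat \<Rightarrow> rat) set" where
  "eigenM M \<epsilon> = {v \<in> Mspace M. mapply (frob M) v = fscale \<epsilon> v}"


section \<open>Determinants over \<open>E \<otimes> \<complex>\<close>\<close>

text \<open>
  \<open>bs\<close> represents a basis over \<open>E\<close> of the quotient of \<open>W\<close> by \<open>U\<close>, where \<open>E\<close> acts through
  \<open>\<rho>\<close>.
\<close>

definition E_basis ::
  "('e \<Rightarrow> rat mat) \<Rightarrow> (nat \<Rightarrow> rat) set \<Rightarrow> (nat \<Rightarrow> rat) set \<Rightarrow> (nat \<Rightarrow> rat) list \<Rightarrow> bool" where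
  "E_basis \<rho> W U bs \<longleftrightarrow> set bs \<subseteq> W \<and>
     (\<forall>v\<in>W. \<exists>!es. length es = length bs \<and>
        v - (\<Sum>k<length bs. mapply (\<rho> (es ! k)) (bs ! k)) \<in> U)"

text \<open>
  The action of \<open>E \<otimes> \<complex>\<close> on complex vectors. It does not depend on the representing formal
  sum as \<open>\<rho>\<close> is additive.
\<close>

definition tensor_act ::
  "('e::field_char_0 \<Rightarrow> rat mat) \<Rightarrow> ('e, complex) qtensor \<Rightarrow> (nat \<Rightarrow> complex) \<Rightarrow> nat \<Rightarrow> complex"
where
  "tensor_act \<rho> x v =
     (\<Sum>(e, z)\<leftarrow>rep_qtensor x. fscale z (mapply (cmat (\<rho> e)) v))"

text \<open>
  \<open>A\<close> is the matrix, with respect to \<open>bs\<close> and \<open>ds\<close>, of the map induced by \<open>g\<close> to the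
  quotient by the complexification of \<open>U\<close>.
\<close>

definition E_matrix ::
  "('e::field_char_0 \<Rightarrow> rat mat) \<Rightarrow> (nat \<Rightarrow> rat) set \<Rightarrow> complex mat \<Rightarrow> (nat \<Rightarrow> rat) list
     \<Rightarrow> (nat \<Rightarrow> rat) list \<Rightarrow> ('e, complex) qtensor mat \<Rightarrow> bool" where
  "E_matrix \<rho> U g bs ds A \<longleftrightarrow> A \<in> carrier_mat (length ds) (length bs) \<and>
     (\<forall>j<length bs. mapply g (cvec (bs ! j)) -
        (\<Sum>i<length ds. tensor_act \<rho> (A $$ (i, j)) (cvec (ds ! i))) \<in> cspan U)"

text \<open>An element of the quotient of the units of \<open>E \<otimes> \<complex>\<close> by those of \<open>E\<close> is a coset.\<close>

definition E_class :: "('e::field_char_0, complex) qtensor \<Rightarrow> ('e, complex) qtensor set" where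
  "E_class x = {x * pure_tensor e 1 | e. e \<noteq> 0}"

definition period_class ::
  "'e::field_char_0 bdr_system \<Rightarrow> rat \<Rightarrow> ('e, complex) qtensor set" where
  "period_class M \<epsilon> = (let Fa = fil M (weight M div 2 + 1) in
     \<Union>{E_class (det A) | A bs ds.
         E_basis (actB M) (eigenM M \<epsilon>) {0} bs \<and> E_basis (actdR M) (Mspace M) Fa ds \<and>
         length bs = length ds \<and> E_matrix (actdR M) Fa (cmp M) bs ds A})"

definition period_ratio :: "'e::field_char_0 bdr_system \<Rightarrow> ('e, complex) qtensor set" where
  "period_ratio M = {u. \<exists>x\<in>period_class M 1. \<exists>y\<in>period_class M (- 1). u * y = x}"

definition chi ::
  "'e::field_char_0 bdr_system \<Rightarrow> rat \<Rightarrow> complex mat \<Rightarrow> ('e, complex) qtensor" where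
  "chi M \<epsilon> g = (THE d. \<exists>bs A. E_basis (actB M) (eigenM M \<epsilon>) {0} bs \<and>
     E_matrix (actB M) {0} g bs bs A \<and> d = det A)"


section \<open>Tensor systems\<close>

text \<open>
  Elements of the tensor space with \<open>r\<close> covariant factors \<open>M\<close> and \<open>s\<close> factors \<open>M\<^sup>\<or>\<close> have
  coordinates indexed by pairs of lists of indices, of lengths \<open>r\<close> and \<open>s\<close>.
\<close>

type_synonym tidx = "nat list \<times> nat list"

definition idx_lists :: "nat \<Rightarrow> nat \<Rightarrow> nat list set" where
  "idx_lists n r = {is. length is = r \<and> set is \<subseteq> {..<n}}"

definition tens_idx :: "nat \<Rightarrow> nat \<times> nat \<Rightarrow> tidx set" where
  "tens_idx n rs = idx_lists n (fst rs) \<times> idx_lists n (snd rs)"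

text \<open>The action of \<open>g\<close> on covariant factors, and of its inverse transpose on dual ones.\<close>

definition tens_act :: "nat \<Rightarrow> 'k::field mat \<Rightarrow> (tidx \<Rightarrow> 'k) \<Rightarrow> tidx \<Rightarrow> 'k" where
  "tens_act n g t = (\<lambda>(is, js).
     if set is \<subseteq> {..<n} \<and> set js \<subseteq> {..<n} then
       \<Sum>(is', js')\<in>tens_idx n (length is, length js).
         (\<Prod>k<length is. g $$ (is ! k, is' ! k)) *
         (\<Prod>k<length js. minv g $$ (js' ! k, js ! k)) * t (is', js')
     else 0)"

definition pure_tens ::
  "(nat \<Rightarrow> 'k::field) list \<Rightarrow> (nat \<Rightarrow> 'k) list \<Rightarrow> tidx \<Rightarrow> 'k" where
  "pure_tens vs ls = (\<lambda>(is, js).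
     if length is = length vs \<and> length js = length ls then
       (\<Prod>k<length vs. (vs ! k) (is ! k)) * (\<Prod>k<length ls. (ls ! k) (js ! k))
     else 0)"

definition dual_fil :: "'e bdr_system \<Rightarrow> int \<Rightarrow> (nat \<Rightarrow> rat) set" where
  "dual_fil M p = {l \<in> Mspace M. \<forall>v\<in>fil M (1 - p). (\<Sum>i<dim M. l i * v i) = 0}"

definition tens_fil :: "'e bdr_system \<Rightarrow> nat \<times> nat \<Rightarrow> int \<Rightarrow> (tidx \<Rightarrow> rat) set" where
  "tens_fil M rs p = module.span fscale
     {pure_tens vs ls | vs ls as bs. length vs = fst rs \<and> length ls = snd rs \<and>
        list_all2 (\<lambda>a v. v \<in> fil M a) as vs \<and> list_all2 (\<lambda>b l. l \<in> dual_fil M b) bs ls \<and>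
        sum_list as + sum_list bs \<ge> p}"

text \<open>The direct sum of the tensor spaces of the types in the list \<open>L\<close>.\<close>

definition dsum_idx :: "nat \<Rightarrow> (nat \<times> nat) list \<Rightarrow> (nat \<times> tidx) set" where
  "dsum_idx n L = (SIGMA j:{..<length L}. tens_idx n (L ! j))"

definition dsum_act :: "nat \<Rightarrow> 'k::field mat \<Rightarrow> (nat \<times> tidx \<Rightarrow> 'k) \<Rightarrow> nat \<times> tidx \<Rightarrow> 'k" where
  "dsum_act n g x = (\<lambda>(j, I). tens_act n g (\<lambda>I'. x (j, I')) I)"

definition dsum_fil ::
  "'e bdr_system \<Rightarrow> (nat \<times> nat) list \<Rightarrow> int \<Rightarrow> (nat \<times> tidx \<Rightarrow> rat) set" where
  "dsum_fil M L p = {x \<in> coord_space (dsum_idx (dim M) L).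
     \<forall>j<length L. (\<lambda>I. x (j, I)) \<in> tens_fil M (L ! j) p}"

definition tens_weight :: "'e bdr_system \<Rightarrow> nat \<times> nat \<Rightarrow> int" where
  "tens_weight M rs = (int (fst rs) - int (snd rs)) * weight M"


section \<open>Multilinear algebra structures\<close>

text \<open>
  A morphism \<open>t\<close> from the unit system, which has weight 0, to a tensor system of type \<open>rs\<close> is
  given by the images \<open>tB\<close>, \<open>tdR\<close> of 1 in the two realizations.
\<close>

definition unit_morphism ::
  "'e bdr_system \<Rightarrow> nat \<times> nat \<Rightarrow> (tidx \<Rightarrow> rat) \<Rightarrow> (tidx \<Rightarrow> rat) \<Rightarrow> bool" where
  "unit_morphism M rs tB tdR \<longleftrightarrow>
     tens_weight M rs = 0 \<and>
     tB \<in> coord_space (tens_idx (dim M) rs) \<and> tens_act (dim M) (frob M) tB = tB \<and>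
     tdR \<in> tens_fil M rs 0 \<and>
     tens_act (dim M) (cmp M) (cvec tB) = cvec tdR"

text \<open>A sub-object carries the induced filtration, which has to be opposite to its conjugate.\<close>

definition subobject ::
  "'e bdr_system \<Rightarrow> (nat \<times> nat) list \<Rightarrow> (nat \<times> tidx \<Rightarrow> rat) set \<Rightarrow> (nat \<times> tidx \<Rightarrow> rat) set
     \<Rightarrow> bool" where
  "subobject M L NB NdR \<longleftrightarrow>
     module.subspace fscale NB \<and> NB \<subseteq> coord_space (dsum_idx (dim M) L) \<and>
     module.subspace fscale NdR \<and> NdR \<subseteq> coord_space (dsum_idx (dim M) L) \<and>
     dsum_act (dim M) (frob M) ` NB \<subseteq> NB \<and>
     dsum_act (dim M) (cmp M) ` cspan NB = cspan NdR \<and>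
     (\<exists>k. (\<forall>rs\<in>set L. tens_weight M rs = k) \<and>
        opposite_fil k (dsum_act (dim M) (cmp M)) NB (\<lambda>p. dsum_fil M L p \<inter> NdR))"

record mult_structure =
  tensors :: "((nat \<times> nat) \<times> (tidx \<Rightarrow> rat) \<times> (tidx \<Rightarrow> rat)) set"
  subobjects :: "((nat \<times> nat) list \<times> (nat \<times> tidx \<Rightarrow> rat) set \<times> (nat \<times> tidx \<Rightarrow> rat) set) set"

definition multilinear_structure :: "'e bdr_system \<Rightarrow> mult_structure \<Rightarrow> bool" where
  "multilinear_structure M S \<longleftrightarrow>
     (\<forall>(rs, tB, tdR)\<in>tensors S. unit_morphism M rs tB tdR) \<and>
     (\<forall>(L, NB, NdR)\<in>subobjects S. subobject M L NB NdR)"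

text \<open>An endomorphism as a tensor with one covariant and one dual factor.\<close>

definition end_tensor :: "rat mat \<Rightarrow> tidx \<Rightarrow> rat" where
  "end_tensor A = (\<lambda>(is, js).
     if length is = 1 \<and> length js = 1 \<and> hd is < dim_row A \<and> hd js < dim_col A
     then A $$ (hd is, hd js) else 0)"

definition contains_E_structure :: "'e::field_char_0 bdr_system \<Rightarrow> mult_structure \<Rightarrow> bool" where
  "contains_E_structure M S \<longleftrightarrow> (\<exists>B :: 'e set. rat_basis B \<and>
     (\<forall>e\<in>B. ((1, 1), end_tensor (actB M e), end_tensor (actdR M e)) \<in> tensors S))"


section \<open>Groups and the torsor of isomorphisms, on complex points\<close>

text \<open>
  The schemes involved are of finite type over a field of characteristic 0 and reduced (groups,
  or torsors under groups), so they are given by their sets of complex points.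
\<close>

definition GB :: "'e bdr_system \<Rightarrow> mult_structure \<Rightarrow> complex mat set" where
  "GB M S = {g \<in> GL (dim M).
     (\<forall>(rs, tB, tdR)\<in>tensors S. tens_act (dim M) g (cvec tB) = cvec tB) \<and>
     (\<forall>(L, NB, NdR)\<in>subobjects S. dsum_act (dim M) g ` cspan NB = cspan NB)}"

definition GdR :: "'e bdr_system \<Rightarrow> mult_structure \<Rightarrow> complex mat set" where
  "GdR M S = {g \<in> GL (dim M).
     (\<forall>(rs, tB, tdR)\<in>tensors S. tens_act (dim M) g (cvec tdR) = cvec tdR) \<and>
     (\<forall>(L, NB, NdR)\<in>subobjects S. dsum_act (dim M) g ` cspan NdR = cspan NdR)}"

definition PdR :: "'e bdr_system \<Rightarrow> mult_structure \<Rightarrow> complex mat set" where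
  "PdR M S = {g \<in> GdR M S. \<forall>p. mapply g ` cspan (fil M p) = cspan (fil M p)}"

definition Zfrob :: "'e bdr_system \<Rightarrow> mult_structure \<Rightarrow> complex mat set" where
  "Zfrob M S = {g \<in> GB M S. g * cmat (frob M) = cmat (frob M) * g}"

definition torsor :: "'e bdr_system \<Rightarrow> mult_structure \<Rightarrow> complex mat set" where
  "torsor M S = {g \<in> GL (dim M).
     (\<forall>(rs, tB, tdR)\<in>tensors S. tens_act (dim M) g (cvec tB) = cvec tdR) \<and>
     (\<forall>(L, NB, NdR)\<in>subobjects S. dsum_act (dim M) g ` cspan NB = cspan NdR)}"


section \<open>Zariski topology, components and their fields of definition\<close>

inductive_set mat_polys :: "nat \<Rightarrow> (complex mat \<Rightarrow> complex) set" for n where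
  const: "(\<lambda>_. c) \<in> mat_polys n"
| entry: "i < n \<Longrightarrow> j < n \<Longrightarrow> (\<lambda>A. A $$ (i, j)) \<in> mat_polys n"
| add: "f \<in> mat_polys n \<Longrightarrow> g \<in> mat_polys n \<Longrightarrow> (\<lambda>A. f A + g A) \<in> mat_polys n"
| mult: "f \<in> mat_polys n \<Longrightarrow> g \<in> mat_polys n \<Longrightarrow> (\<lambda>A. f A * g A) \<in> mat_polys n"

definition zariski_open :: "nat \<Rightarrow> complex mat set \<Rightarrow> bool" where
  "zariski_open n U \<longleftrightarrow>
     (\<exists>Q\<subseteq>mat_polys n. U = {A \<in> carrier_mat n n. \<exists>f\<in>Q. f A \<noteq> 0})"

definition zariski :: "nat \<Rightarrow> complex mat topology" where
  "zariski n = topology (zariski_open n)"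

lemma istopology_zariski_open: "istopology (zariski_open n)"
  unfolding istopology_def
proof (intro conjI allI impI)
  fix U V assume "zariski_open n U" "zariski_open n V"
  then obtain P Q where P: "P \<subseteq> mat_polys n" "U = {A \<in> carrier_mat n n. \<exists>f\<in>P. f A \<noteq> 0}"
    and Q: "Q \<subseteq> mat_polys n" "V = {A \<in> carrier_mat n n. \<exists>f\<in>Q. f A \<noteq> 0}"
    unfolding zariski_open_def by blast
  have "{\<lambda>A. f A * g A | f g. f \<in> P \<and> g \<in> Q} \<subseteq> mat_polys n"
    using P(1) Q(1) by (auto intro: mat_polys.mult)
  moreover have "U \<inter> V = {A \<in> carrier_mat n n.
      \<exists>h\<in>{\<lambda>A. f A * g A | f g. f \<in> P \<and> g \<in> Q}. h A \<noteq> 0}"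
  proof (intro equalityI subsetI)
    fix A assume "A \<in> U \<inter> V"
    then obtain f g where "A \<in> carrier_mat n n" "f \<in> P" "f A \<noteq> 0" "g \<in> Q" "g A \<noteq> 0"
      unfolding P(2) Q(2) by blast
    then show "A \<in> {A \<in> carrier_mat n n.
        \<exists>h\<in>{\<lambda>A. f A * g A | f g. f \<in> P \<and> g \<in> Q}. h A \<noteq> 0}"
      by (intro CollectI conjI bexI[of _ "\<lambda>A. f A * g A"]) auto
  next
    fix A assume "A \<in> {A \<in> carrier_mat n n.
        \<exists>h\<in>{\<lambda>A. f A * g A | f g. f \<in> P \<and> g \<in> Q}. h A \<noteq> 0}"
    then obtain f g where "A \<in> carrier_mat n n" "f \<in> P" "g \<in> Q" "f A * g A \<noteq> 0"
      by blast
    then show "A \<in> U \<inter> V" unfolding P(2) Q(2) by auto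
  qed
  ultimately show "zariski_open n (U \<inter> V)" unfolding zariski_open_def by blast
next
  fix \<U> assume *: "\<forall>U\<in>\<U>. zariski_open n U"
  let ?Q = "{f \<in> mat_polys n. {A \<in> carrier_mat n n. f A \<noteq> 0} \<subseteq> \<Union>\<U>}"
  have "\<Union>\<U> = {A \<in> carrier_mat n n. \<exists>f\<in>?Q. f A \<noteq> 0}"
  proof (intro equalityI subsetI)
    fix A assume "A \<in> \<Union>\<U>"
    then obtain U where U: "U \<in> \<U>" "A \<in> U" by blast
    with * have "zariski_open n U" by blast
    then obtain Q where Q: "Q \<subseteq> mat_polys n" "U = {A \<in> carrier_mat n n. \<exists>f\<in>Q. f A \<noteq> 0}"
      unfolding zariski_open_def by blast
    with U(2) obtain f where f: "f \<in> Q" "f A \<noteq> 0" "A \<in> carrier_mat n n" by blast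
    have "{A \<in> carrier_mat n n. f A \<noteq> 0} \<subseteq> U" using f(1) Q(2) by blast
    also have "U \<subseteq> \<Union>\<U>" using U(1) by (rule Union_upper)
    finally have "f \<in> ?Q" using f(1) Q(1) by blast
    with f(2,3) show "A \<in> {A \<in> carrier_mat n n. \<exists>f\<in>?Q. f A \<noteq> 0}" by blast
  next
    fix A assume "A \<in> {A \<in> carrier_mat n n. \<exists>f\<in>?Q. f A \<noteq> 0}"
    then obtain f :: "complex mat \<Rightarrow> complex" where f: "A \<in> carrier_mat n n" "f A \<noteq> 0"
        "{A \<in> carrier_mat n n. f A \<noteq> 0} \<subseteq> \<Union>\<U>"
      by auto
    from f(1,2) have "A \<in> {A \<in> carrier_mat n n. f A \<noteq> 0}" by simp
    with f(3) show "A \<in> \<Union>\<U>" by (rule subsetD)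
  qed
  moreover have "?Q \<subseteq> mat_polys n" by blast
  ultimately show "zariski_open n (\<Union>\<U>)" unfolding zariski_open_def by (intro exI[of _ ?Q]) simp
qed

definition frob_identity_component :: "'e bdr_system \<Rightarrow> mult_structure \<Rightarrow> complex mat set" where
  "frob_identity_component M S =
     connected_component_of_set (subtopology (zariski (dim M)) (Zfrob M S)) (1\<^sub>m (dim M))"

definition torsor_components :: "'e bdr_system \<Rightarrow> mult_structure \<Rightarrow> complex mat set set" where
  "torsor_components M S = connected_components_of (subtopology (zariski (dim M)) (torsor M S))"

definition torsor0 :: "'e bdr_system \<Rightarrow> mult_structure \<Rightarrow> complex mat set" where
  "torsor0 M S = connected_component_of_set (subtopology (zariski (dim M)) (torsor M S)) (cmp M)"

definition Qbar :: "complex set" where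
  "Qbar = {z. algebraic z}"

text \<open>Automorphisms of \<open>Qbar\<close>; their values elsewhere are irrelevant.\<close>

definition galois_group :: "(complex \<Rightarrow> complex) set" where
  "galois_group = {\<sigma>. bij_betw \<sigma> Qbar Qbar \<and>
     (\<forall>x\<in>Qbar. \<forall>y\<in>Qbar. \<sigma> (x + y) = \<sigma> x + \<sigma> y \<and> \<sigma> (x * y) = \<sigma> x * \<sigma> y)}"

definition Qbar_points :: "complex mat set \<Rightarrow> complex mat set" where
  "Qbar_points X = {A \<in> X. elements_mat A \<subseteq> Qbar}"

text \<open>
  The Galois group acts entrywise on the points of the torsor over \<open>Qbar\<close>, and thereby on its
  components, each of which contains such points.
\<close>

definition galois_component ::
  "'e bdr_system \<Rightarrow> mult_structure \<Rightarrow> (complex \<Rightarrow> complex) \<Rightarrow> complex mat set \<Rightarrow> complex mat set"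
where
  "galois_component M S \<sigma> X =
     (THE Y. Y \<in> torsor_components M S \<and> map_mat \<sigma> ` Qbar_points X \<subseteq> Y)"

text \<open>The field of definition of the union of a set of components.\<close>

definition definition_field ::
  "'e bdr_system \<Rightarrow> mult_structure \<Rightarrow> complex mat set set \<Rightarrow> complex set" where
  "definition_field M S \<X> =
     {x \<in> Qbar. \<forall>\<sigma>\<in>galois_group. galois_component M S \<sigma> ` \<X> = \<X> \<longrightarrow> \<sigma> x = x}"

definition K0 :: "'e bdr_system \<Rightarrow> mult_structure \<Rightarrow> complex set" where
  "K0 M S = definition_field M S {torsor0 M S}"

definition K1 :: "'e bdr_system \<Rightarrow> mult_structure \<Rightarrow> complex set" where
  "K1 M S = definition_field M S
     {X \<in> torsor_components M S.
        X \<subseteq> {p * g * z | p g z. p \<in> PdR M S \<and> g \<in> torsor0 M S \<and> z \<in> Zfrob M S}}"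

end

theory Submission
  imports "HOL-Complex_Analysis.Complex_Analysis" "HOL-Computational_Algebra.Fundamental_Theorem_Algebra" Defs
begin

text \<open>
 Let \<open>D 1 g\<close> and \<open>D (- 1) g\<close> be the determinants of the two period maps with the comparison replaced by
 an isomorphism \<open>g\<close>; they are polynomials in \<open>g\<close> with coefficients in \<open>E\<close>. Under \<open>g \<mapsto> p g z\<close>, with \<open>p\<close> preserving
 the Hodge filtration and \<open>z\<close> commuting with the involution, both change by a common factor and by the
 characters of \<open>z\<close>. The Hodge cocharacter lies in the structure group, so the tangent space of the group
 is the sum of the part preserving the filtration and the part fixed by the involution. Hence
 \<open>D 1 g - ratio * D (- 1) g\<close> vanishes along curves in every tangent direction at the comparison, to infinite
 order by Krull's intersection theorem, and on the whole component, which is irreducible by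
 homogeneity. The ratio is then defined over the field of definition of the component, by specializing
 the comparison to an algebraic point and applying the Galois group.
\<close>

text \<open>The effect on the periods is known for two subgroups, the stabilizer of the filtration
  and the centralizer of the involution, whose tangent spaces span that of the structure group.
  Dimension theory would conclude that their products are dense in the identity component; a formal
  neighbourhood of the comparison takes its place here. The curve
  \<open>mexp n A t * mexp n B t\<close> has one factor in each subgroup, and its second factor is
  joined to 1 inside the centralizer, so that the characters matter on the identity component only.
  Tangent spaces are cut out by all polynomials vanishing on the group, so membership of
  exponentials can be checked through iterated derivatives. The comparison is in general
  transcendental, while Galois automorphisms are given on \<open>Qbar\<close> alone. Hence no
  automorphism is applied to the comparison itself: constancy on the component moves the question to
  an algebraic point, whose conjugates are under control. For a connected group rationality is
  tested with embeddings of the ring generated by one number, extended by specialization.\<close>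

abbreviation Mat :: "nat => 'a mat set" where
 "Mat n == carrier_mat n n"

abbreviation mdet :: "'a::comm_ring_1 mat => 'a" where
 "mdet == Determinant.det"

abbreviation ap :: "'k::semiring_0 mat => (nat => 'k) => nat => 'k" where
 "ap == mapply"

abbreviation sc :: "'k::times => ('i => 'k) => 'i => 'k" where
 "sc == fscale"

abbreviation csp :: "'i set => ('i => 'k::zero) set" where
 "csp == coord_space"

abbreviation ptens :: "'a::field_char_0 => 'b::field_char_0 => ('a, 'b) qtensor" where
 "ptens == pure_tensor"

section \<open>Noetherian rings of functions\<close>

text \<open>A predicate on sets, because the rings in question are built inside one ambient ring by
  adjoining elements one at a time.\<close>

definition subring_set :: "'a::comm_ring_1 set => bool" where
 "subring_set A \<longleftrightarrow> 1 : A & (ALL x:A. - x : A) & (ALL x:A. ALL y:A. x + y : A & x * y : A)"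

lemma subring_setD:
 assumes "subring_set A"
 shows "1 : A" "0 : A" "x : A ==> - x : A" "x : A ==> y : A ==> x + y : A"
  "x : A ==> y : A ==> x * y : A" "x : A ==> y : A ==> x - y : A"
proof -
 show 1: "1 : A" "x : A ==> - x : A" "x : A ==> y : A ==> x + y : A"
  "x : A ==> y : A ==> x * y : A" for x y
  using assms by (auto simp: subring_set_def)
 show "0 : A" using 1(3)[OF 1(1) 1(2)[OF 1(1)]] by simp
 show "x : A ==> y : A ==> x - y : A" using 1(3)[of x "- y"] 1(2)[of y] by simp
qed

lemma subring_set_sum: "subring_set A ==> (!!i. i : I ==> f i : A) ==> sum f I : A"
 by (induction I rule: infinite_finite_induct) (auto simp: subring_setD)

lemma subring_set_prod: "subring_set A ==> (!!i. i : I ==> f i : A) ==> prod f I : A"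
 by (induction I rule: infinite_finite_induct) (auto simp: subring_setD)

lemma subring_set_power: "subring_set A ==> x : A ==> x ^ k : A"
 by (induction k) (auto simp: subring_setD)

text \<open>For \<open>Q\<close> inside \<open>A\<close> this is the ideal of \<open>A\<close>
  generated by \<open>Q\<close>. Building it up one product at a time makes every closure property
  an induction over the terms of a combination.\<close>

inductive_set ispan :: "'a::comm_ring_1 set => 'a set => 'a set" for A Q where
 zero: "0 : ispan A Q"
| step: "a : A ==> q : Q ==> x : ispan A Q ==> a * q + x : ispan A Q"

lemma ispan_add: "x : ispan A Q ==> y : ispan A Q ==> x + y : ispan A Q"
 by (induction rule: ispan.induct) (auto simp: add.assoc intro: ispan.step)

lemma ispan_mult:
 assumes "subring_set A" "b : A" "x : ispan A Q"
 shows "b * x : ispan A Q"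
 using assms(3)
proof (induction rule: ispan.induct)
 case (step a q x)
 have "(b * a) * q + b * x : ispan A Q"
  by (intro ispan.step step subring_setD[OF assms(1)] assms)
 then show ?case by (simp add: algebra_simps)
qed (simp add: ispan.zero)

lemma ispan_base: "subring_set A ==> q : Q ==> q : ispan A Q"
 using ispan.step[of 1 A q Q 0] by (simp add: subring_setD ispan.zero)

lemma ispan_subset: "subring_set A ==> Q' <= ispan A Q ==> x : ispan A Q' ==> x : ispan A Q"
 by (rotate_tac 2, induction rule: ispan.induct) (auto intro: ispan.zero ispan_add ispan_mult)

lemma ispan_mono: "subring_set A ==> Q' <= Q ==> x : ispan A Q' ==> x : ispan A Q"
 by (rule ispan_subset) (auto intro: ispan_base)

lemma ispan_finite_subset:
 assumes "subring_set A" "x : ispan A Q"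
 shows "EX Q'<=Q. finite Q' & x : ispan A Q'"
 using assms(2)
proof (induction rule: ispan.induct)
 case zero
 show ?case by (rule exI[of _ "{}"]) (auto intro: ispan.zero)
next
 case (step a q x)
 then obtain Q' where Q': "Q' <= Q" "finite Q'" "x : ispan A Q'" by blast
 have "a * q + x : ispan A (insert q Q')"
  using Q'(3) step(1) by (intro ispan.step) (auto intro: ispan_mono[OF assms(1), of Q'])
 with Q' step(2) show ?case by (intro exI[of _ "insert q Q'"]) auto
qed

lemma ispan_finite_subset':
 assumes "subring_set A" "finite F" "F <= ispan A Q"
 shows "EX Q'<=Q. finite Q' & F <= ispan A Q'"
 using assms(2,3)
proof (induction F)
 case (insert x F)
 then obtain Q' where Q': "Q' <= Q" "finite Q'" "F <= ispan A Q'" by blast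
 obtain Q'' where Q'': "Q'' <= Q" "finite Q''" "x : ispan A Q''"
  using ispan_finite_subset[OF assms(1), of x Q] insert by blast
 have "insert x F <= ispan A (Q' Un Q'')"
  using Q'(3) Q''(3) ispan_mono[OF assms(1), of Q' "Q' Un Q''"]
   ispan_mono[OF assms(1), of Q'' "Q' Un Q''"] by blast
 with Q' Q'' show ?case by (intro exI[of _ "Q' Un Q''"]) auto
qed auto

text \<open>Finite generation with the generators taken from \<open>Q\<close> itself, so that for a
  sequence they all occur before some index.\<close>

definition noetherian_set :: "'a::comm_ring_1 set => bool" where
 "noetherian_set A \<longleftrightarrow> (ALL Q<=A. EX Q'<=Q. finite Q' & Q <= ispan A Q')"

lemma noetherian_setD:
 assumes "noetherian_set A" "Q <= A"
 obtains Q' where "Q' <= Q" "finite Q'" "Q <= ispan A Q'"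
 using assms(1)[unfolded noetherian_set_def, rule_format, OF assms(2)] by (elim exE conjE)

text \<open>The chain condition in the form used throughout: for leading coefficients in the basis
  theorem, for descending chains of closed sets, and for the homogeneous representatives in Krull's
  theorem.\<close>

lemma noetherian_seq:
 assumes "subring_set A" "noetherian_set A" "!!k. f k : A"
 shows "EX N::nat. f N : ispan A (f ` {..<N})"
proof -
 have "range f <= A" using assms(3) by auto
 then obtain Q' where Q': "Q' <= range f" "finite Q'" "range f <= ispan A Q'"
  by (rule noetherian_setD[OF assms(2)])
 then obtain K where K: "finite K" "Q' = f ` K"
  by (meson finite_subset_image)
 then obtain N where "K <= {..<N}" unfolding finite_nat_iff_bounded by blast
 then have "Q' <= f ` {..<N}" using K by auto
 then show ?thesis using ispan_mono[OF assms(1)] Q'(3) by blast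
qed

section \<open>Polynomials over a subring and Hilbert's basis theorem\<close>

definition poly_set :: "'a::zero set => 'a poly set" where
 "poly_set A = {p. ALL i. coeff p i : A}"

lemma subring_poly_set:
 assumes "subring_set A"
 shows "subring_set (poly_set A)"
 unfolding subring_set_def poly_set_def
 by (auto simp: coeff_mult one_pCons coeff_pCons split: nat.splits
   intro!: subring_setD[OF assms] subring_set_sum[OF assms])

text \<open>Hilbert's basis theorem, with the classical choice of elements of least degree.\<close>

lemma noetherian_poly_set:
 fixes A :: "'a::comm_ring_1 set"
 assumes A: "subring_set A" and N: "noetherian_set A"
 shows "noetherian_set (poly_set A)"
 unfolding noetherian_set_def
proof (intro allI impI)
 fix Q :: "'a poly set" assume Q: "Q <= poly_set A"
 let ?P = "poly_set A"
 let ?J = "ispan ?P Q"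
 have P: "subring_set ?P" by (rule subring_poly_set[OF A])
 have JP: "?J <= ?P"
 proof
  fix x assume "x : ?J"
  then show "x : ?P"
   by (induction rule: ispan.induct) (use Q in \<open>auto intro: subring_setD[OF P]\<close>)
 qed
 have "EX F. finite F & F <= ?J & ?J <= ispan ?P F"
 proof (rule ccontr)
  assume *: "~ ?thesis"
  let ?R = "%(f :: nat => 'a poly) k r. r : ?J - ispan ?P (f ` {..<k}) &
   (ALL r':?J - ispan ?P (f ` {..<k}). degree r <= degree r')"
  have "EX f. ALL k. ?R f k (f k)"
  proof (rule dependent_wellorder_choice)
   fix r and f g :: "nat => 'a poly" and x :: nat
   assume "!!y. y < x ==> f y = g y"
   then have "f ` {..<x} = g ` {..<x}" by auto
   then show "?R f x r = ?R g x r" by simp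
  next
   fix x :: nat and f :: "nat => 'a poly" assume f: "!!y. y < x ==> ?R f y (f y)"
   then have "f ` {..<x} <= ?J" by auto
   with * have "EX r. r : ?J - ispan ?P (f ` {..<x})" by blast
   then obtain r where "r : ?J - ispan ?P (f ` {..<x})" by blast
   from ex_has_least_nat[of "%r. r : ?J - ispan ?P (f ` {..<x})", OF this, of degree]
   show "EX r. ?R f x r" by blast
  qed
  then obtain f where f: "!!k. ?R f k (f k)" by blast
  \<comment> \<open>\<open>f k\<close> was already a candidate when \<open>f j\<close> was chosen,
    so the degrees do not decrease and every earlier leading term can be shifted up to degree
    \<open>d\<close> below.\<close>
  have deg: "degree (f j) <= degree (f k)" if "j < k" for j k
  proof -
   have "f k ~: ispan ?P (f ` {..<j})"
    using f[of k] that ispan_mono[OF P, of "f ` {..<j}" "f ` {..<k}"] by fastforce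
   then show ?thesis using f[of j] f[of k] by blast
  qed
  have fP: "f k : ?P" for k using f JP by blast
  then have "lead_coeff (f k) : A" for k by (auto simp: poly_set_def)
  from noetherian_seq[OF A N, of "%k. lead_coeff (f k)", OF this]
  obtain M where M: "lead_coeff (f M) : ispan A ((%k. lead_coeff (f k)) ` {..<M})" by blast
  define d where "d = degree (f M)"
  have "EX g:ispan ?P (f ` {..<M}). degree g <= d & coeff g d = c"
   if "c : ispan A ((%k. lead_coeff (f k)) ` {..<M})" for c
   using that
  proof (induction rule: ispan.induct)
   case zero
   show ?case by (rule bexI[of _ 0]) (auto intro: ispan.zero)
  next
   case (step a q x)
   then obtain g where g: "g : ispan ?P (f ` {..<M})" "degree g <= d" "coeff g d = x" by blast
   obtain j where j: "j < M" "q = lead_coeff (f j)" using step by auto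
   have dj: "degree (f j) <= d" unfolding d_def by (rule deg[OF j(1)])
   let ?h = "monom a (d - degree (f j))"
   have "?h : ?P" using step(1) by (auto simp: poly_set_def coeff_monom subring_setD[OF A])
   then have "?h * f j + g : ispan ?P (f ` {..<M})" using j(1) g(1) by (intro ispan.step) auto
   moreover have "degree (?h * f j) <= d"
    using degree_mult_le[of ?h "f j"] degree_monom_le[of a "d - degree (f j)"] dj by linarith
   then have "degree (?h * f j + g) <= d" using g(2) by (rule degree_add_le)
   moreover have "coeff (?h * f j + g) d = a * q + x"
    using dj g(3) j(2) by (simp add: coeff_monom_mult)
   ultimately show ?case by blast
  qed
  from this[OF M] obtain g where g: "g : ispan ?P (f ` {..<M})" "degree g <= d"
   "coeff g d = lead_coeff (f M)" by blast
  \<comment> \<open>Cancelling the leading term keeps the difference outside the earlier ideal, so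
    minimality gives it degree at least \<open>d\<close>; but its coefficient at \<open>d\<close> is
    0, so it would have to be 0.\<close>
  let ?r = "f M - g"
  have gJ: "g : ?J" using ispan_subset[OF P _ g(1)] f by blast
  have m1: "- 1 : ?P" by (intro subring_setD[OF P])
  have "?r : ?J" using ispan_add[OF _ ispan_mult[OF P m1 gJ]] f by force
  moreover have rn: "?r ~: ispan ?P (f ` {..<M})"
  proof
   assume "?r : ispan ?P (f ` {..<M})"
   from ispan_add[OF this g(1)] f[of M] show False by simp
  qed
  ultimately have "d <= degree ?r" using f[of M] unfolding d_def by blast
  moreover have "degree ?r <= d" by (rule degree_diff_le) (use g(2) in \<open>simp_all add: d_def\<close>)
  moreover have "coeff ?r d = 0" using g(3) by (simp add: d_def)
  ultimately have "?r = 0" by (metis leading_coeff_0_iff le_antisym)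
  then show False using rn by (simp add: ispan.zero)
 qed
 then obtain F where F: "finite F" "F <= ?J" "?J <= ispan ?P F" by blast
 obtain Q' where Q': "Q' <= Q" "finite Q'" "F <= ispan ?P Q'"
  using ispan_finite_subset'[OF P F(1,2)] by blast
 have "Q <= ispan ?P Q'"
  using ispan_subset[OF P Q'(3)] F(3) ispan_base[OF P, of _ Q] by blast
 with Q' show "EX Q'<=Q. finite Q' & Q <= ispan ?P Q'" by blast
qed

text \<open>The ring generated by \<open>A\<close> and \<open>x\<close> is the image of the
  polynomial ring under evaluation, and the property passes to quotients.\<close>

lemma noetherian_adjoin:
 fixes A :: "'a::comm_ring_1 set"
 assumes A: "subring_set A" and N: "noetherian_set A"
 shows "noetherian_set ((%p. poly p x) ` poly_set A)"
 unfolding noetherian_set_def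
proof (intro allI impI)
 fix Q assume "Q <= (%p. poly p x) ` poly_set A"
 then obtain R where R: "R <= poly_set A" "Q = (%p. poly p x) ` R"
  by (meson subset_imageE)
 obtain R' where R': "R' <= R" "finite R'" "R <= ispan (poly_set A) R'"
  by (rule noetherian_setD[OF noetherian_poly_set[OF A N] R(1)])
 have "poly p x : ispan ((%p. poly p x) ` poly_set A) ((%p. poly p x) ` R')"
  if "p : ispan (poly_set A) R'" for p
  using that by induction (auto intro: ispan.zero ispan.step)
 then show "EX Q'<=Q. finite Q' & Q <= ispan ((%p. poly p x) ` poly_set A) Q'"
  using R R' by (intro exI[of _ "(%p. poly p x) ` R'"]) auto
qed

text \<open>Polynomial functions are taken as functions, not as formal polynomials. They form a
  quotient of a polynomial ring, which is enough for finite generation of ideals.\<close>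

inductive_set fun_alg :: "('x => complex) set => ('x => complex) set" for X where
 const: "(%_. c) : fun_alg X"
| gen: "f : X ==> f : fun_alg X"
| add: "f : fun_alg X ==> g : fun_alg X ==> f + g : fun_alg X"
| mult: "f : fun_alg X ==> g : fun_alg X ==> f * g : fun_alg X"

lemma subring_fun_alg: "subring_set (fun_alg X)"
proof -
 have "1 : fun_alg X" using fun_alg.const[of 1] by (simp add: one_fun_def)
 moreover have "- f : fun_alg X" if "f : fun_alg X" for f
  using fun_alg.mult[OF fun_alg.const[of "- 1"] that] by (simp add: times_fun_def fun_Compl_def)
 ultimately show ?thesis by (auto simp: subring_set_def intro: fun_alg.intros)
qed

lemma fun_alg_insert:
 assumes "f : fun_alg (insert x X)"
 shows "f : (%p. poly p x) ` poly_set (fun_alg X)"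
proof -
 have P: "subring_set (poly_set (fun_alg X))"
  by (intro subring_poly_set subring_fun_alg)
 have C: "[:g:] : poly_set (fun_alg X)" if "g : fun_alg X" for g
  using that by (auto simp: poly_set_def coeff_pCons subring_setD[OF subring_fun_alg] split: nat.splits)
 show ?thesis
  using assms
 proof (induction rule: fun_alg.induct)
  case (const c)
  show ?case using C[OF fun_alg.const[of c]] by force
 next
  case (gen f)
  show ?case
  proof (cases "f = x")
   case True
   have "[:0, 1:] : poly_set (fun_alg X)"
    by (auto simp: poly_set_def coeff_pCons subring_setD[OF subring_fun_alg] split: nat.splits)
   then show ?thesis using True by (force intro: image_eqI[of _ _ "[:0, 1:]"])
  next
   case False
   then show ?thesis using gen C[OF fun_alg.gen[of f X]] by force
  qed
 next
  case (add f g)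
  then show ?case using subring_setD(4)[OF P] by (force simp flip: poly_add)
 next
  case (mult f g)
  then show ?case using subring_setD(5)[OF P] by (force simp flip: poly_mult)
 qed
qed

lemma fun_alg_mono: "f : fun_alg X ==> X <= Y ==> f : fun_alg Y"
 by (induction rule: fun_alg.induct) (auto intro: fun_alg.intros)

lemma fun_alg_insert_eq: "fun_alg (insert x X) = (%p. poly p x) ` poly_set (fun_alg X)"
proof (intro equalityI subsetI)
 fix f assume "f : (%p. poly p x) ` poly_set (fun_alg X)"
 then obtain p where p: "p : poly_set (fun_alg X)" "f = poly p x" by blast
 have "f = (SUM i<=degree p. coeff p i * x ^ i)" unfolding p(2) by (rule poly_altdef)
 also have "... : fun_alg (insert x X)"
  using p(1) fun_alg_mono[of _ X "insert x X"]
  by (intro subring_set_sum subring_setD subring_set_power subring_fun_alg)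
    (auto simp: poly_set_def intro: fun_alg.gen)
 finally show "f : fun_alg (insert x X)" .
qed (rule fun_alg_insert)

lemma noetherian_fun_alg: "finite X ==> noetherian_set (fun_alg X)"
proof (induction X rule: finite_induct)
 case empty
 \<comment> \<open>With no generators only the constants remain; they form a field, so a single
   nonzero member of \<open>Q\<close> generates.\<close>
 have const: "EX c. f = (%_. c)" if "f : fun_alg {}" for f :: "'a => complex"
  using that by induction (auto simp: plus_fun_def times_fun_def)
 show ?case
  unfolding noetherian_set_def
 proof (intro allI impI)
  fix Q :: "('a => complex) set" assume Q: "Q <= fun_alg {}"
  show "EX Q'<=Q. finite Q' & Q <= ispan (fun_alg {}) Q'"
  proof (cases "Q <= {0}")
   case True
   then show ?thesis by (intro exI[of _ "{}"]) (auto intro: ispan.zero)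
  next
   case False
   then obtain q where q: "q : Q" "q ~= 0" by blast
   then obtain c where c: "q = (%_. c)" using const Q by blast
   with q have c0: "c ~= 0" by (auto simp: zero_fun_def)
   have "f : ispan (fun_alg {}) {q}" if f: "f : Q" for f
   proof -
    obtain b where b: "f = (%_. b)" using const Q f by blast
    have "(%_. b / c) * q + 0 : ispan (fun_alg {}) {q}"
     by (intro ispan.intros fun_alg.const) simp
    then show ?thesis using c0 by (simp add: b c times_fun_def)
   qed
   then show ?thesis using q by (intro exI[of _ "{q}"]) auto
  qed
 qed
next
 case (insert x X)
 show ?case unfolding fun_alg_insert_eq
  by (rule noetherian_adjoin[OF subring_fun_alg insert.IH])
qed

section \<open>Algebraic numbers and specialization of rings of complex numbers\<close>

abbreviation adjoin :: "'a::comm_ring_1 set => 'a => 'a set" where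
 "adjoin A x == (%p. poly p x) ` poly_set A"

lemma subring_adjoin:
 assumes "subring_set A"
 shows "subring_set (adjoin A x)"
proof -
 note P = subring_poly_set[OF assms]
 have "1 : adjoin A x" using subring_setD(1)[OF P] by (force intro: image_eqI[of _ _ 1])
 moreover have "- a : adjoin A x" if "a : adjoin A x" for a
  using that subring_setD(3)[OF P] by (force simp flip: poly_minus)
 moreover have "a + b : adjoin A x" if "a : adjoin A x" "b : adjoin A x" for a b
  using that subring_setD(4)[OF P] by (force simp flip: poly_add)
 moreover have "a * b : adjoin A x" if "a : adjoin A x" "b : adjoin A x" for a b
  using that subring_setD(5)[OF P] by (force simp flip: poly_mult)
 ultimately show ?thesis by (auto simp: subring_set_def)
qed

lemma const_in_poly_set: "subring_set A ==> a : A ==> [:a:] : poly_set A"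
 by (auto simp: poly_set_def coeff_pCons subring_setD split: nat.splits)

lemma monom_in_poly_set: "subring_set A ==> a : A ==> monom a k : poly_set A"
 by (auto simp: poly_set_def subring_setD)

lemma adjoin_superset: "subring_set A ==> a : A ==> a : adjoin A x"
 by (rule image_eqI[of _ _ "[:a:]"]) (auto intro: const_in_poly_set)

lemma adjoin_self: "subring_set A ==> x : adjoin A x"
 by (rule image_eqI[of _ _ "[:0, 1:]"])
   (auto simp: poly_set_def coeff_pCons subring_setD split: nat.splits)

text \<open>A ring inside a finite-dimensional rational space. Containment in a finite span is what
  division with remainder yields and what bounds independent powers.\<close>

definition finite_rat_ring :: "complex set => bool" where
 "finite_rat_ring V \<longleftrightarrow> subring_set V & (ALL q. of_rat q : V) & (EX S. finite S & V <= rat_vs.span S)"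

text \<open>The \<open>card S + 1\<close> powers of \<open>x\<close> lie in a space spanned by
  \<open>card S\<close> elements, so either two of them coincide or they are linearly
  dependent.\<close>

lemma finite_rat_ring_algebraic:
 assumes "finite_rat_ring V" "x : V"
 shows "algebraic x"
proof -
 obtain S where S: "finite S" "V <= rat_vs.span S" and V: "subring_set V"
  using assms unfolding finite_rat_ring_def by blast
 let ?N = "card S"
 show ?thesis
 proof (cases "inj_on (%i. x ^ i) {..?N}")
  case False
  then obtain i j where ij: "i < j" "x ^ i = x ^ j"
   unfolding inj_on_def by (metis linorder_neqE_nat)
  have "coeff (monom 1 j - monom 1 i) j ~= (0 :: complex)" using ij(1) by simp
  then have "monom 1 j - monom (1 :: complex) i ~= 0" by (metis coeff_0)
  then show ?thesis
   using ij by (intro algebraicI'[of "monom 1 j - monom 1 i"]) (auto simp: poly_monom)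
 next
  case True
  have "rat_vs.dependent ((%i. x ^ i) ` {..?N})"
  proof (rule ccontr)
   assume *: "~ ?thesis"
   have "(%i. x ^ i) ` {..?N} <= rat_vs.span S"
    using S(2) subring_set_power[OF V assms(2)] by blast
   from rat_vs.independent_span_bound[OF S(1) * this]
   show False using card_image[OF True] by simp
  qed
  then obtain u where u: "EX v:(%i. x ^ i) ` {..?N}. u v ~= 0"
   "(SUM v:(%i. x ^ i) ` {..?N}. of_rat (u v) * v) = 0"
   by (subst (asm) rat_vs.dependent_finite) auto
  then obtain i where i: "i <= ?N" "u (x ^ i) ~= 0" by auto
  let ?p = "SUM i<=?N. monom (of_rat (u (x ^ i))) i :: complex poly"
  have c: "coeff ?p k = (if k <= ?N then of_rat (u (x ^ k)) else 0)" for k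
   by (simp add: coeff_sum)
  have "poly ?p x = 0"
   using u(2) by (simp add: poly_sum poly_monom sum.reindex[OF True])
  moreover have "?p ~= 0"
  proof
   assume "?p = 0"
   then have "coeff ?p i = 0" by simp
   then show False unfolding c using i by simp
  qed
  ultimately show ?thesis by (intro algebraicI'[of ?p]) (auto simp: c)
 qed
qed

lemma span_mult_right:
 assumes "v : rat_vs.span S"
 shows "v * y : rat_vs.span ((%s. s * (y :: complex)) ` S)"
 using assms
proof (induction rule: rat_vs.span_induct_alt)
 case base
 show ?case using rat_vs.span_zero by simp
next
 case (step c a b)
 have "of_rat c * (a * y) + b * y : rat_vs.span ((%s. s * y) ` S)"
  using step by (intro rat_vs.span_add[OF rat_vs.span_scale[OF rat_vs.span_base]]) auto
 then show ?case by (simp add: algebra_simps)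
qed

text \<open>Division by the monic equation leaves powers of \<open>z\<close> below its degree, so
  the products of these with a spanning set of \<open>V\<close> span the larger ring.\<close>

lemma finite_rat_ring_adjoin:
 assumes V: "finite_rat_ring V" and p: "p : poly_set V" "lead_coeff p = 1" "poly p z = 0"
 shows "finite_rat_ring (adjoin V z)"
proof -
 obtain S where S: "finite S" "V <= rat_vs.span S" and sub: "subring_set V" "!!q. of_rat q : V"
  using V unfolding finite_rat_ring_def by blast
 let ?d = "degree p"
 let ?T = "\<Union>k<?d. (%s. s * z ^ k) ` S"
 have "poly q z : rat_vs.span ?T" if "q : poly_set V" for q
  using that
 proof (induction "degree q" arbitrary: q rule: less_induct)
  case less
  show ?case
  proof (cases "degree q < ?d")
   case True
   have "coeff q i * z ^ i : rat_vs.span ?T" if "i <= degree q" for i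
   proof -
    have "coeff q i : rat_vs.span S" using less.prems S(2) by (auto simp: poly_set_def)
    then have "coeff q i * z ^ i : rat_vs.span ((%s. s * z ^ i) ` S)" by (rule span_mult_right)
    moreover have "(%s. s * z ^ i) ` S <= ?T" using that True by (intro UN_upper) simp
    ultimately show ?thesis using rat_vs.span_mono by blast
   qed
   then show ?thesis unfolding poly_altdef by (intro rat_vs.span_sum) auto
  next
   case False
   show ?thesis
   proof (cases "degree q = 0")
    case True
    \<comment> \<open>This case is void, as a monic constant has no root. It is set apart because
      cancelling leading terms lowers the degree only if it is positive.\<close>
    then have "degree p = 0" using False by simp
    then obtain c where "p = [:c:]" by (rule degree_eq_zeroE)
    then have "p = [:1:]" using p(2) by simp
    then show ?thesis using p(3) by simp
   next
    case nz: False
    let ?m = "monom (lead_coeff q) (degree q - ?d)"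
    let ?q = "q - ?m * p"
    have m: "?m : poly_set V"
     using less.prems by (intro monom_in_poly_set[OF sub(1)]) (auto simp: poly_set_def)
    have q: "?q : poly_set V"
     by (intro subring_setD[OF subring_poly_set[OF sub(1)]] less.prems m p)
    have "degree (?m * p) <= degree q"
     using degree_mult_le[of ?m p] degree_monom_le[of "lead_coeff q" "degree q - ?d"] False by linarith
    then have le: "degree ?q <= degree q" by (intro degree_diff_le) auto
    have "coeff ?q (degree q) = 0"
     using False p(2) by (simp add: coeff_monom_mult)
    then have "degree ?q < degree q"
     using le nz by (metis leading_coeff_0_iff degree_0 le_neq_implies_less neq0_conv)
    from less.hyps[OF this q] show ?thesis using p(3) by simp
   qed
  qed
 qed
 then have "adjoin V z <= rat_vs.span ?T" by blast
 moreover have "finite ?T" using S(1) by auto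
 moreover have "of_rat q : adjoin V z" for q using adjoin_superset[OF sub(1) sub(2)] .
 ultimately show ?thesis
  unfolding finite_rat_ring_def using subring_adjoin[OF sub(1)] by blast
qed

lemma finite_rat_ring_Rats: "finite_rat_ring (range of_rat)"
 unfolding finite_rat_ring_def
proof (intro conjI)
 have "x : range of_rat \<longleftrightarrow> x : Rats" for x :: complex by (simp add: Rats_def)
 then show "subring_set (range of_rat :: complex set)" by (auto simp: subring_set_def)
 have "of_rat q * 1 : rat_vs.span {1 :: complex}" for q
  by (intro rat_vs.span_scale rat_vs.span_base) simp
 then show "EX S. finite S & range of_rat <= rat_vs.span (S :: complex set)"
  by (intro exI[of _ "{1}"]) auto
qed auto

lemma finite_rat_ring_algebraic_adjoin:
 assumes "finite_rat_ring V" "algebraic z"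
 shows "EX V'. finite_rat_ring V' & V <= V' & z : V'"
proof -
 have V: "subring_set V" "!!q. of_rat q : V" using assms(1) by (auto simp: finite_rat_ring_def)
 obtain p where p: "ALL i. coeff p i : Rats" "p ~= 0" "poly p z = 0"
  using assms(2) unfolding algebraic_altdef by blast
 let ?p = "Polynomial.smult (inverse (lead_coeff p)) p"
 have "?p : poly_set V"
  unfolding poly_set_def
 proof (intro CollectI allI)
  fix i
  have "coeff ?p i : Rats" using p(1) by (auto simp: Rats_inverse)
  then show "coeff ?p i : V" using V(2) by (auto elim: Rats_cases)
 qed
 moreover have "lead_coeff ?p = 1" "poly ?p z = 0" using p by auto
 ultimately have "finite_rat_ring (adjoin V z)" by (rule finite_rat_ring_adjoin[OF assms(1)])
 then show ?thesis using adjoin_superset[OF V(1)] adjoin_self[OF V(1)] by blast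
qed

text \<open>From this follow both the closure of \<open>Qbar\<close> under the ring operations and
  its algebraic closedness, since each involves only finitely many algebraic numbers.\<close>

lemma finite_rat_ring_algebraic_set:
 assumes "finite C" "ALL x:C. algebraic x"
 shows "EX V. finite_rat_ring V & C <= V"
 using assms
proof (induction C rule: finite_induct)
 case empty
 then show ?case using finite_rat_ring_Rats by blast
next
 case (insert x C)
 then obtain V where V: "finite_rat_ring V" "C <= V" by auto
 with finite_rat_ring_algebraic_adjoin[OF V(1), of x] insert.prems show ?case by auto
qed

lemma subring_Qbar: "subring_set Qbar"
proof -
 have "x + y : Qbar & x * y : Qbar" if xy: "x : Qbar" "y : Qbar" for x y
 proof -
  from xy obtain V where V: "finite_rat_ring V" "{x, y} <= V"
   using finite_rat_ring_algebraic_set[of "{x, y}"] by (auto simp: Qbar_def)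
  then have "x + y : V" "x * y : V" by (auto simp: finite_rat_ring_def subring_setD)
  then show ?thesis using finite_rat_ring_algebraic[OF V(1)] by (auto simp: Qbar_def)
 qed
 moreover have "1 : Qbar" by (auto simp: Qbar_def intro: rat_imp_algebraic)
 moreover have "- x : Qbar" if "x : Qbar" for x using that by (auto simp: Qbar_def)
 ultimately show ?thesis by (auto simp: subring_set_def)
qed

lemma of_rat_in_Qbar: "of_rat q : Qbar"
 by (auto simp: Qbar_def intro: rat_imp_algebraic)

lemma inverse_in_Qbar: "x : Qbar ==> inverse x : Qbar"
 by (auto simp: Qbar_def)

text \<open>After division by the leading coefficient the finitely many coefficients lie in one ring
  that is finite over the rationals, and the root is adjoined to it by a monic equation.\<close>

lemma root_in_Qbar:
 assumes "p : poly_set Qbar" "p ~= 0" "poly p z = 0"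
 shows "z : Qbar"
proof -
 let ?p = "Polynomial.smult (inverse (lead_coeff p)) p"
 have c: "coeff ?p i : Qbar" for i
  using assms(1) by (auto simp: poly_set_def intro!: subring_setD(5)[OF subring_Qbar] inverse_in_Qbar)
 obtain V where V: "finite_rat_ring V" "coeff ?p ` {..degree ?p} <= V"
  using finite_rat_ring_algebraic_set[of "coeff ?p ` {..degree ?p}"] c
  by (auto simp: Qbar_def simp del: coeff_smult)
 have "coeff ?p i : V" for i
 proof (cases "i <= degree ?p")
  case False
  then have "coeff ?p i = 0" by (intro coeff_eq_0) simp
  then show ?thesis using V(1) by (simp add: finite_rat_ring_def subring_setD del: coeff_smult)
 qed (use V(2) in blast)
 then have pV: "?p : poly_set V" unfolding poly_set_def by blast
 have "finite_rat_ring (adjoin V z)"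
  by (rule finite_rat_ring_adjoin[OF V(1) pV]) (use assms in auto)
 moreover have "z : adjoin V z" using V(1) by (intro adjoin_self) (simp add: finite_rat_ring_def)
 ultimately show ?thesis using finite_rat_ring_algebraic by (auto simp: Qbar_def)
qed

text \<open>One notion for complex conjugation, Galois automorphisms and specializations of finitely
  generated rings. Only the values on \<open>A\<close> matter.\<close>

definition hom_on :: "complex set => (complex => complex) => bool" where
 "hom_on A tau \<longleftrightarrow> tau 1 = 1 & (ALL x:A. ALL y:A. tau (x + y) = tau x + tau y & tau (x * y) = tau x * tau y)"

lemma hom_onD:
 assumes "hom_on A tau" "subring_set A"
 shows "tau 1 = 1" "tau 0 = 0" "x : A ==> y : A ==> tau (x + y) = tau x + tau y"
  "x : A ==> y : A ==> tau (x * y) = tau x * tau y" "x : A ==> tau (- x) = - tau x"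
proof -
 show "tau 1 = 1" and add: "x : A ==> y : A ==> tau (x + y) = tau x + tau y"
  and "x : A ==> y : A ==> tau (x * y) = tau x * tau y" for x y
  using assms(1) by (auto simp: hom_on_def)
 have "tau (0 + 0) = tau 0 + tau 0" by (intro add subring_setD[OF assms(2)])
 then show z: "tau 0 = 0" by simp
 show "x : A ==> tau (- x) = - tau x"
  using add[of x "- x"] subring_setD(3)[OF assms(2), of x] z by (simp add: eq_neg_iff_add_eq_0 add.commute)
qed

lemma hom_on_sum:
 assumes "hom_on A tau" "subring_set A" "!!i. i : I ==> f i : A"
 shows "tau (sum f I) = (SUM i:I. tau (f i))"
 using assms(3)
 by (induction I rule: infinite_finite_induct)
   (auto simp: hom_onD[OF assms(1,2)] subring_set_sum[OF assms(2)])

lemma hom_on_prod: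
 assumes "hom_on A tau" "subring_set A" "!!i. i : I ==> f i : A"
 shows "tau (prod f I) = (PROD i:I. tau (f i))"
 using assms(3)
 by (induction I rule: infinite_finite_induct)
   (auto simp: hom_onD[OF assms(1,2)] subring_set_prod[OF assms(2)])

lemma hom_on_of_nat: "hom_on A tau ==> subring_set A ==> of_nat k : A & tau (of_nat k) = of_nat k"
 by (induction k) (auto simp: hom_onD subring_setD)

lemma hom_on_of_int: "hom_on A tau ==> subring_set A ==> of_int k : A & tau (of_int k) = of_int k"
 by (cases k) (auto simp: hom_on_of_nat hom_onD subring_setD simp del: of_nat_Suc)

lemma hom_on_of_rat:
 assumes "hom_on A tau" "subring_set A" "of_rat q : A"
 shows "tau (of_rat q) = of_rat q"
proof -
 obtain a b where q: "quotient_of q = (a, b)" by fastforce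
 then have b: "b > 0" by (rule quotient_of_denom_pos)
 have eq: "of_int b * (of_rat q :: complex) = of_int a"
  using quotient_of_div[OF q] b by (simp add: of_rat_divide)
 have i: "of_int k : A" "tau (of_int k) = of_int k" for k using hom_on_of_int[OF assms(1,2)] by auto
 have "tau (of_int b * of_rat q) = tau (of_int b) * tau (of_rat q)"
  by (rule hom_onD(4)[OF assms(1,2) i(1) assms(3)])
 then have "of_int b * tau (of_rat q) = of_int b * (of_rat q :: complex)"
  unfolding eq i(2) by (rule HOL.sym)
 then show ?thesis using b by simp
qed

lemma map_poly_hom_on:
 assumes "hom_on A tau" "subring_set A" "p : poly_set A" "q : poly_set A"
 shows "map_poly tau (p + q) = map_poly tau p + map_poly tau q"
  and "map_poly tau (p * q) = map_poly tau p * map_poly tau q"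
proof -
 note z = hom_onD(2)[OF assms(1,2)]
 show "map_poly tau (p + q) = map_poly tau p + map_poly tau q"
  using assms(3,4) by (intro poly_eqI) (auto simp: coeff_map_poly z poly_set_def hom_onD[OF assms(1,2)])
 have c: "coeff p i : A" "coeff q i : A" for i using assms(3,4) by (auto simp: poly_set_def)
 have "tau (SUM i<=n. coeff p i * coeff q (n - i)) = (SUM i<=n. tau (coeff p i) * tau (coeff q (n - i)))" for n
  by (subst hom_on_sum[OF assms(1,2)])
    (auto simp: c hom_onD(4)[OF assms(1,2)] intro: subring_setD(5)[OF assms(2)])
 then show "map_poly tau (p * q) = map_poly tau p * map_poly tau q"
  by (intro poly_eqI) (simp add: coeff_map_poly z coeff_mult)
qed

lemma map_poly_hom_on_const:
 "hom_on A tau ==> subring_set A ==> map_poly tau [:a:] = [:tau a:]"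
 by (intro poly_eqI) (simp add: coeff_map_poly hom_onD coeff_pCons split: nat.split)

text \<open>\<open>A\<close> is only a ring, so instead of dividing by the leading coefficient the
  dividend is multiplied by a power of it.\<close>

lemma pseudo_division_in_poly_set:
 fixes A :: "'a::comm_ring_1 set"
 assumes A: "subring_set A" and D: "D : poly_set A" "D ~= 0" and P: "P : poly_set A"
 shows "EX k. EX Q:poly_set A. EX R:poly_set A. Polynomial.smult (lead_coeff D ^ k) P = D * Q + R &
  (R = 0 \<or> degree R < degree D)"
 using P
proof (induction "degree P" arbitrary: P rule: less_induct)
 case less
 note S = subring_poly_set[OF A]
 show ?case
 proof (cases "P = 0 \<or> degree P < degree D")
  case True
  then show ?thesis
   using less.prems subring_setD(2)[OF S]
   by (intro exI[of _ 0] bexI[of _ 0] bexI[of _ P]) auto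
 next
  case False
  let ?m = "monom (lead_coeff P) (degree P - degree D)"
  let ?P = "Polynomial.smult (lead_coeff D) P - D * ?m"
  have m: "?m : poly_set A"
   using less.prems by (intro monom_in_poly_set[OF A]) (auto simp: poly_set_def)
  have sm: "Polynomial.smult c q : poly_set A" if "c : A" "q : poly_set A" for c q
   using that by (auto simp: poly_set_def subring_setD[OF A])
  have lD: "lead_coeff D : A" using D(1) by (auto simp: poly_set_def)
  have P': "?P : poly_set A"
   by (intro subring_setD(5,6)[OF S] sm lD less.prems D m)
  show ?thesis
  proof (cases "?P = 0")
   case True
   then show ?thesis
    using m subring_setD(2)[OF S] by (intro exI[of _ 1] bexI[of _ ?m] bexI[of _ 0]) auto
  next
   case nz: False
   have "degree (D * ?m) <= degree P"
    using degree_mult_le[of D ?m] degree_monom_le[of "lead_coeff P" "degree P - degree D"] False by linarith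
   then have le: "degree ?P <= degree P"
    by (intro degree_diff_le) (auto intro: order.trans[OF degree_smult_le])
   have "coeff ?P (degree P) = 0"
    using False by (subst mult.commute[of D]) (simp add: coeff_monom_mult)
   then have lt: "degree ?P < degree P"
    using le nz by (metis leading_coeff_0_iff le_neq_implies_less)
   obtain k Q R where IH: "Q : poly_set A" "R : poly_set A"
    "Polynomial.smult (lead_coeff D ^ k) ?P = D * Q + R" "R = 0 \<or> degree R < degree D"
    using less.hyps[OF lt P'] by blast
   have "Polynomial.smult (lead_coeff D ^ Suc k) P = D * (Q + Polynomial.smult (lead_coeff D ^ k) ?m) + R"
    using IH(3) by (simp add: smult_diff_right algebra_simps smult_smult)
   moreover have "Q + Polynomial.smult (lead_coeff D ^ k) ?m : poly_set A"
    by (intro subring_setD(4)[OF S] IH(1) sm m subring_set_power[OF A] lD)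
   ultimately show ?thesis using IH(2,4) by blast
  qed
 qed
qed

text \<open>Sending \<open>x\<close> to \<open>xi\<close> is consistent as soon as \<open>xi\<close>
  satisfies the images of all relations of \<open>x\<close> over \<open>A\<close>; the value then
  does not depend on the polynomial that \<open>SOME\<close> picks.\<close>

lemma hom_on_adjoin:
 assumes tau: "hom_on A tau" and A: "subring_set A"
  and xi: "!!p. p : poly_set A ==> poly p x = 0 ==> poly (map_poly tau p) xi = 0"
 shows "EX tau'. hom_on (adjoin A x) tau' & (ALL p:poly_set A. tau' (poly p x) = poly (map_poly tau p) xi)"
proof -
 note S = subring_poly_set[OF A]
 define tau' where "tau' y = poly (map_poly tau (SOME p. p : poly_set A & poly p x = y)) xi" for y
 have eq: "tau' (poly p x) = poly (map_poly tau p) xi" if p: "p : poly_set A" for p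
 proof -
  define q where "q = (SOME q. q : poly_set A & poly q x = poly p x)"
  have q: "q : poly_set A" "poly q x = poly p x"
   using someI[of "%q. q : poly_set A & poly q x = poly p x" p] p by (auto simp: q_def)
  have d: "q - p : poly_set A" by (intro subring_setD(6)[OF S] q p)
  have "poly (map_poly tau (q - p)) xi = 0" by (rule xi[OF d]) (simp add: q(2))
  moreover have "map_poly tau q = map_poly tau (q - p) + map_poly tau p"
   using map_poly_hom_on(1)[OF tau A d p] by simp
  ultimately show ?thesis by (simp add: tau'_def q_def)
 qed
 have "hom_on (adjoin A x) tau'"
  unfolding hom_on_def
 proof (intro conjI ballI)
  have "tau' (poly 1 x) = poly (map_poly tau 1) xi" by (rule eq[OF subring_setD(1)[OF S]])
  moreover have "map_poly tau 1 = 1"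
   by (intro poly_eqI) (simp add: coeff_map_poly hom_onD[OF tau A])
  ultimately show "tau' 1 = 1" by simp
 next
  fix a b assume "a : adjoin A x" "b : adjoin A x"
  then obtain p q where pq: "p : poly_set A" "q : poly_set A" "a = poly p x" "b = poly q x" by blast
  show "tau' (a + b) = tau' a + tau' b"
   using eq[of "p + q"] eq[of p] eq[of q] pq subring_setD(4)[OF S, of p q]
   by (simp add: map_poly_hom_on[OF tau A])
  show "tau' (a * b) = tau' a * tau' b"
   using eq[of "p * q"] eq[of p] eq[of q] pq subring_setD(5)[OF S, of p q]
   by (simp add: map_poly_hom_on[OF tau A])
 qed
 with eq show ?thesis by blast
qed

text \<open>The possible targets of specializations: \<open>Qbar\<close>, where the Galois group
  acts, and the whole of the complex numbers.\<close>

definition alg_closed_set :: "complex set => bool" where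
 "alg_closed_set Om \<longleftrightarrow> subring_set Om & (ALL p:poly_set Om. degree p > 0 --> (EX xi:Om. poly p xi = 0))"

lemma exists_complex_root: "degree p > 0 ==> EX z::complex. poly p z = 0"
 by (rule alg_closed_imp_poly_has_root)

lemma alg_closed_UNIV: "alg_closed_set UNIV"
 by (auto simp: alg_closed_set_def subring_set_def intro: exists_complex_root)

lemma alg_closed_Qbar: "alg_closed_set Qbar"
 unfolding alg_closed_set_def
proof (intro conjI subring_Qbar ballI impI)
 fix p :: "complex poly" assume p: "p : poly_set Qbar" "degree p > 0"
 from exists_complex_root[OF this(2)] obtain z where "poly p z = 0" by blast
 moreover from p(2) have "p ~= 0" by auto
 ultimately show "EX xi:Qbar. poly p xi = 0" using root_in_Qbar[OF p(1)] by blast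
qed

lemma subring_infinite:
 assumes "subring_set (A :: complex set)"
 shows "infinite A"
proof -
 have "of_nat k : A" for k by (induction k) (auto simp: subring_setD[OF assms])
 then have "range of_nat <= A" by blast
 moreover have "infinite (range (of_nat :: nat => complex))"
  by (simp add: finite_image_iff inj_of_nat)
 ultimately show ?thesis using finite_subset by blast
qed

text \<open>The algebraic case extends along a root of the specialized minimal equation; the Bezout
 element of least degree shows that \<open>v\<close> divides a nonzero element of \<open>A\<close>.\<close>

lemma specialize_step:
 assumes A: "subring_set A" and Om: "alg_closed_set Om" and v: "v : adjoin A x" "v ~= 0"
 shows "EX u:A. u ~= 0 & (ALL tau. hom_on A tau --> tau ` A <= Om --> tau u ~= 0 -->
  (EX tau'. hom_on (adjoin A x) tau' & tau' ` adjoin A x <= Om & (ALL a:A. tau' a = tau a) & tau' v ~= 0))"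
proof -
 note S = subring_poly_set[OF A]
 have Om': "subring_set Om" using Om by (simp add: alg_closed_set_def)
 obtain p where p: "p : poly_set A" "v = poly p x" using v by blast
 have ext: "EX tau'. hom_on (adjoin A x) tau' & tau' ` adjoin A x <= Om & (ALL a:A. tau' a = tau a) &
   (ALL p:poly_set A. tau' (poly p x) = poly (map_poly tau p) xi)"
  if tau: "hom_on A tau" "tau ` A <= Om" "xi : Om"
   and xi: "!!p. p : poly_set A ==> poly p x = 0 ==> poly (map_poly tau p) xi = 0" for tau xi
 proof -
  obtain tau' where tau': "hom_on (adjoin A x) tau'"
   "!!p. p : poly_set A ==> tau' (poly p x) = poly (map_poly tau p) xi"
   using hom_on_adjoin[OF tau(1) A xi] by blast
  have "tau' a = tau a" if "a : A" for a
   using tau'(2)[OF const_in_poly_set[OF A that]] map_poly_hom_on_const[OF tau(1) A, of a] by simp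
  moreover have "poly (map_poly tau q) xi : Om" if "q : poly_set A" for q
   using that tau(2,3) hom_onD(2)[OF tau(1) A] unfolding poly_altdef
   by (intro subring_set_sum[OF Om'] subring_setD(5)[OF Om'] subring_set_power[OF Om'])
     (auto simp: coeff_map_poly poly_set_def)
  ultimately show ?thesis using tau' by (intro exI[of _ tau']) auto
 qed
 show ?thesis
 proof (cases "EX P:poly_set A. P ~= 0 & poly P x = 0")
  case False
  \<comment> \<open>Here \<open>x\<close> is transcendental over \<open>A\<close> and may be sent
    anywhere. If the leading coefficient of \<open>p\<close> survives, the image of \<open>p\<close>
    has finitely many roots, and \<open>Om\<close> is infinite.\<close>
  have p0: "p ~= 0" using p(2) v(2) by auto
  have lc: "lead_coeff p : A" using p(1) by (auto simp: poly_set_def)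
  have "EX tau'. hom_on (adjoin A x) tau' & tau' ` adjoin A x <= Om & (ALL a:A. tau' a = tau a) & tau' v ~= 0"
   if tau: "hom_on A tau" "tau ` A <= Om" "tau (lead_coeff p) ~= 0" for tau
  proof -
   have "coeff (map_poly tau p) (degree p) ~= 0"
    using tau(3) by (simp add: coeff_map_poly hom_onD[OF tau(1) A])
   then have "map_poly tau p ~= 0" by (metis coeff_0)
   then have "finite {z. poly (map_poly tau p) z = 0}" by (rule poly_roots_finite)
   then obtain xi where xi: "xi : Om" "poly (map_poly tau p) xi ~= 0"
    using subring_infinite[OF Om'] finite_subset[of Om "{z. poly (map_poly tau p) z = 0}"] by blast
   have "poly (map_poly tau q) xi = 0" if "q : poly_set A" "poly q x = 0" for q
    using False that by auto
   from ext[OF tau(1,2) xi(1) this] xi(2) p show ?thesis by auto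
  qed
  then show ?thesis using lc p0 by (intro bexI[of _ "lead_coeff p"]) auto
 next
  case True
  then obtain P0 where "P0 : poly_set A & P0 ~= 0 & poly P0 x = 0" by blast
  from ex_has_least_nat[of "%P. P : poly_set A & P ~= 0 & poly P x = 0", OF this, of degree]
  obtain P where P: "P : poly_set A" "P ~= 0" "poly P x = 0"
   and minP: "!!q. q : poly_set A ==> q ~= 0 ==> poly q x = 0 ==> degree P <= degree q" by blast
  \<comment> \<open>The nonzero elements of the ideal generated by \<open>p\<close> and the minimal
    equation \<open>P\<close>. One of least degree serves as their greatest common divisor, up to
    powers of its leading coefficient.\<close>
  let ?B = "%D. D ~= 0 & (EX s:poly_set A. EX t:poly_set A. D = s * p + t * P)"
  have "P = 0 * p + 1 * P" by simp
  then have "?B P" using P(2) subring_setD(1,2)[OF S] by blast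
  from ex_has_least_nat[of ?B, OF this, of degree]
  obtain D where BD: "?B D" and minD: "!!q. ?B q ==> degree D <= degree q" by blast
  then obtain s t where st: "s : poly_set A" "t : poly_set A" "D = s * p + t * P" and D0: "D ~= 0" by blast
  have DA: "D : poly_set A" unfolding st(3) by (intro subring_setD(4,5)[OF S] st p P)
  have lD: "lead_coeff D : A" "lead_coeff D ~= 0" using DA D0 by (auto simp: poly_set_def)
  have div: "EX k. EX Q:poly_set A. Polynomial.smult (lead_coeff D ^ k) q = D * Q"
   if q: "q : poly_set A" "a : poly_set A" "b : poly_set A" "q = a * p + b * P" for q a b
  proof -
   obtain k Q R where QR: "Q : poly_set A" "R : poly_set A" "Polynomial.smult (lead_coeff D ^ k) q = D * Q + R"
    "R = 0 \<or> degree R < degree D"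
    using pseudo_division_in_poly_set[OF A DA D0 q(1)] by blast
   have c: "[:lead_coeff D ^ k:] : poly_set A"
    by (intro const_in_poly_set[OF A] subring_set_power[OF A] lD)
   have "R = [:lead_coeff D ^ k:] * q - D * Q" using QR(3) by simp
   also have "... = ([:lead_coeff D ^ k:] * a - Q * s) * p + ([:lead_coeff D ^ k:] * b - Q * t) * P"
    unfolding q(4) st(3) by (simp only: algebra_simps)
   finally have R: "R = ([:lead_coeff D ^ k:] * a - Q * s) * p + ([:lead_coeff D ^ k:] * b - Q * t) * P" .
   have "[:lead_coeff D ^ k:] * a - Q * s : poly_set A" "[:lead_coeff D ^ k:] * b - Q * t : poly_set A"
    by (intro subring_setD(5,6)[OF S] c q QR(1) st)+
   with R have "R ~= 0 ==> ?B R" by blast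
   then have "R = 0" using minD[of R] QR(4) by linarith
   with QR show ?thesis by auto
  qed
  \<comment> \<open>\<open>D\<close> divides a multiple of \<open>p\<close>, and \<open>p\<close>
    does not vanish at \<open>x\<close>.\<close>
  have Dx: "poly D x ~= 0"
  proof
   assume "poly D x = 0"
   moreover have "p = 1 * p + 0 * P" by simp
   from div[OF p(1) _ _ this] obtain k Q where "Polynomial.smult (lead_coeff D ^ k) p = D * Q"
    using subring_setD(1,2)[OF S] by blast
   then have "lead_coeff D ^ k * poly p x = poly D x * poly Q x"
    by (metis poly_mult poly_smult)
   ultimately show False using lD(2) p(2) v(2) by simp
  qed
  have "P = 0 * p + 1 * P" by simp
  from div[OF P(1) _ _ this] obtain k Q where Q: "Q : poly_set A" "Polynomial.smult (lead_coeff D ^ k) P = D * Q"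
   using subring_setD(1,2)[OF S] by blast
  \<comment> \<open>The cofactor of \<open>D\<close> in a multiple of \<open>P\<close> vanishes at
    \<open>x\<close>, so by minimality it has at least the degree of \<open>P\<close>. This leaves a
    constant \<open>b\<close> for \<open>D\<close>, and \<open>b\<close> is
    \<open>poly s x * v\<close>.\<close>
  have Q0: "Q ~= 0" using Q(2) P(2) lD(2) by auto
  have "lead_coeff D ^ k * poly P x = poly D x * poly Q x"
   using Q(2) by (metis poly_mult poly_smult)
  then have "poly Q x = 0" using Dx P(3) by simp
  then have "degree P <= degree Q" using minP Q(1) Q0 by blast
  moreover have "degree P = degree D + degree Q"
   using arg_cong[OF Q(2), of degree] lD(2) D0 Q0 by (simp add: degree_mult_eq)
  ultimately have "degree D = 0" by simp
  then obtain b where b: "D = [:b:]" by (rule degree_eq_zeroE)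
  have bA: "b : A" "b ~= 0" using DA D0 b by (auto simp: poly_set_def coeff_pCons split: nat.splits)
  have lP: "lead_coeff P : A" using P(1) by (auto simp: poly_set_def)
  have lP0: "lead_coeff P ~= 0" using P(2) by simp
  have dP: "degree P > 0"
  proof (rule ccontr)
   assume "~ ?thesis"
   then obtain c where "P = [:c:]" by (metis degree_eq_zeroE neq0_conv)
   then show False using P by simp
  qed
  \<comment> \<open>The leading coefficient of \<open>P\<close> has to survive for the image of
    \<open>P\<close> to have a root and for relations to specialize after pseudo-division;
    \<open>b\<close> has to survive because \<open>v\<close> divides it.\<close>
  let ?u = "lead_coeff P * b"
  have "EX tau'. hom_on (adjoin A x) tau' & tau' ` adjoin A x <= Om & (ALL a:A. tau' a = tau a) & tau' v ~= 0"
   if tau: "hom_on A tau" "tau ` A <= Om" "tau ?u ~= 0" for tau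
  proof -
   have nz: "tau (lead_coeff P) ~= 0" "tau b ~= 0"
    using tau(3) hom_onD(4)[OF tau(1) A lP bA(1)] by auto
   note z = hom_onD(2)[OF tau(1) A]
   have "coeff (map_poly tau P) (degree P) ~= 0" using nz by (simp add: coeff_map_poly z)
   then have "degree (map_poly tau P) > 0" using le_degree dP by fastforce
   moreover have "map_poly tau P : poly_set Om"
    using P(1) tau(2) by (auto simp: poly_set_def coeff_map_poly z)
   ultimately obtain xi where xi: "xi : Om" "poly (map_poly tau P) xi = 0"
    using Om unfolding alg_closed_set_def by blast
   have "poly (map_poly tau q) xi = 0" if q: "q : poly_set A" "poly q x = 0" for q
   proof -
    obtain k Q R where QR: "Q : poly_set A" "R : poly_set A" "Polynomial.smult (lead_coeff P ^ k) q = P * Q + R"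
     "R = 0 \<or> degree R < degree P"
     using pseudo_division_in_poly_set[OF A P(1,2) q(1)] by blast
    have "poly R x = 0" using arg_cong[OF QR(3), of "%p. poly p x"] q P(3) by simp
    then have "R = 0" using minP[OF QR(2)] QR(4) by linarith
    then have e: "[:lead_coeff P ^ k:] * q = P * Q" using QR(3) by simp
    have c: "lead_coeff P ^ k : A" by (intro subring_set_power[OF A] lP)
    have "map_poly tau [:lead_coeff P ^ k:] * map_poly tau q = map_poly tau P * map_poly tau Q"
     using arg_cong[OF e, of "map_poly tau"] map_poly_hom_on(2)[OF tau(1) A const_in_poly_set[OF A c] q(1)]
      map_poly_hom_on(2)[OF tau(1) A P(1) QR(1)] by simp
    then have "tau (lead_coeff P ^ k) * poly (map_poly tau q) xi = 0"
     using xi(2) by (auto simp: map_poly_hom_on_const[OF tau(1) A] dest: arg_cong[of _ _ "%p. poly p xi"])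
    moreover have "tau (lead_coeff P ^ k) = tau (lead_coeff P) ^ k"
     by (induction k) (auto simp: hom_onD[OF tau(1) A] lP subring_set_power[OF A])
    ultimately show ?thesis using nz by simp
   qed
   from ext[OF tau(1,2) xi(1) this] obtain tau' where tau': "hom_on (adjoin A x) tau'"
    "tau' ` adjoin A x <= Om" "ALL a:A. tau' a = tau a" by blast
   have "b = poly s x * v" using arg_cong[OF st(3), of "%p. poly p x"] b P(3) p(2) by simp
   then have "tau b = tau' (poly s x) * tau' v"
    using hom_onD(4)[OF tau'(1) subring_adjoin[OF A], of "poly s x" v] st(1) v(1) tau'(3) bA(1) by auto
   then have "tau' v ~= 0" using nz by auto
   with tau' show ?thesis by blast
  qed
  moreover have "?u : A" by (intro subring_setD(5)[OF A] lP bA)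
  ultimately show ?thesis using lP0 bA(2) by (intro bexI[of _ ?u]) auto
 qed
qed

text \<open>Each adjunction demands that a single element survive, so the demands can be pulled back
  along the list to one element of the first ring.\<close>

lemma specialize_list:
 assumes "subring_set A" "alg_closed_set Om" "v : foldl adjoin A xs" "v ~= 0"
 shows "EX u:A. u ~= 0 & (ALL tau. hom_on A tau --> tau ` A <= Om --> tau u ~= 0 -->
  (EX tau'. hom_on (foldl adjoin A xs) tau' & tau' ` foldl adjoin A xs <= Om & (ALL a:A. tau' a = tau a) & tau' v ~= 0))"
 using assms
proof (induction xs arbitrary: A)
 case Nil
 then show ?case by auto
next
 case (Cons x xs)
 have "v : foldl adjoin (adjoin A x) xs" using Cons.prems(3) by simp
 from Cons.IH[OF subring_adjoin[OF Cons.prems(1)] Cons.prems(2) this Cons.prems(4)]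
 obtain u' where u': "u' : adjoin A x" "u' ~= 0" and
  ext': "!!tau. hom_on (adjoin A x) tau ==> tau ` adjoin A x <= Om ==> tau u' ~= 0 ==>
   EX tau'. hom_on (foldl adjoin (adjoin A x) xs) tau' & tau' ` foldl adjoin (adjoin A x) xs <= Om &
    (ALL a:adjoin A x. tau' a = tau a) & tau' v ~= 0"
  by blast
 obtain u where u: "u : A" "u ~= 0" and
  ext: "!!tau. hom_on A tau ==> tau ` A <= Om ==> tau u ~= 0 ==>
   EX tau'. hom_on (adjoin A x) tau' & tau' ` adjoin A x <= Om & (ALL a:A. tau' a = tau a) & tau' u' ~= 0"
  using specialize_step[OF Cons.prems(1,2) u'] by blast
 have "EX tau'. hom_on (foldl adjoin A (x # xs)) tau' & tau' ` foldl adjoin A (x # xs) <= Om &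
   (ALL a:A. tau' a = tau a) & tau' v ~= 0"
  if tau: "hom_on A tau" "tau ` A <= Om" "tau u ~= 0" for tau
 proof -
  obtain tau1 where tau1: "hom_on (adjoin A x) tau1" "tau1 ` adjoin A x <= Om" "ALL a:A. tau1 a = tau a" "tau1 u' ~= 0"
   using ext[OF tau] by blast
  obtain tau2 where tau2: "hom_on (foldl adjoin (adjoin A x) xs) tau2"
   "tau2 ` foldl adjoin (adjoin A x) xs <= Om" "ALL a:adjoin A x. tau2 a = tau1 a" "tau2 v ~= 0"
   using ext'[OF tau1(1,2,4)] by blast
  have "ALL a:A. tau2 a = tau a" using tau1(3) bspec[OF tau2(3) adjoin_superset[OF Cons.prems(1)]] by simp
  with tau2 show ?thesis by (intro exI[of _ tau2]) simp
 qed
 with u show ?case by blast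
qed

lemma subring_foldl_adjoin: "subring_set A ==> subring_set (foldl adjoin A xs)"
 by (induction xs arbitrary: A) (auto intro: subring_adjoin)

lemma foldl_adjoin_superset: "subring_set A ==> A <= foldl adjoin A xs"
proof (induction xs arbitrary: A)
 case (Cons x xs)
 have "A <= adjoin A x" using adjoin_superset[OF Cons.prems] by (rule subsetI)
 also have "adjoin A x <= foldl adjoin (adjoin A x) xs"
  by (rule Cons.IH[OF subring_adjoin[OF Cons.prems]])
 finally show ?case by simp
qed simp

lemma foldl_adjoin_self: "subring_set A ==> set xs <= foldl adjoin A xs"
proof (induction xs arbitrary: A)
 case (Cons x xs)
 note sub = subring_adjoin[OF Cons.prems, of x]
 have "x : foldl adjoin (adjoin A x) xs"
  by (rule subsetD[OF foldl_adjoin_superset[OF sub] adjoin_self[OF Cons.prems]])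
 with Cons.IH[OF sub] show ?case by simp
qed simp

text \<open>Because of \<open>inj\<close> the condition on \<open>u\<close> in
  \<open>specialize_list\<close> holds automatically; that lemma is applied with
  \<open>v = 1\<close>, as only the existence of the extension matters.\<close>

lemma specialization_exists:
 assumes A: "subring_set A" and Om: "alg_closed_set Om" and tau: "hom_on A tau" "tau ` A <= Om"
  and inj: "!!u. u : A ==> u ~= 0 ==> tau u ~= 0" and X: "finite X"
 shows "EX R tau'. subring_set R & A <= R & X <= R & hom_on R tau' & tau' ` R <= Om & (ALL a:A. tau' a = tau a)"
proof -
 obtain xs where xs: "set xs = X" using finite_list[OF X] by blast
 have "1 : foldl adjoin A xs" using subring_setD(1)[OF subring_foldl_adjoin[OF A]] .
 from specialize_list[OF A Om this one_neq_zero] obtain u where "u : A" "u ~= 0"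
  "!!tau. hom_on A tau ==> tau ` A <= Om ==> tau u ~= 0 ==> EX tau'. hom_on (foldl adjoin A xs) tau' &
   tau' ` foldl adjoin A xs <= Om & (ALL a:A. tau' a = tau a) & tau' 1 ~= 0"
  by blast
 from this(3)[OF tau inj[OF this(1,2)]] obtain tau' where tau': "hom_on (foldl adjoin A xs) tau'"
  "tau' ` foldl adjoin A xs <= Om" "ALL a:A. tau' a = tau a" by blast
 show ?thesis
  by (rule exI[of _ "foldl adjoin A xs"], rule exI[of _ tau'])
    (use tau' subring_foldl_adjoin[OF A] foldl_adjoin_superset[OF A] foldl_adjoin_self[OF A, of xs, unfolded xs] in simp)
qed

section \<open>Zariski topology\<close>

lemma mat_polys_eq: "mat_polys n = fun_alg ((%(i, j) A. A $$ (i, j)) ` ({..<n} \<times> {..<n}))"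
 (is "_ = fun_alg ?X")
proof (intro equalityI subsetI)
 fix f assume "f : mat_polys n"
 then show "f : fun_alg ?X"
 proof induction
  case (entry i j)
  then show ?case by (intro fun_alg.gen) force
 next
  case (add f g)
  then show ?case using fun_alg.add[of f ?X g] by (simp add: plus_fun_def)
 next
  case (mult f g)
  then show ?case using fun_alg.mult[of f ?X g] by (simp add: times_fun_def)
 qed (rule fun_alg.const)
next
 fix f assume "f : fun_alg ?X"
 then show "f : mat_polys n"
  by induction (auto simp: plus_fun_def times_fun_def intro: mat_polys.intros)
qed

lemma subring_mat_polys: "subring_set (mat_polys n)"
 unfolding mat_polys_eq by (rule subring_fun_alg)

lemma noetherian_mat_polys: "noetherian_set (mat_polys n)"
 unfolding mat_polys_eq by (rule noetherian_fun_alg) auto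

lemma fsum_apply: "(SUM j:I. f j) i = (SUM j:I. f j i)"
 by (induction I rule: infinite_finite_induct) auto

lemma fprod_apply: "(PROD j:I. f j) i = (PROD j:I. f j i)"
 by (induction I rule: infinite_finite_induct) auto

lemma mat_polys_sum:
 assumes "!!i. i : I ==> f i : mat_polys n"
 shows "(%A. SUM i:I. f i A) : mat_polys n"
proof -
 have "(%A. SUM i:I. f i A) = sum f I"
  by (rule ext) (simp add: fsum_apply)
 then show ?thesis using subring_set_sum[OF subring_mat_polys assms] by simp
qed

lemma mat_polys_prod:
 assumes "!!i. i : I ==> f i : mat_polys n"
 shows "(%A. PROD i:I. f i A) : mat_polys n"
proof -
 have "(%A. PROD i:I. f i A) = prod f I"
  by (rule ext) (simp add: fprod_apply)
 then show ?thesis using subring_set_prod[OF subring_mat_polys assms] by simp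
qed

lemma mat_polys_diff: "f : mat_polys n ==> g : mat_polys n ==> (%A. f A - g A) : mat_polys n"
 using subring_setD(6)[OF subring_mat_polys, of f n g] by (simp add: fun_diff_def)

lemma mat_polys_cmult: "f : mat_polys n ==> (%A. c * f A) : mat_polys n"
 by (intro mat_polys.intros)

lemma mat_polys_power: "f : mat_polys n ==> (%A. f A ^ k) : mat_polys n"
 by (induction k) (auto intro: mat_polys.intros)

text \<open>Agreement is asked only on \<open>D\<close>: entries of a matrix of the wrong size carry
  no meaning, so a substitution is polynomial on the carrier only.\<close>

lemma mat_polys_subst:
 assumes "f : mat_polys n"
  and "!!i j. i < n ==> j < n ==> EX e:mat_polys m. ALL A:D. e A = phi A $$ (i, j)"
 shows "EX g:mat_polys m. ALL A:D. g A = f (phi A)"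
 using assms(1)
proof induction
 case (const c)
 show ?case by (rule bexI[of _ "%_. c"]) (auto intro: mat_polys.const)
next
 case (entry i j)
 then show ?case using assms(2)[of i j] by blast
next
 case (add f g)
 then obtain f' g' where "f' : mat_polys m" "g' : mat_polys m" "ALL A:D. f' A = f (phi A)" "ALL A:D. g' A = g (phi A)"
  by blast
 then show ?case by (intro bexI[of _ "%A. f' A + g' A"]) (auto intro: mat_polys.add)
next
 case (mult f g)
 then obtain f' g' where "f' : mat_polys m" "g' : mat_polys m" "ALL A:D. f' A = f (phi A)" "ALL A:D. g' A = g (phi A)"
  by blast
 then show ?case by (intro bexI[of _ "%A. f' A * g' A"]) (auto intro: mat_polys.mult)
qed

lemma mult_mat_entry:
 assumes "A : carrier_mat n m" "B : carrier_mat m k" "i < n" "j < k"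
 shows "(A * B) $$ (i, j) = (SUM l<m. A $$ (i, l) * B $$ (l, j))"
 using assms by (auto simp: scalar_prod_def lessThan_atLeast0)

lemma mat_polys_mult_left:
 assumes "f : mat_polys n" "C : Mat n"
 shows "EX g:mat_polys n. ALL A:Mat n. g A = f (C * A)"
proof (rule mat_polys_subst[OF assms(1)])
 fix i j assume ij: "i < n" "j < n"
 have "(%A. SUM l<n. C $$ (i, l) * A $$ (l, j)) : mat_polys n"
  using ij by (intro mat_polys_sum mat_polys_cmult mat_polys.entry) auto
 moreover have "ALL A:Mat n. (SUM l<n. C $$ (i, l) * A $$ (l, j)) = (C * A) $$ (i, j)"
  using mult_mat_entry[OF assms(2) _ ij] by simp
 ultimately show "EX e:mat_polys n. ALL A:Mat n. e A = (C * A) $$ (i, j)"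
  by (intro bexI[of _ "%A. SUM l<n. C $$ (i, l) * A $$ (l, j)"])
qed

lemma openin_zariski: "openin (zariski n) U \<longleftrightarrow> zariski_open n U"
 unfolding zariski_def using topology_inverse'[OF istopology_zariski_open] by simp

lemma topspace_zariski: "topspace (zariski n) = Mat n"
proof
 show "topspace (zariski n) <= Mat n"
  unfolding topspace_def openin_zariski by (auto simp: zariski_open_def)
 have "zariski_open n (Mat n)"
  unfolding zariski_open_def by (intro exI[of _ "{%_. 1}"]) (auto intro: mat_polys.const)
 then show "Mat n <= topspace (zariski n)"
  unfolding topspace_def openin_zariski by blast
qed

lemma continuous_map_zariski_mult_left:
 assumes "C : Mat n"
 shows "continuous_map (zariski n) (zariski n) (%A. C * A)"
 unfolding continuous_map_def topspace_zariski
proof (intro conjI allI impI)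
 show "(%A. C * A) : Mat n \<rightarrow> Mat n" using assms by auto
next
 fix U assume "openin (zariski n) U"
 then obtain Q where Q: "Q <= mat_polys n" "U = {A : Mat n. EX f:Q. f A ~= 0}"
  by (auto simp: openin_zariski zariski_open_def)
 define q where "q f = (SOME g. g : mat_polys n & (ALL A:Mat n. g A = f (C * A)))" for f
 have q: "q f : mat_polys n" "!!A. A : Mat n ==> q f A = f (C * A)" if "f : Q" for f
 proof -
  have "EX g. g : mat_polys n & (ALL A:Mat n. g A = f (C * A))"
   using mat_polys_mult_left[OF subsetD[OF Q(1) that] assms] by auto
  from someI_ex[OF this] show "q f : mat_polys n" "!!A. A : Mat n ==> q f A = f (C * A)"
   unfolding q_def by auto
 qed
 have "{x : Mat n. C * x : U} = {A : Mat n. EX f:q ` Q. f A ~= 0}"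
  using assms by (auto simp: Q(2) q)
 then show "openin (zariski n) {x : Mat n. C * x : U}"
  unfolding openin_zariski zariski_open_def using q(1) by (intro exI[of _ "q ` Q"]) auto
qed

section \<open>Irreducible sets and homogeneous noetherian spaces\<close>

definition irreducible_in :: "'a topology => 'a set => bool" where
 "irreducible_in X S \<longleftrightarrow> S <= topspace X & S ~= {} &
   (ALL A B. closedin X A --> closedin X B --> S <= A Un B --> S <= A \<or> S <= B)"

lemma irreducible_inD:
 "irreducible_in X S ==> closedin X A ==> closedin X B ==> S <= A Un B ==> S <= A \<or> S <= B"
 by (auto simp: irreducible_in_def)

lemma irreducible_in_finite_Union:
 assumes "irreducible_in X S" "finite F" "!!C. C : F ==> closedin X C" "S <= \<Union>F"
 shows "EX C:F. S <= C"
 using assms(2-4)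
proof (induction F rule: finite_induct)
 case empty
 then show ?case using assms(1) by (auto simp: irreducible_in_def)
next
 case (insert C F)
 then have "S <= C Un \<Union>F" "closedin X C" "closedin X (\<Union>F)" by (auto intro: closedin_Union)
 from irreducible_inD[OF assms(1) this(2,3,1)] insert show ?case by auto
qed

lemma irreducible_in_image:
 assumes "irreducible_in X S" "continuous_map X Y h"
 shows "irreducible_in Y (h ` S)"
 unfolding irreducible_in_def
proof (intro conjI allI impI)
 show "h ` S <= topspace Y" using assms by (force simp: irreducible_in_def continuous_map_def)
 show "h ` S ~= {}" using assms(1) by (auto simp: irreducible_in_def)
next
 fix A B assume AB: "closedin Y A" "closedin Y B" "h ` S <= A Un B"
 have S: "S <= topspace X" using assms(1) by (auto simp: irreducible_in_def)
 have "S <= {x : topspace X. h x : A} \<or> S <= {x : topspace X. h x : B}"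
  using AB S by (intro irreducible_inD[OF assms(1)] closedin_continuous_map_preimage[OF assms(2)]) auto
 then show "h ` S <= A \<or> h ` S <= B" by auto
qed

lemma irreducible_in_connectedin: "irreducible_in X S ==> connectedin X S"
 unfolding connectedin_closedin irreducible_in_def by blast

text \<open>Noetherian induction: a closed set that is neither empty nor irreducible is the union of
  two strictly smaller closed sets.\<close>

lemma irreducible_decomposition:
 assumes wf: "wf {(C, D). closedin X C & closedin X D & C \<subset> D}" and "closedin X C"
 shows "EX F. finite F & (ALL D:F. closedin X D & irreducible_in X D) & C = \<Union>F"
 using wf assms(2)
proof (induction C rule: wf_induct_rule)
 case (less C)
 show ?case
 proof (cases "C = {} \<or> irreducible_in X C")
  case True
  then show ?thesis
  proof
   assume "C = {}"
   then show ?thesis by (intro exI[of _ "{}"]) auto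
  next
   assume "irreducible_in X C"
   then show ?thesis using less.prems by (intro exI[of _ "{C}"]) auto
  qed
 next
  case False
  then obtain A B where AB: "closedin X A" "closedin X B" "C <= A Un B" "~ C <= A" "~ C <= B"
   using closedin_subset[OF less.prems] by (auto simp: irreducible_in_def)
  have *: "closedin X (C Int A)" "closedin X (C Int B)" using AB less.prems by auto
  obtain F where F: "finite F" "ALL D:F. closedin X D & irreducible_in X D" "C Int A = \<Union>F"
   using less.IH[of "C Int A"] * AB less.prems by auto
  obtain H where H: "finite H" "ALL D:H. closedin X D & irreducible_in X D" "C Int B = \<Union>H"
   using less.IH[of "C Int B"] * AB less.prems by auto
  have "C = (C Int A) Un (C Int B)" using AB(3) by blast
  then have "C = \<Union>(F Un H)" by (simp only: F(3) H(3) Union_Un_distrib)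
  then show ?thesis using F H by (intro exI[of _ "F Un H"]) auto
 qed
qed

text \<open>A point outside all but one irreducible component exists by irredundancy; by homogeneity
 every point is such a point, so the irreducible components are disjoint.\<close>

lemma homogeneous_component:
 assumes wf: "wf {(C, D). closedin X C & closedin X D & C \<subset> D}"
  and hom: "!!a b. a : topspace X ==> b : topspace X ==>
   EX h k. homeomorphic_maps X X h k & h a = b"
  and a: "a : topspace X"
 shows "irreducible_in X (connected_component_of_set X a)" "openin X (connected_component_of_set X a)"
proof -
 let ?P = "%F. finite F & (ALL D:F. closedin X D & irreducible_in X D) & topspace X = \<Union>F"
 from irreducible_decomposition[OF wf closedin_topspace] obtain F0 where "?P F0" ..
 from ex_has_least_nat[of ?P, OF this, of card] obtain F where
  "?P F & (ALL H. ?P H --> card F <= card H)" ..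
 then have F: "?P F" and min: "!!H. ?P H ==> card F <= card H" by simp_all
 have red: "C = D" if CD: "C : F" "D : F" "C <= D" for C D
 proof (rule ccontr)
  assume "C ~= D"
  have "\<Union>(F - {C}) = \<Union>F"
  proof
   show "\<Union>F <= \<Union>(F - {C})"
   proof
    fix x assume "x : \<Union>F"
    then obtain E where "E : F" "x : E" by blast
    then show "x : \<Union>(F - {C})" using CD \<open>C ~= D\<close> by (cases "E = C") auto
   qed
  qed auto
  then have "?P (F - {C})" using F by auto
  from min[OF this] show False using F CD(1) by (metis card_Diff1_less not_le)
 qed
 have clF: "!!C. C : F ==> closedin X C" and irF: "!!C. C : F ==> irreducible_in X C"
  using F by auto
 have sub: "EX C:F. S <= C" if "irreducible_in X S" for S
  by (rule irreducible_in_finite_Union[OF that]) (use F that in \<open>auto simp: irreducible_in_def\<close>)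
 obtain C1 where C1: "C1 : F" using F a by auto
 \<comment> \<open>By irreducibility \<open>C1\<close> would lie in a single other member of
   \<open>F\<close>, against irredundancy.\<close>
 have "~ C1 <= \<Union>(F - {C1})"
 proof
  assume "C1 <= \<Union>(F - {C1})"
  then obtain D where "D : F - {C1}" "C1 <= D"
   using irreducible_in_finite_Union[OF irF[OF C1], of "F - {C1}"] F by auto
  then show False using red[OF C1] by auto
 qed
 then obtain x where x: "x : C1" "!!D. D : F ==> x : D ==> D = C1" by auto
 have xX: "x : topspace X" using x(1) C1 F by auto
 have disj: "C = D" if CD: "C : F" "D : F" "y : C" "y : D" for C D y
 proof -
  have "y : topspace X" using CD F by auto
  then obtain h k where hk: "homeomorphic_maps X X h k" "h y = x" using hom xX by blast
  have cont: "continuous_map X X h" "continuous_map X X k" and kh: "!!z. z : topspace X ==> k (h z) = z"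
   using hk(1) by (auto simp: homeomorphic_maps_def)
  \<comment> \<open>A homeomorphism taking \<open>y\<close> to \<open>x\<close> carries every
    component through \<open>y\<close> into one through \<open>x\<close>, that is into
    \<open>C1\<close>. So all components through \<open>y\<close> lie in the image of
    \<open>C1\<close> under \<open>k\<close>, which is irreducible and therefore inside one member
    of \<open>F\<close>.\<close>
  have *: "E <= k ` C1" if E: "E : F" "y : E" for E
  proof -
   obtain C' where C': "C' : F" "h ` E <= C'" using sub[OF irreducible_in_image[OF irF[OF E(1)] cont(1)]] by blast
   then have "C' = C1" using x(2)[of C'] E hk(2) by auto
   with C' have "k ` h ` E <= k ` C1" by auto
   moreover have "E <= topspace X" using E F by auto
   ultimately show ?thesis using kh by (force simp: image_iff subset_iff)
  qed
  obtain E where E: "E : F" "k ` C1 <= E" using sub[OF irreducible_in_image[OF irF[OF C1] cont(2)]] by blast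
  have "C = E" using red[OF CD(1) E(1)] *[OF CD(1,3)] E(2) by blast
  moreover have "D = E" using red[OF CD(2) E(1)] *[OF CD(2,4)] E(2) by blast
  ultimately show ?thesis by simp
 qed
 obtain C where C: "C : F" "a : C" using F a by auto
 \<comment> \<open>Disjointness makes \<open>C\<close> the complement of the finitely many others,
   so it is open as well as closed, and a connected set meeting it stays inside.\<close>
 have "C = topspace X - \<Union>(F - {C})"
 proof
  show "C <= topspace X - \<Union>(F - {C})" using C F disj by blast
  show "topspace X - \<Union>(F - {C}) <= C" using F by blast
 qed
 moreover have "closedin X (\<Union>(F - {C}))" using F by (intro closedin_Union) auto
 ultimately have op: "openin X C" by (metis openin_diff openin_topspace)
 have "connected_component_of_set X a = C"
 proof
  show "C <= connected_component_of_set X a"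
   using irreducible_in_connectedin[OF irF[OF C(1)]] C(2)
   by (intro connected_component_of_maximal) auto
  have con: "connectedin X (connected_component_of_set X a)" by (rule connectedin_connected_component_of)
  have "a : connected_component_of_set X a" using a by (simp add: connected_component_of_refl)
  then show "connected_component_of_set X a <= C"
   using connectedin_clopen_cases[OF con clF[OF C(1)] op] C(2) by (auto simp: disjnt_def)
 qed
 then show "irreducible_in X (connected_component_of_set X a)" "openin X (connected_component_of_set X a)"
  using irF[OF C(1)] op by auto
qed

lemma closedin_zariski_subtopology:
 assumes "T <= Mat n" "closedin (subtopology (zariski n) T) C"
 shows "EX Q<=mat_polys n. C = {A : T. ALL f:Q. f A = 0}"
proof -
 obtain D where D: "closedin (zariski n) D" "C = D Int T" using assms(2) by (auto simp: closedin_subtopology)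
 then have "zariski_open n (Mat n - D)" "D <= Mat n"
  by (auto simp: closedin_def openin_zariski topspace_zariski)
 then obtain Q where Q: "Q <= mat_polys n" "Mat n - D = {A : Mat n. EX f:Q. f A ~= 0}"
  by (auto simp: zariski_open_def)
 have "A : D \<longleftrightarrow> (ALL f:Q. f A = 0)" if "A : Mat n" for A
 proof -
  have "A : Mat n - D \<longleftrightarrow> (EX f:Q. f A ~= 0)" unfolding Q(2) using that by simp
  with that show ?thesis by blast
 qed
 then have "C = {A : T. ALL f:Q. f A = 0}" using D(2) assms(1) by auto
 with Q(1) show ?thesis by blast
qed

text \<open>From a strictly descending chain one takes polynomials \<open>f k\<close> that vanish on
  the next set but not on the present one; one that is a combination of its predecessors gives the
  contradiction.\<close>

lemma wf_closedin_zariski: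
 assumes "T <= Mat n"
 shows "wf {(C, D). closedin (subtopology (zariski n) T) C & closedin (subtopology (zariski n) T) D & C \<subset> D}"
proof (rule ccontr)
 assume "~ ?thesis"
 then obtain C where "ALL k. (C (Suc k), C k) : {(C, D). closedin (subtopology (zariski n) T) C &
   closedin (subtopology (zariski n) T) D & C \<subset> D}"
  unfolding wf_iff_no_infinite_down_chain by (simp only: not_not) (erule exE)
 then have C: "closedin (subtopology (zariski n) T) (C k)" "C (Suc k) \<subset> C k" for k
  by (simp_all add: case_prod_beta)
 have "EX f. f : mat_polys n & (ALL A:C (Suc k). f A = 0) & (EX A:C k. f A ~= 0)" for k
 proof -
  obtain A where A: "A : C k" "A ~: C (Suc k)" using C(2)[of k] by blast
  obtain Q where Q: "Q <= mat_polys n" "C (Suc k) = {A : T. ALL f:Q. f A = 0}"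
   using closedin_zariski_subtopology[OF assms C(1)] by blast
  have "A : T" using A(1) closedin_subset[OF C(1)[of k]] by auto
  with A Q show ?thesis by auto
 qed
 then have "ALL k. EX f. f : mat_polys n & (ALL A:C (Suc k). f A = 0) & (EX A:C k. f A ~= 0)" ..
 from choice[OF this] obtain f where
  "ALL k. f k : mat_polys n & (ALL A:C (Suc k). f k A = 0) & (EX A:C k. f k A ~= 0)" ..
 then have f: "f k : mat_polys n" "A : C (Suc k) ==> f k A = 0" "EX A:C k. f k A ~= 0" for k A
  by auto
 have mono: "C k <= C j" if "j <= k" for j k
  by (rule lift_Suc_antimono_le[of C, OF psubset_imp_subset[OF C(2)] that])
 obtain N where N: "f N : ispan (mat_polys n) (f ` {..<N})"
  using noetherian_seq[OF subring_mat_polys noetherian_mat_polys, of f, OF f(1)] by (rule exE)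
 have "ALL A:C N. g A = 0" if "g : ispan (mat_polys n) (f ` {..<N})" for g
  using that
 proof induction
  case (step a q x)
  then obtain j where "j < N" "q = f j" by auto
  then have "q A = 0" if "A : C N" for A using f(2)[of A j] mono[of "Suc j" N] that by auto
  with step show ?case by auto
 qed auto
 with N f(3)[of N] show False by blast
qed

text \<open>Homogeneity is asked for left translations by matrices, which is how the torsor is
  homogeneous. The first conclusion says that a component is open, the second that it is
  irreducible, both in terms of single polynomials.\<close>

lemma homogeneous_zariski_component:
 assumes T: "T <= Mat n"
  and hom: "!!a b. a : T ==> b : T ==> EX h:Mat n. EX k:Mat n.
   k * h = 1\<^sub>m n & h * k = 1\<^sub>m n & h * a = b & (%A. h * A) ` T <= T & (%A. k * A) ` T <= T"
  and X: "X = connected_component_of_set (subtopology (zariski n) T) c" and c: "c : T"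
 shows "a : X ==> EX f:mat_polys n. f a ~= 0 & (ALL A:T. f A ~= 0 --> A : X)"
  and "f : mat_polys n ==> g : mat_polys n ==> a : X ==> f a ~= 0 ==> b : X ==> g b ~= 0 ==>
   EX x:X. f x ~= 0 & g x ~= 0"
proof -
 let ?S = "subtopology (zariski n) T"
 have top: "topspace ?S = T" using T by (auto simp: topspace_zariski)
 have hom': "EX h k. homeomorphic_maps ?S ?S h k & h a = b"
  if ab: "a : topspace ?S" "b : topspace ?S" for a b
 proof -
  obtain h k where hk: "h : Mat n" "k : Mat n" "k * h = 1\<^sub>m n" "h * k = 1\<^sub>m n"
   "h * a = b" "(%A. h * A) ` T <= T" "(%A. k * A) ` T <= T"
   using hom[of a b] ab by (auto simp: top)
  have "continuous_map ?S ?S (%A. h * A)" "continuous_map ?S ?S (%A. k * A)"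
   using hk T by (auto simp: continuous_map_in_subtopology topspace_zariski
     intro!: continuous_map_from_subtopology continuous_map_zariski_mult_left)
  moreover have "k * (h * A) = A" "h * (k * A) = A" if "A : T" for A
  proof -
   have A: "A : Mat n" using that T by blast
   show "k * (h * A) = A" using A hk by (simp flip: assoc_mult_mat[of k n n h n A n])
   show "h * (k * A) = A" using A hk by (simp flip: assoc_mult_mat[of h n n k n A n])
  qed
  ultimately have "homeomorphic_maps ?S ?S (%A. h * A) (%A. k * A)"
   by (auto simp: homeomorphic_maps_def top)
  then show ?thesis using hk(5) by (intro exI[of _ "%A. h * A"] exI[of _ "%A. k * A"]) simp
 qed
 have ir: "irreducible_in ?S X" and op: "openin ?S X"
  unfolding X using homogeneous_component[OF wf_closedin_zariski[OF T] hom', of c] c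
  by (simp_all only: top)
 have XT: "X <= T" using openin_subset[OF op] top by simp
 show "EX f:mat_polys n. f a ~= 0 & (ALL A:T. f A ~= 0 --> A : X)" if "a : X"
 proof -
  obtain U where "openin (zariski n) U" "X = U Int T" using op by (auto simp: openin_subtopology)
  then obtain Q where Q: "Q <= mat_polys n" "X = {A : Mat n. EX f:Q. f A ~= 0} Int T"
   by (auto simp: openin_zariski zariski_open_def)
  then show ?thesis using that T by blast
 qed
 show "EX x:X. f x ~= 0 & g x ~= 0"
  if fg: "f : mat_polys n" "g : mat_polys n" "a : X" "f a ~= 0" "b : X" "g b ~= 0"
 proof (rule ccontr)
  assume *: "~ ?thesis"
  have cl: "closedin ?S {A : T. h A = 0}" if "h : mat_polys n" for h
  proof -
   have "openin (zariski n) {A : Mat n. EX f:{h}. f A ~= 0}"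
    unfolding openin_zariski zariski_open_def using that by (intro exI[of _ "{h}"]) simp
   then have "openin ?S ({A : Mat n. EX f:{h}. f A ~= 0} Int T)"
    by (auto simp: openin_subtopology)
   moreover have "topspace ?S - {A : T. h A = 0} = {A : Mat n. EX f:{h}. f A ~= 0} Int T"
    using T by (auto simp: topspace_zariski)
   ultimately show ?thesis unfolding closedin_def top by auto
  qed
  have "X <= {A : T. f A = 0} Un {A : T. g A = 0}" using * XT by blast
  from irreducible_inD[OF ir cl[OF fg(1)] cl[OF fg(2)] this] fg show False by blast
 qed
qed

section \<open>Polynomials vanishing to infinite order\<close>

interpretation fs: vector_space "sc :: 'k::field => ('i => 'k) => 'i => 'k"
 by unfold_locales (auto simp: fscale_def algebra_simps)

lemma coord_space_decomp:
 fixes v :: "'i => 'k::field"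
 assumes "finite I" "v : csp I"
 shows "v = (SUM j:I. sc (v j) (%i. if i = j then 1 else 0))"
proof
 fix i
 have "(SUM j:I. sc (v j) (%i. if i = j then 1 else 0)) i = (SUM j:I. if i = j then v j else 0)"
  unfolding fsum_apply by (intro sum.cong) (auto simp: fscale_def)
 then show "v i = (SUM j:I. sc (v j) (%i. if i = j then 1 else 0)) i"
  using assms by (auto simp: coord_space_def)
qed

text \<open>A linear projection onto \<open>W\<close>, recorded by the images \<open>q j\<close> of
  the unit vectors. It produces both the projection to the tangent space and rational equations for
  a rational subspace.\<close>

lemma subspace_projection:
 fixes W :: "('i => 'k::field) set"
 assumes "finite I" "module.subspace sc W" "W <= csp I"
 shows "EX q. (ALL j. q j : W) & (ALL v:W. v = (SUM j:I. sc (v j) (q j)))"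
proof -
 interpret p: vector_space_pair "sc :: 'k => ('i => 'k) => 'i => 'k" "sc :: 'k => ('i => 'k) => 'i => 'k"
  by unfold_locales
 have "Vector_Spaces.linear sc sc (%v :: 'i => 'k. v)"
  by unfold_locales auto
 from p.linear_exists_left_inverse_on[OF this assms(2)]
 obtain g where g: "g ` UNIV <= W" "Vector_Spaces.linear sc sc g" "ALL v:W. g v = v"
  by (auto simp: inj_on_def)
 interpret g: Vector_Spaces.linear "sc :: 'k => ('i => 'k) => 'i => 'k" sc g by (fact g(2))
 let ?q = "%j. g (%i. if i = j then 1 else 0)"
 have "v = (SUM j:I. sc (v j) (?q j))" if "v : W" for v
 proof -
  have "v = g v" using g(3) that by simp
  also have "... = g (SUM j:I. sc (v j) (%i. if i = j then 1 else 0))"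
   using coord_space_decomp[OF assms(1), of v] assms(3) that by auto
  also have "... = (SUM j:I. sc (v j) (?q j))" by (simp only: g.sum g.scale)
  finally show ?thesis .
 qed
 then show ?thesis using g(1) by (intro exI[of _ ?q]) auto
qed

text \<open>\<open>hp n k\<close>: polynomial functions of two matrices, homogeneous of degree \<open>k\<close> in the second.\<close>

inductive hp :: "nat => nat => (complex mat \<times> complex mat => complex) => bool" for n where
 zero: "hp n k (%_. 0)"
| const: "hp n 0 (%_. c)"
| fst: "i < n ==> j < n ==> hp n 0 (%p. fst p $$ (i, j))"
| snd: "i < n ==> j < n ==> hp n (Suc 0) (%p. snd p $$ (i, j))"
| add: "hp n k f ==> hp n k g ==> hp n k (%p. f p + g p)"
| mult: "hp n k f ==> hp n l g ==> hp n (k + l) (%p. f p * g p)"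

lemma hp_cmult: "hp n k f ==> hp n k (%p. c * f p)"
 using hp.mult[OF hp.const[of n c]] by simp

lemma hp_sum:
 assumes "!!i. i : I ==> hp n k (f i)"
 shows "hp n k (%p. SUM i:I. f i p)"
 using assms by (induction I rule: infinite_finite_induct) (auto intro: hp.intros)

lemma hp_mat_polys: "f : mat_polys n ==> hp n 0 (%p. f (fst p))"
proof (induction rule: mat_polys.induct)
 case (mult f g)
 then show ?case using hp.mult[of n 0 _ 0] by simp
qed (auto intro: hp.intros)

lemma hp_homogeneous:
 assumes "hp n k f" "A : Mat n" "B : Mat n"
 shows "f (A, s \<cdot>\<^sub>m B) = s ^ k * f (A, B)"
 using assms by induction (auto simp: algebra_simps power_add)

lemma hp_subst:
 assumes "hp n k f"
  and "!!i j. i < n ==> j < n ==> EX e. hp n 0 e & (ALL p:D. e p = phi p $$ (i, j))"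
  and "!!i j. i < n ==> j < n ==> EX e. hp n 1 e & (ALL p:D. e p = psi p $$ (i, j))"
 shows "EX g. hp n k g & (ALL p:D. g p = f (phi p, psi p))"
 using assms(1)
proof induction
 case (zero k)
 show ?case by (rule exI[of _ "%_. 0"]) (auto intro: hp.intros)
next
 case (const c)
 show ?case by (rule exI[of _ "%_. c"]) (auto intro: hp.intros)
next
 case (fst i j)
 then show ?case using assms(2)[of i j] by simp
next
 case (snd i j)
 then show ?case using assms(3)[of i j] by simp
next
 case (add k f g)
 obtain f' where f': "hp n k f'" "ALL p:D. f' p = f (phi p, psi p)" using add.IH(1) by (elim exE conjE bexE) (rule that)
 obtain g' where g': "hp n k g'" "ALL p:D. g' p = g (phi p, psi p)" using add.IH(2) by (elim exE conjE bexE) (rule that)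
 from f' g' show ?case by (intro exI[of _ "%p. f' p + g' p"]) (auto intro: hp.add)
next
 case (mult k f l g)
 obtain f' where f': "hp n k f'" "ALL p:D. f' p = f (phi p, psi p)" using mult.IH(1) by (elim exE conjE bexE) (rule that)
 obtain g' where g': "hp n l g'" "ALL p:D. g' p = g (phi p, psi p)" using mult.IH(2) by (elim exE conjE bexE) (rule that)
 from f' g' show ?case by (intro exI[of _ "%p. f' p * g' p"]) (auto intro: hp.mult)
qed

lemma hp_tendsto:
 assumes "hp n k f"
  and "!!i j. i < n ==> j < n ==> ((%t. a t $$ (i, j)) \<longlongrightarrow> A $$ (i, j)) F"
  and "!!i j. i < n ==> j < n ==> ((%t. b t $$ (i, j)) \<longlongrightarrow> B $$ (i, j)) F"
 shows "((%t. f (a t, b t)) \<longlongrightarrow> f (A, B)) F"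
 using assms(1) by induction (auto intro!: tendsto_intros assms(2,3))

lemma add_regroup:
 fixes x :: "'a::ab_semigroup_add"
 shows "x = a + r ==> y = b + s ==> x + y = a + b + (r + s)"
 by (simp only: ac_simps)

lemma add_regroup3:
 fixes x :: "'a::ab_semigroup_add"
 shows "x = a + b + r ==> y = c + d + s ==> x + y = a + c + (b + d) + (r + s)"
 by (simp only: ac_simps)

text \<open>Taylor expansion to first order, exact because the remainder may also depend on
  \<open>A\<close>. It supplies one factor of the quadratic remainder of a product in
  \<open>mat_polys_derivative\<close>.\<close>

lemma mat_polys_one_expansion:
 assumes "f : mat_polys n"
 shows "EX R. hp n 1 R & (ALL A:Mat n. f A = f (1\<^sub>m n) + R (A, A - 1\<^sub>m n))"
 using assms
proof induction
 case (const c)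
 show ?case by (rule exI[of _ "%_. 0"]) (auto intro: hp.intros)
next
 case (entry i j)
 then show ?case by (intro exI[of _ "%p. snd p $$ (i, j)"]) (auto intro: hp.intros)
next
 case (add f g)
 obtain R where R: "hp n 1 R" "ALL A:Mat n. f A = f (1\<^sub>m n) + R (A, A - 1\<^sub>m n)"
  using add.IH(1) by (elim exE conjE bexE) (rule that)
 obtain S where S: "hp n 1 S" "ALL A:Mat n. g A = g (1\<^sub>m n) + S (A, A - 1\<^sub>m n)"
  using add.IH(2) by (elim exE conjE bexE) (rule that)
 have "f A + g A = f (1\<^sub>m n) + g (1\<^sub>m n) + (R (A, A - 1\<^sub>m n) + S (A, A - 1\<^sub>m n))"
  if "A : Mat n" for A
  by (rule add_regroup[OF bspec[OF R(2) that] bspec[OF S(2) that]])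
 then show ?case
  by (intro exI[of _ "%p. R p + S p"] conjI ballI hp.add[OF R(1) S(1)])
next
 case (mult f g)
 obtain R where R: "hp n 1 R" "ALL A:Mat n. f A = f (1\<^sub>m n) + R (A, A - 1\<^sub>m n)"
  using mult.IH(1) by (elim exE conjE bexE) (rule that)
 obtain S where S: "hp n 1 S" "ALL A:Mat n. g A = g (1\<^sub>m n) + S (A, A - 1\<^sub>m n)"
  using mult.IH(2) by (elim exE conjE bexE) (rule that)
 note RS = R(1) S(1) R(2) S(2)
 have "hp n (1 + 0) (%p. R p * g (fst p))" by (intro hp.mult RS hp_mat_polys mult)
 then have hp1: "hp n 1 (%p. f (1\<^sub>m n) * S p + R p * g (fst p))"
  by (intro hp.add hp_cmult S(1)) simp
 have "f A * g A = f (1\<^sub>m n) * g (1\<^sub>m n) + (f (1\<^sub>m n) * S (A, A - 1\<^sub>m n) + R (A, A - 1\<^sub>m n) * g A)"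
  if "A : Mat n" for A
 proof -
  have f: "f A = f (1\<^sub>m n) + R (A, A - 1\<^sub>m n)" and g: "g A = g (1\<^sub>m n) + S (A, A - 1\<^sub>m n)"
   using bspec[OF R(2) that] bspec[OF S(2) that] .
  have "x = x1 + r ==> y = y1 + t ==> x * y = x1 * y1 + (x1 * t + r * y)" for x x1 r y y1 t :: complex
   by (simp add: algebra_simps)
  from this[OF f g] show ?thesis .
 qed
 then show ?case
  by (intro exI[of _ "%p. f (1\<^sub>m n) * S p + R p * g (fst p)"] conjI ballI hp1) (simp only: fst_conv)
qed

definition lin_form :: "nat => (nat \<times> nat => complex) => complex mat => complex" where
 "lin_form n l X = (SUM p:{..<n} \<times> {..<n}. l p * X $$ p)"

lemma lin_form_hp: "hp n 1 (%p. lin_form n l (snd p))"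
 unfolding lin_form_def by (intro hp_sum hp_cmult) (auto intro: hp.snd)

lemma lin_form_add: "A : Mat n ==> B : Mat n ==>
  lin_form n l (A + B) = lin_form n l A + lin_form n l B"
 unfolding lin_form_def sum.distrib[symmetric] by (intro sum.cong) (auto simp: algebra_simps)

lemma lin_form_diff: "A : Mat n ==> B : Mat n ==>
  lin_form n l (A - B) = lin_form n l A - lin_form n l B"
 unfolding lin_form_def sum_subtractf[symmetric] by (intro sum.cong) (auto simp: algebra_simps)

text \<open>Chain rule along curves and expansion at the identity come out of one induction, so that
  both refer to the same partial derivatives \<open>d\<close>.\<close>

lemma mat_polys_derivative:
 assumes "f : mat_polys n"
 shows "EX d. (ALL p. d p : mat_polys n) &
  (ALL gam gam' t. (ALL i<n. ALL j<n. ((%s. gam s $$ (i, j)) has_field_derivative gam' $$ (i, j)) (at t)) -->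
   ((%s. f (gam s)) has_field_derivative lin_form n (%p. d p (gam t)) gam') (at t)) &
  (EX Q. hp n 2 Q & (ALL A:Mat n.
   f A = f (1\<^sub>m n) + lin_form n (%p. d p (1\<^sub>m n)) (A - 1\<^sub>m n) + Q (A, A - 1\<^sub>m n)))"
 using assms
proof induction
 case (const c)
 show ?case
  by (rule exI[of _ "%_ _. 0"], intro conjI exI[of _ "%_. 0"])
    (auto simp: lin_form_def intro: mat_polys.const hp.zero)
next
 case (entry i j)
 let ?d = "%p (_ :: complex mat). if p = (i, j) then 1 else (0 :: complex)"
 have l: "lin_form n (%p. ?d p A) X = X $$ (i, j)" for X and A :: "complex mat"
 proof -
  have "lin_form n (%p. ?d p A) X = (SUM p:{..<n} \<times> {..<n}. if p = (i, j) then X $$ p else 0)"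
   unfolding lin_form_def by (intro sum.cong) auto
  then show ?thesis using entry by simp
 qed
 show ?case
 proof (rule exI[of _ ?d], intro conjI exI[of _ "%_. 0"])
  show "ALL p. ?d p : mat_polys n" by (auto intro: mat_polys.const)
 qed (use entry in \<open>auto simp: l intro: hp.zero\<close>)
next
 case (add f g)
 obtain d Q where d: "ALL p. d p : mat_polys n"
  "ALL gam gam' t. (ALL i<n. ALL j<n. ((%s. gam s $$ (i, j)) has_field_derivative gam' $$ (i, j)) (at t)) -->
   ((%s. f (gam s)) has_field_derivative lin_form n (%p. d p (gam t)) gam') (at t)"
  "hp n 2 Q" "ALL A:Mat n.
   f A = f (1\<^sub>m n) + lin_form n (%p. d p (1\<^sub>m n)) (A - 1\<^sub>m n) + Q (A, A - 1\<^sub>m n)"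
  using add.IH(1) by (elim exE conjE) (rule that)
 obtain e R where e: "ALL p. e p : mat_polys n"
  "ALL gam gam' t. (ALL i<n. ALL j<n. ((%s. gam s $$ (i, j)) has_field_derivative gam' $$ (i, j)) (at t)) -->
   ((%s. g (gam s)) has_field_derivative lin_form n (%p. e p (gam t)) gam') (at t)"
  "hp n 2 R" "ALL A:Mat n.
   g A = g (1\<^sub>m n) + lin_form n (%p. e p (1\<^sub>m n)) (A - 1\<^sub>m n) + R (A, A - 1\<^sub>m n)"
  using add.IH(2) by (elim exE conjE) (rule that)
 have l: "lin_form n (%p. d p A + e p A) X = lin_form n (%p. d p A) X + lin_form n (%p. e p A) X" for A X
  unfolding lin_form_def sum.distrib[symmetric] by (simp add: algebra_simps)
 show ?case
 proof (rule exI[of _ "%p A. d p A + e p A"], intro conjI allI impI)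
  show "(%A. d p A + e p A) : mat_polys n" for p by (intro mat_polys.add) (use d(1) e(1) in blast)+
  show "((%s. f (gam s) + g (gam s)) has_field_derivative lin_form n (%p. d p (gam t) + e p (gam t)) gam') (at t)"
   if "ALL i<n. ALL j<n. ((%s. gam s $$ (i, j)) has_field_derivative gam' $$ (i, j)) (at t)" for gam gam' t
   unfolding l by (intro DERIV_add d(2)[rule_format] e(2)[rule_format]) (use that in auto)
  show "EX Q. hp n 2 Q & (ALL A:Mat n. f A + g A = f (1\<^sub>m n) + g (1\<^sub>m n) +
    lin_form n (%p. d p (1\<^sub>m n) + e p (1\<^sub>m n)) (A - 1\<^sub>m n) + Q (A, A - 1\<^sub>m n))"
  proof (rule exI[of _ "%p. Q p + R p"], intro conjI hp.add d(3) e(3) ballI)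
   fix A :: "complex mat" assume A: "A : Mat n"
   show "f A + g A = f (1\<^sub>m n) + g (1\<^sub>m n) +
    lin_form n (%p. d p (1\<^sub>m n) + e p (1\<^sub>m n)) (A - 1\<^sub>m n) + (Q (A, A - 1\<^sub>m n) + R (A, A - 1\<^sub>m n))"
    unfolding l by (rule add_regroup3[OF bspec[OF d(4) A] bspec[OF e(4) A]])
  qed
 qed
next
 case (mult f g)
 obtain d Q where d: "ALL p. d p : mat_polys n"
  "ALL gam gam' t. (ALL i<n. ALL j<n. ((%s. gam s $$ (i, j)) has_field_derivative gam' $$ (i, j)) (at t)) -->
   ((%s. f (gam s)) has_field_derivative lin_form n (%p. d p (gam t)) gam') (at t)"
  "hp n 2 Q" "ALL A:Mat n.
   f A = f (1\<^sub>m n) + lin_form n (%p. d p (1\<^sub>m n)) (A - 1\<^sub>m n) + Q (A, A - 1\<^sub>m n)"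
  using mult.IH(1) by (elim exE conjE) (rule that)
 obtain e R where e: "ALL p. e p : mat_polys n"
  "ALL gam gam' t. (ALL i<n. ALL j<n. ((%s. gam s $$ (i, j)) has_field_derivative gam' $$ (i, j)) (at t)) -->
   ((%s. g (gam s)) has_field_derivative lin_form n (%p. e p (gam t)) gam') (at t)"
  "hp n 2 R" "ALL A:Mat n.
   g A = g (1\<^sub>m n) + lin_form n (%p. e p (1\<^sub>m n)) (A - 1\<^sub>m n) + R (A, A - 1\<^sub>m n)"
  using mult.IH(2) by (elim exE conjE) (rule that)
 let ?h = "%p A. d p A * g A + f A * e p A"
 have l: "lin_form n (%p. d p A * x + y * e p A) X =
   lin_form n (%p. d p A) X * x + lin_form n (%p. e p A) X * y" for A X x y
  unfolding lin_form_def sum_distrib_right sum.distrib[symmetric] by (simp add: algebra_simps)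
 obtain S where S: "hp n 1 S" "ALL A:Mat n. g A = g (1\<^sub>m n) + S (A, A - 1\<^sub>m n)"
  using mat_polys_one_expansion[OF mult.hyps(2)] by (elim exE conjE bexE) (rule that)
 show ?case
 proof (rule exI[of _ ?h], intro conjI allI impI)
  show "?h p : mat_polys n" for p
   by (intro mat_polys.add mat_polys.mult mult.hyps) (use d(1) e(1) in blast)+
  show "((%s. f (gam s) * g (gam s)) has_field_derivative lin_form n (%p. ?h p (gam t)) gam') (at t)"
   if "ALL i<n. ALL j<n. ((%s. gam s $$ (i, j)) has_field_derivative gam' $$ (i, j)) (at t)" for gam gam' t
   unfolding l by (intro DERIV_mult d(2)[rule_format] e(2)[rule_format]) (use that in auto)
  let ?l = "%p. lin_form n (%q. d q (1\<^sub>m n)) (snd p)"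
  let ?Q = "%p. f (1\<^sub>m n) * R p + (Q p * g (fst p) + ?l p * S p)"
  have "hp n (2 + 0) (%p. Q p * g (fst p))" by (intro hp.mult d hp_mat_polys mult.hyps)
  moreover have "hp n (1 + 1) (%p. ?l p * S p)" by (intro hp.mult lin_form_hp S)
  ultimately have hpQ: "hp n 2 ?Q" by (intro hp.add hp_cmult e(3)) (simp_all add: numeral_2_eq_2)
  have "f A * g A = f (1\<^sub>m n) * g (1\<^sub>m n) + lin_form n (%p. ?h p (1\<^sub>m n)) (A - 1\<^sub>m n) + ?Q (A, A - 1\<^sub>m n)"
   if A: "A : Mat n" for A
  proof -
   define L where "L = lin_form n (%q. d q (1\<^sub>m n)) (A - 1\<^sub>m n)"
   define L' where "L' = lin_form n (%q. e q (1\<^sub>m n)) (A - 1\<^sub>m n)"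
   have f: "f A = f (1\<^sub>m n) + L + Q (A, A - 1\<^sub>m n)" unfolding L_def by (rule bspec[OF d(4) A])
   have g: "g A = g (1\<^sub>m n) + L' + R (A, A - 1\<^sub>m n)" unfolding L'_def by (rule bspec[OF e(4) A])
   have S': "S (A, A - 1\<^sub>m n) = L' + R (A, A - 1\<^sub>m n)" using bspec[OF S(2) A, unfolded g] by (simp only: add.assoc add_left_cancel)
   have "x = x1 + L + q ==> y = y1 + L' + r ==>
    x * y = x1 * y1 + (L * y1 + L' * x1) + (x1 * r + (q * y + L * (L' + r)))" for x x1 q y y1 r :: complex
    by (simp add: algebra_simps)
   from this[OF f g] show ?thesis unfolding l fst_conv snd_conv L_def[symmetric] L'_def[symmetric] S' .
  qed
  then show "EX Q. hp n 2 Q & (ALL A:Mat n. f A * g A = f (1\<^sub>m n) * g (1\<^sub>m n) +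
    lin_form n (%p. ?h p (1\<^sub>m n)) (A - 1\<^sub>m n) + Q (A, A - 1\<^sub>m n))"
   by (intro exI[of _ ?Q] conjI ballI hpQ)
 qed
qed

section \<open>The tangent space at the identity and Krull's intersection theorem\<close>

definition vanishing :: "nat => complex mat set => (complex mat => complex) set" where
 "vanishing n G = {f : mat_polys n. ALL A:G. f A = 0}"

text \<open>Differentials at the identity of the polynomials vanishing on \<open>G\<close>, and their annihilator,
 the tangent space of \<open>G\<close> at the identity.\<close>

definition conormal :: "nat => complex mat set => (nat \<times> nat => complex) set" where
 "conormal n G = {l : csp ({..<n} \<times> {..<n}). EX f:vanishing n G. EX Q. hp n 2 Q &
   (ALL A:Mat n. f A = lin_form n l (A - 1\<^sub>m n) + Q (A, A - 1\<^sub>m n))}"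

definition tangent :: "nat => complex mat set => complex mat set" where
 "tangent n G = {X : Mat n. ALL l:conormal n G. lin_form n l X = 0}"

lemma subspace_conormal: "module.subspace sc (conormal n G)"
proof (rule fs.subspaceI)
 show "0 : conormal n G"
  unfolding conormal_def vanishing_def
  by (auto simp: coord_space_def lin_form_def intro!: bexI[of _ "%_. 0"] exI[of _ "%_. 0"] mat_polys.const hp.zero)
next
 fix l m assume "l : conormal n G" "m : conormal n G"
 then obtain f Q g R where *: "l : csp ({..<n} \<times> {..<n})" "m : csp ({..<n} \<times> {..<n})"
  "f : mat_polys n" "ALL A:G. f A = 0" "g : mat_polys n" "ALL A:G. g A = 0" "hp n 2 Q" "hp n 2 R"
  "ALL A:Mat n. f A = lin_form n l (A - 1\<^sub>m n) + Q (A, A - 1\<^sub>m n)"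
  "ALL A:Mat n. g A = lin_form n m (A - 1\<^sub>m n) + R (A, A - 1\<^sub>m n)"
  unfolding conormal_def vanishing_def by auto
 have "lin_form n (l + m) X = lin_form n l X + lin_form n m X" for X
  unfolding lin_form_def sum.distrib[symmetric] by (simp add: algebra_simps)
 then show "l + m : conormal n G"
  unfolding conormal_def vanishing_def using *
  by (intro CollectI conjI bexI[of _ "%A. f A + g A"] exI[of _ "%p. Q p + R p"])
    (auto simp: coord_space_def intro: mat_polys.add hp.add)
next
 fix c l assume "l : conormal n G"
 then obtain f Q where *: "l : csp ({..<n} \<times> {..<n})"
  "f : mat_polys n" "ALL A:G. f A = 0" "hp n 2 Q"
  "ALL A:Mat n. f A = lin_form n l (A - 1\<^sub>m n) + Q (A, A - 1\<^sub>m n)"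
  unfolding conormal_def vanishing_def by blast
 have "lin_form n (sc c l) X = c * lin_form n l X" for X
  unfolding lin_form_def sum_distrib_left fscale_def by (simp add: algebra_simps)
 then show "sc c l : conormal n G"
  unfolding conormal_def vanishing_def using *
  by (intro CollectI conjI bexI[of _ "%A. c * f A"] exI[of _ "%p. c * Q p"])
    (auto simp: coord_space_def fscale_def algebra_simps intro: mat_polys_cmult hp_cmult)
qed

text \<open>Each entry of \<open>B - \<pi> B\<close> is a conormal form evaluated at
  \<open>B\<close>. On \<open>G\<close> such a form is of second order in
  \<open>A - 1\<^sub>m n\<close>, so elements of \<open>G\<close> near the identity are tangent up
  to second order.\<close>

lemma tangent_projection:
 "EX \<pi>. \<pi> : Mat n \<rightarrow> tangent n G &
  (ALL p:{..<n} \<times> {..<n}. EX l. ALL B:Mat n. \<pi> B $$ p = lin_form n l B) &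
  (ALL p:{..<n} \<times> {..<n}. EX Q. hp n 2 Q & (ALL A:G Int Mat n. (A - 1\<^sub>m n) $$ p = \<pi> (A - 1\<^sub>m n) $$ p + Q (A, A - 1\<^sub>m n)))"
proof -
 let ?I = "{..<n} \<times> {..<n}"
 have "conormal n G <= csp ?I" by (auto simp: conormal_def)
 from subspace_projection[OF _ subspace_conormal this] obtain q where
  q: "!!j. q j : conormal n G" "!!l. l : conormal n G ==> l = (SUM j:?I. sc (l j) (q j))" by auto
 define \<pi> where "\<pi> B = mat n n (%p. B $$ p - lin_form n (q p) B)" for B :: "complex mat"
 have "\<pi> B : tangent n G" if B: "B : Mat n" for B
  unfolding tangent_def
 proof (intro CollectI conjI ballI)
  show "\<pi> B : Mat n" by (simp add: \<pi>_def)
  fix l assume "l : conormal n G"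
  from q(2)[OF this] have l: "l p = (SUM j:?I. l j * q j p)" for p
   by (metis (mono_tags, lifting) fscale_def fsum_apply sum.cong)
  have "lin_form n l (\<pi> B) = (SUM p:?I. l p * (B $$ p - lin_form n (q p) B))"
   unfolding lin_form_def[of n l] by (intro sum.cong) (auto simp: \<pi>_def)
  also have "... = lin_form n l B - (SUM p:?I. l p * lin_form n (q p) B)"
   by (simp add: lin_form_def[of n l] algebra_simps sum_subtractf)
  also have "(SUM p:?I. l p * lin_form n (q p) B) = (SUM p:?I. SUM r:?I. l p * (q p r * B $$ r))"
   by (simp only: lin_form_def sum_distrib_left)
  also have "... = (SUM r:?I. SUM p:?I. l p * (q p r * B $$ r))" by (rule sum.swap)
  also have "... = (SUM r:?I. (SUM p:?I. l p * q p r) * B $$ r)"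
   by (simp only: sum_distrib_right mult.assoc)
  also have "... = lin_form n l B" unfolding l[symmetric] by (simp only: lin_form_def)
  finally show "lin_form n l (\<pi> B) = 0" by simp
 qed
 moreover have "EX l. ALL B:Mat n. \<pi> B $$ p = lin_form n l B" if p: "p : ?I" for p
 proof -
  have "\<pi> B $$ p = lin_form n (%r. (if r = p then 1 else 0) - q p r) B" for B
  proof -
   have "lin_form n (%r. (if r = p then 1 else 0) - q p r) B =
    (SUM r:?I. if r = p then B $$ r else 0) - lin_form n (q p) B"
    unfolding lin_form_def sum_subtractf[symmetric] by (intro sum.cong) (auto simp: algebra_simps)
   then show ?thesis using p by (auto simp: \<pi>_def)
  qed
  then show ?thesis by blast
 qed
 moreover have "EX Q. hp n 2 Q & (ALL A:G Int Mat n. (A - 1\<^sub>m n) $$ p = \<pi> (A - 1\<^sub>m n) $$ p + Q (A, A - 1\<^sub>m n))"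
  if p: "p : ?I" for p
 proof -
  obtain f Q where fQ: "ALL A:G. f A = 0" "hp n 2 Q"
   "ALL A:Mat n. f A = lin_form n (q p) (A - 1\<^sub>m n) + Q (A, A - 1\<^sub>m n)"
   using q(1)[of p] unfolding conormal_def vanishing_def by blast
  have "(A - 1\<^sub>m n) $$ p = \<pi> (A - 1\<^sub>m n) $$ p + (- 1) * Q (A, A - 1\<^sub>m n)" if A: "A : G Int Mat n" for A
  proof -
   have "lin_form n (q p) (A - 1\<^sub>m n) + Q (A, A - 1\<^sub>m n) = 0" using fQ A by fastforce
   then show ?thesis using p by (auto simp: \<pi>_def add_eq_0_iff)
  qed
  then show ?thesis using hp_cmult[OF fQ(2), of "- 1"] by (intro exI[of _ "%r. (- 1) * Q r"]) blast
 qed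
 ultimately show ?thesis by (intro exI[of _ \<pi>]) auto
qed

text \<open>An equation of \<open>G\<close> allows to raise the order of vanishing at the identity: the leading form
 vanishes on the tangent space, and modulo higher order it only depends on the projection.\<close>

lemma vanishing_order_step:
 assumes G: "G <= Mat n" and P: "hp n k P" "!!A. A : G ==> P (A, A - 1\<^sub>m n) = b A"
  and curve: "!!X. X : tangent n G ==> EX gam. (ALL t. gam t : G & b (gam t) = 0) & gam (0::complex) = 1\<^sub>m n &
   (ALL i<n. ALL j<n. ((%t. gam t $$ (i, j)) has_field_derivative X $$ (i, j)) (at 0))"
 shows "EX P'. hp n (Suc k) P' & (ALL A:G. P' (A, A - 1\<^sub>m n) = b A)"
proof -
 have zero: "P (1\<^sub>m n, X) = 0" if X: "X : tangent n G" for X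
 proof -
  obtain gam where gam: "!!t. gam t : G" "!!t. b (gam t) = 0" "gam (0::complex) = 1\<^sub>m n"
   "!!i j. i < n ==> j < n ==> ((%t. gam t $$ (i, j)) has_field_derivative X $$ (i, j)) (at 0)"
   using curve[OF X] by (elim exE conjE) auto
  have c: "gam t : Mat n" for t using gam(1) G by blast
  \<comment> \<open>The rescaled secant tends to \<open>X\<close>, and homogeneity of degree
    \<open>k\<close> turns the vanishing of \<open>b\<close> on the curve into that of
    \<open>P\<close> at \<open>(gam t, bet t)\<close>; the limit at 0 gives the leading form at
    \<open>X\<close>.\<close>
  define bet where "bet t = (1 / t) \<cdot>\<^sub>m (gam t - 1\<^sub>m n)" for t
  have "P (gam t, bet t) = 0" if "t ~= 0" for t
  proof -
   have "t \<cdot>\<^sub>m bet t = gam t - 1\<^sub>m n"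
    using that c[of t] by (intro eq_matI) (auto simp: bet_def)
   moreover have "bet t : Mat n" using c[of t] by (auto simp: bet_def)
   ultimately have "t ^ k * P (gam t, bet t) = b (gam t)"
    using hp_homogeneous[OF P(1) c[of t], of "bet t" t] P(2)[OF gam(1)[of t]] by simp
   then show ?thesis using gam(2) that by simp
  qed
  then have "eventually (%t. P (gam t, bet t) = 0) (at 0)" by (auto simp: eventually_at_filter)
  then have "((%t. P (gam t, bet t)) \<longlongrightarrow> 0) (at 0)" by (rule tendsto_eventually)
  moreover have "((%t. P (gam t, bet t)) \<longlongrightarrow> P (1\<^sub>m n, X)) (at 0)"
  proof (rule hp_tendsto[OF P(1)])
   fix i j assume ij: "i < n" "j < n"
   have "((%t. gam t $$ (i, j)) \<longlongrightarrow> gam 0 $$ (i, j)) (at 0)"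
    using DERIV_isCont[OF gam(4)[OF ij]] by (simp add: isCont_def)
   then show "((%t. gam t $$ (i, j)) \<longlongrightarrow> 1\<^sub>m n $$ (i, j)) (at 0)" by (simp add: gam(3))
   have "((%t. (gam t $$ (i, j) - gam 0 $$ (i, j)) / (t - 0)) \<longlongrightarrow> X $$ (i, j)) (at 0)"
    using gam(4)[OF ij] by (simp add: has_field_derivative_iff)
   moreover have "(gam t $$ (i, j) - gam 0 $$ (i, j)) / (t - 0) = bet t $$ (i, j)" for t
    using ij c[of t] by (simp add: bet_def gam(3))
   ultimately show "((%t. bet t $$ (i, j)) \<longlongrightarrow> X $$ (i, j)) (at 0)" by simp
  qed
  ultimately show ?thesis by (metis tendsto_unique trivial_limit_at)
 qed
 obtain \<pi> where \<pi>: "\<pi> : Mat n \<rightarrow> tangent n G"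
  "!!i j. i < n ==> j < n ==> EX l. ALL B:Mat n. \<pi> B $$ (i, j) = lin_form n l B"
  "!!i j. i < n ==> j < n ==> EX Q. hp n 2 Q & (ALL A:G. (A - 1\<^sub>m n) $$ (i, j) = \<pi> (A - 1\<^sub>m n) $$ (i, j) + Q (A, A - 1\<^sub>m n))"
  using tangent_projection[of n G] G by (elim exE conjE) (auto simp: Int_absorb2)
 let ?D = "{p. snd p : Mat n}"
 have sub: "EX g. hp n l g & (ALL p:?D. g p = f (1\<^sub>m n, \<pi> (snd p)))" if "hp n l f" for l f
 proof (rule hp_subst[OF that])
  fix i j assume ij: "i < n" "j < n"
  show "EX e. hp n 0 e & (ALL p:?D. e p = 1\<^sub>m n $$ (i, j))"
   by (intro exI[of _ "%_. 1\<^sub>m n $$ (i, j)"]) (auto intro: hp.const)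
  obtain l where "ALL B:Mat n. \<pi> B $$ (i, j) = lin_form n l B" using \<pi>(2)[OF ij] by blast
  then show "EX e. hp n 1 e & (ALL p:?D. e p = \<pi> (snd p) $$ (i, j))"
   by (intro exI[of _ "%p. lin_form n l (snd p)"]) (auto intro: lin_form_hp[unfolded One_nat_def])
 qed
 \<comment> \<open>Replacing \<open>A\<close> by the identity in the first argument and the
   difference by its tangential part in the second costs a term of one order more, first for entries
   and then for sums and products.\<close>
 have "EX P'. hp n (Suc k) P' & (ALL A:G. P (A, A - 1\<^sub>m n) = P (1\<^sub>m n, \<pi> (A - 1\<^sub>m n)) + P' (A, A - 1\<^sub>m n))"
  using P(1)
 proof induction
  case (zero k)
  show ?case by (intro exI[of _ "%_. 0"]) (auto intro: hp.zero)
 next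
  case (const c)
  show ?case by (intro exI[of _ "%_. 0"]) (auto intro: hp.zero)
 next
  case (fst i j)
  then show ?case using G
   by (intro exI[of _ "%p. snd p $$ (i, j)"]) (auto intro: hp.snd)
 next
  case (snd i j)
  then show ?case using \<pi>(3)[OF snd] by (simp add: numeral_2_eq_2)
 next
  case (add k f g)
  obtain f' where f': "hp n (Suc k) f'"
   "ALL A:G. f (A, A - 1\<^sub>m n) = f (1\<^sub>m n, \<pi> (A - 1\<^sub>m n)) + f' (A, A - 1\<^sub>m n)"
   using add.IH(1) by (elim exE conjE bexE) (rule that)
  obtain g' where g': "hp n (Suc k) g'"
   "ALL A:G. g (A, A - 1\<^sub>m n) = g (1\<^sub>m n, \<pi> (A - 1\<^sub>m n)) + g' (A, A - 1\<^sub>m n)"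
   using add.IH(2) by (elim exE conjE bexE) (rule that)
  from f' g' show ?case by (intro exI[of _ "%p. f' p + g' p"]) (auto intro: hp.add)
 next
  case (mult k f l g)
  obtain f' where f': "hp n (Suc k) f'"
   "ALL A:G. f (A, A - 1\<^sub>m n) = f (1\<^sub>m n, \<pi> (A - 1\<^sub>m n)) + f' (A, A - 1\<^sub>m n)"
   using mult.IH(1) by (elim exE conjE bexE) (rule that)
  obtain g' where g': "hp n (Suc l) g'"
   "ALL A:G. g (A, A - 1\<^sub>m n) = g (1\<^sub>m n, \<pi> (A - 1\<^sub>m n)) + g' (A, A - 1\<^sub>m n)"
   using mult.IH(2) by (elim exE conjE bexE) (rule that)
  note * = f'(1) g'(1) f'(2) g'(2)
  obtain f0 where f0: "hp n k f0" "ALL p:?D. f0 p = f (1\<^sub>m n, \<pi> (snd p))" using sub[OF mult.hyps(1)] by (elim exE conjE bexE) (rule that)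
  have "hp n (Suc k + l) (%p. f' p * g p)" "hp n (k + Suc l) (%p. f0 p * g' p)"
   by (intro hp.mult * f0 mult.hyps)+
  then have "hp n (Suc (k + l)) (%p. f' p * g p + f0 p * g' p)" by (auto intro: hp.add)
  moreover have "f (A, A - 1\<^sub>m n) * g (A, A - 1\<^sub>m n) = f (1\<^sub>m n, \<pi> (A - 1\<^sub>m n)) * g (1\<^sub>m n, \<pi> (A - 1\<^sub>m n)) +
    (f' (A, A - 1\<^sub>m n) * g (A, A - 1\<^sub>m n) + f0 (A, A - 1\<^sub>m n) * g' (A, A - 1\<^sub>m n))" if A: "A : G" for A
  proof -
   have e: "f0 (A, A - 1\<^sub>m n) = f (1\<^sub>m n, \<pi> (A - 1\<^sub>m n))" using bspec[OF f0(2), of "(A, A - 1\<^sub>m n)"] minus_carrier_mat[OF one_carrier_mat, of A] by simp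
   have f: "f (A, A - 1\<^sub>m n) = f (1\<^sub>m n, \<pi> (A - 1\<^sub>m n)) + f' (A, A - 1\<^sub>m n)"
    and g: "g (A, A - 1\<^sub>m n) = g (1\<^sub>m n, \<pi> (A - 1\<^sub>m n)) + g' (A, A - 1\<^sub>m n)" using *(3,4) A by blast+
   show ?thesis unfolding e f g by (simp add: algebra_simps)
  qed
  ultimately show ?case by (intro exI[of _ "%p. f' p * g p + f0 p * g' p"]) auto
 qed
 then obtain P' where P': "hp n (Suc k) P'"
  "ALL A:G. P (A, A - 1\<^sub>m n) = P (1\<^sub>m n, \<pi> (A - 1\<^sub>m n)) + P' (A, A - 1\<^sub>m n)" by (elim exE conjE bexE) (rule that)
 have "P' (A, A - 1\<^sub>m n) = b A" if A: "A : G" for A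
 proof -
  have "A - 1\<^sub>m n : Mat n" using A G by auto
  then have "P (1\<^sub>m n, \<pi> (A - 1\<^sub>m n)) = 0" using zero \<pi>(1) by blast
  then show ?thesis using P'(2) P(2)[OF A] A by auto
 qed
 with P'(1) show ?thesis by blast
qed

abbreviation pair_gens :: "nat => (complex mat \<times> complex mat => complex) set" where
 "pair_gens n == (%(i, j) p. fst p $$ (i, j)) ` ({..<n} \<times> {..<n}) Un (%(i, j) p. snd p $$ (i, j)) ` ({..<n} \<times> {..<n})"

lemma hp_fun_alg: "hp n k f ==> f : fun_alg (pair_gens n)"
proof (induction rule: hp.induct)
 case (add k f g)
 then show ?case using fun_alg.add[of f _ g] by (simp add: plus_fun_def)
next
 case (mult k f l g)
 then show ?case using fun_alg.mult[of f _ g] by (simp add: times_fun_def)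
qed (force intro: fun_alg.const fun_alg.gen)+

definition eval_poly :: "(complex mat => complex) poly => complex mat => complex poly" where
 "eval_poly P A = map_poly (%f. f A) P"

lemma coeff_eval_poly: "coeff (eval_poly P A) i = coeff P i A"
 by (simp add: eval_poly_def coeff_map_poly)

lemma eval_poly_simps:
 "eval_poly (P + Q) A = eval_poly P A + eval_poly Q A"
 "eval_poly (P - Q) A = eval_poly P A - eval_poly Q A"
 "eval_poly (P * Q) A = eval_poly P A * eval_poly Q A"
 by (intro poly_eqI; simp add: coeff_eval_poly coeff_mult fsum_apply)+

lemma eval_poly_monom: "eval_poly (monom f k) A = monom (f A) k"
 by (intro poly_eqI) (simp add: coeff_eval_poly)

text \<open>Along the ray \<open>s \<cdot>\<^sub>m (A - 1\<^sub>m n)\<close> everything becomes a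
  polynomial in \<open>s\<close>, whose powers separate the homogeneous degrees.\<close>

lemma fun_alg_pair_ray:
 assumes "f : fun_alg (pair_gens n)"
 shows "EX P:poly_set (mat_polys n). ALL A:Mat n. ALL s. f (A, s \<cdot>\<^sub>m (A - 1\<^sub>m n)) = poly (eval_poly P A) s"
proof -
 note S = subring_poly_set[OF subring_mat_polys[of n]]
 note M = monom_in_poly_set[OF subring_mat_polys[of n]]
 show ?thesis
  using assms
 proof induction
  case (const c)
  show ?case
   by (intro bexI[of _ "monom (%_. c) 0"] M mat_polys.const) (simp add: eval_poly_monom poly_monom)
 next
  case (gen f)
  then obtain i j where "i < n" "j < n" "f = (%p. fst p $$ (i, j)) \<or> f = (%p. snd p $$ (i, j))" by auto
  then show ?case
  proof (elim disjE)
   assume ij: "i < n" "j < n" "f = (%p. fst p $$ (i, j))"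
   then show ?case
    by (intro bexI[of _ "monom (%A. A $$ (i, j)) 0"] M mat_polys.entry) (simp_all add: eval_poly_monom poly_monom)
  next
   assume ij: "i < n" "j < n" "f = (%p. snd p $$ (i, j))"
   then show ?case
    by (intro bexI[of _ "monom (%A. A $$ (i, j) - 1\<^sub>m n $$ (i, j)) 1"] M mat_polys_diff mat_polys.entry mat_polys.const)
      (simp_all add: eval_poly_monom poly_monom)
  qed
 next
  case (add f g)
  obtain P where P: "P : poly_set (mat_polys n)"
   "ALL A:Mat n. ALL s. f (A, s \<cdot>\<^sub>m (A - 1\<^sub>m n)) = poly (eval_poly P A) s"
   using add.IH(1) by (elim exE conjE bexE) (rule that)
  obtain Q where Q: "Q : poly_set (mat_polys n)"
   "ALL A:Mat n. ALL s. g (A, s \<cdot>\<^sub>m (A - 1\<^sub>m n)) = poly (eval_poly Q A) s"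
   using add.IH(2) by (elim exE conjE bexE) (rule that)
  from P Q show ?case by (intro bexI[of _ "P + Q"]) (auto simp: eval_poly_simps intro: subring_setD(4)[OF S])
 next
  case (mult f g)
  obtain P where P: "P : poly_set (mat_polys n)"
   "ALL A:Mat n. ALL s. f (A, s \<cdot>\<^sub>m (A - 1\<^sub>m n)) = poly (eval_poly P A) s"
   using mult.IH(1) by (elim exE conjE bexE) (rule that)
  obtain Q where Q: "Q : poly_set (mat_polys n)"
   "ALL A:Mat n. ALL s. g (A, s \<cdot>\<^sub>m (A - 1\<^sub>m n)) = poly (eval_poly Q A) s"
   using mult.IH(2) by (elim exE conjE bexE) (rule that)
  from P Q show ?case by (intro bexI[of _ "P * Q"]) (auto simp: eval_poly_simps intro: subring_setD(5)[OF S])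
 qed
qed

text \<open>Perdry's proof of Krull's intersection theorem: a relation between the homogeneous
 representatives \<open>P k\<close> of \<open>b\<close> yields \<open>b = q b\<close> on \<open>G\<close> with \<open>q\<close> vanishing at the identity.\<close>

lemma local_vanishing:
 assumes G: "G <= Mat n" and b: "b : mat_polys n"
  and curve: "!!X. X : tangent n G ==> EX gam. (ALL t. gam t : G & b (gam t) = 0) & gam (0::complex) = 1\<^sub>m n &
   (ALL i<n. ALL j<n. ((%t. gam t $$ (i, j)) has_field_derivative X $$ (i, j)) (at 0))"
 shows "EX e:mat_polys n. e (1\<^sub>m n) ~= 0 & (ALL A:G. e A * b A = 0)"
proof -
 have "EX P. hp n k P & (ALL A:G. P (A, A - 1\<^sub>m n) = b A)" for k
 proof (induction k)
  case 0
  show ?case using hp_mat_polys[OF b] by (intro exI[of _ "%p. b (fst p)"]) simp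
 next
  case (Suc k)
  obtain P where P: "hp n k P" "ALL A:G. P (A, A - 1\<^sub>m n) = b A" using Suc.IH by (elim exE conjE bexE) (rule that)
  show ?case by (rule vanishing_order_step[OF G P(1) _ curve]) (use P(2) in auto)
 qed
 then have "ALL k. EX P. hp n k P & (ALL A:G. P (A, A - 1\<^sub>m n) = b A)" ..
 from choice[OF this] obtain P where "ALL k. hp n k (P k) & (ALL A:G. P k (A, A - 1\<^sub>m n) = b A)" ..
 then have P: "hp n k (P k)" "A : G ==> P k (A, A - 1\<^sub>m n) = b A" for k A by auto
 let ?R = "fun_alg (pair_gens n)"
 obtain N where N: "P N : ispan ?R (P ` {..<N})"
  using noetherian_seq[OF subring_fun_alg noetherian_fun_alg, of "pair_gens n" P] hp_fun_alg[OF P(1)] by auto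
 \<comment> \<open>Scaling the second argument by \<open>s\<close> multiplies \<open>P i\<close> by
   \<open>s ^ i\<close>. A combination of the \<open>P i\<close> with \<open>i < N\<close> thus
   becomes a polynomial in \<open>s\<close> times \<open>b\<close>; at the identity the coefficients
   of the combination do not depend on \<open>s\<close>, so the power \<open>s ^ N\<close> is absent
   there.\<close>
 have "EX W:poly_set (mat_polys n). (ALL A:G. ALL s. f (A, s \<cdot>\<^sub>m (A - 1\<^sub>m n)) = poly (eval_poly W A) s * b A) &
   (coeff W N (1\<^sub>m n) = 0)" if "f : ispan ?R (P ` {..<N})" for f
  using that
 proof induction
  case zero
  show ?case
   by (intro bexI[of _ 0]) (auto simp: eval_poly_def subring_setD(2)[OF subring_poly_set[OF subring_mat_polys]])
 next
  case (step a q x)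
  obtain W where W: "W : poly_set (mat_polys n)"
   "ALL A:G. ALL s. x (A, s \<cdot>\<^sub>m (A - 1\<^sub>m n)) = poly (eval_poly W A) s * b A" "coeff W N (1\<^sub>m n) = 0"
   using step.IH by (elim exE conjE bexE) (rule that)
  obtain i where i: "i < N" "q = P i" using step by auto
  obtain U where U: "U : poly_set (mat_polys n)"
   "ALL A:Mat n. ALL s. a (A, s \<cdot>\<^sub>m (A - 1\<^sub>m n)) = poly (eval_poly U A) s"
   using fun_alg_pair_ray[OF step(1)] by (elim exE conjE bexE) (rule that)
  have one: "(%_. 1) : mat_polys n" by (rule mat_polys.const)
  let ?V = "monom (%_. 1) i * U + W"
  have "?V : poly_set (mat_polys n)"
   by (intro subring_setD(4,5)[OF subring_poly_set[OF subring_mat_polys]] monom_in_poly_set[OF subring_mat_polys] one U W)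
  moreover have "(a * q + x) (A, s \<cdot>\<^sub>m (A - 1\<^sub>m n)) = poly (eval_poly ?V A) s * b A" if A: "A : G" for A s
  proof -
   have A': "A : Mat n" using A G by blast
   have cA: "A - 1\<^sub>m n : Mat n" by (rule minus_carrier_mat) simp
   have "q (A, s \<cdot>\<^sub>m (A - 1\<^sub>m n)) = s ^ i * b A"
    using hp_homogeneous[OF P(1)[of i] A' cA, of s] P(2)[OF A] i(2) by simp
   then show ?thesis
    using U(2) A' W(2) A by (simp add: eval_poly_simps eval_poly_monom poly_monom algebra_simps)
  qed
  moreover have "coeff ?V N (1\<^sub>m n) = 0"
  proof -
   have z: "s \<cdot>\<^sub>m (1\<^sub>m n - 1\<^sub>m n) = (0\<^sub>m n n :: complex mat)" for s by (intro eq_matI) auto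
   have "poly (eval_poly U (1\<^sub>m n)) s = a (1\<^sub>m n, 0\<^sub>m n n)" for s
    using U(2)[rule_format, of "1\<^sub>m n" s] by (simp add: z)
   then have "poly (eval_poly U (1\<^sub>m n)) = poly [:a (1\<^sub>m n, 0\<^sub>m n n):]" by auto
   then have "eval_poly U (1\<^sub>m n) = [:a (1\<^sub>m n, 0\<^sub>m n n):]" by (simp only: poly_eq_poly_eq_iff)
   then have "coeff U (N - i) (1\<^sub>m n) = 0"
    using i(1) by (metis coeff_eval_poly coeff_pCons_Suc coeff_0 Suc_diff_Suc)
   then show ?thesis using W(3) i(1) by (simp add: coeff_monom_mult times_fun_def)
  qed
  ultimately show ?case by blast
 qed
 note rel = this[OF N]
 obtain W where W: "W : poly_set (mat_polys n)"
  "ALL A:G. ALL s. P N (A, s \<cdot>\<^sub>m (A - 1\<^sub>m n)) = poly (eval_poly W A) s * b A" "coeff W N (1\<^sub>m n) = 0"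
  using rel by (elim exE conjE bexE) (rule that)
 \<comment> \<open>The relation multiplies \<open>b A\<close> by a polynomial in \<open>s\<close>
   and also by \<open>s ^ N\<close>; this is the difference of the coefficients of
   \<open>s ^ N\<close>.\<close>
 let ?e = "%A. 1 - coeff W N A"
 have "?e A * b A = 0" if A: "A : G" for A
 proof -
  have A': "A : Mat n" using A G by blast
  have "s ^ N * b A = poly (eval_poly W A) s * b A" for s
  proof -
   have "P N (A, s \<cdot>\<^sub>m (A - 1\<^sub>m n)) = s ^ N * P N (A, A - 1\<^sub>m n)"
    by (rule hp_homogeneous[OF P(1) A' minus_carrier_mat[OF one_carrier_mat]])
   then show ?thesis using P(2)[OF A, of N] bspec[OF W(2) A, rule_format, of s] by auto
  qed
  then have "poly (Polynomial.smult (b A) (monom 1 N - eval_poly W A)) s = 0" for s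
   by (simp add: poly_monom algebra_simps)
  then have "Polynomial.smult (b A) (monom 1 N - eval_poly W A) = 0" using poly_all_0_iff_0 by blast
  then have "coeff (Polynomial.smult (b A) (monom 1 N - eval_poly W A)) N = coeff 0 N" by (simp only:)
  then show ?thesis by (auto simp: coeff_eval_poly)
 qed
 moreover have "?e : mat_polys n"
  using W(1) by (intro mat_polys_diff mat_polys.const) (auto simp: poly_set_def)
 ultimately show ?thesis using W(3) by (intro bexI[of _ ?e]) auto
qed

section \<open>One-parameter subgroups\<close>

text \<open>The exponential of \<open>t X\<close>, entry by entry, so that theorems on scalar power
  series apply.\<close>

definition mexp :: "nat => complex mat => complex => complex mat" where
 "mexp n X t = mat n n (%p. \<Sum>k. (X ^\<^sub>m k) $$ p / fact k * t ^ k)"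

lemma mexp_carrier [simp]: "mexp n X t : Mat n"
 by (simp add: mexp_def)

lemma mexp_dim [simp]: "dim_row (mexp n X t) = n" "dim_col (mexp n X t) = n"
 by (simp_all add: mexp_def)

lemma pow_mat_entry_bound:
 assumes "X : Mat n" "i < n" "j < n"
  and "!!i j. i < n ==> j < n ==> cmod (X $$ (i, j)) <= C"
 shows "cmod ((X ^\<^sub>m k) $$ (i, j)) <= (of_nat n * C) ^ k"
 using assms(2,3)
proof (induction k arbitrary: i j)
 case 0
 then show ?case using assms(1) by auto
next
 case (Suc k)
 have Xk: "X ^\<^sub>m k : Mat n" using assms(1) by simp
 have C: "0 <= C" using assms(4)[OF Suc.prems] norm_ge_zero order.trans by blast
 have "cmod ((X ^\<^sub>m Suc k) $$ (i, j)) <= (SUM l<n. cmod ((X ^\<^sub>m k) $$ (i, l) * X $$ (l, j)))"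
  using mult_mat_entry[OF Xk assms(1) Suc.prems] by (simp add: sum_norm_le)
 also have "... <= (SUM l<n. (of_nat n * C) ^ k * C)"
  using Suc.prems C by (intro sum_mono) (auto simp: norm_mult intro!: mult_mono Suc.IH assms(4))
 also have "... = (of_nat n * C) ^ Suc k" by simp
 finally show ?case .
qed

lemma summable_mexp:
 fixes X :: "complex mat"
 assumes "X : Mat n" "i < n" "j < n"
 shows "summable (%k. (X ^\<^sub>m k) $$ (i, j) / fact k * t ^ k)"
proof -
 define C where "C = Max ((%p. cmod (X $$ p)) ` ({..<n} \<times> {..<n}))"
 have C: "cmod (X $$ (i, j)) <= C" if "i < n" "j < n" for i j
  unfolding C_def using that by (intro Max_ge) auto
 let ?r = "of_nat n * C * cmod t"
 show ?thesis
 proof (rule summable_comparison_test'[of "%k. inverse (fact k) * ?r ^ k" 0])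
  show "summable (%k. inverse (fact k) * ?r ^ k)" by (rule summable_exp)
  fix k
  have "cmod ((X ^\<^sub>m k) $$ (i, j)) / fact k * cmod t ^ k <= (of_nat n * C) ^ k / fact k * cmod t ^ k"
   by (intro mult_right_mono divide_right_mono pow_mat_entry_bound[OF assms C]) auto
  then show "cmod ((X ^\<^sub>m k) $$ (i, j) / fact k * t ^ k) <= inverse (fact k) * ?r ^ k"
   by (simp add: norm_mult norm_divide norm_power power_mult_distrib field_simps)
 qed
qed

lemma mexp_mult_right_entry:
 assumes X: "X : Mat n" and F: "F : Mat n" and ij: "i < n" "j < n"
 shows "(mexp n X t * F) $$ (i, j) = (\<Sum>k. (X ^\<^sub>m k * F) $$ (i, j) / fact k * t ^ k)"
proof -
 have Xk: "X ^\<^sub>m k : Mat n" for k using X by simp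
 have "(mexp n X t * F) $$ (i, j) = (SUM l<n. (\<Sum>k. (X ^\<^sub>m k) $$ (i, l) / fact k * t ^ k) * F $$ (l, j))"
  using mult_mat_entry[OF mexp_carrier F ij] ij by (simp add: mexp_def)
 also have "... = (SUM l<n. \<Sum>k. (X ^\<^sub>m k) $$ (i, l) / fact k * t ^ k * F $$ (l, j))"
  using ij by (intro sum.cong refl suminf_mult2 summable_mexp[OF X]) auto
 also have "... = (\<Sum>k. SUM l<n. (X ^\<^sub>m k) $$ (i, l) / fact k * t ^ k * F $$ (l, j))"
  using ij by (intro suminf_sum[symmetric] summable_mult2 summable_mexp[OF X]) auto
 also have "... = (\<Sum>k. (X ^\<^sub>m k * F) $$ (i, j) / fact k * t ^ k)"
  unfolding mult_mat_entry[OF Xk F ij]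
  by (intro suminf_cong) (simp add: sum_distrib_left sum_distrib_right sum_divide_distrib mult_ac)
 finally show ?thesis .
qed

lemma mexp_mult_left_entry:
 assumes X: "X : Mat n" and F: "F : Mat n" and ij: "i < n" "j < n"
 shows "(F * mexp n X t) $$ (i, j) = (\<Sum>k. (F * X ^\<^sub>m k) $$ (i, j) / fact k * t ^ k)"
proof -
 have Xk: "X ^\<^sub>m k : Mat n" for k using X by simp
 have "(F * mexp n X t) $$ (i, j) = (SUM l<n. F $$ (i, l) * (\<Sum>k. (X ^\<^sub>m k) $$ (l, j) / fact k * t ^ k))"
  using mult_mat_entry[OF F mexp_carrier ij] ij by (simp add: mexp_def)
 also have "... = (SUM l<n. \<Sum>k. F $$ (i, l) * ((X ^\<^sub>m k) $$ (l, j) / fact k * t ^ k))"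
  using ij by (intro sum.cong refl suminf_mult[symmetric] summable_mexp[OF X]) auto
 also have "... = (\<Sum>k. SUM l<n. F $$ (i, l) * ((X ^\<^sub>m k) $$ (l, j) / fact k * t ^ k))"
  using ij by (intro suminf_sum[symmetric] summable_mult summable_mexp[OF X]) auto
 also have "... = (\<Sum>k. (F * X ^\<^sub>m k) $$ (i, j) / fact k * t ^ k)"
  unfolding mult_mat_entry[OF F Xk ij]
  by (intro suminf_cong) (simp add: sum_distrib_left sum_distrib_right sum_divide_distrib mult_ac)
 finally show ?thesis .
qed

text \<open>With two generators the statement also covers invariant subspaces:
  \<open>mexp_FB\<close> takes for \<open>F\<close> a projection whose kernel is the
  subspace.\<close>

lemma mexp_intertwine:
 assumes X: "X : Mat n" and Y: "Y : Mat n" and F: "F : Mat n" and c: "Y * F = F * X"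
 shows "mexp n Y t * F = F * mexp n X t"
proof -
 have "Y ^\<^sub>m k * F = F * X ^\<^sub>m k" for k
 proof (induction k)
  case 0
  show ?case using X Y F by simp
 next
  case (Suc k)
  have Xk: "X ^\<^sub>m k : Mat n" "Y ^\<^sub>m k : Mat n" using X Y by simp_all
  have "Y ^\<^sub>m Suc k * F = Y ^\<^sub>m k * (F * X)" using assoc_mult_mat[OF Xk(2) Y F] c by simp
  also have "... = Y ^\<^sub>m k * F * X" using assoc_mult_mat[OF Xk(2) F X] by simp
  also have "... = F * X ^\<^sub>m Suc k" using assoc_mult_mat[OF F Xk(1) X] Suc by simp
  finally show ?case .
 qed
 then show ?thesis
  using F by (intro eq_matI) (auto simp: mexp_mult_right_entry[OF Y F] mexp_mult_left_entry[OF X F] simp del: index_mult_mat(1))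
qed

lemma mexp_commute:
 "X : Mat n ==> F : Mat n ==> X * F = F * X ==> mexp n X t * F = F * mexp n X t"
 by (rule mexp_intertwine)

lemma mexp_derivative:
 assumes X: "X : Mat n" and ij: "i < n" "j < n"
 shows "((%s. mexp n X s $$ (i, j)) has_field_derivative (mexp n X t * X) $$ (i, j)) (at t)"
proof -
 let ?c = "%k. (X ^\<^sub>m k) $$ (i, j) / fact k"
 have "((%s. \<Sum>k. ?c k * s ^ k) has_field_derivative (\<Sum>k. diffs ?c k * t ^ k)) (at t)"
  by (intro termdiffs_strong_converges_everywhere summable_mexp[OF X ij])
 moreover have "diffs ?c k = (X ^\<^sub>m k * X) $$ (i, j) / fact k" for k
  by (simp add: diffs_def del: of_nat_Suc)
 ultimately show ?thesis
  using mexp_mult_right_entry[OF X X ij, of t] ij by (simp add: mexp_def)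
qed

lemma mexp_0: "X : Mat n ==> mexp n X 0 = 1\<^sub>m n"
 using powser_zero[of "%k. (X ^\<^sub>m k) $$ p / fact k" for p] by (intro eq_matI) (auto simp: mexp_def)

text \<open>The product has derivative 0 in \<open>t\<close> since \<open>X\<close> commutes with
  its exponential, so it keeps its value at 0.\<close>

lemma mexp_inverse:
 assumes X: "X : Mat n"
 shows "mexp n X t * mexp n X (- t) = 1\<^sub>m n"
proof -
 have "(mexp n X t * mexp n X (- t)) $$ (i, j) = (1\<^sub>m n :: complex mat) $$ (i, j)" if ij: "i < n" "j < n" for i j
 proof -
  let ?H = "%s. SUM l<n. mexp n X s $$ (i, l) * mexp n X (- s) $$ (l, j)"
  have "(?H has_field_derivative 0) (at s)" for s
  proof -
   have d2: "((%s. mexp n X (- s) $$ (l, j)) has_field_derivative (mexp n X (- s) * X) $$ (l, j) * (- 1)) (at s)"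
    if "l < n" for l
    by (rule DERIV_chain2[where f = "%s. mexp n X s $$ (l, j)" and g = uminus,
       OF mexp_derivative[OF X that ij(2)]]) (auto intro!: derivative_eq_intros)
   have "(?H has_field_derivative (SUM l<n. (mexp n X s * X) $$ (i, l) * mexp n X (- s) $$ (l, j) +
     ((mexp n X (- s) * X) $$ (l, j) * (- 1)) * mexp n X s $$ (i, l))) (at s)"
    by (intro DERIV_sum DERIV_mult mexp_derivative[OF X] d2 ij) auto
   moreover have "(SUM l<n. (mexp n X s * X) $$ (i, l) * mexp n X (- s) $$ (l, j) +
     ((mexp n X (- s) * X) $$ (l, j) * (- 1)) * mexp n X s $$ (i, l)) =
     ((mexp n X s * X) * mexp n X (- s)) $$ (i, j) - (mexp n X s * (mexp n X (- s) * X)) $$ (i, j)"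
    using mult_mat_entry[OF mult_carrier_mat[OF mexp_carrier[of n X s] X] mexp_carrier[of n X "- s"] ij]
     mult_mat_entry[OF mexp_carrier[of n X s] mult_carrier_mat[OF mexp_carrier[of n X "- s"] X] ij]
    by (simp add: sum_subtractf algebra_simps)
   moreover have "(mexp n X s * X) * mexp n X (- s) = mexp n X s * (mexp n X (- s) * X)"
    using mexp_commute[OF X X HOL.refl, of "- s"] X by (simp add: assoc_mult_mat[of _ n n _ n _ n])
   ultimately show ?thesis by simp
  qed
  then obtain c where "?H s = c" for s
   using has_field_derivative_zero_constant[of UNIV ?H] by (auto intro: has_field_derivative_at_within)
  note c = this
  have "?H t = ?H 0" unfolding c[of t] c[of 0] by (rule HOL.refl)
  then show ?thesis
   using mult_mat_entry[OF mexp_carrier[of n X t] mexp_carrier[of n X "- t"] ij]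
    mult_mat_entry[OF mexp_carrier[of n X 0] mexp_carrier[of n X 0] ij] ij
   by (simp add: mexp_0[OF X] del: index_mult_mat(1) index_one_mat(1))
 qed
 then show ?thesis by (intro eq_matI) auto
qed

lemma conormal_of_vanishing:
 assumes "h : vanishing n G" "1\<^sub>m n : G"
  and "hp n 2 Q" "ALL A:Mat n. h A = h (1\<^sub>m n) + lin_form n l (A - 1\<^sub>m n) + Q (A, A - 1\<^sub>m n)"
  and X: "X : tangent n G"
 shows "lin_form n l X = 0"
proof -
 \<comment> \<open>Forms in \<open>conormal\<close> vanish off the index square, hence the
   truncation.\<close>
 let ?l = "%p. if p : {..<n} \<times> {..<n} then l p else 0"
 have eq: "lin_form n ?l Y = lin_form n l Y" for Y
  unfolding lin_form_def by (intro sum.cong) auto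
 have h1: "h (1\<^sub>m n) = 0" using assms(1,2) by (auto simp: vanishing_def)
 have "h A = lin_form n ?l (A - 1\<^sub>m n) + Q (A, A - 1\<^sub>m n)" if "A : Mat n" for A
  using bspec[OF assms(4) that] unfolding eq h1 by simp
 then have "?l : conormal n G"
  unfolding conormal_def using assms(1,3) by (auto simp: coord_space_def)
 then show ?thesis using X eq by (auto simp: tangent_def)
qed

text \<open>The derivation is the left-invariant one: \<open>f'\<close> at \<open>A\<close> is the
  differential of \<open>f\<close> at \<open>A\<close> in direction \<open>A * X\<close>. It
  preserves the ideal of \<open>G\<close>, because for \<open>g\<close> in \<open>G\<close> the
  translate of \<open>f\<close> by \<open>g\<close> also vanishes on \<open>G\<close>, so its
  differential at the identity kills \<open>X\<close>.\<close>

lemma vanishing_derivation: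
 assumes G: "G <= Mat n" "1\<^sub>m n : G" "ALL A:G. ALL B:G. A * B : G"
  and X: "X : tangent n G" and f: "f : vanishing n G"
 shows "EX f':vanishing n G. ALL t. ((%s. f (mexp n X s)) has_field_derivative f' (mexp n X t)) (at t)"
proof -
 have Xc: "X : Mat n" using X by (simp add: tangent_def)
 have fm: "f : mat_polys n" and f0: "!!A. A : G ==> f A = 0" using f by (auto simp: vanishing_def)
 obtain d where d': "ALL p. d p : mat_polys n"
  "ALL gam gam' t. (ALL i<n. ALL j<n. ((%s. gam s $$ (i, j)) has_field_derivative gam' $$ (i, j)) (at t)) -->
   ((%s. f (gam s)) has_field_derivative lin_form n (%p. d p (gam t)) gam') (at t)"
  using mat_polys_derivative[OF fm] by (elim exE conjE) (rule that)
 note d = d'[rule_format]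
 define f' where "f' A = (SUM (i, j):{..<n} \<times> {..<n}. d (i, j) A * (SUM l<n. A $$ (i, l) * X $$ (l, j)))" for A
 have f'm: "f' : mat_polys n"
  unfolding f'_def case_prod_beta
  by (intro mat_polys_sum mat_polys.mult d(1) mat_polys.entry mat_polys.const) auto
 have f'_eq: "f' A = lin_form n (%p. d p A) (A * X)" if "A : Mat n" for A
  unfolding f'_def lin_form_def using mult_mat_entry[OF that Xc] by (intro sum.cong) auto
 have "f' g = 0" if g: "g : G" for g
 proof -
  have gc: "g : Mat n" using g G(1) by blast
  obtain h where h: "h : mat_polys n" "ALL A:Mat n. h A = f (g * A)"
   using mat_polys_mult_left[OF fm gc] by (elim bexE) (rule that)
  obtain e Q where e:
   "ALL gam gam' t. (ALL i<n. ALL j<n. ((%s. gam s $$ (i, j)) has_field_derivative gam' $$ (i, j)) (at t)) -->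
    ((%s. h (gam s)) has_field_derivative lin_form n (%p. e p (gam t)) gam') (at t)"
   "hp n 2 Q" "ALL A:Mat n.
    h A = h (1\<^sub>m n) + lin_form n (%p. e p (1\<^sub>m n)) (A - 1\<^sub>m n) + Q (A, A - 1\<^sub>m n)"
   using mat_polys_derivative[OF h(1)] by (elim exE conjE) (rule that)
  have "h : vanishing n G" using h f0 G(1) bspec[OF bspec[OF G(3) g]] by (auto simp: vanishing_def)
  from conormal_of_vanishing[OF this G(2) e(2,3) X] have z: "lin_form n (%p. e p (1\<^sub>m n)) X = 0" .
  \<comment> \<open>The line need not stay in \<open>G\<close>; it only serves to compute the
    derivative of \<open>f (g * A)\<close> at the identity in direction \<open>X\<close> in two
    ways.\<close>
  let ?gam = "%s. 1\<^sub>m n + s \<cdot>\<^sub>m X"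
  have gam0: "?gam 0 = 1\<^sub>m n" using Xc by (intro eq_matI) auto
  have "((%s. ?gam s $$ (i, j)) has_field_derivative X $$ (i, j)) (at 0)" if "i < n" "j < n" for i j
   using that Xc by (auto intro!: derivative_eq_intros)
  with e(1)[rule_format, of ?gam X 0] have "((%s. h (?gam s)) has_field_derivative 0) (at 0)"
   unfolding gam0 z by blast
  moreover have "h (?gam s) = f (g * ?gam s)" for s
   using h(2) Xc by auto
  ultimately have 1: "((%s. f (g * ?gam s)) has_field_derivative 0) (at 0)" by simp
  have "((%s. (g * ?gam s) $$ (i, j)) has_field_derivative (g * X) $$ (i, j)) (at 0)" if ij: "i < n" "j < n" for i j
  proof -
   have "?gam s : Mat n" for s using Xc by auto
   from mult_mat_entry[OF gc this ij]
   have "(g * ?gam s) $$ (i, j) = (SUM l<n. g $$ (i, l) * (1\<^sub>m n $$ (l, j) + s * X $$ (l, j)))" for s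
    using ij Xc by simp
   moreover have "((%s. SUM l<n. g $$ (i, l) * (1\<^sub>m n $$ (l, j) + s * X $$ (l, j))) has_field_derivative
     (SUM l<n. g $$ (i, l) * X $$ (l, j))) (at 0)"
    by (auto intro!: derivative_eq_intros sum.cong simp: mult.commute)
   ultimately show ?thesis using mult_mat_entry[OF gc Xc ij] by (simp add: mult.commute)
  qed
  with d(2)[of "%s. g * ?gam s" "g * X" 0]
  have "((%s. f (g * ?gam s)) has_field_derivative lin_form n (%p. d p g) (g * X)) (at 0)"
   using gc unfolding gam0 by simp
  from DERIV_unique[OF this 1] show ?thesis using f'_eq[OF gc] by simp
 qed
 then have "f' : vanishing n G" using f'm by (simp add: vanishing_def)
 moreover have "((%s. f (mexp n X s)) has_field_derivative f' (mexp n X t)) (at t)" for t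
  unfolding f'_eq[OF mexp_carrier] by (intro d(2)) (auto intro: mexp_derivative[OF Xc])
 ultimately show ?thesis by blast
qed

text \<open>All derivatives at 0 of this entire function are values at the identity of polynomials
  in the ideal of \<open>G\<close>, so they vanish.\<close>

lemma vanishing_mexp:
 assumes G: "G <= Mat n" "1\<^sub>m n : G" "ALL A:G. ALL B:G. A * B : G"
  and X: "X : tangent n G" and f: "f : vanishing n G"
 shows "f (mexp n X t) = 0"
proof -
 have Xc: "X : Mat n" using X by (simp add: tangent_def)
 have "(deriv ^^ k) (%s. f (mexp n X s)) 0 = 0" if "f : vanishing n G" for k f
  using that
 proof (induction k arbitrary: f)
  case 0
  then show ?case using G(2) by (simp add: vanishing_def mexp_0[OF Xc])
 next
  case (Suc k)
  obtain f' where f': "f' : vanishing n G"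
   "ALL t. ((%s. f (mexp n X s)) has_field_derivative f' (mexp n X t)) (at t)"
   using vanishing_derivation[OF G X Suc.prems] by (elim bexE) (rule that)
  have "deriv (%s. f (mexp n X s)) = (%s. f' (mexp n X s))"
   using f'(2) by (auto intro: DERIV_imp_deriv)
  then show ?case using Suc.IH[OF f'(1)] by (simp add: funpow_Suc_right del: funpow.simps)
 qed
 note zero = this[OF f]
 have "(%s. f (mexp n X s)) holomorphic_on UNIV"
  using vanishing_derivation[OF G X f] unfolding holomorphic_on_def field_differentiable_def by blast
 from holomorphic_fun_eq_0_on_connected[OF this open_UNIV connected_UNIV, of 0 t] zero
 show ?thesis by simp
qed

lemma mat_polys_continuous:
 assumes "f : mat_polys n" "!!i j. i < n ==> j < n ==> continuous_on UNIV (%s. gam s $$ (i, j))"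
 shows "continuous_on UNIV (%s. f (gam s))"
 using assms(1) by induction (auto intro!: continuous_intros assms(2))

text \<open>Polynomials are continuous for the usual topology, so the curve is continuous for the
  Zariski topology and the image of the plane is connected.\<close>

lemma curve_in_connected_component:
 fixes gam :: "complex => complex mat"
 assumes Z: "Z <= Mat n" and gam: "!!s. gam s : Z"
  and cont: "!!i j. i < n ==> j < n ==> continuous_on UNIV (%s. gam s $$ (i, j))"
 shows "gam t : connected_component_of_set (subtopology (zariski n) Z) (gam s)"
proof -
 have "continuous_map euclidean (zariski n) gam"
  unfolding continuous_map_def topspace_zariski
 proof (intro conjI allI impI)
  show "gam : topspace euclidean \<rightarrow> Mat n" using gam Z by auto
  fix U assume "openin (zariski n) U"
  then obtain Q where Q: "Q <= mat_polys n" "U = {A : Mat n. EX f:Q. f A ~= 0}"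
   by (auto simp: openin_zariski zariski_open_def)
  have "{x : topspace euclidean. gam x : U} = (UN f:Q. {x. f (gam x) ~= 0})"
   using gam Z by (auto simp: Q(2))
  moreover have "open {x. f (gam x) ~= 0}" if "f : Q" for f
  proof -
   have "continuous_on UNIV (%x. f (gam x))" using that Q(1) cont by (intro mat_polys_continuous[of f n]) auto
   then show ?thesis by (intro open_Collect_neq) auto
  qed
  ultimately show "openin euclidean {x : topspace euclidean. gam x : U}" by auto
 qed
 then have "continuous_map euclidean (subtopology (zariski n) Z) gam"
  using gam by (auto simp: continuous_map_in_subtopology)
 from connectedin_continuous_map_image[OF this, of UNIV]
 have "connectedin (subtopology (zariski n) Z) (range gam)" by (simp add: connected_UNIV)
 then have "range gam <= connected_component_of_set (subtopology (zariski n) Z) (gam s)"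
  by (intro connected_component_of_maximal) auto
 then show ?thesis by auto
qed

section \<open>Rational structures\<close>

lemma coord_spaceD: "v : csp I ==> i ~: I ==> v i = 0"
 unfolding coord_space_def by blast

lemma coord_space_subspace: "module.subspace sc (csp I :: ('i => 'k::field) set)"
 by (rule fs.subspaceI) (auto simp: coord_space_def fscale_def)

lemma cspan_subspace: "module.subspace sc (cspan W)"
 unfolding cspan_def by (rule fs.subspace_span)

lemma cvec_in_cspan: "x : W ==> cvec x : cspan W"
 unfolding cspan_def by (intro fs.span_base) auto

lemma cspan_least: "module.subspace sc S ==> (!!x. x : W ==> cvec x : S) ==> cspan W <= S"
 unfolding cspan_def by (intro fs.span_minimal) auto

lemma cspan_mono: "W <= W' ==> cspan W <= cspan W'"
 unfolding cspan_def by (intro fs.span_mono) auto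

definition flinear :: "(('i => 'k::field) => 'j => 'k) => bool" where
 "flinear f \<longleftrightarrow> (ALL u v. f (u + v) = f u + f v) & (ALL c v. f (sc c v) = sc c (f v))"

lemma flinear_0: "flinear f ==> f 0 = 0"
proof -
 assume f: "flinear f"
 have "f (0 + 0) = f 0 + f 0" using f unfolding flinear_def by blast
 then show ?thesis by simp
qed

lemma flinear_sum: "flinear f ==> f (SUM i:I. v i) = (SUM i:I. f (v i))"
 by (induction I rule: infinite_finite_induct) (auto simp: flinear_0, auto simp: flinear_def)

lemma flinear_diff: "flinear f ==> f (u - v) = f u - f v"
proof -
 assume f: "flinear f"
 have "f (u - v + v) = f (u - v) + f v" using f unfolding flinear_def by blast
 then show ?thesis by simp
qed

lemma flinear_cspan_image:
 assumes "flinear f" "module.subspace sc S" "!!x. x : W ==> f (cvec x) : S" "v : cspan W"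
 shows "f v : S"
proof -
 have "module.subspace sc {v. f v : S}"
  using assms(1,2) flinear_0[OF assms(1)] unfolding flinear_def
  by (intro fs.subspaceI) (auto intro: fs.subspace_0 fs.subspace_add fs.subspace_scale)
 from cspan_least[OF this] assms(3,4) show ?thesis by blast
qed

lemma cvec_add: "cvec (x + y) = cvec x + cvec y"
 by (auto simp: cvec_def of_rat_add)

lemma cvec_diff: "cvec (x - y) = cvec x - cvec y"
 by (auto simp: cvec_def of_rat_diff)

lemma cvec_0: "cvec 0 = 0"
 by (auto simp: cvec_def)

lemma cvec_fscale: "cvec (sc c x) = sc (of_rat c) (cvec x)"
 by (auto simp: cvec_def fscale_def of_rat_mult)

lemma cvec_sum: "cvec (SUM i:I. x i) = (SUM i:I. cvec (x i))"
 by (rule ext) (simp add: cvec_def fsum_apply of_rat_sum)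

text \<open>Equations with rational coefficients, obtained from a rational projection onto
  \<open>W\<close>. They survive ring homomorphisms, and they turn stability of a subspace into
  polynomial conditions on a matrix.\<close>

lemma cspan_eqs:
 assumes I: "finite I" and W: "module.subspace sc W" "W <= csp I"
 shows "EX q :: 'i => 'i => rat. (ALL j. q j : W) &
  (ALL v. v : cspan W \<longleftrightarrow> v : csp I & (ALL i. v i = (SUM j:I. v j * of_rat (q j i))))"
proof -
 obtain q where q: "ALL j. q j : W" "ALL v:W. v = (SUM j:I. sc (v j) (q j))"
  using subspace_projection[OF I W] by (elim exE conjE) (rule that)
 let ?S = "{v : csp I. ALL i. v i = (SUM j:I. v j * of_rat (q j i))} :: ('i => complex) set"
 have "module.subspace sc ?S"
 proof (rule fs.subspaceI)
  show "0 : ?S" by (simp add: coord_space_def)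
 next
  fix x y :: "'i => complex" assume xy: "x : ?S" "y : ?S"
  have x: "(SUM j:I. x j * of_rat (q j i)) = x i" and y: "(SUM j:I. y j * of_rat (q j i)) = y i" for i
   using xy by (blast intro: HOL.sym)+
  have "x + y : csp I"
   using xy by (intro fs.subspace_add[OF coord_space_subspace]) blast+
  then show "x + y : ?S" by (simp add: distrib_right sum.distrib x y)
 next
  fix c and x :: "'i => complex" assume xS: "x : ?S"
  have x: "(SUM j:I. x j * of_rat (q j i)) = x i" for i using xS by (blast intro: HOL.sym)
  have "sc c x : csp I"
   using xS by (intro fs.subspace_scale[OF coord_space_subspace]) blast
  then show "sc c x : ?S" by (simp add: fscale_def mult.assoc sum_distrib_left[symmetric] x)
 qed
 moreover have "cvec x : ?S" if x: "x : W" for x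
 proof (intro CollectI conjI allI)
  show "cvec x : csp I" using x W(2) by (auto simp: coord_space_def cvec_def)
  fix i
  have "x i = (SUM j:I. sc (x j) (q j)) i" using q(2) x by auto
  then have "x i = (SUM j:I. x j * q j i)" by (simp add: fsum_apply fscale_def)
  then show "cvec x i = (SUM j:I. cvec x j * of_rat (q j i))"
   by (simp add: cvec_def of_rat_sum of_rat_mult)
 qed
 ultimately have sub: "cspan W <= ?S" by (rule cspan_least)
 have "v : cspan W" if "v : ?S" for v
 proof -
  have "v = (SUM j:I. sc (v j) (cvec (q j)))"
  proof
   fix i
   have "v i = (SUM j:I. v j * of_rat (q j i))" using that by blast
   then show "v i = (SUM j:I. sc (v j) (cvec (q j))) i" by (simp add: fsum_apply fscale_def cvec_def)
  qed
  moreover have "... : cspan W"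
   using q(1) by (intro fs.subspace_sum[OF cspan_subspace] fs.subspace_scale[OF cspan_subspace] cvec_in_cspan) auto
  ultimately show ?thesis by simp
 qed
 with sub have "v : cspan W \<longleftrightarrow> v : ?S" for v by blast
 then show ?thesis using q(1) by (intro exI[of _ q]) simp
qed

lemma cspan_coord_space: "W <= csp I ==> cspan W <= csp I"
 by (rule cspan_least[OF coord_space_subspace]) (auto simp: coord_space_def cvec_def)

lemma cspan_full: "finite I ==> cspan (csp I) = (csp I :: ('i => complex) set)"
proof (intro equalityI cspan_coord_space order.refl subsetI)
 fix v :: "'i => complex" assume I: "finite I" and v: "v : csp I"
 have "(%i. if i = j then 1 else 0) = cvec (%i. if i = j then 1 else 0)" for j :: 'i
  by (auto simp: cvec_def)
 then have "v = (SUM j:I. sc (v j) (cvec (%i. if i = j then 1 else 0)))"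
  using coord_space_decomp[OF I v] by simp
 also have "... : cspan (csp I)"
  by (intro fs.subspace_sum[OF cspan_subspace] fs.subspace_scale[OF cspan_subspace] cvec_in_cspan)
    (auto simp: coord_space_def)
 finally show "v : cspan (csp I)" .
qed

lemma cspan_zero: "cspan {0} = {0}"
proof -
 have "cspan {0} <= {0}" by (rule cspan_least[OF fs.subspace_single_0]) (simp only: cvec_0 singleton_iff)
 moreover have "0 : cspan {0}" by (rule fs.subspace_0[OF cspan_subspace])
 ultimately show ?thesis by blast
qed

lemma cspan_hom_on:
 assumes I: "finite I" and W: "module.subspace sc W" "W <= csp I"
  and tau: "hom_on R tau" "subring_set R" and v: "v : cspan W" "range v <= R" and rat: "!!q. of_rat q : R"
 shows "(%i. tau (v i)) : cspan W"
proof -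
 obtain q where q: "ALL v. v : cspan W \<longleftrightarrow> v : csp I & (ALL i. v i = (SUM j:I. v j * of_rat (q j i)))"
  using cspan_eqs[OF I W] by (elim exE conjE) (rule that)
 have vR: "v i : R" for i using v(2) by auto
 from v(1) q have v': "v : csp I" "!!i. v i = (SUM j:I. v j * of_rat (q j i))" by blast+
 have "tau (v i) = (SUM j:I. tau (v j) * of_rat (q j i))" for i
 proof -
  have "tau (v i) = tau (SUM j:I. v j * of_rat (q j i))" using v'(2)[of i] by (rule arg_cong)
  also have "... = (SUM j:I. tau (v j) * of_rat (q j i))"
   using vR rat by (subst hom_on_sum[OF tau])
    (auto simp: hom_onD(4)[OF tau] hom_on_of_rat[OF tau] subring_setD(5)[OF tau(2)])
  finally show ?thesis .
 qed
 moreover have "(%i. tau (v i)) : csp I"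
  using v'(1) hom_onD(2)[OF tau] by (auto simp: coord_space_def)
 ultimately show ?thesis using q by blast
qed

lemma hom_on_cnj: "hom_on UNIV cnj"
 by (auto simp: hom_on_def)

lemma subring_UNIV: "subring_set UNIV"
 by (auto simp: subring_set_def)

lemma vconj_cspan:
 assumes "finite I" "module.subspace sc W" "W <= csp I" "v : cspan W"
 shows "vconj v : cspan W"
 unfolding vconj_def
 by (rule cspan_hom_on[OF assms(1-3) hom_on_cnj subring_UNIV assms(4)]) auto

lemma vconj_vconj [simp]: "vconj (vconj v) = v"
 by (simp add: vconj_def)

lemma vconj_cvec [simp]: "vconj (cvec x) = cvec x"
proof -
 have "cnj (of_rat q) = of_rat q" for q
  by (rule hom_on_of_rat[OF hom_on_cnj subring_UNIV]) simp
 then show ?thesis by (auto simp: vconj_def cvec_def)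
qed

subsection \<open>Matrices acting on vectors\<close>

lemma mapply_flinear: "flinear (ap A)"
 by (auto simp: flinear_def mapply_def fscale_def fun_eq_iff algebra_simps sum.distrib sum_distrib_left)

lemma mapply_coord_space: "A : carrier_mat n m ==> ap A v : csp {..<n}"
 by (auto simp: coord_space_def mapply_def)

lemma mapply_mult:
 assumes "A : carrier_mat n m" "B : carrier_mat m k"
 shows "ap (A * B) v = ap A (ap B v)"
proof
 fix i
 show "ap (A * B) v i = ap A (ap B v) i"
 proof (cases "i < n")
  case True
  have "(SUM j<k. (A * B) $$ (i, j) * v j) = (SUM j<k. (SUM l<m. A $$ (i, l) * B $$ (l, j)) * v j)"
   using mult_mat_entry[OF assms True] by simp
  also have "... = (SUM j<k. SUM l<m. A $$ (i, l) * (B $$ (l, j) * v j))"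
   by (simp add: sum_distrib_right mult.assoc)
  also have "... = (SUM l<m. SUM j<k. A $$ (i, l) * (B $$ (l, j) * v j))" by (rule sum.swap)
  also have "... = (SUM l<m. A $$ (i, l) * (SUM j<k. B $$ (l, j) * v j))" by (simp add: sum_distrib_left)
  finally show ?thesis using assms True by (simp add: mapply_def)
 qed (use assms in \<open>simp add: mapply_def\<close>)
qed

lemma mapply_one: "v : csp {..<n} ==> ap (1\<^sub>m n) v = (v :: nat => 'k::comm_semiring_1)"
proof
 fix i assume v: "v : csp {..<n}"
 have "(SUM j<n. (1\<^sub>m n :: 'k mat) $$ (i, j) * v j) = (SUM j<n. if i = j then v j else 0)" if "i < n"
  using that by (intro sum.cong) auto
 then show "ap (1\<^sub>m n) v i = v i" using v by (auto simp: mapply_def coord_space_def)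
qed

lemma mapply_add: "A : carrier_mat n m ==> B : carrier_mat n m ==> ap (A + B) v = ap A v + ap B v"
 by (auto simp: mapply_def algebra_simps sum.distrib fun_eq_iff)

lemma mapply_minus: "A : carrier_mat n m ==> B : carrier_mat n m ==>
  ap (A - B) v = ap A v - ap B (v :: nat => 'k::comm_ring_1)"
 by (auto simp: mapply_def algebra_simps sum_subtractf fun_eq_iff)

lemma mapply_smult: "ap (c \<cdot>\<^sub>m A) v = sc c (ap A (v :: nat => 'k::comm_semiring_1))"
 by (auto simp: mapply_def fscale_def sum_distrib_left mult.assoc fun_eq_iff)

lemma mapply_cmat_cvec: "ap (cmat A) (cvec v) = cvec (ap A v)"
 by (auto simp: mapply_def cvec_def of_rat_sum of_rat_mult fun_eq_iff)

lemma mapply_unit: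
 assumes "A : Mat n" "j < n" "i < n"
 shows "ap A (%i. if i = j then 1 else 0) i = (A $$ (i, j) :: 'k::comm_semiring_1)"
proof -
 have "(SUM l<n. A $$ (i, l) * (if l = j then 1 else 0)) = (SUM l<n. if l = j then A $$ (i, l) else 0)"
  by (intro sum.cong) auto
 then show ?thesis using assms by (simp add: mapply_def)
qed

lemma mat_eq_of_mapply:
 assumes "A : Mat n" "B : Mat n"
  and "!!v. v : csp {..<n} ==> ap A v = ap B (v :: nat => 'k::comm_semiring_1)"
 shows "A = B"
proof (rule eq_matI)
 fix i j assume "i < dim_row B" "j < dim_col B"
 then have ij: "i < n" "j < n" using assms by auto
 have "(%i. if i = j then 1 else 0 :: 'k) : csp {..<n}" using ij by (auto simp: coord_space_def)
 from arg_cong[OF assms(3)[OF this], of "%f. f i"]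
 show "A $$ (i, j) = B $$ (i, j)" using mapply_unit[OF assms(1) ij(2,1)] mapply_unit[OF assms(2) ij(2,1)] by simp
qed (use assms in auto)

text \<open>Linearity is demanded on coordinate vectors only, since the Hodge components to which
  this is applied are specified only there.\<close>

lemma matrix_of_flinear:
 fixes f :: "(nat => 'k::field) => nat => 'k"
 assumes add: "!!u v. u : csp {..<n} ==> v : csp {..<n} ==> f (u + v) = f u + f v"
  and scale: "!!c v. v : csp {..<n} ==> f (sc c v) = sc c (f v)"
  and im: "!!v. v : csp {..<n} ==> f v : csp {..<n}"
 shows "EX A:Mat n. ALL v:csp {..<n}. ap A v = f v"
proof -
 let ?e = "%j i :: nat. if i = j then 1 else (0 :: 'k)"
 have e: "?e j : csp {..<n}" if "j < n" for j using that by (auto simp: coord_space_def)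
 define A where "A = mat n n (%(i, j). f (?e j) i)"
 have "ap A v = f v" if v: "v : csp {..<n}" for v
 proof -
  have z: "f 0 = 0" using add[of 0 0] by (simp add: coord_space_def)
  have sum: "f (SUM j:J. sc (v j) (?e j)) = (SUM j:J. sc (v j) (f (?e j)))" if "J <= {..<n}" "finite J" for J
   using that(2,1)
  proof (induction J rule: finite_induct)
   case (insert j J)
   have "f (sc (v j) (?e j) + (SUM j:J. sc (v j) (?e j))) =
     f (sc (v j) (?e j)) + f (SUM j:J. sc (v j) (?e j))"
    using insert.prems e
    by (intro add fs.subspace_sum[OF coord_space_subspace] fs.subspace_scale[OF coord_space_subspace]) auto
   also have "f (sc (v j) (?e j)) = sc (v j) (f (?e j))" using insert.prems e by (intro scale) auto
   finally show ?case using insert by simp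
  qed (simp add: z)
  have "f v = f (SUM j<n. sc (v j) (?e j))" using coord_space_decomp[OF _ v] by simp
  also have "... = (SUM j<n. sc (v j) (f (?e j)))" by (rule sum) auto
  finally have "f v i = (SUM j<n. v j * f (?e j) i)" for i by (simp add: fsum_apply fscale_def)
  moreover have "f v i = 0" if "~ i < n" for i using im[OF v] that by (auto simp: coord_space_def)
  ultimately show ?thesis by (auto simp: mapply_def A_def mult.commute fun_eq_iff)
 qed
 then show ?thesis by (intro bexI[of _ A]) (auto simp: A_def)
qed

lemma GL_minv:
 assumes "g : GL n"
 shows "g : Mat n" "minv g : Mat n" "g * minv g = 1\<^sub>m n" "minv g * g = 1\<^sub>m n"
proof -
 show g: "g : Mat n" using assms by (simp add: GL_def)
 obtain h where h: "inverts_mat g h" "inverts_mat h g" using assms by (auto simp: GL_def invertible_mat_def)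
 have "h : Mat n"
  using h g by (auto simp: inverts_mat_def)
   (metis carrier_matD(2) carrier_matI index_mult_mat(2,3) index_one_mat(2,3))
 then have ex: "h : carrier_mat (dim_row g) (dim_row g) & inverts_mat g h & inverts_mat h g" using h g by auto
 have "k = h" if "k : carrier_mat (dim_row g) (dim_row g) & inverts_mat g k & inverts_mat k g" for k
 proof -
  have k: "k : Mat n" "k * g = 1\<^sub>m n" using that g by (auto simp: inverts_mat_def)
  have h': "h : Mat n" "g * h = 1\<^sub>m n" using ex g by (auto simp: inverts_mat_def)
  show ?thesis using assoc_mult_mat[OF k(1) g h'(1)] k h' by simp
 qed
 with ex have "minv g = h" unfolding minv_def by (intro the_equality) blast+
 with ex g show "minv g : Mat n" "g * minv g = 1\<^sub>m n" "minv g * g = 1\<^sub>m n"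
  by (auto simp: inverts_mat_def)
qed

lemma GL_I:
 assumes "g : Mat n" "h : Mat n" "g * h = 1\<^sub>m n" "h * g = 1\<^sub>m n"
 shows "g : GL n" "minv g = (h :: 'k::field mat)"
proof -
 show g: "g : GL n" using assms by (auto simp: GL_def invertible_mat_def inverts_mat_def)
 show "minv g = h"
  using assoc_mult_mat[OF GL_minv(2)[OF g] assms(1,2)] GL_minv[OF g] assms by simp
qed

lemma GL_mult: "g : GL n ==> h : GL n ==> g * h : GL n & minv (g * h) = minv h * minv g"
proof -
 assume gh: "g : GL n" "h : GL n"
 note g = GL_minv[OF gh(1)] and h = GL_minv[OF gh(2)]
 have 1: "g * h * (minv h * minv g) = 1\<^sub>m n"
  using assoc_mult_mat[OF mult_carrier_mat[OF g(1) h(1)] h(2) g(2)] assoc_mult_mat[OF g(1) h(1,2)] g h by simp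
 have 2: "minv h * minv g * (g * h) = 1\<^sub>m n"
  using assoc_mult_mat[OF mult_carrier_mat[OF h(2) g(2)] g(1) h(1)] assoc_mult_mat[OF h(2) g(2,1)] g h by simp
 show ?thesis using GL_I[OF _ _ 1 2] g h by simp
qed

lemma GL_minv_GL: "g : GL n ==> minv g : GL n & minv (minv g) = g"
 using GL_I[of "minv g" n g] GL_minv[of g n] by simp

lemma GL_one: "(1\<^sub>m n :: 'k::field mat) : GL n & minv (1\<^sub>m n :: 'k mat) = 1\<^sub>m n"
 using GL_I[of "1\<^sub>m n" n "1\<^sub>m n :: 'k mat"] by simp

lemma GL_det: "(g : GL n) \<longleftrightarrow> g : Mat n & det g ~= 0"
proof
 assume g: "g : GL n"
 have "det (g * minv g) = det g * det (minv g)" by (rule det_mult[OF GL_minv(1,2)[OF g]])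
 then show "g : Mat n & det g ~= 0" using GL_minv[OF g] by auto
next
 assume g: "g : Mat n & det g ~= 0"
 note adj = adj_mat[OF conjunct1[OF g]]
 let ?h = "inverse (det g) \<cdot>\<^sub>m adj_mat g"
 have s: "inverse (det g) \<cdot>\<^sub>m (det g \<cdot>\<^sub>m 1\<^sub>m n) = 1\<^sub>m n" using g by (intro eq_matI) auto
 have "g * ?h = 1\<^sub>m n" using mult_smult_distrib[OF conjunct1[OF g] adj(1)] adj(2) s by simp
 moreover have "?h * g = 1\<^sub>m n" using mult_smult_assoc_mat[OF adj(1) conjunct1[OF g]] adj(3) s by simp
 ultimately show "g : GL n" using GL_I[of g n ?h] adj(1) g by simp
qed

text \<open>Cramer's rule without division: entries of the inverse become polynomials after
  multiplication by the determinant.\<close>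

lemma minv_entry:
 assumes "g : GL n" "i < n" "j < n"
 shows "det g * minv g $$ (i, j) = adj_mat g $$ (i, j)"
proof -
 note g = GL_minv[OF assms(1)]
 note adj = adj_mat[OF g(1)]
 have "adj_mat g = adj_mat g * g * minv g" using assoc_mult_mat[OF adj(1) g(1,2)] g adj(1) by simp
 also have "... = det g \<cdot>\<^sub>m minv g"
  unfolding adj(3) using mult_smult_assoc_mat[OF one_carrier_mat g(2)] g(2) by simp
 finally show ?thesis using assms g(2) by simp
qed

lemma elements_mat_entry:
 "A : carrier_mat n m ==> i < n ==> j < m ==> A $$ (i, j) : elements_mat A"
 by (force simp: elements_mat_def)

lemma map_mat_mult_hom_on:
 assumes tau: "hom_on R tau" "subring_set R" and A: "A : carrier_mat n m" "elements_mat A <= R"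
  and B: "B : carrier_mat m k" "elements_mat B <= R"
 shows "map_mat tau (A * B) = map_mat tau A * map_mat tau B"
proof (rule eq_matI)
 fix i j assume "i < dim_row (map_mat tau A * map_mat tau B)" "j < dim_col (map_mat tau A * map_mat tau B)"
 then have ij: "i < n" "j < k" using A B by auto
 have AR: "A $$ (i, l) : R" if "l < m" for l using A(2) elements_mat_entry[OF A(1) ij(1) that] by blast
 have BR: "B $$ (l, j) : R" if "l < m" for l using B(2) elements_mat_entry[OF B(1) that ij(2)] by blast
 have "map_mat tau (A * B) $$ (i, j) = tau (SUM l<m. A $$ (i, l) * B $$ (l, j))"
  using mult_mat_entry[OF A(1) B(1) ij] A B ij by (simp del: index_mult_mat(1))
 also have "... = (SUM l<m. tau (A $$ (i, l)) * tau (B $$ (l, j)))"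
  using AR BR by (subst hom_on_sum[OF tau]) (auto simp: hom_onD(4)[OF tau] subring_setD(5)[OF tau(2)])
 also have "... = (map_mat tau A * map_mat tau B) $$ (i, j)"
  using mult_mat_entry[of "map_mat tau A" n m "map_mat tau B" k i j] A B ij by simp
 finally show "map_mat tau (A * B) $$ (i, j) = (map_mat tau A * map_mat tau B) $$ (i, j)" .
qed (use A B in auto)

lemma minv_hom_on:
 assumes tau: "hom_on R tau" "subring_set R" and g: "g : GL n" "elements_mat g <= R" "elements_mat (minv g) <= R"
 shows "map_mat tau g : GL n" "minv (map_mat tau g) = map_mat tau (minv g)"
proof -
 note G = GL_minv[OF g(1)]
 have 1: "map_mat tau (1\<^sub>m n) = 1\<^sub>m n" by (intro eq_matI) (auto simp: hom_onD[OF tau])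
 have "map_mat tau g * map_mat tau (minv g) = 1\<^sub>m n"
  using map_mat_mult_hom_on[OF tau G(1) g(2) G(2) g(3)] G 1 by simp
 moreover have "map_mat tau (minv g) * map_mat tau g = 1\<^sub>m n"
  using map_mat_mult_hom_on[OF tau G(2) g(3) G(1) g(2)] G 1 by simp
 ultimately show "map_mat tau g : GL n" "minv (map_mat tau g) = map_mat tau (minv g)"
  using GL_I[of "map_mat tau g" n "map_mat tau (minv g)"] G by auto
qed

section \<open>Matrices acting on tensor spaces in coordinates\<close>

lemma finite_idx_lists [simp]: "finite (idx_lists n r)"
 unfolding idx_lists_def by (rule finite_subset[OF _ finite_lists_length_eq[of "{..<n}" r]]) auto

lemma finite_tens_idx [simp]: "finite (tens_idx n rs)"
 by (simp add: tens_idx_def)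

lemma finite_dsum_idx [simp]: "finite (dsum_idx n L)"
 by (simp add: dsum_idx_def)

lemma idx_lists_Suc: "idx_lists n (Suc r) = (%(l, ls). ls @ [l]) ` ({..<n} \<times> idx_lists n r)"
proof (intro equalityI subsetI)
 fix x assume x: "x : idx_lists n (Suc r)"
 then have "x ~= []" by (auto simp: idx_lists_def)
 then obtain ls l where "x = ls @ [l]" by (cases x rule: rev_cases) auto
 with x show "x : (%(l, ls). ls @ [l]) ` ({..<n} \<times> idx_lists n r)"
  by (auto simp: idx_lists_def intro!: image_eqI[of _ _ "(l, ls)"])
qed (auto simp: idx_lists_def)

text \<open>The distributive law behind the multiplicativity of tensor powers.\<close>

lemma prod_sum_lists:
 fixes f :: "nat => nat => 'k::comm_semiring_1"
 shows "(PROD k<r. SUM l<n. f k l) = (SUM ls:idx_lists n r. PROD k<r. f k (ls ! k))"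
proof (induction r)
 case 0
 have "idx_lists n 0 = {[]}" by (auto simp: idx_lists_def)
 then show ?case by simp
next
 case (Suc r)
 have inj: "inj_on (%(l :: nat, ls). ls @ [l]) ({..<n} \<times> idx_lists n r)" by (auto simp: inj_on_def)
 have "(SUM ls:idx_lists n (Suc r). PROD k<Suc r. f k (ls ! k)) =
   (SUM (l, ls):{..<n} \<times> idx_lists n r. PROD k<Suc r. f k ((ls @ [l]) ! k))"
  unfolding idx_lists_Suc sum.reindex[OF inj] by (simp add: case_prod_beta)
 also have "... = (SUM (l, ls):{..<n} \<times> idx_lists n r. f r l * (PROD k<r. f k (ls ! k)))"
  by (intro sum.cong) (auto simp: idx_lists_def nth_append mult.commute)
 also have "... = (SUM l<n. f r l) * (SUM ls:idx_lists n r. PROD k<r. f k (ls ! k))"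
  by (simp add: sum_product sum.cartesian_product)
 finally show ?case by (simp add: Suc mult.commute)
qed

definition tcoef :: "'k::comm_ring_1 mat => 'k mat => tidx => tidx => 'k" where
 "tcoef g h p p' = (PROD k<length (fst p). g $$ (fst p ! k, fst p' ! k)) *
   (PROD k<length (snd p). h $$ (snd p' ! k, snd p ! k))"

text \<open>The second matrix stands for the inverse of the first but is kept independent. The
  identities are then polynomial in the two matrices, and they apply to images under ring
  homomorphisms and to pairs such as \<open>mu t\<close> and \<open>mu (inverse t)\<close>.\<close>

definition tact2 :: "nat => 'k::comm_ring_1 mat => 'k mat => (tidx => 'k) => tidx => 'k" where
 "tact2 n g h t p = (if p : tens_idx n (length (fst p), length (snd p)) then
   SUM p':tens_idx n (length (fst p), length (snd p)). tcoef g h p p' * t p' else 0)"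

lemma tens_act_eq: "tens_act n g = tact2 n g (minv g)"
proof (intro ext)
 fix t and p :: tidx
 show "tens_act n g t p = tact2 n g (minv g) t p"
  by (cases p) (auto simp: tens_act_def tact2_def tcoef_def tens_idx_def idx_lists_def case_prod_beta
    intro!: sum.cong)
qed

lemma tens_idx_lengths: "p : tens_idx n rs ==> (length (fst p), length (snd p)) = rs"
 by (cases rs) (auto simp: tens_idx_def idx_lists_def)

lemma tens_idxD:
 assumes "p : tens_idx n (r, s)"
 shows "length (fst p) = r" "length (snd p) = s" "k < r ==> fst p ! k < n" "k < s ==> snd p ! k < n"
proof -
 have p: "length (fst p) = r" "length (snd p) = s" "set (fst p) <= {..<n}" "set (snd p) <= {..<n}"
  using assms by (auto simp: tens_idx_def idx_lists_def)
 then show "length (fst p) = r" "length (snd p) = s" by simp_all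
 show "k < r ==> fst p ! k < n" using subsetD[OF p(3) nth_mem[of k "fst p"]] p(1) by simp
 show "k < s ==> snd p ! k < n" using subsetD[OF p(4) nth_mem[of k "snd p"]] p(2) by simp
qed

lemma tact2_at: "p : tens_idx n rs ==>
  tact2 n g h t p = (SUM p':tens_idx n rs. tcoef g h p p' * t p')"
 using tens_idx_lengths[of p n rs] by (auto simp: tact2_def)

lemma tact2_coord_space:
 assumes "t : csp (tens_idx n rs)"
 shows "tact2 n g h t : csp (tens_idx n rs)"
 unfolding coord_space_def
proof (intro CollectI allI impI)
 fix p assume p: "p ~: tens_idx n rs"
 show "tact2 n g h t p = 0"
 proof (cases "p : tens_idx n (length (fst p), length (snd p))")
  case True
  have "t p' = 0" if p': "p' : tens_idx n (length (fst p), length (snd p))" for p'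
  proof -
   have "p' ~: tens_idx n rs"
   proof
    assume "p' : tens_idx n rs"
    then have "rs = (length (fst p), length (snd p))"
     using tens_idx_lengths[of p' n rs] tens_idx_lengths[OF p'] by simp
    then show False using p True by simp
   qed
   then show ?thesis by (rule coord_spaceD[OF assms])
  qed
  then show ?thesis by (simp add: tact2_def)
 qed (simp add: tact2_def)
qed

lemma tact2_flinear: "flinear (tact2 n g (h :: 'k::field mat))"
 by (auto simp: flinear_def tact2_def fscale_def fun_eq_iff distrib_left distrib_right sum.distrib sum_distrib_left mult_ac
   intro!: sum.cong)

lemma tcoef_mult:
 assumes a: "a : Mat n" and b: "b : Mat n"
  and a': "a' : Mat n" and b': "b' : Mat n"
  and p: "p : tens_idx n rs" and q: "q : tens_idx n rs"
 shows "tcoef (a * b) (b' * a') p q = (SUM p':tens_idx n rs. tcoef a a' p p' * tcoef b b' p' q)"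
proof -
 obtain r s where rs: "rs = (r, s)" by fastforce
 note len = tens_idxD(1,2)[OF p[unfolded rs]] tens_idxD(1,2)[OF q[unfolded rs]]
 note bd = tens_idxD(3)[OF p[unfolded rs]] tens_idxD(3)[OF q[unfolded rs]] and bd' = tens_idxD(4)[OF p[unfolded rs]] tens_idxD(4)[OF q[unfolded rs]]
 have 1: "(PROD k<r. (a * b) $$ (fst p ! k, fst q ! k)) =
   (SUM ls:idx_lists n r. PROD k<r. a $$ (fst p ! k, ls ! k) * b $$ (ls ! k, fst q ! k))"
  using mult_mat_entry[OF a b bd] by (subst prod_sum_lists[symmetric]) (auto intro!: prod.cong)
 have 2: "(PROD k<s. (b' * a') $$ (snd q ! k, snd p ! k)) =
   (SUM ls:idx_lists n s. PROD k<s. b' $$ (snd q ! k, ls ! k) * a' $$ (ls ! k, snd p ! k))"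
  using mult_mat_entry[OF b' a' bd'(2,1)] by (subst prod_sum_lists[symmetric]) (auto intro!: prod.cong)
 have "tcoef (a * b) (b' * a') p q = (SUM (ls, ms):idx_lists n r \<times> idx_lists n s.
   (PROD k<r. a $$ (fst p ! k, ls ! k) * b $$ (ls ! k, fst q ! k)) *
   (PROD k<s. b' $$ (snd q ! k, ms ! k) * a' $$ (ms ! k, snd p ! k)))"
  unfolding tcoef_def len 1 2 by (simp add: sum_product sum.cartesian_product)
 also have "... = (SUM p':tens_idx n rs. tcoef a a' p p' * tcoef b b' p' q)"
  unfolding rs tens_idx_def
  by (intro sum.cong) (auto simp: tcoef_def len idx_lists_def prod.distrib mult_ac)
 finally show ?thesis .
qed

lemma tact2_mult:
 assumes "a : Mat n" "b : Mat n" "a' : Mat n" "b' : Mat n"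
 shows "tact2 n (a * b) (b' * a') t = tact2 n a a' (tact2 n b b' t)"
proof
 fix p :: tidx
 define rs where "rs = (length (fst p), length (snd p))"
 show "tact2 n (a * b) (b' * a') t p = tact2 n a a' (tact2 n b b' t) p"
 proof (cases "p : tens_idx n rs")
  case True
  let ?T = "tens_idx n rs"
  have "tact2 n (a * b) (b' * a') t p = (SUM q:?T. (SUM p':?T. tcoef a a' p p' * tcoef b b' p' q) * t q)"
   unfolding tact2_at[OF True] by (intro sum.cong HOL.refl) (simp add: tcoef_mult[OF assms True])
  also have "... = (SUM q:?T. SUM p':?T. tcoef a a' p p' * (tcoef b b' p' q * t q))"
   by (simp add: sum_distrib_right mult.assoc)
  also have "... = (SUM p':?T. SUM q:?T. tcoef a a' p p' * (tcoef b b' p' q * t q))" by (rule sum.swap)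
  also have "... = (SUM p':?T. tcoef a a' p p' * tact2 n b b' t p')"
   by (intro sum.cong HOL.refl) (simp add: tact2_at[of _ n rs] sum_distrib_left)
  also have "... = tact2 n a a' (tact2 n b b' t) p" unfolding tact2_at[OF True] ..
  finally show ?thesis .
 qed (simp add: tact2_def rs_def)
qed

lemma tact2_one:
 fixes t :: "tidx => 'k::comm_ring_1"
 assumes "t : csp (tens_idx n rs)"
 shows "tact2 n (1\<^sub>m n) (1\<^sub>m n) t = t"
proof
 fix p :: tidx
 show "tact2 n (1\<^sub>m n) (1\<^sub>m n) t p = t p"
 proof (cases "p : tens_idx n rs")
  case True
  have "tcoef (1\<^sub>m n) (1\<^sub>m n :: 'k mat) p q = (if p = q then 1 else 0)" if q: "q : tens_idx n rs" for q
  proof -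
   obtain r s where rs: "rs = (r, s)" by fastforce
   note len = tens_idxD(1,2)[OF True[unfolded rs]] tens_idxD(1,2)[OF q[unfolded rs]]
   note bd = tens_idxD(3)[OF True[unfolded rs]] tens_idxD(3)[OF q[unfolded rs]] and bd' = tens_idxD(4)[OF True[unfolded rs]] tens_idxD(4)[OF q[unfolded rs]]
   show ?thesis
   proof (cases "p = q")
    case True
    then show ?thesis using bd bd' by (simp add: tcoef_def len)
   next
    case False
    then have "fst p ~= fst q \<or> snd p ~= snd q" by (simp add: prod_eq_iff)
    then consider k where "k < r" "fst p ! k ~= fst q ! k" | k where "k < s" "snd p ! k ~= snd q ! k"
     using len by (metis nth_equalityI)
    then show ?thesis
    proof cases
     case 1
     then have "(PROD k<r. (1\<^sub>m n :: 'k mat) $$ (fst p ! k, fst q ! k)) = 0"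
      using bd by (intro prod_zero) (auto intro!: bexI[of _ k])
     then show ?thesis using False by (simp add: tcoef_def len)
    next
     case 2
     then have "(PROD k<s. (1\<^sub>m n :: 'k mat) $$ (snd q ! k, snd p ! k)) = 0"
      using bd' by (intro prod_zero) (auto intro!: bexI[of _ k])
     then show ?thesis using False by (simp add: tcoef_def len)
    qed
   qed
  qed
  then have "tact2 n (1\<^sub>m n) (1\<^sub>m n) t p = (SUM q:tens_idx n rs. if p = q then t q else 0)"
   unfolding tact2_at[OF True] by (intro sum.cong) auto
  then show ?thesis using True by simp
 next
  case False
  then show ?thesis using coord_spaceD[OF assms] coord_spaceD[OF tact2_coord_space[OF assms]] by simp
 qed
qed

lemma tact2_pure_tens:
 assumes g: "g : Mat n" and h: "h : Mat n"
 shows "tact2 n g h (pure_tens vs ls) = pure_tens (map (ap g) vs) (map (ap (transpose_mat h)) ls)"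
proof
 fix p :: tidx
 let ?r = "length vs" and ?s = "length ls"
 show "tact2 n g h (pure_tens vs ls) p = pure_tens (map (ap g) vs) (map (ap (transpose_mat h)) ls) p"
 proof (cases "(length (fst p), length (snd p)) = (?r, ?s)")
  case len: True
  show ?thesis
  proof (cases "p : tens_idx n (?r, ?s)")
   case True
   note bd = tens_idxD(3)[OF True] and bd' = tens_idxD(4)[OF True]
   have 1: "(PROD k<?r. ap g (vs ! k) (fst p ! k)) =
     (SUM is:idx_lists n ?r. PROD k<?r. g $$ (fst p ! k, is ! k) * (vs ! k) (is ! k))"
    using bd g by (subst prod_sum_lists[symmetric]) (auto simp: mapply_def intro!: prod.cong)
   have 2: "(PROD k<?s. ap (transpose_mat h) (ls ! k) (snd p ! k)) =
     (SUM is:idx_lists n ?s. PROD k<?s. h $$ (is ! k, snd p ! k) * (ls ! k) (is ! k))"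
    using bd' h by (subst prod_sum_lists[symmetric]) (auto simp: mapply_def intro!: prod.cong sum.cong)
   have "pure_tens (map (ap g) vs) (map (ap (transpose_mat h)) ls) p =
     (SUM is:idx_lists n ?r. PROD k<?r. g $$ (fst p ! k, is ! k) * (vs ! k) (is ! k)) *
     (SUM is:idx_lists n ?s. PROD k<?s. h $$ (is ! k, snd p ! k) * (ls ! k) (is ! k))"
    unfolding 1[symmetric] 2[symmetric] using len by (simp add: pure_tens_def case_prod_beta)
   also have "... = (SUM (is, js):tens_idx n (?r, ?s).
     (PROD k<?r. g $$ (fst p ! k, is ! k) * (vs ! k) (is ! k)) *
     (PROD k<?s. h $$ (js ! k, snd p ! k) * (ls ! k) (js ! k)))"
    by (simp add: sum_product sum.cartesian_product tens_idx_def)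
   also have "... = tact2 n g h (pure_tens vs ls) p"
    unfolding tact2_at[OF True] using len
    by (intro sum.cong) (auto simp: tcoef_def pure_tens_def tens_idx_def idx_lists_def prod.distrib mult_ac)
   finally show ?thesis by simp
  next
   case False
   then have "~ set (fst p) <= {..<n} \<or> ~ set (snd p) <= {..<n}"
    using len by (auto simp: tens_idx_def idx_lists_def mem_Times_iff)
   then have "(EX k<?r. ~ fst p ! k < n) \<or> (EX k<?s. ~ snd p ! k < n)"
    using len by (auto simp: subset_iff in_set_conv_nth)
   then have "pure_tens (map (ap g) vs) (map (ap (transpose_mat h)) ls) p = 0"
   proof (elim disjE exE conjE)
    fix k assume k: "k < ?r" "~ fst p ! k < n"
    then have "(PROD k<?r. (map (ap g) vs ! k) (fst p ! k)) = 0"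
     using g by (intro prod_zero) (auto simp: mapply_def intro!: bexI[of _ k])
    then show ?thesis by (simp add: pure_tens_def case_prod_beta)
   next
    fix k assume k: "k < ?s" "~ snd p ! k < n"
    then have "(PROD k<?s. (map (ap (transpose_mat h)) ls ! k) (snd p ! k)) = 0"
     using h by (intro prod_zero) (auto simp: mapply_def intro!: bexI[of _ k])
    then show ?thesis by (simp add: pure_tens_def case_prod_beta)
   qed
   then show ?thesis using False len by (simp add: tact2_def)
  qed
 next
  case len: False
  have z: "pure_tens vs ls q = 0" if "q : tens_idx n (length (fst p), length (snd p))" for q
   using len tens_idx_lengths[OF that] by (auto simp: pure_tens_def case_prod_beta)
  have "tact2 n g h (pure_tens vs ls) p = 0" by (simp add: tact2_def z)
  then show ?thesis using len by (auto simp: pure_tens_def case_prod_beta)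
 qed
qed

lemma tact2_hom_on:
 assumes tau: "hom_on R tau" "subring_set R"
  and g: "g : Mat n" "elements_mat g <= R" and h: "h : Mat n" "elements_mat h <= R"
  and t: "range t <= R"
 shows "tact2 n (map_mat tau g) (map_mat tau h) (%p. tau (t p)) = (%p. tau (tact2 n g h t p))"
proof
 fix p :: tidx
 define rs where "rs = (length (fst p), length (snd p))"
 show "tact2 n (map_mat tau g) (map_mat tau h) (%p. tau (t p)) p = tau (tact2 n g h t p)"
 proof (cases "p : tens_idx n rs")
  case True
  have gR: "g $$ (i, j) : R" "h $$ (i, j) : R" if "i < n" "j < n" for i j
   using elements_mat_entry[OF g(1) that] elements_mat_entry[OF h(1) that] g(2) h(2) by auto
  have tc: "tcoef (map_mat tau g) (map_mat tau h) p q = tau (tcoef g h p q) & tcoef g h p q : R"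
   if q: "q : tens_idx n rs" for q
  proof -
   obtain r s where rs': "rs = (r, s)" by fastforce
   note len = tens_idxD(1,2)[OF True[unfolded rs']] tens_idxD(1,2)[OF q[unfolded rs']]
   note bd = tens_idxD(3)[OF True[unfolded rs']] tens_idxD(3)[OF q[unfolded rs']] and bd' = tens_idxD(4)[OF True[unfolded rs']] tens_idxD(4)[OF q[unfolded rs']]
   have a: "(PROD k<r. g $$ (fst p ! k, fst q ! k)) : R" "(PROD k<s. h $$ (snd q ! k, snd p ! k)) : R"
    using bd bd' by (auto intro!: subring_set_prod[OF tau(2)] gR)
   have "tau (PROD k<r. g $$ (fst p ! k, fst q ! k)) = (PROD k<r. map_mat tau g $$ (fst p ! k, fst q ! k))"
    using bd g(1) by (subst hom_on_prod[OF tau]) (auto intro: gR)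
   moreover have "tau (PROD k<s. h $$ (snd q ! k, snd p ! k)) = (PROD k<s. map_mat tau h $$ (snd q ! k, snd p ! k))"
    using bd' h(1) by (subst hom_on_prod[OF tau]) (auto intro: gR)
   ultimately show ?thesis
    using a unfolding tcoef_def len by (simp add: hom_onD(4)[OF tau] subring_setD(5)[OF tau(2)])
  qed
  have tR: "t q : R" for q using t by auto
  have "tau (SUM q:tens_idx n rs. tcoef g h p q * t q) = (SUM q:tens_idx n rs. tau (tcoef g h p q) * tau (t q))"
   using tc tR by (subst hom_on_sum[OF tau]) (auto simp: hom_onD(4)[OF tau] intro: subring_setD(5)[OF tau(2)])
  then show ?thesis unfolding tact2_at[OF True] using tc by simp
 next
  case False
  then show ?thesis by (simp add: tact2_def rs_def hom_onD[OF tau])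
 qed
qed

lemma tact2_cvec:
 assumes "g : Mat n" "h : Mat n"
 shows "tact2 n (cmat g) (cmat h) (cvec t) = cvec (tact2 n g h t)"
proof
 fix p :: tidx
 define rs where "rs = (length (fst p), length (snd p))"
 show "tact2 n (cmat g) (cmat h) (cvec t) p = cvec (tact2 n g h t) p"
 proof (cases "p : tens_idx n rs")
  case True
  have "tcoef (cmat g) (cmat h) p q = of_rat (tcoef g h p q)" if q: "q : tens_idx n rs" for q
  proof -
   obtain r s where rs': "rs = (r, s)" by fastforce
   note len = tens_idxD(1,2)[OF True[unfolded rs']] tens_idxD(1,2)[OF q[unfolded rs']]
   note bd = tens_idxD(3)[OF True[unfolded rs']] tens_idxD(3)[OF q[unfolded rs']] and bd' = tens_idxD(4)[OF True[unfolded rs']] tens_idxD(4)[OF q[unfolded rs']]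
   show ?thesis unfolding tcoef_def len of_rat_mult of_rat_prod
    using bd bd' assms by simp
  qed
  then show ?thesis unfolding cvec_def tact2_at[OF True] by (simp add: of_rat_sum of_rat_mult)
 next
  case False
  then show ?thesis by (simp add: tact2_def rs_def cvec_def)
 qed
qed

text \<open>With the scalar \<open>t powi w\<close> this produces the weight of the tensor space,
  which is \<open>r - s\<close> times \<open>w\<close>.\<close>

lemma tact2_smult:
 fixes c :: "'k::field"
 assumes "c ~= 0" "g : Mat n" "h : Mat n" "t : csp (tens_idx n (r, s))"
 shows "tact2 n (c \<cdot>\<^sub>m g) (inverse c \<cdot>\<^sub>m h) t = sc (c powi (int r - int s)) (tact2 n g h t)"
proof
 fix p :: tidx
 show "tact2 n (c \<cdot>\<^sub>m g) (inverse c \<cdot>\<^sub>m h) t p = sc (c powi (int r - int s)) (tact2 n g h t) p"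
 proof (cases "p : tens_idx n (r, s)")
  case True
  have "tcoef (c \<cdot>\<^sub>m g) (inverse c \<cdot>\<^sub>m h) p q = c powi (int r - int s) * tcoef g h p q"
   if q: "q : tens_idx n (r, s)" for q
  proof -
   note len = tens_idxD(1,2)[OF True] tens_idxD(1,2)[OF q]
   note bd = tens_idxD(3)[OF True] tens_idxD(3)[OF q] and bd' = tens_idxD(4)[OF True] tens_idxD(4)[OF q]
   have "c powi (int r - int s) = c ^ r * inverse c ^ s"
    using assms(1) by (simp add: power_int_diff power_inverse divide_inverse)
   moreover have "(PROD k<r. (c \<cdot>\<^sub>m g) $$ (fst p ! k, fst q ! k)) = c ^ r * (PROD k<r. g $$ (fst p ! k, fst q ! k))"
    using bd assms(2) by (simp add: prod.distrib)
   moreover have "(PROD k<s. (inverse c \<cdot>\<^sub>m h) $$ (snd q ! k, snd p ! k)) =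
     inverse c ^ s * (PROD k<s. h $$ (snd q ! k, snd p ! k))"
    using bd' assms(3) by (simp add: prod.distrib)
   ultimately show ?thesis unfolding tcoef_def len by (simp add: mult_ac)
  qed
  then show ?thesis unfolding fscale_def tact2_at[OF True] by (simp add: sum_distrib_left mult_ac)
 next
  case False
  then show ?thesis using coord_spaceD[OF tact2_coord_space[OF assms(4)]]
   by (simp add: fscale_def)
 qed
qed

definition dact2 :: "nat => 'k::comm_ring_1 mat => 'k mat => (nat \<times> tidx => 'k) => nat \<times> tidx => 'k" where
 "dact2 n g h x = (%(j, I). tact2 n g h (%I'. x (j, I')) I)"

lemma dsum_act_eq: "dsum_act n g = dact2 n g (minv g)"
 by (auto simp: dsum_act_def dact2_def tens_act_eq fun_eq_iff)

lemma dsum_coord_space_iff: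
 "x : csp (dsum_idx n L) \<longleftrightarrow> (ALL j<length L. (%I. x (j, I)) : csp (tens_idx n (L ! j))) &
   (ALL j>=length L. (%I. x (j, I)) = 0)"
 unfolding coord_space_def dsum_idx_def by (auto simp: fun_eq_iff not_less) (metis not_le)+

lemma dact2_flinear: "flinear (dact2 n g (h :: 'k::field mat))"
 using tact2_flinear[of n g h] unfolding flinear_def dact2_def
 by (auto simp: fun_eq_iff plus_fun_def fscale_def)

lemma dact2_component: "(%I. dact2 n g h x (j, I)) = tact2 n g h (%I. x (j, I))"
 by (simp add: dact2_def)

lemma dact2_coord_space:
 assumes "x : csp (dsum_idx n L)"
 shows "dact2 n g (h :: 'k::field mat) x : csp (dsum_idx n L)"
 using assms unfolding dsum_coord_space_iff dact2_component
 by (auto intro: tact2_coord_space simp: flinear_0[OF tact2_flinear])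

lemma dact2_mult:
 assumes "a : Mat n" "b : Mat n" "a' : Mat n" "b' : Mat n"
 shows "dact2 n (a * b) (b' * a') x = dact2 n a a' (dact2 n b b' x)"
 unfolding dact2_def tact2_mult[OF assms] by (simp add: case_prod_beta)

lemma dact2_one:
 assumes "x : csp (dsum_idx n L)"
 shows "dact2 n (1\<^sub>m n) (1\<^sub>m n) x = (x :: _ => 'k::field)"
proof
 fix p :: "nat \<times> tidx"
 obtain j I where p: "p = (j, I)" by (cases p)
 have "tact2 n (1\<^sub>m n) (1\<^sub>m n) (%I. x (j, I)) = (%I. x (j, I))"
  using assms tact2_one[of "%I. x (j, I)" n "L ! j"] flinear_0[OF tact2_flinear]
  unfolding dsum_coord_space_iff by (cases "j < length L") (auto simp: not_less)
 then show "dact2 n (1\<^sub>m n) (1\<^sub>m n) x p = x p" by (simp add: dact2_def p)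
qed

lemma dact2_hom_on:
 assumes "hom_on R tau" "subring_set R"
  and "g : Mat n" "elements_mat g <= R" and "h : Mat n" "elements_mat h <= R"
  and "range x <= R"
 shows "dact2 n (map_mat tau g) (map_mat tau h) (%p. tau (x p)) = (%p. tau (dact2 n g h x p))"
proof
 fix p :: "nat \<times> tidx"
 obtain j I where p: "p = (j, I)" by (cases p)
 have "range (%I. x (j, I)) <= R" using assms(7) by auto
 from fun_cong[OF tact2_hom_on[OF assms(1-6) this], of I]
 show "dact2 n (map_mat tau g) (map_mat tau h) (%p. tau (x p)) p = tau (dact2 n g h x p)"
  by (simp add: dact2_def p)
qed

lemma dact2_cvec:
 assumes "g : Mat n" "h : Mat n"
 shows "dact2 n (cmat g) (cmat h) (cvec x) = cvec (dact2 n g h x)"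
proof
 fix p :: "nat \<times> tidx"
 obtain j I where p: "p = (j, I)" by (cases p)
 have "tact2 n (cmat g) (cmat h) (cvec (%I. x (j, I))) I = cvec (tact2 n g h (%I. x (j, I))) I"
  by (simp add: tact2_cvec[OF assms])
 then show "dact2 n (cmat g) (cmat h) (cvec x) p = cvec (dact2 n g h x) p"
  by (simp add: dact2_def p cvec_def)
qed

subsection \<open>Isomorphisms of tensor structures\<close>

text \<open>The coordinate ring of the general linear group, as functions.\<close>

inductive reg_fun :: "nat => (complex mat => complex) => bool" for n where
 const: "reg_fun n (%_. c)"
| entry: "i < n ==> j < n ==> reg_fun n (%A. A $$ (i, j))"
| inv_entry: "i < n ==> j < n ==> reg_fun n (%A. minv A $$ (i, j))"
| add: "reg_fun n f ==> reg_fun n g ==> reg_fun n (%A. f A + g A)"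
| mult: "reg_fun n f ==> reg_fun n g ==> reg_fun n (%A. f A * g A)"

lemma reg_fun_sum: "(!!i. i : I ==> reg_fun n (f i)) ==> reg_fun n (%A. SUM i:I. f i A)"
 by (induction I rule: infinite_finite_induct) (auto intro: reg_fun.intros)

lemma reg_fun_prod: "(!!i. i : I ==> reg_fun n (f i)) ==> reg_fun n (%A. PROD i:I. f i A)"
 by (induction I rule: infinite_finite_induct) (auto intro: reg_fun.intros)

lemma det_mat_polys: "EX d:mat_polys n. ALL A:Mat n. d A = mdet A"
proof -
 have "(%A. SUM p:{p. p permutes {0..<n}}. signof p * (PROD i = 0..<n. A $$ (i, p i))) : mat_polys n"
  by (intro mat_polys_sum mat_polys.mult mat_polys.const mat_polys_prod mat_polys.entry)
    (auto dest: permutes_in_image)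
 then show ?thesis by (rule bexI[rotated]) (simp add: det_def')
qed

lemma submatrix_det_mat_polys:
 assumes "i < n" "j < n"
 shows "EX d:mat_polys n. ALL A:Mat n. d A = adj_mat A $$ (i, j)"
proof -
 obtain d where d: "d : mat_polys (n - 1)" "ALL A:carrier_mat (n - 1) (n - 1). d A = mdet A"
  using det_mat_polys[of "n - 1"] by blast
 have "EX g:mat_polys n. ALL A:Mat n. g A = d (mat_delete A j i)"
 proof (rule mat_polys_subst[OF d(1)])
  fix k l assume kl: "k < n - 1" "l < n - 1"
  have "ALL A:Mat n. A $$ (if k < j then k else Suc k, if l < i then l else Suc l) = mat_delete A j i $$ (k, l)"
   using kl by (auto simp: mat_delete_def)
  then show "EX e:mat_polys n. ALL A:Mat n. e A = mat_delete A j i $$ (k, l)"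
   using kl by (intro bexI[of _ "%A. A $$ (if k < j then k else Suc k, if l < i then l else Suc l)"] mat_polys.entry) auto
 qed
 then obtain g where g: "g : mat_polys n" "ALL A:Mat n. g A = d (mat_delete A j i)" by (elim bexE) (rule that)
 have "(-1) ^ (j + i) * g A = adj_mat A $$ (i, j)" if A: "A : Mat n" for A
  using g(2) d(2) A assms mat_delete_carrier[OF A, of j i] by (auto simp: adj_mat_def cofactor_def)
 then show ?thesis using mat_polys_cmult[OF g(1)] by (intro bexI[of _ "%A. (-1) ^ (j + i) * g A"]) auto
qed

lemma reg_fun_clear:
 assumes "reg_fun n f"
 shows "EX N. EX p:mat_polys n. ALL A:GL n. mdet A ^ N * f A = p A"
proof -
 obtain d where d: "d : mat_polys n" "ALL A:Mat n. d A = mdet A"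
  using det_mat_polys[of n] by (elim bexE) (rule that)
 have dG: "d A = mdet A" if "A : GL n" for A using d(2) GL_minv(1)[OF that] by blast
 show ?thesis
  using assms
 proof induction
  case (const c)
  show ?case by (intro exI[of _ 0] bexI[of _ "%_. c"]) (auto intro: mat_polys.const)
 next
  case (entry i j)
  then show ?case by (intro exI[of _ 0] bexI[of _ "%A. A $$ (i, j)"]) (auto intro: mat_polys.entry)
 next
  case (inv_entry i j)
  obtain e where e: "e : mat_polys n" "ALL A:Mat n. e A = adj_mat A $$ (i, j)"
   using submatrix_det_mat_polys[OF inv_entry] by (elim bexE) (rule that)
  have "ALL A:GL n. mdet A ^ 1 * minv A $$ (i, j) = e A"
  proof
   fix A :: "complex mat" assume A: "A : GL n"
   show "mdet A ^ 1 * minv A $$ (i, j) = e A"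
    using minv_entry[OF A inv_entry] bspec[OF e(2) GL_minv(1)[OF A]] by simp
  qed
  then show ?case using e(1) by (intro exI[of _ 1] bexI[of _ e])
 next
  case (add f g)
  obtain N p where p: "p : mat_polys n" "ALL A:GL n. mdet A ^ N * f A = p A"
   using add.IH(1) by (elim exE bexE) (rule that)
  obtain K q where q: "q : mat_polys n" "ALL A:GL n. mdet A ^ K * g A = q A"
   using add.IH(2) by (elim exE bexE) (rule that)
  have "mdet A ^ (N + K) * (f A + g A) = d A ^ K * p A + d A ^ N * q A" if "A : GL n" for A
   using bspec[OF p(2) that] bspec[OF q(2) that] dG[OF that]
   by (simp add: power_add algebra_simps flip: bspec[OF p(2) that] bspec[OF q(2) that])
  then show ?case
   by (intro exI[of _ "N + K"] bexI[of _ "%A. d A ^ K * p A + d A ^ N * q A"] ballI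
     mat_polys.add mat_polys.mult mat_polys_power d(1) p(1) q(1))
 next
  case (mult f g)
  obtain N p where p: "p : mat_polys n" "ALL A:GL n. mdet A ^ N * f A = p A"
   using mult.IH(1) by (elim exE bexE) (rule that)
  obtain K q where q: "q : mat_polys n" "ALL A:GL n. mdet A ^ K * g A = q A"
   using mult.IH(2) by (elim exE bexE) (rule that)
  have "mdet A ^ (N + K) * (f A * g A) = p A * q A" if "A : GL n" for A
   by (simp add: power_add algebra_simps flip: bspec[OF p(2) that] bspec[OF q(2) that])
  then show ?case
   by (intro exI[of _ "N + K"] bexI[of _ "%A. p A * q A"] ballI mat_polys.mult p(1) q(1))
 qed
qed

text \<open>Multiplying by a power of the determinant replaces a regular function by a polynomial
  without changing its zeros on invertible matrices, so polynomials suffice to detect the closure of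
  \<open>G\<close> there.\<close>

lemma reg_fun_vanishing:
 assumes "reg_fun n f" "G <= GL n" "!!A. A : G ==> f A = 0"
  and "A : GL n" "!!p. p : vanishing n G ==> p A = 0"
 shows "f A = 0"
proof -
 obtain N p where p: "p : mat_polys n" "ALL A:GL n. mdet A ^ N * f A = p A"
  using reg_fun_clear[OF assms(1)] by (elim exE bexE) (rule that)
 have "p B = 0" if "B : G" for B
 proof -
  have "mdet B ^ N * f B = p B" using p(2) that assms(2) by blast
  then show ?thesis using assms(3)[OF that] by simp
 qed
 then have "p : vanishing n G" using p(1) by (simp add: vanishing_def)
 then have "mdet A ^ N * f A = 0" using assms(5) bspec[OF p(2) assms(4)] by simp
 then show ?thesis using assms(4) by (simp add: GL_det)
qed

lemma tact2_reg:
 assumes "!!i j. i < n ==> j < n ==> reg_fun n (%A. g A $$ (i, j))"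
  and "!!i j. i < n ==> j < n ==> reg_fun n (%A. h A $$ (i, j))"
 shows "reg_fun n (%A. tact2 n (g A) (h A) t p)"
proof (cases "p : tens_idx n (length (fst p), length (snd p))")
 case True
 have "reg_fun n (%A. tcoef (g A) (h A) p q)" if q: "q : tens_idx n (length (fst p), length (snd p))" for q
  unfolding tcoef_def
  by (intro reg_fun.mult reg_fun_prod assms tens_idxD(3,4)[OF True] tens_idxD(3,4)[OF q]) simp_all
 then show ?thesis
  unfolding tact2_at[OF True] by (intro reg_fun_sum reg_fun.mult reg_fun.const)
next
 case False
 then have "(%A. tact2 n (g A) (h A) t p) = (%_. 0)" by (simp add: tact2_def False)
 then show ?thesis by (simp add: reg_fun.const)
qed

lemma dact2_reg:
 assumes "!!i j. i < n ==> j < n ==> reg_fun n (%A. g A $$ (i, j))"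
  and "!!i j. i < n ==> j < n ==> reg_fun n (%A. h A $$ (i, j))"
 shows "reg_fun n (%A. dact2 n (g A) (h A) x p)"
 unfolding dact2_def case_prod_beta by (rule tact2_reg[OF assms])

text \<open>Tensors \<open>s v x\<close> and subspaces \<open>a v y\<close> on two rational realizations; the realization is
 \<open>v = False\<close> for Betti and \<open>v = True\<close> for de Rham.\<close>

locale tensor_structure =
 fixes n :: nat and X :: "'x set" and rs :: "'x => nat \<times> nat" and s :: "bool => 'x => tidx => rat"
  and Y :: "'y set" and L :: "'y => (nat \<times> nat) list" and a :: "bool => 'y => (nat \<times> tidx => rat) set"
 assumes s: "x : X ==> s v x : csp (tens_idx n (rs x))"
  and a: "y : Y ==> module.subspace sc (a v y)" "y : Y ==> a v y <= csp (dsum_idx n (L y))"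
begin

definition iso :: "bool => bool => complex mat set" where
 "iso u v = {g : GL n. (ALL x:X. tens_act n g (cvec (s u x)) = cvec (s v x)) &
   (ALL y:Y. dsum_act n g ` cspan (a u y) = cspan (a v y))}"

lemma cvec_s: "x : X ==> cvec (s v x) : csp (tens_idx n (rs x))"
 using s by (fastforce simp: coord_space_def cvec_def)

lemma cspan_a: "y : Y ==> x : cspan (a v y) ==> x : csp (dsum_idx n (L y))"
 using cspan_coord_space[OF a(2)] by blast

text \<open>Equality of a subspace with an image is replaced by two inclusions on rational vectors,
  one for the matrix and one for its inverse. This form consists of equations with rational
  coefficients, as needed for \<open>iso_hom_on\<close> and \<open>iso_closed\<close>.\<close>

lemma iso_iff:
 "g : iso u v \<longleftrightarrow> g : GL n & (ALL x:X. tact2 n g (minv g) (cvec (s u x)) = cvec (s v x)) &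
   (ALL y:Y. (ALL x:a u y. dact2 n g (minv g) (cvec x) : cspan (a v y)) &
      (ALL x:a v y. dact2 n (minv g) g (cvec x) : cspan (a u y)))"
proof (cases "g : GL n")
 case True
 note g = GL_minv[OF True]
 have inv: "dact2 n g (minv g) (dact2 n (minv g) g x) = x"
  "dact2 n (minv g) g (dact2 n g (minv g) x) = x"
  if "x : csp (dsum_idx n L')" for x :: "nat \<times> tidx => complex" and L'
  using dact2_mult[OF g(1,2) g(2) g(1), of x] dact2_mult[OF g(2,1) g(1) g(2), of x] g dact2_one[OF that]
  by simp_all
 have "dact2 n g (minv g) ` cspan (a u y) = cspan (a v y) \<longleftrightarrow>
   (ALL x:a u y. dact2 n g (minv g) (cvec x) : cspan (a v y)) &
   (ALL x:a v y. dact2 n (minv g) g (cvec x) : cspan (a u y))" (is "?l = (?r1 & ?r2)") if y: "y : Y" for y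
 proof
  assume l: ?l
  have ?r1 using l cvec_in_cspan by blast
  moreover have ?r2
  proof
   fix x assume "x : a v y"
   then have "cvec x : dact2 n g (minv g) ` cspan (a u y)" unfolding l by (rule cvec_in_cspan)
   then obtain z where "z : cspan (a u y)" "cvec x = dact2 n g (minv g) z" by blast
   then show "dact2 n (minv g) g (cvec x) : cspan (a u y)" using inv(2)[OF cspan_a[OF y]] by simp
  qed
  ultimately show "?r1 & ?r2" ..
 next
  assume r: "?r1 & ?r2"
  have 1: "dact2 n g (minv g) x : cspan (a v y)" if "x : cspan (a u y)" for x
   by (rule flinear_cspan_image[OF dact2_flinear cspan_subspace _ that]) (use r in blast)
  have 2: "dact2 n (minv g) g x : cspan (a u y)" if "x : cspan (a v y)" for x
   by (rule flinear_cspan_image[OF dact2_flinear cspan_subspace _ that]) (use r in blast)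
  have "x : dact2 n g (minv g) ` cspan (a u y)" if "x : cspan (a v y)" for x
   using 2[OF that] inv(1)[OF cspan_a[OF y that]] by (metis imageI)
  with 1 show ?l by blast
 qed
 then show ?thesis unfolding iso_def tens_act_eq dsum_act_eq using True by auto
qed (simp add: iso_def)

lemma iso_GL: "g : iso u v ==> g : GL n"
 by (simp add: iso_def)

lemma iso_mult:
 assumes "g : iso u v" "h : iso v w"
 shows "h * g : iso u w"
proof -
 note g = GL_minv[OF iso_GL[OF assms(1)]] and h = GL_minv[OF iso_GL[OF assms(2)]]
 note hg = GL_mult[OF iso_GL[OF assms(2)] iso_GL[OF assms(1)]]
 have 1: "tens_act n (h * g) t = tens_act n h (tens_act n g t)" for t
  unfolding tens_act_eq conjunct2[OF hg] by (rule tact2_mult[OF h(1) g(1) h(2) g(2)])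
 have "dsum_act n (h * g) = dsum_act n h \<circ> dsum_act n g"
  unfolding dsum_act_eq conjunct2[OF hg] using dact2_mult[OF h(1) g(1) h(2) g(2)] by auto
 then have 2: "dsum_act n (h * g) ` S = dsum_act n h ` dsum_act n g ` S" for S by (simp add: image_comp)
 show ?thesis using assms hg unfolding iso_def by (simp add: 1 2)
qed

lemma iso_minv:
 assumes "g : iso u v"
 shows "minv g : iso v u"
proof -
 note G = iso_GL[OF assms]
 note g = GL_minv[OF G]
 have "tact2 n (minv g) g (cvec (s v x)) = cvec (s u x)" if x: "x : X" for x
 proof -
  have "cvec (s v x) = tact2 n g (minv g) (cvec (s u x))" using assms x unfolding iso_iff by simp
  then show ?thesis
   using tact2_mult[OF g(2,1) g(1) g(2), of "cvec (s u x)"] g tact2_one[OF cvec_s[OF x, of u]] by simp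
 qed
 then show ?thesis using assms GL_minv_GL[OF G] unfolding iso_iff by simp
qed

lemma iso_one: "1\<^sub>m n : iso v v"
 using GL_one tact2_one[OF cvec_s] dact2_one[OF cspan_a[OF _ cvec_in_cspan]] cvec_in_cspan
 unfolding iso_iff by auto

text \<open>The conditions are equations with rational coefficients in the entries of
  \<open>g\<close> and of its inverse. This is what lets isomorphisms be specialized and
  conjugated.\<close>

lemma iso_hom_on:
 assumes tau: "hom_on R tau" "subring_set R" and rat: "!!q. of_rat q : R"
  and g: "g : iso u v" "elements_mat g <= R" "elements_mat (minv g) <= R"
 shows "map_mat tau g : iso u v"
proof -
 note G = iso_GL[OF g(1)]
 note gi = GL_minv[OF G]
 note m = minv_hom_on[OF tau G g(2,3)]
 have cv: "(%i. tau (cvec x i)) = cvec x" "range (cvec x) <= R" for x :: "'i => rat"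
  using hom_on_of_rat[OF tau rat] rat by (auto simp: cvec_def)
 have R: "range (dact2 n h k x) <= R" if "h : Mat n" "elements_mat h <= R"
  "k : Mat n" "elements_mat k <= R" "range x <= R" for h k x
 proof -
  have e: "h $$ (i, j) : R" "k $$ (i, j) : R" if "i < n" "j < n" for i j
   using that \<open>h : _\<close> \<open>k : _\<close> \<open>elements_mat h <= R\<close> \<open>elements_mat k <= R\<close> elements_mat_entry by blast+
  have x: "x p : R" for p using that(5) by auto
  have "dact2 n h k x (j, p) : R" for j p
  proof (cases "p : tens_idx n (length (fst p), length (snd p))")
   case True
   have "tcoef h k p q : R" if q: "q : tens_idx n (length (fst p), length (snd p))" for q
    unfolding tcoef_def
    by (intro subring_setD(5)[OF tau(2)] subring_set_prod[OF tau(2)] e tens_idxD(3,4)[OF True] tens_idxD(3,4)[OF q]) simp_all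
   then show ?thesis
    unfolding dact2_def prod.case tact2_at[OF True]
    by (intro subring_set_sum[OF tau(2)] subring_setD(5)[OF tau(2)] x)
  qed (simp add: dact2_def tact2_def subring_setD[OF tau(2)])
  then show ?thesis by auto
 qed
 have "tact2 n (map_mat tau g) (map_mat tau (minv g)) (cvec (s u x)) = cvec (s v x)" if x: "x : X" for x
 proof -
  have "tact2 n g (minv g) (cvec (s u x)) = cvec (s v x)" using g(1) x unfolding iso_iff by simp
  then show ?thesis
   using tact2_hom_on[OF tau gi(1) g(2) gi(2) g(3) cv(2), of "s u x"] by (simp add: cv(1))
 qed
 moreover have "dact2 n (map_mat tau h) (map_mat tau k) (cvec x) : cspan (a w y)"
  if "h : Mat n" "elements_mat h <= R" "k : Mat n" "elements_mat k <= R"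
   "dact2 n h k (cvec x) : cspan (a w y)" "y : Y" for h k x w y
  using cspan_hom_on[OF finite_dsum_idx a(1)[OF that(6)] a(2)[OF that(6)] tau that(5) R[OF that(1-4) cv(2)] rat]
   dact2_hom_on[OF tau that(1-4) cv(2), of x] by (simp add: cv(1))
 ultimately show ?thesis
  using g gi m unfolding iso_iff by simp
qed

text \<open>The group is closed among invertible matrices because its conditions are zeros of
  regular functions. In this way exponentials of tangent vectors are seen to lie in it.\<close>

lemma iso_closed:
 assumes A: "A : GL n" "!!p. p : vanishing n (iso v v) ==> p A = 0"
 shows "A : iso v v"
proof -
 have sub: "iso v v <= GL n" by (auto simp: iso_def)
 have reg: "f A = 0" if "reg_fun n f" "!!B. B : iso v v ==> f B = 0" for f
  by (rule reg_fun_vanishing[OF that(1) sub _ A(1)]) (use that(2) A(2) in blast)+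
 have entry: "i < n ==> j < n ==> reg_fun n (%A. A $$ (i, j))"
  "i < n ==> j < n ==> reg_fun n (%A. minv A $$ (i, j))" for i j
  by (intro reg_fun.intros; simp)+
 have "tact2 n A (minv A) (cvec (s v x)) p = cvec (s v x) p" if x: "x : X" for x p
 proof -
  have "tact2 n A (minv A) (cvec (s v x)) p + (- cvec (s v x) p) = 0"
  proof (rule reg)
   show "reg_fun n (%A. tact2 n A (minv A) (cvec (s v x)) p + (- cvec (s v x) p))"
    by (intro reg_fun.add reg_fun.const tact2_reg entry)
  qed (use x in \<open>simp add: iso_iff\<close>)
  then show ?thesis by simp
 qed
 moreover have "dact2 n (g A) (h A) (cvec x) : cspan (a v y)"
  if y: "y : Y" and gh: "!!i j. i < n ==> j < n ==> reg_fun n (%A. g A $$ (i, j))"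
    "!!i j. i < n ==> j < n ==> reg_fun n (%A. h A $$ (i, j))"
   and x: "x : a v y" and B: "!!B. B : iso v v ==> dact2 n (g B) (h B) (cvec x) : cspan (a v y)" for y g h x
 proof -
  let ?I = "dsum_idx n (L y)"
  obtain q where q: "ALL w. w : cspan (a v y) \<longleftrightarrow>
    w : csp ?I & (ALL i. w i = (SUM j:?I. w j * of_rat (q j i)))"
   using cspan_eqs[OF finite_dsum_idx a(1)[OF y, of v] a(2)[OF y, of v]] by (elim exE conjE) (rule that)
  have "dact2 n (g A) (h A) (cvec x) i =
    (SUM j:?I. dact2 n (g A) (h A) (cvec x) j * of_rat (q j i))" for i
  proof -
   have "dact2 n (g A) (h A) (cvec x) i + (- 1) *
     (SUM j:?I. dact2 n (g A) (h A) (cvec x) j * of_rat (q j i)) = 0"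
   proof (rule reg)
    show "reg_fun n (%A. dact2 n (g A) (h A) (cvec x) i + (- 1) *
      (SUM j:?I. dact2 n (g A) (h A) (cvec x) j * of_rat (q j i)))"
     by (intro reg_fun.add reg_fun.mult reg_fun_sum reg_fun.const dact2_reg gh)
    fix B assume "B : iso v v"
    from B[OF this] q have "dact2 n (g B) (h B) (cvec x) i =
      (SUM j:?I. dact2 n (g B) (h B) (cvec x) j * of_rat (q j i))" by blast
    then show "dact2 n (g B) (h B) (cvec x) i + (- 1) *
      (SUM j:?I. dact2 n (g B) (h B) (cvec x) j * of_rat (q j i)) = 0" by simp
   qed
   then show ?thesis by simp
  qed
  moreover have "dact2 n (g A) (h A) (cvec x) : csp ?I"
   by (rule dact2_coord_space[OF cspan_a[OF y cvec_in_cspan[OF x]]])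
  ultimately show ?thesis using q by blast
 qed
 note * = this
 have "dact2 n A (minv A) (cvec x) : cspan (a v y)" "dact2 n (minv A) A (cvec x) : cspan (a v y)"
  if "y : Y" "x : a v y" for x y
  using *[OF that(1) entry that(2)] *[OF that(1) entry(2,1) that(2)] that by (auto simp: iso_iff)
 ultimately show ?thesis using A(1) unfolding iso_iff by auto
qed

end

lemma cmat_carrier: "A : carrier_mat n m ==> cmat A : carrier_mat n m"
 by simp

text \<open>On a tensor with one factor of each kind the action is conjugation, so carrying one
  endomorphism to another means intertwining them.\<close>

lemma tens_act_end_tensor:
 assumes g: "g : GL n" and A: "A : Mat n" "A' : Mat n"
  and eq: "tens_act n g (cvec (end_tensor A)) = cvec (end_tensor A')"
 shows "g * cmat A = cmat A' * g"
proof -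
 note G = GL_minv[OF g]
 have I: "idx_lists n 1 = (%i. [i]) ` {..<n}"
  by (auto simp: idx_lists_def length_Suc_conv)
 have "cmat A' = g * cmat A * minv g"
 proof (rule eq_matI)
  fix i j assume "i < dim_row (g * cmat A * minv g)" "j < dim_col (g * cmat A * minv g)"
  then have ij: "i < n" "j < n" using G by auto
  have p: "([i], [j]) : tens_idx n (1, 1)" using ij by (simp add: tens_idx_def I[simplified])
  have "of_rat (A' $$ (i, j)) = cvec (end_tensor A') ([i], [j])"
   using ij A by (simp add: end_tensor_def cvec_def)
  also have "... = (SUM q:tens_idx n (1, 1). tcoef g (minv g) ([i], [j]) q * cvec (end_tensor A) q)"
   unfolding eq[symmetric] tens_act_eq tact2_at[OF p] ..
  also have "tens_idx n (1, 1) = (%(k, l). ([k], [l])) ` ({..<n} \<times> {..<n})"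
   unfolding tens_idx_def by (auto simp: I[simplified])
  also have "(SUM q:(%(k, l). ([k], [l])) ` ({..<n} \<times> {..<n}). tcoef g (minv g) ([i], [j]) q * cvec (end_tensor A) q) =
    (SUM (k, l):{..<n} \<times> {..<n}. g $$ (i, k) * minv g $$ (l, j) * of_rat (A $$ (k, l)))"
   using A by (subst sum.reindex) (auto simp: inj_on_def tcoef_def end_tensor_def cvec_def intro!: sum.cong)
  also have "... = (SUM k<n. SUM l<n. g $$ (i, k) * minv g $$ (l, j) * of_rat (A $$ (k, l)))"
   by (simp add: sum.cartesian_product)
  also have "... = (SUM l<n. (SUM k<n. g $$ (i, k) * of_rat (A $$ (k, l))) * minv g $$ (l, j))"
   by (subst sum.swap) (simp add: sum_distrib_left sum_distrib_right mult_ac)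
  also have "... = (SUM l<n. (g * cmat A) $$ (i, l) * minv g $$ (l, j))"
   using mult_mat_entry[OF G(1) cmat_carrier[OF A(1)] ij(1)] A by (auto intro!: sum.cong simp del: index_mult_mat(1))
  also have "... = (g * cmat A * minv g) $$ (i, j)"
   using mult_mat_entry[OF mult_carrier_mat[OF G(1) cmat_carrier[OF A(1)]] G(2) ij] by simp
  finally show "cmat A' $$ (i, j) = (g * cmat A * minv g) $$ (i, j)" using ij A by simp
 qed (use G A in auto)
 then have "cmat A' * g = g * cmat A * (minv g * g)"
  using assoc_mult_mat[OF mult_carrier_mat[OF G(1) cmat_carrier[OF A(1)]] G(2,1)] by simp
 then show ?thesis using G A by simp
qed

section \<open>Modules over the tensor product\<close>

lemma pure_tensor_simps:
 "ptens (a + a') b = ptens a b + ptens a' b"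
 "ptens a (b + b') = ptens a b + ptens a b'"
 "ptens (of_rat q * a) b = ptens a (of_rat q * b)"
 "ptens a b * ptens c d = ptens (a * c) (b * d)"
 "ptens 1 1 = 1" "ptens 0 b = 0"
 by (transfer; simp add: tens_rel.intros list_times_def)+

lemma pure_tensor_0_right: "ptens a 0 = 0"
 using pure_tensor_simps(3)[of 0 a 0] by (simp add: pure_tensor_simps(6))

lemma pure_tensor_sum:
 "ptens (SUM i:I. f i) b = (SUM i:I. ptens (f i) b)"
 "ptens a (SUM i:I. g i) = (SUM i:I. ptens a (g i))"
 by (induction I rule: infinite_finite_induct; simp add: pure_tensor_simps pure_tensor_0_right)+

lemma qtensor_induct [case_names zero step]:
 assumes "P 0" "!!a b x. P x ==> P (ptens a b + x)"
 shows "P x"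
proof -
 have "P (abs_qtensor xs)" for xs
 proof (induction xs)
  case Nil
  then show ?case using assms(1) by (simp add: zero_qtensor_def)
 next
  case (Cons x xs)
  obtain a b where "x = (a, b)" by (cases x)
  moreover have "abs_qtensor ((a, b) # xs) = ptens a b + abs_qtensor xs"
   by (simp add: pure_tensor.abs_eq plus_qtensor.abs_eq)
  ultimately show ?case using assms(2)[OF Cons] by simp
 qed
 then show ?thesis by (metis Quotient_qtensor Quotient_abs_rep)
qed

definition qlinear :: "('a::field_char_0 => rat) => bool" where
 "qlinear l \<longleftrightarrow> (ALL x y. l (x + y) = l x + l y) & (ALL q x. l (of_rat q * x) = q * l x)"

lemma qlinear_0: "qlinear l ==> l 0 = 0"
 using qlinear_def[of l] by (metis mult_zero_left of_rat_0)

lemma qlinear_sum: "qlinear l ==> l (SUM i:I. f i) = (SUM i:I. l (f i))"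
 by (induction I rule: infinite_finite_induct) (auto simp: qlinear_0, auto simp: qlinear_def)

text \<open>The map \<open>l \<otimes> id\<close> attached to a rational functional \<open>l\<close>.\<close>

definition contract :: "('a::field_char_0 => rat) => ('a, 'b::field_char_0) qtensor => 'b" where
 "contract l x = (\<Sum>(a, b)\<leftarrow>rep_qtensor x. of_rat (l a) * b)"

lemma tens_rel_rep: "tens_rel (rep_qtensor (abs_qtensor xs)) xs"
 using Quotient_rep_abs[OF Quotient_qtensor, of xs] tens_rel.refl by blast

lemma contract_abs: "qlinear l ==> contract l (abs_qtensor xs) = (\<Sum>(a, b)\<leftarrow>xs. of_rat (l a) * b)"
 unfolding contract_def by (rule tens_rel_functional[OF tens_rel_rep]) (auto simp: qlinear_def)

lemma contract_simps:
 assumes "qlinear l"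
 shows "contract l (ptens a b) = of_rat (l a) * b" "contract l (x + y) = contract l x + contract l y"
  "contract l 0 = 0"
proof -
 show "contract l (ptens a b) = of_rat (l a) * b"
  by (simp add: pure_tensor.abs_eq contract_abs[OF assms])
 show "contract l 0 = 0" by (simp add: zero_qtensor_def contract_abs[OF assms])
 show "contract l (x + y) = contract l x + contract l y"
 proof -
  obtain xs ys where "x = abs_qtensor xs" "y = abs_qtensor ys"
   by (metis Quotient_qtensor Quotient_abs_rep)
  then show ?thesis by (simp add: plus_qtensor.abs_eq contract_abs[OF assms])
 qed
qed

lemma contract_minus: "qlinear l ==> contract l (x - y) = contract l x - contract l y"
 using contract_simps(2)[of l "x - y" y] by simp

lemma contract_sum: "qlinear l ==> contract l (SUM i:I. f i) = (SUM i:I. contract l (f i))"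
 by (induction I rule: infinite_finite_induct) (auto simp: contract_simps)

locale number_field_basis =
 fixes B :: "'e::field_char_0 set"
 assumes finite_B: "finite B" and basis_B: "rat_basis B"
begin

definition coef :: "'e => 'e => rat" where
 "coef bet e = rat_vs.representation B e bet"

lemma indep_B: "~ rat_vs.dependent B" and span_B: "e : rat_vs.span B"
 using basis_B by (auto simp: rat_basis_def)

lemma qlinear_coef: "qlinear (coef bet)"
 unfolding qlinear_def coef_def
 using rat_vs.representation_add[OF indep_B span_B span_B] rat_vs.representation_scale[OF indep_B span_B] by auto

lemma coef_expand: "e = (SUM bet:B. of_rat (coef bet e) * bet)"
 unfolding coef_def using rat_vs.sum_representation_eq[OF indep_B span_B finite_B order.refl, of e] by simp

lemma coef_basis: "al : B ==> coef bet al = (if bet = al then 1 else 0)"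
 unfolding coef_def using rat_vs.representation_basis[OF indep_B, of al] by auto

text \<open>Since \<open>B\<close> is a basis of \<open>E\<close>, the tensor product is free over
  its second factor with these coordinates. Membership in \<open>tensor_sub K\<close> is decided
  coordinate by coordinate.\<close>

abbreviation kap :: "'e => ('e, 'b::field_char_0) qtensor => 'b" where
 "kap bet == contract (coef bet)"

lemmas kap_simps = contract_simps[OF qlinear_coef]

lemma kap_expand: "x = (SUM bet:B. ptens bet (kap bet x))"
proof (induction x rule: qtensor_induct)
 case zero
 then show ?case by (simp add: kap_simps pure_tensor_0_right)
next
 case (step a b x)
 have "ptens a b = (SUM bet:B. ptens (of_rat (coef bet a) * bet) b)"
  using arg_cong[OF coef_expand[of a], of "%a. ptens a b"] by (simp only: pure_tensor_sum)
 then have p: "ptens a b = (SUM bet:B. ptens bet (of_rat (coef bet a) * b))"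
  by (simp only: pure_tensor_simps(3))
 have "(SUM bet:B. ptens bet (kap bet (ptens a b + x))) =
   (SUM bet:B. ptens bet (of_rat (coef bet a) * b)) + (SUM bet:B. ptens bet (kap bet x))"
  by (simp only: kap_simps pure_tensor_simps(2) sum.distrib)
 then show ?case unfolding p[symmetric] step[symmetric] by (rule HOL.sym)
qed

lemma qtensor_eqI: "(!!bet. bet : B ==> kap bet x = kap bet y) ==> x = y"
 by (subst kap_expand[of x], subst kap_expand[of y]) simp

text \<open>The structure constants are rational, so a ring homomorphism applied to the coordinates
  respects products.\<close>

lemma kap_mult: "kap gam (x * y) = (SUM al:B. SUM bet:B. of_rat (coef gam (al * bet)) * (kap al x * kap bet y))"
proof -
 have "x * y = (SUM al:B. SUM bet:B. ptens (al * bet) (kap al x * kap bet y))"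
  by (subst kap_expand[of x], subst kap_expand[of y])
    (simp add: sum_product pure_tensor_simps(4))
 then show ?thesis by (simp add: contract_sum[OF qlinear_coef] kap_simps)
qed

lemma kap_one: "kap bet (1 :: ('e, 'b::field_char_0) qtensor) = of_rat (coef bet 1)"
 using kap_simps(1)[of bet 1 "1 :: 'b"] by (simp add: pure_tensor_simps)

lemma kap_in_tensor_sub: "(!!bet. bet : B ==> kap bet x : K) ==> x : tensor_sub K"
proof -
 assume K: "!!bet. bet : B ==> kap bet x : K"
 obtain bs where bs: "set bs = B" "distinct bs" using finite_distinct_list[OF finite_B] by blast
 have "x = (\<Sum>(a, b)\<leftarrow>map (%bet. (bet, kap bet x)) bs. ptens a b)"
  by (subst kap_expand) (use bs in \<open>simp add: o_def sum_list_distinct_conv_sum_set\<close>)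
 then show ?thesis unfolding tensor_sub_def using K bs(1)
  by (intro CollectI exI[of _ "map (%bet. (bet, kap bet x)) bs"] conjI) auto
qed

lemma pure_tensor_inject: "ptens (a :: 'e) (1 :: 'b::field_char_0) = ptens a' 1 ==> a = a'"
proof -
 assume *: "ptens a (1 :: 'b) = ptens a' 1"
 have "coef bet a = coef bet a'" for bet
  using arg_cong[OF *, of "kap bet"] by (simp add: kap_simps)
 then show ?thesis by (subst coef_expand[of a], subst coef_expand[of a']) simp
qed

end

text \<open>\<open>field_action\<close> asks only for a unital ring homomorphism; rational linearity
  follows by clearing denominators.\<close>

lemma field_action_of_rat:
 assumes rho: "field_action n rho"
 shows "rho (of_rat q * e) = q \<cdot>\<^sub>m rho (e :: 'e::field_char_0)"
proof -
 have c: "rho e : Mat n" and add: "rho (d + e) = rho d + rho e" for d e using rho by (auto simp: field_action_def)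
 have z: "rho 0 = 0\<^sub>m n n"
 proof (rule eq_matI)
  fix i j assume "i < dim_row (0\<^sub>m n n :: rat mat)" "j < dim_col (0\<^sub>m n n :: rat mat)"
  then have ij: "i < n" "j < n" by auto
  have "rho 0 $$ (i, j) = (rho 0 + rho 0) $$ (i, j)" using add[of 0 0] by simp
  then show "rho 0 $$ (i, j) = 0\<^sub>m n n $$ (i, j)" using ij c[of 0] by simp
 qed (use c[of 0] in auto)
 have nat: "rho (of_nat k * e) = of_nat k \<cdot>\<^sub>m rho e" for k e
 proof (induction k)
  case 0
  then show ?case using c[of e] z by (auto intro!: eq_matI)
 next
  case (Suc k)
  have "rho (of_nat (Suc k) * e) = rho e + rho (of_nat k * e)" unfolding add[symmetric] by (simp add: algebra_simps)
  then show ?case using Suc c[of e] by (auto intro!: eq_matI simp: algebra_simps)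
 qed
 have neg: "rho (- e) = (- 1) \<cdot>\<^sub>m rho e" for e
 proof (rule eq_matI)
  fix i j assume "i < dim_row ((- 1) \<cdot>\<^sub>m rho e)" "j < dim_col ((- 1) \<cdot>\<^sub>m rho e)"
  then have ij: "i < n" "j < n" using c[of e] by auto
  have "(rho (- e) + rho e) $$ (i, j) = 0" unfolding add[symmetric] using z ij by simp
  then show "rho (- e) $$ (i, j) = ((- 1) \<cdot>\<^sub>m rho e) $$ (i, j)" using ij c[of e] c[of "- e"] by (simp add: eq_neg_iff_add_eq_0)
 qed (use c[of e] c[of "- e"] in auto)
 have int: "rho (of_int k * e) = of_int k \<cdot>\<^sub>m rho e" for k e
 proof (cases k)
  case (nonneg m)
  then show ?thesis using nat[of m e] by simp
 next
  case (neg m)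
  have k: "(of_int k :: 'e) = - of_nat (Suc m)" unfolding neg by (simp del: of_nat_Suc)
  have "rho (of_int k * e) = rho (- (of_nat (Suc m) * e))" by (simp only: k mult_minus_left)
  also have "... = (- 1) \<cdot>\<^sub>m (of_nat (Suc m) \<cdot>\<^sub>m rho e)" unfolding \<open>!!e. rho (- e) = _\<close> nat ..
  also have "... = of_int k \<cdot>\<^sub>m rho e"
  proof -
   have "(of_int k :: rat) = - of_nat (Suc m)" unfolding neg by (simp del: of_nat_Suc)
   then show ?thesis by (auto intro!: eq_matI simp del: of_nat_Suc)
  qed
  finally show ?thesis .
 qed
 obtain a b where q: "quotient_of q = (a, b)" by fastforce
 have b: "b > 0" and qab: "q = of_int a / of_int b" using quotient_of_denom_pos[OF q] quotient_of_div[OF q] by auto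
 have "of_int b * (of_rat q * e) = of_int a * e" using b by (simp add: qab of_rat_divide)
 then have eq: "of_int b \<cdot>\<^sub>m rho (of_rat q * e) = of_int a \<cdot>\<^sub>m rho e" using int by metis
 show ?thesis
 proof (rule eq_matI)
  fix i j assume "i < dim_row (q \<cdot>\<^sub>m rho e)" "j < dim_col (q \<cdot>\<^sub>m rho e)"
  then have ij: "i < n" "j < n" using c[of e] by auto
  have "of_int b * rho (of_rat q * e) $$ (i, j) = of_int a * rho e $$ (i, j)"
   using arg_cong[OF eq, of "%A. A $$ (i, j)"] ij c[of e] c[of "of_rat q * e"] by simp
  then show "rho (of_rat q * e) $$ (i, j) = (q \<cdot>\<^sub>m rho e) $$ (i, j)"
   using ij c[of e] b by (simp add: qab field_simps)
 qed (use c[of e] c[of "of_rat q * e"] in auto)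
qed

lemma cmat_add: "A : carrier_mat n m ==> B : carrier_mat n m ==> cmat (A + B) = cmat A + cmat B"
 by (auto intro!: eq_matI simp: of_rat_add)

lemma cmat_smult: "cmat (q \<cdot>\<^sub>m A) = of_rat q \<cdot>\<^sub>m cmat A"
 by (auto intro!: eq_matI simp: of_rat_mult)

lemma cmat_mult:
 assumes "A : carrier_mat n m" "B : carrier_mat m k"
 shows "cmat (A * B) = cmat A * cmat B"
proof (rule eq_matI)
 fix i j assume "i < dim_row (cmat A * cmat B)" "j < dim_col (cmat A * cmat B)"
 then have ij: "i < n" "j < k" using assms by auto
 show "cmat (A * B) $$ (i, j) = (cmat A * cmat B) $$ (i, j)"
  using mult_mat_entry[OF assms ij] mult_mat_entry[OF cmat_carrier[OF assms(1)] cmat_carrier[OF assms(2)] ij] ij assms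
  by (simp add: of_rat_sum of_rat_mult del: index_mult_mat(1))
qed (use assms in auto)

lemma cmat_one: "cmat (1\<^sub>m n) = 1\<^sub>m n"
 by (auto intro!: eq_matI)

lemma fscale_simps:
 "sc (a + b) v = sc a v + sc b (v :: 'i => 'k::comm_ring_1)" "sc a (u + v) = sc a u + sc a v"
 "sc (a * b) v = sc a (sc b v)" "sc 1 v = v" "sc 0 v = 0" "sc a 0 = 0"
 by (auto simp: fscale_def algebra_simps fun_eq_iff)

lemma flinear_plus:
 fixes f :: "('i => 'k::field) => 'j => 'k"
 assumes "flinear f" "flinear g"
 shows "flinear (%v. f v + g v)"
proof -
 have f: "f (u + v) = f u + f v" "f (sc c u) = sc c (f u)"
  and g: "g (u + v) = g u + g v" "g (sc c u) = sc c (g u)" for u v c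
  using assms by (simp_all add: flinear_def)
 show ?thesis unfolding flinear_def f g fscale_simps(2)[symmetric] by (simp only: ac_simps HOL.simp_thms)
qed

lemma flinear_fscale:
 fixes f :: "('i => 'k::field) => 'j => 'k"
 assumes "flinear f"
 shows "flinear (%v. sc b (f v))"
proof -
 have f: "f (u + v) = f u + f v" "f (sc c u) = sc c (f u)" for u v c
  using assms by (simp_all add: flinear_def)
 have "sc b (sc c w) = sc c (sc b w)" for c and w :: "'j => 'k"
  by (simp add: fscale_def mult.left_commute)
 then show ?thesis unfolding flinear_def f fscale_simps(2) by blast
qed

locale field_module =
 fixes n :: nat and rho :: "'e::field_char_0 => rat mat"
 assumes action: "field_action n rho"
begin

lemma rho_carrier [simp]: "rho e : Mat n"
 and rho_simps: "rho 1 = 1\<^sub>m n" "rho (d + e) = rho d + rho e" "rho (d * e) = rho d * rho e"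
 using action by (auto simp: field_action_def)

lemmas rho_of_rat = field_action_of_rat[OF action]

text \<open>Independence of the formal sum chosen by \<open>rep_qtensor\<close>, on which all module
  laws of \<open>tensor_act\<close> rest.\<close>

lemma tensor_act_tens_rel:
 assumes "tens_rel xs ys"
 shows "(\<Sum>(e, z)\<leftarrow>xs. sc z (ap (cmat (rho e)) v)) = (\<Sum>(e, z)\<leftarrow>ys. sc z (ap (cmat (rho e)) v))"
 using assms
proof induction
 case (zero b)
 have "rho 0 = 0 \<cdot>\<^sub>m rho 0" using rho_of_rat[of 0 0] by simp
 then have "ap (cmat (rho 0)) v = sc 0 (ap (cmat (rho 0)) v)"
  by (metis cmat_smult mapply_smult of_rat_0)
 then show ?case by (simp add: fscale_simps)
next
 case (add_left a a' b)
 then show ?case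
  by (simp add: rho_simps cmat_add[of _ n n] mapply_add[of _ n n] fscale_simps)
next
 case (scale q a b)
 have "sc b (ap (cmat (rho (of_rat q * a))) v) = sc (of_rat q * b) (ap (cmat (rho a)) v)"
  unfolding rho_of_rat cmat_smult mapply_smult fscale_simps(3)[symmetric] by (simp only: mult.commute)
 then show ?case by (simp only: list.map prod.case)
qed (simp_all add: fscale_simps add_ac)

abbreviation act :: "('e, complex) qtensor => (nat => complex) => nat => complex" where
 "act == tensor_act rho"

lemma act_abs: "act (abs_qtensor xs) v = (\<Sum>(e, z)\<leftarrow>xs. sc z (ap (cmat (rho e)) v))"
 unfolding tensor_act_def by (rule tensor_act_tens_rel[OF tens_rel_rep])

lemma act_pure: "act (ptens e z) v = sc z (ap (cmat (rho e)) v)"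
 by (simp add: pure_tensor.abs_eq act_abs)

lemma act_0: "act 0 v = 0"
 by (simp add: zero_qtensor_def act_abs)

lemma act_add: "act (x + y) v = act x v + act y v"
proof -
 obtain xs ys where "x = abs_qtensor xs" "y = abs_qtensor ys"
  by (metis Quotient_qtensor Quotient_abs_rep)
 then show ?thesis by (simp add: plus_qtensor.abs_eq act_abs)
qed

lemma act_sum: "act (SUM i:I. x i) v = (SUM i:I. act (x i) v)"
 by (induction I rule: infinite_finite_induct) (auto simp: act_0 act_add)

lemma act_minus: "act (x - y) v = act x v - act y v"
 using act_add[of "x - y" y v] by simp

lemma act_flinear: "flinear (act x)"
proof (induction x rule: qtensor_induct)
 case zero
 show ?case by (auto simp: flinear_def act_0 fscale_def fun_eq_iff)
next
 case (step a b x)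
 have eq: "act (ptens a b + x) = (%v. sc b (ap (cmat (rho a)) v) + act x v)"
  by (rule ext) (simp only: act_add act_pure)
 have "flinear (%v. sc b (ap (cmat (rho a)) v))"
  by (rule flinear_fscale[OF mapply_flinear])
 then show ?case unfolding eq by (rule flinear_plus[OF _ step])
qed

lemma act_mult: "act (x * y) v = act x (act y v)"
proof (induction x rule: qtensor_induct)
 case zero
 then show ?case by (simp add: act_0)
next
 case (step a b x)
 have "act (ptens a b * y) v = act (ptens a b) (act y v)"
 proof (induction y rule: qtensor_induct)
  case zero
  show ?case unfolding act_0 mult_zero_right by (rule flinear_0[OF act_flinear, symmetric])
 next
  case (step c d y)
  have lin: "ap (cmat (rho a)) (sc d w) = sc d (ap (cmat (rho a)) w)" for w
   using mapply_flinear[of "cmat (rho a)"] by (simp add: flinear_def)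
  have "act (ptens a b * ptens c d) v = sc (b * d) (ap (cmat (rho a)) (ap (cmat (rho c)) v))"
   unfolding pure_tensor_simps act_pure rho_simps cmat_mult[OF rho_carrier rho_carrier]
    mapply_mult[OF cmat_carrier[OF rho_carrier] cmat_carrier[OF rho_carrier]] ..
  then have 1: "act (ptens a b * ptens c d) v = act (ptens a b) (act (ptens c d) v)"
   unfolding act_pure lin fscale_simps(3) .
  have 2: "act (ptens a b) (u + w) = act (ptens a b) u + act (ptens a b) w" for u w
   using act_flinear[of "ptens a b"] by (simp add: flinear_def)
  show ?case unfolding distrib_left act_add 1 2 step ..
 qed
 with step show ?case by (simp only: distrib_right act_add)
qed

lemma act_one: "v : csp {..<n} ==> act 1 v = v"
 using act_pure[of 1 1 v] by (simp add: pure_tensor_simps rho_simps cmat_one mapply_one fscale_simps)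

lemma act_cspan:
 assumes "!!e u. u : U ==> ap (rho e) u : U" "v : cspan U"
 shows "act x v : cspan U"
proof (induction x rule: qtensor_induct)
 case zero
 show ?case unfolding act_0 by (rule fs.subspace_0[OF cspan_subspace])
next
 case (step a b x)
 have "ap (cmat (rho a)) v : cspan U"
  by (rule flinear_cspan_image[OF mapply_flinear cspan_subspace _ assms(2)])
    (simp add: mapply_cmat_cvec cvec_in_cspan assms(1))
 then show ?case unfolding act_add act_pure
  by (intro fs.subspace_add[OF cspan_subspace] fs.subspace_scale[OF cspan_subspace] step)
qed

end

lemma tensor_act_commute:
 assumes "field_module n rho" "field_module n rho'" "h : Mat n"
  and "!!e. h * cmat (rho e) = cmat (rho' e) * h"
 shows "ap h (tensor_act rho x v) = tensor_act rho' x (ap h v)"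
proof -
 interpret a: field_module n rho by fact
 interpret b: field_module n rho' by fact
 show ?thesis
 proof (induction x rule: qtensor_induct)
  case zero
  show ?case unfolding a.act_0 b.act_0 by (rule flinear_0[OF mapply_flinear])
 next
  case (step e z x)
  have "ap h (ap (cmat (rho e)) v) = ap (cmat (rho' e)) (ap h v)"
   using mapply_mult[OF assms(3) cmat_carrier[OF a.rho_carrier]] mapply_mult[OF cmat_carrier[OF b.rho_carrier] assms(3)]
    assms(4) by metis
  note eq = this
  have lin: "ap h (u + w) = ap h u + ap h w" "ap h (sc c w) = sc c (ap h w)" for c u w
   using mapply_flinear[of h] by (simp_all add: flinear_def)
  show ?case unfolding a.act_add b.act_add a.act_pure b.act_pure lin step eq ..
 qed
qed

text \<open>Over \<open>E \<otimes> \<complex>\<close>, which is in general not a field, ranks are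
  compared by determinants: padding with zeros to square matrices leaves the product 1 but gives the
  first factor a zero column.\<close>

lemma rectangular_inverse_le:
 fixes A :: "'a::comm_ring_1 mat"
 assumes A: "A : carrier_mat m k" and B: "B : carrier_mat k m" and AB: "A * B = 1\<^sub>m m"
 shows "m <= k"
proof (rule ccontr)
 assume "~ m <= k"
 then have km: "k < m" by simp
 define A' where "A' = mat m m (%(i, j). if j < k then A $$ (i, j) else 0)"
 define B' where "B' = mat m m (%(i, j). if i < k then B $$ (i, j) else 0)"
 have A'c: "A' : carrier_mat m m" and B'c: "B' : carrier_mat m m" by (auto simp: A'_def B'_def)
 have "A' * B' = 1\<^sub>m m"
 proof (rule eq_matI)
  fix i j assume "i < dim_row (1\<^sub>m m :: 'a mat)" "j < dim_col (1\<^sub>m m :: 'a mat)"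
  then have ij: "i < m" "j < m" by auto
  have "(A' * B') $$ (i, j) = (SUM l<m. if l < k then A $$ (i, l) * B $$ (l, j) else 0)"
   unfolding mult_mat_entry[OF A'c B'c ij] by (intro sum.cong) (use ij in \<open>auto simp: A'_def B'_def\<close>)
  also have "... = (SUM l<k. A $$ (i, l) * B $$ (l, j))"
   using km by (intro sum.mono_neutral_cong_right) auto
  also have "... = (1\<^sub>m m) $$ (i, j)" unfolding AB[symmetric] mult_mat_entry[OF A B ij] ..
  finally show "(A' * B') $$ (i, j) = (1\<^sub>m m) $$ (i, j)" .
 qed (auto simp: A'_def B'_def)
 then have "mdet A' * mdet B' = 1"
  using det_mult[OF A'c B'c] by simp
 moreover have "mdet A' = 0"
 proof -
  have "(PROD i = 0..<m. A' $$ (i, p i)) = 0" if p: "p permutes {0..<m}" for p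
  proof -
   obtain i where i: "i < m" "p i = k"
    using permutes_surj[OF p] p km by (metis atLeast0LessThan lessThan_iff permutes_in_image surjD)
   then have "A' $$ (i, p i) = 0" using km by (simp add: A'_def)
   then show ?thesis using i by (intro prod_zero) auto
  qed
  then show ?thesis unfolding det_def'[OF A'c] by (intro sum.neutral) auto
 qed
 ultimately show False by simp
qed

lemma contract_cspan:
 assumes "qlinear l" "module.subspace sc U" "v : cspan U"
 shows "(%i. l (v i)) : U"
 using assms(3) unfolding cspan_def
proof (induction rule: fs.span_induct_alt)
 case base
 then show ?case using fs.subspace_0[OF assms(2)] qlinear_0[OF assms(1)] by (simp add: zero_fun_def)
next
 case (step c x y)
 then obtain u where u: "u : U" "x = cvec u" by auto
 have "l (sc c x i) = l c * u i" for i
  using assms(1) by (simp add: u(2) cvec_def fscale_def qlinear_def mult.commute)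
 then have "(%i. l ((sc c x + y) i)) = sc (l c) u + (%i. l (y i))"
  using assms(1) by (auto simp: qlinear_def fscale_def)
 then show ?case
  using fs.subspace_add[OF assms(2) fs.subspace_scale[OF assms(2) u(1)] step(2)] by simp
qed

lemma qlinear_functional_exists: "z ~= (0 :: complex) ==> EX l. qlinear l & l z = 1"
proof -
 assume z: "z ~= 0"
 obtain l :: "complex => rat" where l: "!!x y. l (x + y) = l x + l y" "!!q x. l (of_rat q * x) = q * l x" "l 1 = 1"
  using rat_functional_exists by blast
 then show ?thesis using z
  by (intro exI[of _ "%x. l (x / z)"]) (auto simp: qlinear_def add_divide_distrib simp flip: times_divide_eq_right)
qed

text \<open>A quotient of \<open>W\<close> by \<open>U\<close> over \<open>E\<close>. It occurs for
  the eigenspaces of the involution with \<open>U = {0}\<close> and for the de Rham space modulo a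
  step of the filtration.\<close>

locale E_space = number_field_basis B + field_module n rho for B :: "'e::field_char_0 set" and n and rho :: "'e => rat mat" +
 fixes W U :: "(nat => rat) set"
 assumes W: "module.subspace sc W" "W <= csp {..<n}" "!!e v. v : W ==> ap (rho e) v : W"
  and U: "module.subspace sc U" "U <= W" "!!e v. v : U ==> ap (rho e) v : U"
begin

definition ecomb :: "'e list => (nat => rat) list => nat => rat" where
 "ecomb es bs = (SUM k<length bs. ap (rho (es ! k)) (bs ! k))"

lemma mapply_rho_add: "ap (rho (d + e)) v = ap (rho d) v + ap (rho e) v"
 by (simp add: rho_simps mapply_add[of _ n n])

lemma mapply_rho_0: "ap (rho 0) v = 0"
 using mapply_rho_add[of 0 0 v] by simp

lemma mapply_rho_diff: "ap (rho (d - e)) v = ap (rho d) v - ap (rho e) v"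
 using mapply_rho_add[of "d - e" e v] by (simp add: algebra_simps)

lemma mapply_rho_mult: "ap (rho (d * e)) v = ap (rho d) (ap (rho e) v)"
 by (simp add: rho_simps mapply_mult[of _ n n _ n])

definition eindep :: "(nat => rat) list => bool" where
 "eindep bs \<longleftrightarrow> (ALL es. length es = length bs --> ecomb es bs : U --> (ALL k<length bs. es ! k = 0))"

text \<open>Independence over \<open>E\<close> modulo \<open>U\<close> implies independence over the
  rationals, which bounds the length by the dimension of the ambient space.\<close>

lemma eindep_length:
 assumes bs: "set bs <= W" "eindep bs"
 shows "length bs <= n"
proof -
 let ?e = "%j i :: nat. if i = j then 1 else (0 :: rat)"
 have zero: "q k = 0" if "(SUM k<length bs. sc (q k) (bs ! k)) = 0" "k < length bs" for q k
 proof -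
  let ?es = "map (%k. of_rat (q k) :: 'e) [0..<length bs]"
  have "ap (rho (?es ! k)) (bs ! k) = sc (q k) (bs ! k)" if k: "k < length bs" for k
  proof -
   have "bs ! k : csp {..<n}" using bs(1) W(2) k nth_mem by blast
   then show ?thesis using k rho_of_rat[of "q k" 1] by (simp add: rho_simps mapply_smult mapply_one)
  qed
  then have "ecomb ?es bs = 0" unfolding ecomb_def that(1)[symmetric] by (intro sum.cong) auto
  then have "ecomb ?es bs : U" using fs.subspace_0[OF U(1)] by simp
  with bs(2) have "?es ! k = 0" using that(2) unfolding eindep_def by fastforce
  then show ?thesis using that(2) by simp
 qed
 have dist: "distinct bs"
  unfolding distinct_conv_nth
 proof (intro allI impI)
  fix i j assume ij: "i < length bs" "j < length bs" "i ~= j"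
  show "bs ! i ~= bs ! j"
  proof
   assume eq: "bs ! i = bs ! j"
   let ?q = "%k. if k = i then 1 else if k = j then - 1 else (0 :: rat)"
   have "(SUM k<length bs. sc (?q k) (bs ! k)) = (SUM k:{i, j}. sc (?q k) (bs ! k))"
    using ij by (intro sum.mono_neutral_right) (auto simp: fscale_simps)
   also have "... = 0" using ij eq by (auto simp: fscale_def fun_eq_iff)
   finally show False using zero[of ?q i] ij by simp
  qed
 qed
 have ind: "~ fs.dependent (set bs)"
 proof
  assume "fs.dependent (set bs)"
  then obtain u where u: "EX v:set bs. u v ~= 0" "(SUM v:set bs. sc (u v) v) = 0"
   by (subst (asm) fs.dependent_finite) auto
  have "(SUM k<length bs. sc (u (bs ! k)) (bs ! k)) = (SUM v:set bs. sc (u v) v)"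
   by (rule sum.reindex_bij_betw) (rule bij_betw_nth[OF dist HOL.refl HOL.refl])
  then have "u (bs ! k) = 0" if "k < length bs" for k using zero[of "%k. u (bs ! k)" k] that u(2) by simp
  then show False using u(1) by (auto simp: in_set_conv_nth)
 qed
 have "set bs <= fs.span (?e ` {..<n})"
 proof
  fix v assume "v : set bs"
  then have "v : csp {..<n}" using bs(1) W(2) by blast
  from coord_space_decomp[OF _ this] have "v = (SUM j<n. sc (v j) (?e j))" by simp
  also have "... : fs.span (?e ` {..<n})" by (intro fs.span_sum fs.span_scale fs.span_base) auto
  finally show "v : fs.span (?e ` {..<n})" .
 qed
 from fs.independent_span_bound[OF _ ind this] have "card (set bs) <= card (?e ` {..<n})" by simp
 also have "... <= n" using card_image_le[of "{..<n}" ?e] by simp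
 finally show ?thesis using distinct_card[OF dist] by simp
qed

lemma E_basis_iff:
 "E_basis rho W U bs \<longleftrightarrow> set bs <= W & (ALL v:W. EX! es. length es = length bs & v - ecomb es bs : U)"
 by (simp add: E_basis_def ecomb_def)

lemma ecomb_diff:
 assumes "length es = length bs" "length ds = length bs"
 shows "ecomb (map2 (-) es ds) bs = ecomb es bs - ecomb ds bs"
 unfolding ecomb_def sum_subtractf[symmetric] using assms by (intro sum.cong) (auto simp: mapply_rho_diff)

lemma E_basis_eindep:
 assumes "E_basis rho W U bs"
 shows "set bs <= W" "eindep bs"
proof -
 show s: "set bs <= W" using assms by (simp add: E_basis_iff)
 show "eindep bs"
  unfolding eindep_def
 proof (intro allI impI)
  fix es :: "'e list" and k assume es: "length es = length bs" "ecomb es bs : U" "k < length bs"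
  have "ecomb (replicate (length bs) 0) bs = 0" by (simp add: ecomb_def mapply_rho_0)
  then have z: "0 - ecomb (replicate (length bs) 0) bs : U" using fs.subspace_0[OF U(1)] by simp
  have "0 - ecomb es bs : U" using fs.subspace_diff[OF U(1) fs.subspace_0[OF U(1)] es(2)] by simp
  moreover have "EX! es. length es = length bs & 0 - ecomb es bs : U"
   using assms fs.subspace_0[OF W(1)] unfolding E_basis_iff by blast
  ultimately have "es = replicate (length bs) 0" using z es(1) by (metis length_replicate)
  then show "es ! k = 0" using es by simp
 qed
qed

text \<open>An independent list of maximal length spans: in a relation with one more vector the
  coefficient of that vector is nonzero and can be divided out.\<close>

lemma E_basis_exists: "EX bs. E_basis rho W U bs"
proof -
 let ?P = "%bs. set bs <= W & eindep bs"
 have "?P []" by (simp add: eindep_def)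
 moreover have "ALL bs. ?P bs --> length bs < Suc n" using eindep_length by (auto simp: less_Suc_eq_le)
 ultimately obtain bs where bs: "set bs <= W" "eindep bs" and max: "!!ds. ?P ds ==> length ds <= length bs"
  using ex_has_greatest_nat[of ?P "[]" length "Suc n"] by blast
 have "EX! es. length es = length bs & v - ecomb es bs : U" if v: "v : W" for v
 proof -
  have "EX es. length es = length bs & v - ecomb es bs : U"
  proof -
   have "~ eindep (bs @ [v])" using max[of "bs @ [v]"] bs(1) v by auto
   then obtain es where es: "length es = Suc (length bs)" "ecomb es (bs @ [v]) : U"
    "~ (ALL k<Suc (length bs). es ! k = 0)" unfolding eindep_def by auto
   let ?e = "es ! length bs" and ?ds = "take (length bs) es"
   have split: "ecomb es (bs @ [v]) = ecomb ?ds bs + ap (rho ?e) v"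
    unfolding ecomb_def using es(1) by (simp add: nth_append)
   have e0: "?e ~= 0"
   proof
    assume e: "?e = 0"
    then have "ecomb ?ds bs : U" using es(2) split by (simp add: mapply_rho_0)
    then have "ALL k<length bs. ?ds ! k = 0" using bs(2) es(1) unfolding eindep_def by simp
    then show False using es(3) e by (auto simp: less_Suc_eq)
   qed
   let ?fs = "map (%d. - (inverse ?e * d)) ?ds"
   have vW: "v : csp {..<n}" using v W(2) by blast
   have "ap (rho (inverse ?e)) (ecomb es (bs @ [v])) : U" by (rule U(3)[OF es(2)])
   moreover have "ap (rho (inverse ?e)) (ecomb es (bs @ [v])) = v - ecomb ?fs bs"
   proof -
    have "ap (rho (inverse ?e)) (ecomb ?ds bs) = - ecomb ?fs bs"
     unfolding ecomb_def flinear_sum[OF mapply_flinear] sum_negf[symmetric]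
    proof (intro sum.cong HOL.refl)
     fix k assume "k : {..<length bs}"
     then have "?fs ! k = 0 - inverse ?e * ?ds ! k" using es(1) by simp
     then show "ap (rho (inverse ?e)) (ap (rho (?ds ! k)) (bs ! k)) = - ap (rho (?fs ! k)) (bs ! k)"
      by (simp only: mapply_rho_diff mapply_rho_mult mapply_rho_0) simp
    qed
    moreover have "ap (rho (inverse ?e)) (ap (rho ?e) v) = v"
     using mapply_rho_mult[of "inverse ?e" ?e v] e0 by (simp add: rho_simps mapply_one[OF vW])
    moreover have "ap (rho (inverse ?e)) (ecomb ?ds bs + ap (rho ?e) v) =
      ap (rho (inverse ?e)) (ecomb ?ds bs) + ap (rho (inverse ?e)) (ap (rho ?e) v)"
     using mapply_flinear[of "rho (inverse ?e)"] by (simp add: flinear_def)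
    ultimately show ?thesis unfolding split by simp
   qed
   ultimately show ?thesis using es(1) by (intro exI[of _ ?fs]) simp
  qed
  moreover have "es = ds" if "length es = length bs" "v - ecomb es bs : U" "length ds = length bs" "v - ecomb ds bs : U" for es ds
  proof -
   have "(v - ecomb ds bs) - (v - ecomb es bs) : U" by (rule fs.subspace_diff[OF U(1) that(4,2)])
   then have "ecomb (map2 (-) es ds) bs : U" using ecomb_diff[OF that(1,3)] by simp
   then have "ALL k<length bs. map2 (-) es ds ! k = 0" using bs(2) that unfolding eindep_def by simp
   then show ?thesis using that by (intro nth_equalityI) auto
  qed
  ultimately show ?thesis by blast
 qed
 then show ?thesis using bs(1) unfolding E_basis_iff by blast
qed

definition tcomb :: "(nat => ('e, complex) qtensor) => (nat => rat) list => nat => complex" where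
 "tcomb x bs = (SUM k<length bs. act (x k) (cvec (bs ! k)))"

text \<open>Independence over \<open>E\<close> persists over \<open>E \<otimes> \<complex>\<close>: apply a rational functional to the second factor.\<close>

lemma tcomb_unique:
 assumes bs: "E_basis rho W U bs" and x: "tcomb x bs : cspan U" and k: "k < length bs"
 shows "x k = 0"
proof (rule qtensor_eqI)
 fix bet assume bet: "bet : B"
 have "kap bet (x k) = 0"
 proof (rule ccontr)
  assume nz: "kap bet (x k) ~= 0"
  then obtain l where l: "qlinear l" "l (kap bet (x k)) = 1" using qlinear_functional_exists by blast
  define e where "e i = (SUM al:B. of_rat (l (kap al (x i))) * al)" for i
  have "(%i. l (tcomb x bs i)) : U" by (rule contract_cspan[OF l(1) U(1) x])
  moreover have "(%i. l (tcomb x bs i)) = ecomb (map e [0..<length bs]) bs"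
  proof
   fix i
   have "l (act (x j) (cvec b) i) = ap (rho (e j)) b i" for j b
   proof -
    have "act (x j) (cvec b) = (SUM al:B. sc (kap al (x j)) (cvec (ap (rho al) b)))"
     by (subst kap_expand) (simp add: act_sum act_pure mapply_cmat_cvec)
    then have "act (x j) (cvec b) i = (SUM al:B. of_rat (ap (rho al) b i) * kap al (x j))"
     by (simp add: fsum_apply fscale_def cvec_def mult.commute)
    then have "l (act (x j) (cvec b) i) = (SUM al:B. ap (rho al) b i * l (kap al (x j)))"
     using l(1) by (simp add: qlinear_sum) (simp add: qlinear_def)
    moreover have "ap (rho (SUM al:J. of_rat (l (kap al (x j))) * al)) b =
      (SUM al:J. sc (l (kap al (x j))) (ap (rho al) b))" for J
     by (induction J rule: infinite_finite_induct)
       (simp_all add: mapply_rho_0 mapply_rho_add rho_of_rat mapply_smult)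
    ultimately show ?thesis by (simp add: e_def fsum_apply fscale_def mult.commute)
   qed
   then show "l (tcomb x bs i) = ecomb (map e [0..<length bs]) bs i"
    unfolding tcomb_def ecomb_def by (simp add: fsum_apply qlinear_sum[OF l(1)])
  qed
  ultimately have "map e [0..<length bs] ! k = 0"
   using E_basis_eindep(2)[OF bs] k unfolding eindep_def by (metis length_map length_upt diff_zero)
  then have "coef bet (e k) = 0" using k qlinear_0[OF qlinear_coef] by simp
  moreover have "coef bet (e k) = (SUM al:B. if al = bet then l (kap al (x k)) else 0)"
   unfolding e_def qlinear_sum[OF qlinear_coef]
   using qlinear_coef[of bet] coef_basis by (intro sum.cong) (auto simp: qlinear_def)
  ultimately show False using l(2) bet finite_B by simp
 qed
 then show "kap bet (x k) = kap bet 0" by (simp add: kap_simps)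
qed

text \<open>The vectors that can be expressed in this way form a complex subspace, and it contains
  the rational vectors of \<open>W\<close>.\<close>

lemma tcomb_exists:
 assumes bs: "E_basis rho W U bs" and v: "v : cspan W"
 shows "EX x. v - tcomb x bs : cspan U"
proof -
 have add: "tcomb x bs + tcomb y bs = tcomb (%k. x k + y k) bs" for x y
  unfolding tcomb_def sum.distrib[symmetric] by (simp add: act_add)
 have scale: "sc c (tcomb x bs) = tcomb (%k. ptens 1 c * x k) bs" for c x
 proof -
  have "sc c v = act (ptens 1 c) v" if "v : csp {..<n}" for v
   using that by (simp add: act_pure rho_simps cmat_one mapply_one)
  moreover have "act (x k) (cvec (bs ! k)) : csp {..<n}" if "k < length bs" for k
   using act_cspan[OF W(3) cvec_in_cspan, of "bs ! k" "x k"] cspan_coord_space[OF W(2)] that bs nth_mem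
   unfolding E_basis_def by blast
  ultimately have "sc c (act (x k) (cvec (bs ! k))) = act (ptens 1 c * x k) (cvec (bs ! k))"
   if "k < length bs" for k using that by (simp add: act_mult)
  moreover have "sc c (tcomb x bs) = (SUM k<length bs. sc c (act (x k) (cvec (bs ! k))))"
   unfolding tcomb_def by (rule fs.scale_sum_right)
  ultimately show ?thesis by (simp add: tcomb_def)
 qed
 let ?S = "{v. EX x. v - tcomb x bs : cspan U}"
 have "module.subspace sc ?S"
 proof (rule fs.subspaceI)
  have "0 - tcomb (%_. 0) bs = 0" by (simp add: tcomb_def act_0)
  then have "0 - tcomb (%_. 0) bs : cspan U" using fs.subspace_0[OF cspan_subspace] by simp
  then show "0 : ?S" by blast
 next
  fix u v assume "u : ?S" "v : ?S"
  then obtain x y where xy: "u - tcomb x bs : cspan U" "v - tcomb y bs : cspan U" by blast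
  have "(u + v) - tcomb (%k. x k + y k) bs = (u - tcomb x bs) + (v - tcomb y bs)"
   unfolding add[symmetric] by (rule add_diff_add)
  then have "(u + v) - tcomb (%k. x k + y k) bs : cspan U"
   using fs.subspace_add[OF cspan_subspace xy] by (simp only:)
  then show "u + v : ?S" by blast
 next
  fix c v assume "v : ?S"
  then obtain x where x: "v - tcomb x bs : cspan U" by blast
  have "sc c v - tcomb (%k. ptens 1 c * x k) bs = sc c (v - tcomb x bs)"
   unfolding scale[symmetric] by (rule fs.scale_right_diff_distrib[symmetric])
  then have "sc c v - tcomb (%k. ptens 1 c * x k) bs : cspan U"
   using fs.subspace_scale[OF cspan_subspace x] by (simp only:)
  then show "sc c v : ?S" by blast
 qed
 moreover have "cvec w : ?S" if w: "w : W" for w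
 proof -
  obtain es where es: "length es = length bs" "w - ecomb es bs : U" using bs w unfolding E_basis_iff by blast
  have "cvec (ecomb es bs) = tcomb (%k. ptens (es ! k) 1) bs"
   unfolding ecomb_def tcomb_def cvec_sum by (simp add: act_pure mapply_cmat_cvec fscale_simps)
  then have "cvec w - tcomb (%k. ptens (es ! k) 1) bs : cspan U"
   using cvec_in_cspan[OF es(2)] by (simp add: cvec_diff)
  then show ?thesis by blast
 qed
 ultimately show ?thesis using cspan_least[of ?S W] v by blast
qed

lemma E_matrix_iff:
 "E_matrix rho U g bs ds A \<longleftrightarrow> A : carrier_mat (length ds) (length bs) &
   (ALL j<length bs. ap g (cvec (bs ! j)) - tcomb (%i. A $$ (i, j)) ds : cspan U)"
 by (simp add: E_matrix_def tcomb_def)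

lemma tcomb_diff: "tcomb x bs - tcomb y bs = tcomb (%k. x k - y k) bs"
 unfolding tcomb_def sum_subtractf[symmetric] by (simp add: act_minus)

lemma E_matrix_unique:
 assumes "E_basis rho W U ds" "E_matrix rho U g bs ds A" "E_matrix rho U g bs ds A'"
 shows "A = A'"
proof (rule eq_matI)
 fix i j assume "i < dim_row A'" "j < dim_col A'"
 then have ij: "i < length ds" "j < length bs" using assms(3) by (auto simp: E_matrix_iff)
 let ?v = "ap g (cvec (bs ! j))"
 have "(?v - tcomb (%i. A' $$ (i, j)) ds) - (?v - tcomb (%i. A $$ (i, j)) ds) : cspan U"
  by (rule fs.subspace_diff[OF cspan_subspace]) (use assms(2,3) ij in \<open>auto simp: E_matrix_iff\<close>)
 then have "tcomb (%i. A $$ (i, j) - A' $$ (i, j)) ds : cspan U"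
  unfolding tcomb_diff[symmetric] by (simp add: algebra_simps)
 from tcomb_unique[OF assms(1) this ij(1)] show "A $$ (i, j) = A' $$ (i, j)" by simp
qed (use assms in \<open>auto simp: E_matrix_iff\<close>)

lemma E_matrix_exists:
 assumes "E_basis rho W U ds" "!!b. b : set bs ==> ap g (cvec b) : cspan W"
 shows "EX A. E_matrix rho U g bs ds A"
proof -
 have "EX x. ap g (cvec (bs ! j)) - tcomb x ds : cspan U" if "j < length bs" for j
  using tcomb_exists[OF assms(1) assms(2)] that by simp
 then have "ALL j. EX x. j < length bs --> ap g (cvec (bs ! j)) - tcomb x ds : cspan U" by blast
 from choice[OF this] obtain x where x: "ALL j. j < length bs --> ap g (cvec (bs ! j)) - tcomb (x j) ds : cspan U" ..
 have "tcomb (%i. mat (length ds) (length bs) (%(i, j). x j i) $$ (i, j)) ds = tcomb (x j) ds" if "j < length bs" for j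
  unfolding tcomb_def using that by (intro sum.cong) auto
 then show ?thesis using x
  by (intro exI[of _ "mat (length ds) (length bs) (%(i, j). x j i)"]) (simp add: E_matrix_iff)
qed

lemma E_matrix_one: "E_basis rho W U bs ==> E_matrix rho U (1\<^sub>m n) bs bs (1\<^sub>m (length bs))"
 unfolding E_matrix_iff
proof (intro conjI allI impI)
 fix j assume bs: "E_basis rho W U bs" and j: "j < length bs"
 have "bs ! j : csp {..<n}" using bs j W(2) nth_mem unfolding E_basis_def by blast
 then have cv: "cvec (bs ! j) : csp {..<n}" by (auto simp: coord_space_def cvec_def)
 have "tcomb (%i. 1\<^sub>m (length bs) $$ (i, j)) bs = (SUM k<length bs. if k = j then cvec (bs ! k) else 0)"
  unfolding tcomb_def using j act_one[OF cv] by (intro sum.cong) (auto simp: act_0)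
 then have "ap (1\<^sub>m n) (cvec (bs ! j)) - tcomb (%i. 1\<^sub>m (length bs) $$ (i, j)) bs = 0"
  using j mapply_one[OF cv] by simp
 then show "ap (1\<^sub>m n) (cvec (bs ! j)) - tcomb (%i. 1\<^sub>m (length bs) $$ (i, j)) bs : cspan U"
  using fs.subspace_0[OF cspan_subspace] by simp
qed simp

end

lemma add_assoc_imp_diff: "x = a + (b + c) ==> x - c = a + (b :: 'a::ab_group_add)"
 by (simp add: algebra_simps)

text \<open>The later relations between determinants come from this composition rule;
  \<open>hU\<close> makes \<open>h\<close> well defined on the quotients.\<close>

lemma E_matrix_mult:
 assumes "E_space B n rho W U" "E_space B n rho' W' U'"
  and g: "E_matrix rho U g bs ds A" "g : Mat n" and h: "E_matrix rho' U' h ds es A'" "h : Mat n"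
  and comm: "!!e. h * cmat (rho e) = cmat (rho' e) * h" and hU: "!!u. u : U ==> ap h (cvec u) : cspan U'"
 shows "E_matrix rho' U' (h * g) bs es (A' * A)"
proof -
 interpret a: E_space B n rho W U by fact
 interpret b: E_space B n rho' W' U' by fact
 have A: "A : carrier_mat (length ds) (length bs)" and A': "A' : carrier_mat (length es) (length ds)"
  using g(1) h(1) by (auto simp: E_matrix_def)
 have commute: "ap h (a.act x v) = b.act x (ap h v)" for x v
  by (rule tensor_act_commute[OF a.field_module_axioms b.field_module_axioms h(2) comm])
 show ?thesis
  unfolding b.E_matrix_iff
 proof (intro conjI allI impI mult_carrier_mat[OF A' A])
  fix j assume j: "j < length bs"
  define r where "r = ap g (cvec (bs ! j)) - a.tcomb (%i. A $$ (i, j)) ds"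
  have r: "r : cspan U" using g(1) j unfolding a.E_matrix_iff r_def by blast
  define q where "q i = ap h (cvec (ds ! i)) - b.tcomb (%k. A' $$ (k, i)) es" for i
  have q: "q i : cspan U'" if "i < length ds" for i using h(1) that unfolding b.E_matrix_iff q_def by blast
  have hr: "ap h r : cspan U'"
   by (rule flinear_cspan_image[OF mapply_flinear cspan_subspace hU r])
  have "ap (h * g) (cvec (bs ! j)) = ap h (r + a.tcomb (%i. A $$ (i, j)) ds)"
   using mapply_mult[OF h(2) g(2)] by (simp add: r_def)
  also have "... = ap h r + ap h (a.tcomb (%i. A $$ (i, j)) ds)"
   using mapply_flinear[of h] by (simp add: flinear_def)
  also have "ap h (a.tcomb (%i. A $$ (i, j)) ds) = (SUM i<length ds. b.act (A $$ (i, j)) (ap h (cvec (ds ! i))))"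
   unfolding a.tcomb_def flinear_sum[OF mapply_flinear] commute ..
  also have "... = (SUM i<length ds. b.act (A $$ (i, j)) (q i) + b.act (A $$ (i, j)) (b.tcomb (%k. A' $$ (k, i)) es))"
  proof (intro sum.cong HOL.refl)
   fix i
   have "ap h (cvec (ds ! i)) = q i + b.tcomb (%k. A' $$ (k, i)) es" by (simp add: q_def)
   then show "b.act (A $$ (i, j)) (ap h (cvec (ds ! i))) =
     b.act (A $$ (i, j)) (q i) + b.act (A $$ (i, j)) (b.tcomb (%k. A' $$ (k, i)) es)"
    using b.act_flinear[of "A $$ (i, j)"] by (simp add: flinear_def)
  qed
  also have "... = (SUM i<length ds. b.act (A $$ (i, j)) (q i)) +
    (SUM i<length ds. b.act (A $$ (i, j)) (b.tcomb (%k. A' $$ (k, i)) es))" by (rule sum.distrib)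
  also have "(SUM i<length ds. b.act (A $$ (i, j)) (b.tcomb (%k. A' $$ (k, i)) es)) = b.tcomb (%k. (A' * A) $$ (k, j)) es"
  proof -
   have "(SUM i<length ds. b.act (A $$ (i, j)) (b.tcomb (%k. A' $$ (k, i)) es)) =
     (SUM i<length ds. SUM k<length es. b.act (A' $$ (k, i) * A $$ (i, j)) (cvec (es ! k)))"
    unfolding b.tcomb_def flinear_sum[OF b.act_flinear] by (simp add: b.act_mult[symmetric] mult.commute)
   also have "... = (SUM k<length es. SUM i<length ds. b.act (A' $$ (k, i) * A $$ (i, j)) (cvec (es ! k)))"
    by (rule sum.swap)
   also have "... = b.tcomb (%k. (A' * A) $$ (k, j)) es"
    unfolding b.tcomb_def using mult_mat_entry[OF A' A _ j] by (intro sum.cong) (auto simp: b.act_sum simp del: index_mult_mat(1))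
   finally show ?thesis .
  qed
  finally have "ap (h * g) (cvec (bs ! j)) = ap h r + ((SUM i<length ds. b.act (A $$ (i, j)) (q i)) +
    b.tcomb (%k. (A' * A) $$ (k, j)) es)" .
  from add_assoc_imp_diff[OF this]
  have "ap (h * g) (cvec (bs ! j)) - b.tcomb (%k. (A' * A) $$ (k, j)) es =
    ap h r + (SUM i<length ds. b.act (A $$ (i, j)) (q i))" .
  also have "... : cspan U'"
   using q by (intro fs.subspace_add[OF cspan_subspace] hr fs.subspace_sum[OF cspan_subspace] b.act_cspan b.U(3)) auto
  finally show "ap (h * g) (cvec (bs ! j)) - b.tcomb (%k. (A' * A) $$ (k, j)) es : cspan U'" .
 qed
qed

context E_space
begin

text \<open>One basis is expressed in the other with coefficients in \<open>E\<close> itself, not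
  merely in \<open>E \<otimes> \<complex>\<close>, and conversely; hence the determinant comes from
  a nonzero element of \<open>E\<close>.\<close>

lemma E_matrix_base_change:
 assumes bs: "E_basis rho W U bs" and ds: "E_basis rho W U ds"
 shows "length bs = length ds & (EX P e. E_matrix rho U (1\<^sub>m n) bs ds P & e ~= 0 & mdet P = ptens e 1)"
proof -
 have rat: "EX P. P : carrier_mat (length ds) (length bs) & E_matrix rho U (1\<^sub>m n) bs ds (map_mat (%e. ptens e 1) P)"
  if bs: "E_basis rho W U bs" and ds: "E_basis rho W U ds" for bs ds
 proof -
  have bW: "bs ! j : W" if "j < length bs" for j using bs that nth_mem unfolding E_basis_def by blast
  have "EX es. j < length bs --> length es = length ds & bs ! j - ecomb es ds : U" for j
   using ds bW unfolding E_basis_iff by blast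
  then have "ALL j. EX es. j < length bs --> length es = length ds & bs ! j - ecomb es ds : U" ..
  from choice[OF this] obtain es where es: "ALL j. j < length bs --> length (es j) = length ds & bs ! j - ecomb (es j) ds : U" ..
  let ?P = "mat (length ds) (length bs) (%(i, j). es j ! i)"
  have "ap (1\<^sub>m n) (cvec (bs ! j)) - tcomb (%i. map_mat (%e. ptens e 1) ?P $$ (i, j)) ds : cspan U"
   if j: "j < length bs" for j
  proof -
   have "cvec (bs ! j) : csp {..<n}" using bW[OF j] W(2) by (force simp: coord_space_def cvec_def)
   then have 1: "ap (1\<^sub>m n) (cvec (bs ! j)) = cvec (bs ! j)" by (rule mapply_one)
   have "tcomb (%i. map_mat (%e. ptens e 1) ?P $$ (i, j)) ds = cvec (ecomb (es j) ds)"
    unfolding ecomb_def tcomb_def cvec_sum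
    using j by (intro sum.cong) (auto simp: act_pure mapply_cmat_cvec fscale_simps)
   then show ?thesis using es j cvec_in_cspan[of "bs ! j - ecomb (es j) ds" U] by (simp add: 1 cvec_diff)
  qed
  then show ?thesis by (intro exI[of _ ?P]) (simp add: E_matrix_iff)
 qed
 interpret pt: comm_ring_hom "%e :: 'e. ptens e (1 :: complex)"
  by unfold_locales (simp_all add: pure_tensor_simps)
 obtain P where P: "P : carrier_mat (length ds) (length bs)" "E_matrix rho U (1\<^sub>m n) bs ds (map_mat (%e. ptens e 1) P)"
  using rat[OF bs ds] by blast
 obtain Q where Q: "Q : carrier_mat (length bs) (length ds)" "E_matrix rho U (1\<^sub>m n) ds bs (map_mat (%e. ptens e 1) Q)"
  using rat[OF ds bs] by blast
 have self: "E_space B n rho W U" by unfold_locales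
 have comm: "1\<^sub>m n * cmat (rho e) = cmat (rho e) * 1\<^sub>m n" for e
  by (simp add: left_mult_one_mat[of _ n n] right_mult_one_mat[of _ n n])
 have stay: "ap (1\<^sub>m n) (cvec u) : cspan U" if "u : U" for u
 proof -
  have "cvec u : csp {..<n}" using that U(2) W(2) by (force simp: coord_space_def cvec_def)
  then show ?thesis using cvec_in_cspan[OF that] by (simp add: mapply_one)
 qed
 have inv: "X * Y = 1\<^sub>m (length cs)"
  if cs: "E_basis rho W U cs" "E_matrix rho U (1\<^sub>m n) cs fs Y" "E_matrix rho U (1\<^sub>m n) fs cs X" for cs fs X Y
 proof -
  have "E_matrix rho U (1\<^sub>m n * 1\<^sub>m n) cs cs (X * Y)"
   by (rule E_matrix_mult[OF self self that(2) _ that(3) _ comm stay]) auto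
  then have "E_matrix rho U (1\<^sub>m n) cs cs (X * Y)" by simp
  from E_matrix_unique[OF cs(1) this E_matrix_one[OF cs(1)]] show ?thesis .
 qed
 have QP: "map_mat (%e. ptens e (1 :: complex)) Q * map_mat (%e. ptens e 1) P = 1\<^sub>m (length bs)"
  by (rule inv[OF bs P(2) Q(2)])
 have PQ: "map_mat (%e. ptens e (1 :: complex)) P * map_mat (%e. ptens e 1) Q = 1\<^sub>m (length ds)"
  by (rule inv[OF ds Q(2) P(2)])
 have len: "length bs = length ds"
  using rectangular_inverse_le[OF _ _ QP, of "length ds"] rectangular_inverse_le[OF _ _ PQ, of "length bs"] P(1) Q(1)
  by simp
 have Pc: "P : carrier_mat (length ds) (length ds)" and Qc: "Q : carrier_mat (length ds) (length ds)"
  using P(1) Q(1) len by simp_all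
 have "ptens (mdet Q * mdet P) (1 :: complex) =
   ptens (mdet Q) 1 * ptens (mdet P) 1"
  by (simp only: pure_tensor_simps(4) mult_1)
 also have "... = mdet (map_mat (%e. ptens e (1 :: complex)) Q * map_mat (%e. ptens e 1) P)"
  using det_mult[of "map_mat (%e. ptens e (1 :: complex)) Q" "length ds" "map_mat (%e. ptens e 1) P"] Pc Qc
  by (simp only: pt.hom_det map_carrier_mat)
 also have "... = ptens 1 1" unfolding QP by (simp add: pure_tensor_simps(5))
 finally have "ptens (mdet Q * mdet P) (1 :: complex) = ptens 1 1" .
 then have "mdet Q * mdet P = 1" by (rule pure_tensor_inject)
 then have "mdet P ~= 0" by auto
 then show ?thesis using len P by (intro conjI exI[of _ "map_mat (%e. ptens e 1) P"] exI[of _ "mdet P"]) simp_all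
qed

end

section \<open>The Hodge decomposition\<close>

lemma subspace_preimage:
 assumes f: "flinear f" and S: "module.subspace sc S" and T: "module.subspace sc T"
 shows "module.subspace sc {v : T. f v : S}"
proof -
 have fa: "f (u + v) = f u + f v" "f (sc b u) = sc b (f u)" for u v b using f by (simp_all add: flinear_def)
 show ?thesis
  by (rule fs.subspaceI; unfold mem_Collect_eq flinear_0[OF f] fa)
   (intro conjI fs.subspace_0 fs.subspace_add fs.subspace_scale S T; elim conjE; assumption)+
qed

lemma mapply_mat_sum:
 assumes "!!i. i : I ==> A i : Mat n"
 shows "ap (mat n n (%ij. SUM i:I. x i * A i $$ ij)) v = (SUM i:I. sc (x i) (ap (A i) v :: nat => complex))"
proof
 fix k
 have "(SUM j<n. (SUM i:I. x i * A i $$ (k, j)) * v j) = (SUM i:I. SUM j<n. x i * (A i $$ (k, j) * v j))"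
  unfolding sum_distrib_right by (subst sum.swap) (simp add: mult.assoc)
 then show "ap (mat n n (%ij. SUM i:I. x i * A i $$ ij)) v k = (SUM i:I. sc (x i) (ap (A i) v)) k"
  unfolding fsum_apply fscale_def mapply_def using carrier_matD[OF assms]
  by (cases "k < n") (simp_all add: sum_distrib_left)
qed

locale bdr =
 fixes M :: "'e::field_char_0 bdr_system" and S :: mult_structure
 assumes number_field: "number_field TYPE('e)" and system: "bdr_system M"
  and structure_M: "multilinear_structure M S" and E_structure: "contains_E_structure M S"
  and middle: "even (weight M) ==> hodgeM M (weight M div 2) (weight M div 2) = {0}"
begin

abbreviation n where "n == dim M"
abbreviation w where "w == weight M"
abbreviation c where "c == cmp M"
abbreviation F where "F == frob M"
abbreviation Fc where "Fc == cmat (frob M)"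
abbreviation V where "V == (csp {..<n} :: (nat => complex) set)"

lemma actB: "field_action n (actB M)" and actdR: "field_action n (actdR M)"
 and F_carrier: "F : Mat n" and F_square: "F * F = 1\<^sub>m n"
 and F_actB: "F * actB M e = actB M e * F"
 and c_GL: "c : GL n" and c_act: "c * cmat (actB M e) = cmat (actdR M e) * c"
 using system by (auto simp: bdr_system_def)

lemma fil: "module.subspace sc (fil M p)" "fil M p <= csp {..<n}"
  "v : fil M p ==> ap (actdR M e) v : fil M p" "p <= q ==> fil M q <= fil M p"
proof -
 note sys = system[unfolded bdr_system_def]
 have *: "ALL p. module.subspace sc (fil M p) & fil M p <= csp {..<n} &
   (ALL e. ap (actdR M e) ` fil M p <= fil M p)"
  using sys by (elim conjE)
 have **: "ALL p q. p <= q --> fil M q <= fil M p" using sys by (elim conjE)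
 show "module.subspace sc (fil M p)" "fil M p <= csp {..<n}"
  using spec[OF *, of p] by simp_all
 have "ap (actdR M e) ` fil M p <= fil M p" using spec[OF *, of p] by (elim conjE allE[of _ e])
 then show "v : fil M p ==> ap (actdR M e) v : fil M p" by (rule subsetD[OF _ imageI])
 show "p <= q ==> fil M q <= fil M p" using spec[OF spec[OF **, of p], of q] by (rule mp)
qed

lemmas c_carrier = GL_minv[OF c_GL]

sublocale mB: field_module n "actB M"
 by unfold_locales (rule actB)
sublocale mdR: field_module n "actdR M"
 by unfold_locales (rule actdR)

lemma Fc_carrier [simp]: "Fc : Mat n"
 using F_carrier by simp

lemma Fc_square: "Fc * Fc = 1\<^sub>m n"
 using cmat_mult[OF F_carrier F_carrier] F_square cmat_one by metis

lemma Fc_GL: "Fc : GL n" "minv Fc = Fc"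
 using GL_I[OF Fc_carrier Fc_carrier Fc_square Fc_square] by auto

lemma F_GL: "F : GL n" "minv F = F"
 using GL_I[OF F_carrier F_carrier F_square F_square] by auto

lemma Fc_act: "Fc * cmat (actB M e) = cmat (actB M e) * Fc"
 using cmat_mult[OF F_carrier mB.rho_carrier, of e] cmat_mult[OF mB.rho_carrier F_carrier, of e] F_actB by simp

lemma mapply_Fc_Fc: "v : V ==> ap Fc (ap Fc v) = v"
 using mapply_mult[OF Fc_carrier Fc_carrier, of v] Fc_square mapply_one[of v n] by simp

lemma mapply_V: "A : Mat n ==> ap A v : V"
 by (rule mapply_coord_space)

lemma vconj_mapply: "vconj (ap A v) = ap (map_mat cnj A) (vconj v)"
 by (auto simp: vconj_def mapply_def)

text \<open>The reality condition on the comparison as an identity of matrices. It lets complex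
  conjugation be replaced by the linear map \<open>Fc\<close> in the description of the Hodge
  pieces.\<close>

lemma c_Fc: "c * Fc = map_mat cnj c"
proof (rule mat_eq_of_mapply[of _ n])
 fix v :: "nat => complex" assume v: "v : V"
 have "vconj v : V" using v by (auto simp: coord_space_def vconj_def)
 then have "ap c (ap Fc (vconj (vconj v))) = vconj (ap c (vconj v))"
  using system unfolding bdr_system_def by blast
 then show "ap (c * Fc) v = ap (map_mat cnj c) v"
  using mapply_mult[OF c_carrier(1) Fc_carrier, of v] by (simp add: vconj_mapply)
qed (use c_carrier Fc_carrier in auto)

definition FB :: "int => (nat => complex) set" where
 "FB p = {v : V. ap c v : cspan (fil M p)}"

lemma FB_subspace: "module.subspace sc (FB p)"
 unfolding FB_def by (rule subspace_preimage[OF mapply_flinear cspan_subspace coord_space_subspace])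

lemma FB_mono: "p <= q ==> FB q <= FB p"
 using cspan_mono[OF fil(4)] by (auto simp: FB_def)

lemma FB_act: "v : FB p ==> ap (cmat (actB M e)) v : FB p"
proof -
 assume v: "v : FB p"
 have "ap c (ap (cmat (actB M e)) v) = ap (cmat (actdR M e)) (ap c v)"
  using mapply_mult[OF c_carrier(1) cmat_carrier[OF mB.rho_carrier], of e v]
   mapply_mult[OF cmat_carrier[OF mdR.rho_carrier] c_carrier(1), of e v] c_act by simp
 also have "... : cspan (fil M p)"
  by (rule flinear_cspan_image[OF mapply_flinear cspan_subspace, where W="fil M p"])
   (use v fil(3) in \<open>auto simp: FB_def mapply_cmat_cvec cvec_in_cspan\<close>)
 finally show ?thesis by (simp add: FB_def mapply_V[OF cmat_carrier[OF mB.rho_carrier]])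
qed

lemma hodge_fil_eq: "hodge_fil (ap c) (csp {..<n}) (fil M) p = FB p"
 by (simp add: hodge_fil_def FB_def cspan_full)

text \<open>The de Rham filtration is rational, hence stable under conjugation, so the conjugate
  filtration is the image of the original one under the involution.\<close>

lemma vconj_FB: "v : vconj ` FB q \<longleftrightarrow> v : V & ap Fc v : FB q"
proof -
 have 1: "ap c (ap Fc v) = vconj (ap c (vconj v))" for v
  using mapply_mult[OF c_carrier(1) Fc_carrier, of v] by (simp add: c_Fc vconj_mapply)
 have cs: "vconj v : cspan (fil M q) \<longleftrightarrow> v : cspan (fil M q)" for v
  using vconj_cspan[OF _ fil(1,2), of v q] vconj_cspan[OF _ fil(1,2), of "vconj v" q] by auto
 have Vc: "vconj v : V \<longleftrightarrow> v : V" for v by (auto simp: coord_space_def vconj_def)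
 have "v : vconj ` FB q \<longleftrightarrow> vconj v : FB q" by (metis (no_types, lifting) imageE image_eqI vconj_vconj)
 also have "... \<longleftrightarrow> v : V & ap Fc v : FB q" by (simp add: FB_def 1 cs Vc mapply_V[OF Fc_carrier])
 finally show ?thesis .
qed

text \<open>The Hodge piece of type \<open>(p, w - p)\<close>, described by linear conditions
  only.\<close>

definition H :: "int => (nat => complex) set" where
 "H p = {v : FB p. ap Fc v : FB (w - p)}"

lemma H_eq: "hodgeM M p (w - p) = H p"
 unfolding hodgeM_def hodge_piece_def hodge_fil_eq H_def
proof (intro equalityI subsetI)
 fix v assume "v : FB p Int vconj ` FB (w - p)"
 then show "v : {v : FB p. ap Fc v : FB (w - p)}" using vconj_FB[of v "w - p"] by blast
next
 fix v assume "v : {v : FB p. ap Fc v : FB (w - p)}"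
 then have v: "v : FB p" "ap Fc v : FB (w - p)" by blast+
 then have "v : V" unfolding FB_def by blast
 then show "v : FB p Int vconj ` FB (w - p)" using vconj_FB[of v "w - p"] v by blast
qed

lemma H_V: "v : H p ==> v : V"
 by (simp add: H_def FB_def)

lemma H_subspace: "module.subspace sc (H p)"
 unfolding H_def by (rule subspace_preimage[OF mapply_flinear FB_subspace FB_subspace])

lemma H_Fc: "v : H p ==> ap Fc v : H (w - p)"
 using mapply_Fc_Fc[of v] H_V[of v p] by (simp add: H_def)

lemma H_act: "v : H p ==> ap (cmat (actB M e)) v : H p"
proof -
 assume v: "v : H p"
 have "ap Fc (ap (cmat (actB M e)) v) = ap (cmat (actB M e)) (ap Fc v)"
  using mapply_mult[OF Fc_carrier cmat_carrier[OF mB.rho_carrier], of e v]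
   mapply_mult[OF cmat_carrier[OF mB.rho_carrier] Fc_carrier, of e v] Fc_act by simp
 then show ?thesis using v FB_act by (simp add: H_def)
qed

definition decomp :: "(nat => complex) => (int => nat => complex) => bool" where
 "decomp v h \<longleftrightarrow> (ALL p. h p : H p) & finite {p. h p ~= 0} & v = (SUM p:{p. h p ~= 0}. h p)"

lemma decomp_ex1: "v : V ==> EX! h. decomp v h"
proof -
 assume v: "v : V"
 have "opposite_fil w (ap c) (csp {..<n}) (fil M)"
  using system by (simp add: bdr_system_def)
 then show ?thesis using v cspan_full[of "{..<n}"] H_eq
  unfolding opposite_fil_def decomp_def hodgeM_def by auto
qed

definition dec :: "(nat => complex) => int => nat => complex" where
 "dec v = (THE h. decomp v h)"

lemma decomp_dec: "v : V ==> decomp v (dec v)"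
 unfolding dec_def by (rule theI'[OF decomp_ex1])

lemma dec_H: "v : V ==> dec v p : H p"
 using decomp_dec by (simp add: decomp_def)

lemma dec_V: "v : V ==> dec v p : V"
 using dec_H H_V by blast

lemma decompI: "(!!p. h p : H p) ==> finite A ==> (!!p. p ~: A ==> h p = 0) ==> v = (SUM p:A. h p) ==> decomp v h"
 unfolding decomp_def by (auto intro: finite_subset[of _ A] intro!: sum.mono_neutral_right)

lemma dec_unique:
 assumes "v : V" "!!p. h p : H p" "finite A" "!!p. p ~: A ==> h p = 0" "v = (SUM p:A. h p)"
 shows "dec v = h"
 using decomp_ex1[OF assms(1)] decomp_dec[OF assms(1)] decompI[OF assms(2-5)] by blast

lemma dec_sum_superset:
 assumes "v : V" "finite A" "!!p. p ~: A ==> dec v p = 0"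
 shows "v = (SUM p:A. dec v p)"
proof -
 have "v = (SUM p:{p. dec v p ~= 0}. dec v p)" using decomp_dec[OF assms(1)] by (simp add: decomp_def)
 also have "... = (SUM p:A. dec v p)" using assms(2,3) by (intro sum.mono_neutral_left) auto
 finally show ?thesis .
qed

lemma finite_dec: "v : V ==> finite {p. dec v p ~= 0}"
 using decomp_dec by (simp add: decomp_def)

lemma dec_add: "u : V ==> v : V ==> dec (u + v) = (%p. dec u p + dec v p)"
proof (rule dec_unique[of _ _ "{p. dec u p ~= 0} Un {p. dec v p ~= 0}"])
 assume uv: "u : V" "v : V"
 show "u + v : V" by (rule fs.subspace_add[OF coord_space_subspace uv])
 show "dec u p + dec v p : H p" for p by (intro fs.subspace_add[OF H_subspace] dec_H uv)
 show fin: "finite ({p. dec u p ~= 0} Un {p. dec v p ~= 0})" using finite_dec uv by simp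
 have "u = (SUM p:{p. dec u p ~= 0} Un {p. dec v p ~= 0}. dec u p)" by (rule dec_sum_superset[OF uv(1) fin]) simp
 moreover have "v = (SUM p:{p. dec u p ~= 0} Un {p. dec v p ~= 0}. dec v p)" by (rule dec_sum_superset[OF uv(2) fin]) simp
 ultimately show "u + v = (SUM p:{p. dec u p ~= 0} Un {p. dec v p ~= 0}. dec u p + dec v p)"
  by (simp only: sum.distrib)
qed simp

text \<open>\<open>\<pi>\<close> is the identity for scalars and for the action of \<open>E\<close>,
  and the reflection taking \<open>p\<close> to \<open>w - p\<close> for the involution, which
  exchanges the pieces \<open>H p\<close> and \<open>H (w - p)\<close>.\<close>

lemma dec_map:
 assumes f: "flinear f" "!!p u. u : H p ==> f u : H (\<pi> p)" and \<pi>: "!!p. \<pi> (\<pi> p) = p" and v: "v : V"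
 shows "dec (f v) = (%p. f (dec v (\<pi> p)))"
proof (rule dec_unique[of _ _ "\<pi> ` {p. dec v p ~= 0}"])
 let ?A = "{p. dec v p ~= 0}"
 have "v = (SUM p:?A. dec v p)" using decomp_dec[OF v] by (simp add: decomp_def)
 then have fv: "f v = (SUM p:?A. f (dec v p))" by (metis flinear_sum[OF f(1)])
 then show "f v : V" using f(2)[OF dec_H[OF v]] H_V by (auto intro: fs.subspace_sum[OF coord_space_subspace])
 show "f (dec v (\<pi> p)) : H p" for p using f(2)[OF dec_H[OF v, of "\<pi> p"]] \<pi> by simp
 show "finite (\<pi> ` ?A)" using finite_dec[OF v] by simp
 show "f (dec v (\<pi> p)) = 0" if "p ~: \<pi> ` ?A" for p
 proof -
  have "dec v (\<pi> p) = 0" using that \<pi>[of p] by (metis (mono_tags, lifting) image_eqI mem_Collect_eq)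
  then show ?thesis by (simp only: flinear_0[OF f(1)])
 qed
 have "inj_on \<pi> ?A" by (metis \<pi> inj_onI)
 then show "f v = (SUM p:\<pi> ` ?A. f (dec v (\<pi> p)))" unfolding fv by (subst sum.reindex) (simp_all add: \<pi>)
qed

lemma dec_scale: "v : V ==> dec (sc a v) = (%p. sc a (dec v p))"
 by (rule dec_map[of "sc a" "%p. p"], simp add: flinear_def fscale_def fun_eq_iff algebra_simps)
  (erule fs.subspace_scale[OF H_subspace], rule HOL.refl)

lemma dec_single: "v : H p ==> dec v = (%q. if q = p then v else 0)"
 by (rule dec_unique[of _ _ "{p}"]) (auto intro: H_V fs.subspace_0[OF H_subspace])

lemma dec_Fc: "v : V ==> dec (ap Fc v) = (%p. ap Fc (dec v (w - p)))"
 by (rule dec_map[OF mapply_flinear H_Fc]) simp_all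

lemma dec_act: "v : V ==> dec (ap (cmat (actB M e)) v) = (%p. ap (cmat (actB M e)) (dec v p))"
 by (rule dec_map[OF mapply_flinear H_act]) simp_all

lemma FB_sum: "v : V ==> (!!p. p < a ==> dec v p = 0) ==> v : FB a"
proof -
 assume v: "v : V" and z: "!!p. p < a ==> dec v p = 0"
 have "dec v p : FB a" for p
 proof (cases "p < a")
  case True
  then show ?thesis using z fs.subspace_0[OF FB_subspace] by simp
 next
  case False
  then show ?thesis using dec_H[OF v, of p] FB_mono[of a p] by (auto simp: H_def)
 qed
 then have "(SUM p:{p. dec v p ~= 0}. dec v p) : FB a" by (intro fs.subspace_sum[OF FB_subspace])
 then show "v : FB a" using decomp_dec[OF v] by (simp add: decomp_def)
qed

text \<open>The top component below \<open>a\<close> of an element of \<open>FB a\<close> would lie in two consecutive pieces.\<close>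

lemma FB_dec: "v : FB a ==> p < a ==> dec v p = 0"
proof (rule ccontr)
 assume v: "v : FB a" and p: "p < a" and nz: "dec v p ~= 0"
 have vV: "v : V" using v by (simp add: FB_def)
 let ?A = "{p. dec v p ~= 0}"
 have fin: "finite ?A" by (rule finite_dec[OF vV])
 define L where "L = {q : ?A. q < a}"
 have L: "finite L" "L ~= {}" using fin p nz by (auto simp: L_def)
 define r where "r = Max L"
 have r: "r : L" "!!q. q : L ==> q <= r" using Max_in[OF L] Max_ge[OF L(1)] by (auto simp: r_def)
 \<comment> \<open>The part of \<open>v\<close> below \<open>a\<close>. It lies in
   \<open>FB a\<close> because \<open>v\<close> and its other components do, and its image under the
   involution lies in \<open>FB (w - r)\<close> because \<open>r\<close> is the largest index
   involved.\<close>
 define x where "x = (SUM q:L. dec v q)"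
 have xV: "x : V" unfolding x_def by (intro fs.subspace_sum[OF coord_space_subspace] dec_V vV)
 have "v = (SUM q:?A. dec v q)" using decomp_dec[OF vV] by (simp add: decomp_def)
 also have "?A = L Un (?A - L)" by (auto simp: L_def)
 also have "(SUM q:L Un (?A - L). dec v q) = x + (SUM q:?A - L. dec v q)"
  unfolding x_def using fin L by (intro sum.union_disjoint) auto
 finally have "x = v - (SUM q:?A - L. dec v q)" by (metis add_diff_cancel_right')
 moreover have "(SUM q:?A - L. dec v q) : FB a"
 proof (intro fs.subspace_sum[OF FB_subspace])
  fix q assume "q : ?A - L"
  then have "a <= q" by (auto simp: L_def)
  then show "dec v q : FB a" using dec_H[OF vV, of q] FB_mono[of a q] by (auto simp: H_def)
 qed
 ultimately have xa: "x : FB a" using fs.subspace_diff[OF FB_subspace v] by (simp only:)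
 have Fx: "ap Fc x = (SUM q:L. ap Fc (dec v q))" unfolding x_def by (rule flinear_sum[OF mapply_flinear])
 have FL: "ap Fc (dec v q) : FB (w - r)" if "q : L" for q
  using dec_H[OF vV, of q] r(2)[OF that] FB_mono[of "w - r" "w - q"] by (auto simp: H_def)
 have xF: "ap Fc x : FB (w - r)" unfolding Fx by (rule fs.subspace_sum[OF FB_subspace FL])
 have ra: "r < a" using r(1) by (simp add: L_def)
 have "x : H r" using xa xF ra FB_mono[of r a] by (auto simp: H_def)
 moreover have "x : H (r + 1)" using xa xF ra FB_mono[of "r + 1" a] FB_mono[of "w - (r + 1)" "w - r"] by (auto simp: H_def)
 ultimately have "(%q. if q = r then x else 0) = (%q. if q = r + 1 then x else 0)" using dec_single by metis
 from fun_cong[OF this, of r] have x0: "x = 0" by simp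
 have "dec x = (%q. if q : L then dec v q else 0)"
  by (rule dec_unique[OF xV, of _ L])
   (use L dec_H[OF vV] fs.subspace_0[OF H_subspace] in \<open>auto simp: x_def intro: sum.cong\<close>)
 moreover have "dec x = (%q. if q = r then x else 0)" using dec_single \<open>x : H r\<close> by blast
 ultimately have "dec v r = x" using r(1) by (metis (full_types))
 then show False using x0 r(1) by (simp add: L_def)
qed

section \<open>The Hodge cocharacter\<close>

definition Pm :: "int => complex mat" where
 "Pm p = (SOME A. A : Mat n & (ALL v:V. ap A v = dec v p))"

lemma Pm: "Pm p : Mat n" "v : V ==> ap (Pm p) v = dec v p"
proof -
 have "EX A:Mat n. ALL v:V. ap A v = dec v p"
  by (rule matrix_of_flinear) (simp_all only: dec_add dec_scale dec_V)
 then have "EX A. A : Mat n & (ALL v:V. ap A v = dec v p)" by blast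
 from someI_ex[OF this] show "Pm p : Mat n" "v : V ==> ap (Pm p) v = dec v p"
  unfolding Pm_def by blast+
qed

text \<open>A finite set containing all Hodge indices, read off from the unit vectors and made
  symmetric under \<open>p \<mapsto> w - p\<close> for the reindexing in
  \<open>mu_Fc\<close>.\<close>

definition PS :: "int set" where
 "PS = (let A = (\<Union>j<n. {p. dec (%i. if i = j then 1 else 0) p ~= 0}) in A Un (%p. w - p) ` A)"

lemma unit_V: "j < n ==> (%i. if i = j then 1 else 0) : V"
 by (auto simp: coord_space_def)

lemma finite_PS: "finite PS"
 unfolding PS_def Let_def using finite_dec[OF unit_V] by auto

lemma PS_sym: "p : PS ==> w - p : PS"
 unfolding PS_def Let_def by force

lemma dec_PS: "v : V ==> p ~: PS ==> dec v p = 0"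
proof -
 assume v: "v : V" and p: "p ~: PS"
 have "ap (Pm p) (%i. if i = j then 1 else 0) = 0" if "j < n" for j
  using p that Pm(2)[OF unit_V[OF that]] by (auto simp: PS_def Let_def)
 then have "ap (Pm p) (SUM j<n. sc (v j) (%i. if i = j then 1 else 0)) = 0"
  using mapply_flinear[of "Pm p"] by (simp add: flinear_sum[OF mapply_flinear]) (simp add: flinear_def fscale_simps)
 then show ?thesis using coord_space_decomp[OF _ v] Pm(2)[OF v] by simp
qed

lemma dec_sum: "v : V ==> v = (SUM p:PS. dec v p)"
 by (rule dec_sum_superset) (auto simp: finite_PS dec_PS)

text \<open>The Hodge cocharacter: multiplication by \<open>t powi p\<close> on
  \<open>H p\<close>.\<close>

definition mu :: "complex => complex mat" where
 "mu t = mat n n (%ij. SUM p:PS. t powi p * Pm p $$ ij)"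

lemma mu_carrier [simp]: "mu t : Mat n"
 by (simp add: mu_def)

lemma mapply_mu: "v : V ==> ap (mu t) v = (SUM p:PS. sc (t powi p) (dec v p))"
 unfolding mu_def mapply_mat_sum[OF Pm(1)] by (simp add: Pm(2))

lemma dec_mu: "v : V ==> dec (ap (mu t) v) = (%p. if p : PS then sc (t powi p) (dec v p) else 0)"
proof (rule dec_unique[of _ _ PS])
 assume v: "v : V"
 show "ap (mu t) v : V" by (rule mapply_V) simp
 show "(if p : PS then sc (t powi p) (dec v p) else 0) : H p" for p
  using fs.subspace_scale[OF H_subspace dec_H[OF v]] fs.subspace_0[OF H_subspace] by simp
 show "ap (mu t) v = (SUM p:PS. if p : PS then sc (t powi p) (dec v p) else 0)"
  unfolding mapply_mu[OF v] by (rule sum.cong) auto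
qed (auto simp: finite_PS)

lemma mu_mult: "t ~= 0 ==> s ~= 0 ==> mu t * mu s = mu (t * s)"
proof (rule mat_eq_of_mapply[of _ n])
 fix v :: "nat => complex" assume ts: "t ~= 0" "s ~= 0" and v: "v : V"
 have "ap (mu t * mu s) v = ap (mu t) (ap (mu s) v)" by (rule mapply_mult[OF mu_carrier mu_carrier])
 also have "... = (SUM p:PS. sc (t powi p) (if p : PS then sc (s powi p) (dec v p) else 0))"
  unfolding mapply_mu[OF mapply_V[OF mu_carrier]] dec_mu[OF v] ..
 also have "... = (SUM p:PS. sc ((t * s) powi p) (dec v p))"
  by (intro sum.cong) (auto simp: fscale_def power_int_mult_distrib)
 finally show "ap (mu t * mu s) v = ap (mu (t * s)) v" unfolding mapply_mu[OF v] .
qed (auto intro: mult_carrier_mat[OF mu_carrier mu_carrier])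

lemma mu_one: "mu 1 = 1\<^sub>m n"
proof (rule mat_eq_of_mapply[of _ n])
 fix v :: "nat => complex" assume v: "v : V"
 show "ap (mu 1) v = ap (1\<^sub>m n) v"
  unfolding mapply_mu[OF v] mapply_one[OF v] by (simp add: fscale_simps dec_sum[OF v, symmetric])
qed auto

lemma mu_GL: "t ~= 0 ==> mu t : GL n & minv (mu t) = mu (inverse t)"
 using GL_I[of "mu t" n "mu (inverse t)"] mu_mult[of t "inverse t"] mu_mult[of "inverse t" t] mu_one by simp

text \<open>The involution exchanges \<open>H p\<close> and \<open>H (w - p)\<close>, so it changes
  the exponent \<open>p\<close> into \<open>w - p\<close>.\<close>

lemma mu_Fc: "t ~= 0 ==> mu t * Fc = Fc * ((t powi w) \<cdot>\<^sub>m mu (inverse t))"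
proof (rule mat_eq_of_mapply[of _ n])
 fix v :: "nat => complex" assume t: "t ~= 0" and v: "v : V"
 have "ap (mu t * Fc) v = ap (mu t) (ap Fc v)" by (rule mapply_mult[OF mu_carrier Fc_carrier])
 also have "... = (SUM p:PS. sc (t powi p) (ap Fc (dec v (w - p))))"
  unfolding mapply_mu[OF mapply_V[OF Fc_carrier]] dec_Fc[OF v] ..
 also have "... = (SUM p:PS. sc (t powi (w - p)) (ap Fc (dec v p)))"
  by (rule sum.reindex_bij_witness[of _ "%p. w - p" "%p. w - p"]) (auto intro: PS_sym)
 also have "... = ap Fc (SUM p:PS. sc (t powi (w - p)) (dec v p))"
  using mapply_flinear[of Fc] by (simp add: flinear_sum[OF mapply_flinear]) (simp add: flinear_def)
 also have "(SUM p:PS. sc (t powi (w - p)) (dec v p)) = sc (t powi w) (ap (mu (inverse t)) v)"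
  unfolding mapply_mu[OF v] fs.scale_sum_right
  using t by (intro sum.cong) (auto simp: fscale_def power_int_diff power_int_inverse divide_inverse)
 also have "ap Fc ... = ap (Fc * ((t powi w) \<cdot>\<^sub>m mu (inverse t))) v"
  unfolding mapply_smult[symmetric] by (rule mapply_mult[symmetric, OF Fc_carrier smult_carrier_mat[OF mu_carrier]])
 finally show "ap (mu t * Fc) v = ap (Fc * ((t powi w) \<cdot>\<^sub>m mu (inverse t))) v" .
qed (auto intro: mult_carrier_mat[OF mu_carrier Fc_carrier] mult_carrier_mat[OF Fc_carrier smult_carrier_mat[OF mu_carrier]])

end

section \<open>The Hodge cocharacter lies in the structure group\<close>

text \<open>Off 0 the function is a Laurent polynomial of order at least \<open>k\<close> at 0. The
  value at 0 is left free, because \<open>powi\<close> takes a default value there.\<close>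

definition pord :: "int => (complex => complex) => bool" where
 "pord k f \<longleftrightarrow> (EX P. ALL t. t ~= 0 --> f t = t powi k * poly P t)"

lemma pord_0: "pord k (%_. 0)"
 unfolding pord_def by (rule exI[of _ 0]) simp

lemma pord_add: "pord k f ==> pord k g ==> pord k (%t. f t + g t)"
 unfolding pord_def
proof (elim exE)
 fix P Q assume "ALL t. t ~= 0 --> f t = t powi k * poly P t" "ALL t. t ~= 0 --> g t = t powi k * poly Q t"
 then show "EX P. ALL t. t ~= 0 --> f t + g t = t powi k * poly P t"
  by (intro exI[of _ "P + Q"]) (simp add: algebra_simps)
qed

lemma pord_sum: "(!!i. i : I ==> pord k (f i)) ==> pord k (%t. SUM i:I. f i t)"
 by (induction I rule: infinite_finite_induct) (simp_all add: pord_0 pord_add)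

lemma pord_mult: "pord k f ==> pord l g ==> pord (k + l) (%t. f t * g t)"
 unfolding pord_def
proof (elim exE)
 fix P Q assume "ALL t. t ~= 0 --> f t = t powi k * poly P t" "ALL t. t ~= 0 --> g t = t powi l * poly Q t"
 then show "EX P. ALL t. t ~= 0 --> f t * g t = t powi (k + l) * poly P t"
  by (intro exI[of _ "P * Q"]) (simp add: power_int_add)
qed

lemma pord_const: "pord 0 (%_. a)"
 unfolding pord_def by (rule exI[of _ "[:a:]"]) simp

lemma pord_cmult: "pord k f ==> pord k (%t. a * f t)"
 using pord_mult[OF pord_const[of a], of k f] by simp

lemma pord_powi: "pord k (%t. t powi k)"
 unfolding pord_def by (rule exI[of _ 1]) simp

lemma pord_mono: "pord l f ==> k <= l ==> pord k f"
 unfolding pord_def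
proof (elim exE)
 fix P assume kl: "k <= l" and P: "ALL t. t ~= 0 --> f t = t powi l * poly P t"
 have "t powi l = t powi k * t ^ nat (l - k)" if "t ~= 0" for t :: complex
 proof -
  have "k + int (nat (l - k)) = l" using kl by simp
  then have "t powi l = t powi (k + int (nat (l - k)))" by simp
  also have "... = t powi k * t ^ nat (l - k)" using that by (simp only: power_int_add power_int_of_nat simp_thms)
  finally show ?thesis .
 qed
 with P show "EX P. ALL t. t ~= 0 --> f t = t powi k * poly P t"
  by (intro exI[of _ "monom 1 (nat (l - k)) * P"]) (simp add: poly_monom)
qed

lemma pord_prod: "(!!k. k < r ==> pord (a k) (f k)) ==> pord (SUM k<r. a k) (%t. PROD k<(r::nat). f k t)"
 by (induction r) (simp_all add: pord_const pord_mult)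

text \<open>Comparing orders of growth at 0 and at infinity leaves a single power.\<close>

lemma pord_both:
 assumes "pord p f" "pord (- p) (%t. f (inverse t))" "t ~= 0"
 shows "f t = t powi p * f 1"
proof -
 obtain P where P: "!!t. t ~= 0 ==> f t = t powi p * poly P t" using assms(1) unfolding pord_def by auto
 obtain Q where Q: "!!t. t ~= 0 ==> f (inverse t) = t powi (- p) * poly Q t" using assms(2) unfolding pord_def by auto
 have PQ: "poly P (inverse t) = poly Q t" if "t ~= 0" for t
  using P[of "inverse t"] Q[OF that] that by (simp add: power_int_inverse power_int_minus)
 \<comment> \<open>As \<open>poly P (inverse t) = poly Q t\<close>, the reflected polynomial is
   \<open>Q\<close> times a power of the variable with the degree of \<open>P\<close> as exponent.
   If this degree were positive, its constant term, the leading coefficient of \<open>P\<close>,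
   would be 0.\<close>
 let ?R = "reflect_poly P - monom 1 (degree P) * Q"
 have "poly ?R t = 0" if "t ~= 0" for t
  using PQ[OF that] poly_reflect_poly_nz[OF that, of P] by (simp add: poly_monom)
 then have "UNIV - {0} <= {t. poly ?R t = 0}" by auto
 moreover have "infinite (UNIV - {0 :: complex})" by (simp add: infinite_UNIV_char_0)
 ultimately have "?R = 0" using poly_roots_finite[of ?R] finite_subset by blast
 then have R: "reflect_poly P = monom 1 (degree P) * Q" by simp
 have "degree P = 0"
 proof (rule ccontr)
  assume d: "degree P ~= 0"
  then have "lead_coeff P = 0" using arg_cong[OF R, of "%R. coeff R 0"] by (simp add: coeff_monom_mult)
  then show False using d by auto
 qed
 then have "poly P t = poly P 1" by (auto elim: degree_eq_zeroE)
 then show ?thesis using P[OF assms(3)] P[of 1] by simp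
qed

lemma tens_fil_coord_space:
 assumes "!!p. fil M p <= csp {..<dim M}"
 shows "tens_fil M rs p <= csp (tens_idx (dim M) rs)"
 unfolding tens_fil_def
proof (rule fs.span_minimal[OF _ coord_space_subspace], rule subsetI)
 fix x :: "tidx => rat"
 assume "x : {pure_tens vs ls | vs ls as bs. length vs = fst rs & length ls = snd rs &
    list_all2 (%a v. v : fil M a) as vs & list_all2 (%b l. l : dual_fil M b) bs ls &
    sum_list as + sum_list bs >= p}"
 then obtain vs ls as bs where x: "x = pure_tens vs ls" "length vs = fst rs" "length ls = snd rs"
  "list_all2 (%a v. v : fil M a) as vs" "list_all2 (%b l. l : dual_fil M b) bs ls" by auto
 have vs: "vs ! k : csp {..<dim M}" if "k < length vs" for k
  using list_all2_nthD2[OF x(4) that] assms by blast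
 have ls: "ls ! k : csp {..<dim M}" if "k < length ls" for k
  using list_all2_nthD2[OF x(5) that] by (simp add: dual_fil_def)
 show "x : csp (tens_idx (dim M) rs)" unfolding coord_space_def mem_Collect_eq
 proof (intro allI impI)
  fix I :: tidx assume I: "I ~: tens_idx (dim M) rs"
  obtain ks js where II: "I = (ks, js)" by (cases I)
  show "x I = 0"
  proof (cases "length ks = length vs & length js = length ls")
   case True
   then have "(EX k<length vs. ~ ks ! k < dim M) \<or> (EX k<length ls. ~ js ! k < dim M)"
    using I x(2,3) unfolding II tens_idx_def idx_lists_def by (auto simp: in_set_conv_nth subset_iff)
   then have "(EX k<length vs. (vs ! k) (ks ! k) = 0) \<or> (EX k<length ls. (ls ! k) (js ! k) = 0)"
    using coord_spaceD[OF vs] coord_spaceD[OF ls] by blast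
   then show ?thesis unfolding x(1) II pure_tens_def by auto
  qed (auto simp: x(1) II pure_tens_def)
 qed
qed

lemma smult_zero_mat: "A : carrier_mat n m ==> (0 :: rat) \<cdot>\<^sub>m A = 0\<^sub>m n m"
 by auto

lemma cmat_zero: "cmat (0\<^sub>m n m) = 0\<^sub>m n m"
 by auto

lemma cvec_pure_tens: "cvec (pure_tens vs ls) = pure_tens (map cvec vs) (map cvec ls)"
 by (auto simp: fun_eq_iff cvec_def pure_tens_def of_rat_mult of_rat_prod)

lemma vconj_tact2:
 assumes "g : Mat n" "h : Mat n"
 shows "tact2 n (map_mat cnj g) (map_mat cnj h) (vconj x) = vconj (tact2 n g h x)"
 unfolding vconj_def by (rule tact2_hom_on[OF hom_on_cnj subring_UNIV]) (use assms in auto)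

context bdr
begin

lemma pord_FB:
 assumes v: "v : FB a"
 shows "pord a (%t. ap (mu t) v i)"
proof -
 have vV: "v : V" using v by (simp add: FB_def)
 have "pord a (%t. SUM p:PS. dec v p i * t powi p)"
 proof (rule pord_sum)
  fix p
  show "pord a (%t. dec v p i * t powi p)"
  proof (cases "p < a")
   case True
   then show ?thesis using FB_dec[OF v] pord_0 by simp
  next
   case False
   then show ?thesis by (intro pord_cmult pord_mono[OF pord_powi]) simp
  qed
 qed
 then show ?thesis by (simp add: mapply_mu[OF vV] fsum_apply fscale_def mult.commute)
qed

text \<open>A form killing \<open>FB (1 - b)\<close> sees only components of degree at most
  \<open>- b\<close>, on which the inverse cocharacter has exponent at least
  \<open>b\<close>.\<close>

lemma pord_dual:
 assumes l: "!!u. u : FB (1 - b) ==> (SUM i<n. l i * u i) = 0"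
 shows "pord b (%t. ap (transpose_mat (mu (inverse t))) l j)"
proof (cases "j < n")
 case True
 let ?e = "%i. if i = j then 1 else 0 :: complex"
 have eq: "ap (transpose_mat (mu (inverse t))) l j = (SUM p:PS. (SUM i<n. l i * dec ?e p i) * inverse t powi p)" for t
 proof -
  have "ap (transpose_mat (mu (inverse t))) l j = (SUM i<n. l i * ap (mu (inverse t)) ?e i)"
   using True carrier_matD[OF mu_carrier, of "inverse t"]
   by (simp add: mapply_def[of "transpose_mat _"] mapply_unit[OF mu_carrier True] mult.commute)
  also have "... = (SUM i<n. SUM p:PS. l i * dec ?e p i * inverse t powi p)"
   by (simp add: mapply_mu[OF unit_V[OF True]] fsum_apply fscale_def sum_distrib_left mult_ac)
  also have "... = (SUM p:PS. (SUM i<n. l i * dec ?e p i) * inverse t powi p)"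
   by (subst sum.swap) (simp add: sum_distrib_right)
  finally show ?thesis .
 qed
 have "pord b (%t. SUM p:PS. (SUM i<n. l i * dec ?e p i) * inverse t powi p)"
 proof (rule pord_sum)
  fix p
  show "pord b (%t. (SUM i<n. l i * dec ?e p i) * inverse t powi p)"
  proof (cases "1 - b <= p")
   case True
   have "dec ?e p : FB (1 - b)" using dec_H[OF unit_V[OF \<open>j < n\<close>], of p] FB_mono[OF True] by (auto simp: H_def)
   then show ?thesis using l pord_0 by simp
  next
   case False
   then show ?thesis
    using pord_mono[OF pord_powi, of b "- p"] by (intro pord_cmult) (simp add: power_int_minus power_int_inverse)
  qed
 qed
 then show ?thesis by (simp only: eq)
next
 case False
 then show ?thesis using pord_0 carrier_matD[OF mu_carrier] by (simp add: mapply_def)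
qed

lemma FB_minv: "v : cspan (fil M a) ==> ap (minv c) v : FB a"
proof -
 assume v: "v : cspan (fil M a)"
 then have "v : V" using cspan_coord_space[OF fil(2)] by blast
 then have "ap c (ap (minv c) v) = v"
  using mapply_mult[OF c_carrier(1,2), of v] unfolding c_carrier(3) by (simp add: mapply_one)
 then show ?thesis using v mapply_V[OF c_carrier(2)] by (simp add: FB_def)
qed

text \<open>The orders of the factors add up, and the definition of the tensor filtration bounds
  their sum from below. The matrix \<open>minv c\<close> first brings the de Rham tensor back to the
  Betti side.\<close>

lemma pord_tens_fil_pure:
 assumes "length vs = r" "length ls = s" "list_all2 (%a v. v : fil M a) as vs" "list_all2 (%b l. l : dual_fil M b) bs ls"
  "sum_list as + sum_list bs >= k"
 shows "pord k (%t. tact2 n (mu t * minv c) (c * mu (inverse t)) (cvec (pure_tens vs ls)) I)"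
proof -
 obtain ks js where I: "I = (ks, js)" by (cases I)
 have eq: "tact2 n (mu t * minv c) (c * mu (inverse t)) (cvec (pure_tens vs ls)) I =
   (if length ks = r & length js = s then
    (PROD k<r. ap (mu t) (ap (minv c) (cvec (vs ! k))) (ks ! k)) *
    (PROD k<s. ap (transpose_mat (mu (inverse t))) (ap (transpose_mat c) (cvec (ls ! k))) (js ! k)) else 0)" for t
  unfolding cvec_pure_tens tact2_pure_tens[OF mult_carrier_mat[OF mu_carrier c_carrier(2)] mult_carrier_mat[OF c_carrier(1) mu_carrier]]
  using assms(1,2)
  by (simp add: I pure_tens_def mapply_mult[OF mu_carrier c_carrier(2)] transpose_mult[OF c_carrier(1) mu_carrier]
    mapply_mult[OF transpose_carrier_mat[THEN iffD2, OF mu_carrier] transpose_carrier_mat[THEN iffD2, OF c_carrier(1)]])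
 have 1: "pord (as ! k) (%t. ap (mu t) (ap (minv c) (cvec (vs ! k))) i)" if "k < r" for k i
  using list_all2_nthD2[OF assms(3)] that assms(1) by (intro pord_FB FB_minv cvec_in_cspan) simp
 have 2: "pord (bs ! k) (%t. ap (transpose_mat (mu (inverse t))) (ap (transpose_mat c) (cvec (ls ! k))) j)" if "k < s" for k j
 proof (rule pord_dual)
  \<comment> \<open>The transpose of \<open>c\<close> carries the form to the Betti side: it kills
    \<open>FB (1 - bs ! k)\<close> because \<open>c\<close> maps that space into the filtration step
    killed by the form.\<close>
  fix u assume u: "u : FB (1 - bs ! k)"
  let ?l = "ls ! k"
  have l: "?l : dual_fil M (bs ! k)" using list_all2_nthD2[OF assms(4)] that assms(2) by simp
  define f where "f = (%v (_::unit). SUM i<n. cvec ?l i * v i :: complex)"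
  have fl: "flinear f" unfolding flinear_def f_def
   by (auto simp: fun_eq_iff fscale_def algebra_simps sum.distrib sum_distrib_left)
  have cu: "ap c u : cspan (fil M (1 - bs ! k))" using u by (simp add: FB_def)
  have "f (cvec x) : {0}" if "x : fil M (1 - bs ! k)" for x
  proof -
   have "(SUM i<n. ?l i * x i) = 0" using l that by (simp add: dual_fil_def)
   then have "(SUM i<n. cvec ?l i * cvec x i) = of_rat 0" by (simp add: cvec_def of_rat_mult[symmetric] of_rat_sum[symmetric] del: of_rat_0)
   then show ?thesis by (simp add: f_def fun_eq_iff)
  qed
  from flinear_cspan_image[OF fl fs.subspace_single_0 this cu] have "f (ap c u) : {0}" .
  then have "(SUM i<n. cvec ?l i * ap c u i) = 0" by (simp add: f_def fun_eq_iff)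
  moreover have "(SUM i<n. cvec ?l i * ap c u i) = (SUM i<n. SUM j<n. c $$ (i, j) * cvec ?l i * u j)"
   using carrier_matD[OF c_carrier(1)] by (simp add: mapply_def sum_distrib_left mult_ac)
  moreover have "(SUM j<n. ap (transpose_mat c) (cvec ?l) j * u j) = (SUM j<n. SUM i<n. c $$ (i, j) * cvec ?l i * u j)"
   using carrier_matD[OF c_carrier(1)] by (simp add: mapply_def sum_distrib_right)
  ultimately show "(SUM j<n. ap (transpose_mat c) (cvec ?l) j * u j) = 0"
   using sum.swap[of "%i j. c $$ (i, j) * cvec ?l i * u j" "{..<n}" "{..<n}"] by simp
 qed
 have "sum_list as = (SUM k<r. as ! k)" "sum_list bs = (SUM k<s. bs ! k)"
  using list_all2_lengthD[OF assms(3)] list_all2_lengthD[OF assms(4)] assms(1,2)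
  by (simp_all add: sum_list_sum_nth atLeast0LessThan)
 then have le: "k <= (SUM k<r. as ! k) + (SUM k<s. bs ! k)" using assms(5) by simp
 show ?thesis
 proof (cases "length ks = r & length js = s")
  case True
  then show ?thesis unfolding eq by (simp only: True if_True simp_thms) (intro pord_mono[OF pord_mult[OF pord_prod pord_prod] le] 1 2)
 next
  case False
  then show ?thesis unfolding eq using pord_0 by (simp only: if_False)
 qed
qed

lemma pord_tens_fil:
 assumes "x : cspan (tens_fil M (r, s) k)"
 shows "pord k (%t. tact2 n (mu t * minv c) (c * mu (inverse t)) x I)"
proof -
 let ?f = "%t. tact2 n (mu t * minv c) (c * mu (inverse t))"
 let ?S = "{x. pord k (%t. ?f t x I)}"
 have lin: "?f t 0 = 0" "?f t (u + v) = ?f t u + ?f t v" "?f t (sc a u) = sc a (?f t u)" for t u v a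
  using flinear_0[OF tact2_flinear] tact2_flinear[of n "mu t * minv c" "c * mu (inverse t)"] unfolding flinear_def by blast+
 have S: "module.subspace sc ?S"
 proof (rule fs.subspaceI)
  show "0 : ?S" by (simp only: mem_Collect_eq lin zero_fun_apply pord_0)
 next
  fix u v assume "u : ?S" "v : ?S"
  then show "u + v : ?S" by (simp only: mem_Collect_eq lin plus_fun_apply pord_add)
 next
  fix a u assume "u : ?S"
  then have "pord k (%t. a * ?f t u I)" by (intro pord_cmult) simp
  then show "sc a u : ?S" unfolding mem_Collect_eq lin by (simp only: fscale_def)
 qed
 have "cvec x : ?S" if "x : tens_fil M (r, s) k" for x
  using that unfolding tens_fil_def
 proof (induction rule: fs.span_induct)
  show "module.subspace sc {x. cvec x : ?S}"
   using fs.subspace_0[OF S] fs.subspace_add[OF S] fs.subspace_scale[OF S]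
   by (intro fs.subspaceI) (simp_all only: mem_Collect_eq cvec_0 cvec_add cvec_fscale)
 next
  fix x :: "tidx => rat"
  assume "x : {pure_tens vs ls | vs ls as bs. length vs = fst (r, s) & length ls = snd (r, s) &
    list_all2 (%a v. v : fil M a) as vs & list_all2 (%b l. l : dual_fil M b) bs ls &
    sum_list as + sum_list bs >= k}"
  then obtain vs ls as bs where x: "x = pure_tens vs ls" "length vs = r" "length ls = s"
   "list_all2 (%a v. v : fil M a) as vs" "list_all2 (%b l. l : dual_fil M b) bs ls" "sum_list as + sum_list bs >= k"
   by auto
  show "cvec x : ?S" unfolding x(1) mem_Collect_eq by (rule pord_tens_fil_pure[OF x(2-6)])
 qed
 then show ?thesis using cspan_least[OF S] assms by blast
qed

text \<open>The two membership conditions say that \<open>y\<close> has Hodge type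
  \<open>(p, k - p)\<close>, with \<open>k\<close> the weight. The first bounds the order of growth
  at 0, the second, through the involution, the order at infinity.\<close>

lemma tact2_mu:
 assumes y: "y : csp (tens_idx n (r, s))"
  and p: "tact2 n c (minv c) y : cspan (tens_fil M (r, s) p)"
  and q: "tact2 n c (minv c) (tact2 n Fc Fc y) : cspan (tens_fil M (r, s) (tens_weight M (r, s) - p))"
  and t: "t ~= 0"
 shows "tact2 n (mu t) (mu (inverse t)) y = sc (t powi p) y"
proof -
 define k where "k = tens_weight M (r, s)"
 define f where "f = (%t. tact2 n (mu t) (mu (inverse t)) y)"
 define z where "z = tact2 n Fc Fc y"
 have cz: "tact2 n (mu t * minv c) (c * mu (inverse t)) (tact2 n c (minv c) x) = tact2 n (mu t) (mu (inverse t)) x" for t x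
 proof -
  have "mu t * minv c * c = mu t" "minv c * (c * mu (inverse t)) = mu (inverse t)"
   using c_carrier(3,4) assoc_mult_mat[OF mu_carrier c_carrier(2,1)] assoc_mult_mat[OF c_carrier(2,1) mu_carrier, symmetric]
   by (simp_all add: right_mult_one_mat[OF mu_carrier] left_mult_one_mat[OF mu_carrier])
  then show ?thesis
   using tact2_mult[OF mult_carrier_mat[OF mu_carrier c_carrier(2)] c_carrier(1) mult_carrier_mat[OF c_carrier(1) mu_carrier] c_carrier(2), of t "inverse t" x]
   by simp
 qed
 have 1: "pord p (%t. f t I)" for I
  using pord_tens_fil[OF p, of I] unfolding cz f_def .
 have 2: "pord (k - p) (%t. tact2 n (mu t) (mu (inverse t)) z I)" for I
  using pord_tens_fil[OF q, of I] unfolding cz z_def k_def .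
 have zc: "z : csp (tens_idx n (r, s))" unfolding z_def by (rule tact2_coord_space[OF y])
 \<comment> \<open>Conjugation by the involution sends \<open>mu t\<close> to
   \<open>t powi w\<close> times \<open>mu (inverse t)\<close>, and on this tensor space the scalar
   contributes \<open>t powi k\<close>.\<close>
 have 3: "f (inverse t) = sc (t powi (- k)) (tact2 n Fc Fc (tact2 n (mu t) (mu (inverse t)) z))" if t: "t ~= 0" for t
 proof -
  note cr = mult_carrier_mat[OF mu_carrier Fc_carrier] mult_carrier_mat[OF Fc_carrier mu_carrier]
  have A: "Fc * (mu t * Fc) = (t powi w) \<cdot>\<^sub>m mu (inverse t)"
   unfolding mu_Fc[OF t] using assoc_mult_mat[OF Fc_carrier Fc_carrier smult_carrier_mat[OF mu_carrier], symmetric] Fc_square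
   by (simp add: left_mult_one_mat[OF smult_carrier_mat[OF mu_carrier]])
  have B: "Fc * mu (inverse t) * Fc = inverse (t powi w) \<cdot>\<^sub>m mu t"
  proof -
   have "Fc * (mu (inverse t) * Fc) = (inverse t powi w) \<cdot>\<^sub>m mu t"
    using mu_Fc[of "inverse t"] t assoc_mult_mat[OF Fc_carrier Fc_carrier smult_carrier_mat[OF mu_carrier], symmetric] Fc_square
    by (simp add: left_mult_one_mat[OF smult_carrier_mat[OF mu_carrier]])
   then show ?thesis using assoc_mult_mat[OF Fc_carrier mu_carrier Fc_carrier] by (simp add: power_int_inverse)
  qed
  have "tact2 n Fc Fc (tact2 n (mu t) (mu (inverse t)) z) =
    tact2 n (Fc * mu t) (mu (inverse t) * Fc) z"
   using tact2_mult[OF Fc_carrier mu_carrier Fc_carrier mu_carrier, of t "inverse t" z] by simp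
  also have "... = tact2 n (Fc * mu t * Fc) (Fc * (mu (inverse t) * Fc)) y"
   unfolding z_def using tact2_mult[OF cr(2) Fc_carrier cr(1) Fc_carrier, of t "inverse t" y] by simp
  also have "... = tact2 n ((t powi w) \<cdot>\<^sub>m mu (inverse t)) (inverse (t powi w) \<cdot>\<^sub>m mu t) y"
   using A B assoc_mult_mat[OF Fc_carrier mu_carrier Fc_carrier, of t] assoc_mult_mat[OF Fc_carrier mu_carrier Fc_carrier, of "inverse t"] by simp
  also have "... = sc ((t powi w) powi (int r - int s)) (tact2 n (mu (inverse t)) (mu t) y)"
   using t by (intro tact2_smult[OF _ mu_carrier mu_carrier y]) simp
  also have "(t powi w) powi (int r - int s) = t powi k"
   by (simp add: k_def tens_weight_def power_int_mult[symmetric] mult.commute)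
  finally show ?thesis using t
   by (simp add: f_def fscale_simps(3)[symmetric] power_int_minus fscale_simps(4))
 qed
 have 4: "pord (- p) (%t. f (inverse t) I)" for I
 proof -
  have "pord (- k + (k - p)) (%t. t powi (- k) * tact2 n Fc Fc (tact2 n (mu t) (mu (inverse t)) z) I)"
  proof (rule pord_mult[OF pord_powi])
   have "tact2 n Fc Fc (tact2 n (mu t) (mu (inverse t)) z) I = (SUM J:tens_idx n (r, s).
     (if I : tens_idx n (r, s) then tcoef Fc Fc I J else 0) * tact2 n (mu t) (mu (inverse t)) z J)" for t
   proof (cases "I : tens_idx n (r, s)")
    case True
    then show ?thesis unfolding tact2_at[OF True] by simp
   next
    case False
    then show ?thesis using coord_spaceD[OF tact2_coord_space[OF tact2_coord_space[OF zc]] False] by simp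
   qed
   then show "pord (k - p) (%t. tact2 n Fc Fc (tact2 n (mu t) (mu (inverse t)) z) I)"
    by (simp only:) (intro pord_sum pord_cmult 2)
  qed
  then have "pord (- p) (%t. t powi (- k) * tact2 n Fc Fc (tact2 n (mu t) (mu (inverse t)) z) I)" by simp
  then show ?thesis unfolding pord_def using 3 by (simp add: fscale_def)
 qed
 have f1: "f 1 = y" using tact2_one[OF y] by (simp add: f_def mu_one)
 show ?thesis
 proof
  fix I
  have "f t I = t powi p * f 1 I" by (rule pord_both[OF 1 4 t])
  then show "tact2 n (mu t) (mu (inverse t)) y I = sc (t powi p) y I" unfolding f1 by (simp add: f_def fscale_def)
 qed
qed

lemma unit_M: "(rs, tB, tdR) : tensors S ==> unit_morphism M rs tB tdR"
 using structure_M unfolding multilinear_structure_def by blast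

lemma subobject_M: "(L, NB, NdR) : subobjects S ==> subobject M L NB NdR"
 using structure_M unfolding multilinear_structure_def by blast

sublocale TS: tensor_structure n "tensors S" fst "%v x. if v then snd (snd x) else fst (snd x)"
 "subobjects S" fst "%v x. if v then snd (snd x) else fst (snd x)"
proof
 fix x and v :: bool assume x: "x : tensors S"
 obtain rs tB tdR where e: "x = (rs, tB, tdR)" by (cases x)
 have u: "tB : csp (tens_idx n rs)" "tdR : tens_fil M rs 0" using unit_M x e by (auto simp: unit_morphism_def)
 show "(if v then snd (snd x) else fst (snd x)) : csp (tens_idx n (fst x))"
  using u tens_fil_coord_space[OF fil(2), of rs 0] by (auto simp: e)
next
 fix y and v :: bool assume y: "y : subobjects S"
 obtain L NB NdR where e: "y = (L, NB, NdR)" by (cases y)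
 note so = subobject_M[OF y[unfolded e], unfolded subobject_def]
 show "module.subspace sc (if v then snd (snd y) else fst (snd y))"
  "(if v then snd (snd y) else fst (snd y)) <= csp (dsum_idx n (fst y))"
  using so by (cases v; simp add: e)+
qed

lemma GB_iso: "GB M S = TS.iso False False" and GdR_iso: "GdR M S = TS.iso True True" and torsor_iso: "torsor M S = TS.iso False True"
 unfolding GB_def GdR_def torsor_def TS.iso_def by (simp_all only: case_prod_unfold if_True if_False)

lemma c_torsor: "c : torsor M S"
 unfolding torsor_def
proof (intro CollectI conjI ballI c_GL)
 fix x assume "x : tensors S"
 then show "case x of (rs, tB, tdR) => tens_act n c (cvec tB) = cvec tdR"
  using unit_M unfolding unit_morphism_def by (cases x) blast
next
 fix y assume "y : subobjects S"
 then show "case y of (L, NB, NdR) => dsum_act n c ` cspan NB = cspan NdR"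
  using subobject_M unfolding subobject_def by (cases y) blast
qed

lemma GB_I:
 assumes "g : GL n"
  and "!!rs tB tdR. (rs, tB, tdR) : tensors S ==> tact2 n g (minv g) (cvec tB) = cvec tB"
  and "!!L NB NdR x. (L, NB, NdR) : subobjects S ==> x : cspan NB ==>
      dact2 n g (minv g) x : cspan NB & dact2 n (minv g) g x : cspan NB"
 shows "g : GB M S"
 unfolding GB_iso TS.iso_iff if_False
proof (intro conjI ballI assms(1))
 fix x assume "x : tensors S"
 then show "tact2 n g (minv g) (cvec (fst (snd x))) = cvec (fst (snd x))"
  using assms(2)[of "fst x" "fst (snd x)" "snd (snd x)"] by simp
next
 fix y z assume "y : subobjects S" "z : fst (snd y)"
 then have "dact2 n g (minv g) (cvec z) : cspan (fst (snd y)) & dact2 n (minv g) g (cvec z) : cspan (fst (snd y))"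
  by (intro assms(3)[of "fst y" _ "snd (snd y)"] cvec_in_cspan) simp_all
 then show "dact2 n g (minv g) (cvec z) : cspan (fst (snd y))" "dact2 n (minv g) g (cvec z) : cspan (fst (snd y))" by blast+
qed

lemma Fc_GB: "Fc : GB M S"
proof (rule GB_I[OF Fc_GL(1)])
 fix rs tB tdR assume "(rs, tB, tdR) : tensors S"
 then have "tens_act n F tB = tB" using unit_M by (simp add: unit_morphism_def)
 then show "tact2 n Fc (minv Fc) (cvec tB) = cvec tB"
  unfolding Fc_GL(2) tact2_cvec[OF F_carrier F_carrier] by (simp add: tens_act_eq F_GL(2))
next
 fix L NB NdR x assume y: "(L, NB, NdR) : subobjects S" and x: "x : cspan NB"
 have "dsum_act n F ` NB <= NB" using subobject_M[OF y] by (simp add: subobject_def)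
 then have "dact2 n Fc Fc (cvec z) : cspan NB" if "z : NB" for z
  unfolding dact2_cvec[OF F_carrier F_carrier] using that by (intro cvec_in_cspan) (auto simp: dsum_act_eq F_GL(2))
 then have "dact2 n Fc Fc x : cspan NB"
  by (rule flinear_cspan_image[OF dact2_flinear cspan_subspace _ x])
 then show "dact2 n Fc (minv Fc) x : cspan NB & dact2 n (minv Fc) Fc x : cspan NB" by (simp add: Fc_GL(2))
qed

lemma cspan_dsum_fil_component:
 assumes "x : cspan (dsum_fil M L p)" "j < length L"
 shows "(%I. x (j, I)) : cspan (tens_fil M (L ! j) p)"
proof (rule flinear_cspan_image[where f="%x I. x (j, I)", OF _ cspan_subspace _ assms(1)])
 show "flinear (%(x :: nat \<times> tidx => complex) I. x (j, I))" by (auto simp: flinear_def fscale_def fun_eq_iff)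
 fix x assume "x : dsum_fil M L p"
 then have "(%I. x (j, I)) : tens_fil M (L ! j) p" using assms(2) by (simp add: dsum_fil_def)
 from cvec_in_cspan[OF this] show "(%I. cvec x (j, I)) : cspan (tens_fil M (L ! j) p)" by (simp add: cvec_def)
qed

lemma cspan_tens_fil_conj: "x : cspan (tens_fil M rs p) ==> vconj x : cspan (tens_fil M rs p)"
 by (rule vconj_cspan[OF finite_tens_idx _ tens_fil_coord_space[OF fil(2)]]) (simp add: tens_fil_def)

lemma dact2_mu_piece:
 assumes y: "(L, NB, NdR) : subobjects S" and k: "ALL rs:set L. tens_weight M rs = k" and t: "t ~= 0"
  and h: "h : hodge_piece (dsum_act n c) NB (%p. dsum_fil M L p Int NdR) p (k - p)"
 shows "h : cspan NB" "dact2 n (mu t) (mu (inverse t)) h = sc (t powi p) h"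
proof -
 obtain u where u: "h = vconj u" "dsum_act n c u : cspan (dsum_fil M L (k - p) Int NdR)"
  and h1: "h : cspan NB" "dsum_act n c h : cspan (dsum_fil M L p Int NdR)"
  using h by (auto simp: hodge_piece_def hodge_fil_def)
 show "h : cspan NB" by (rule h1(1))
 then have hc: "h : csp (dsum_idx n L)" using TS.cspan_a[OF y, of h False] by simp
 have u2: "dact2 n c (minv c) u : cspan (dsum_fil M L (k - p))"
  and h2: "dact2 n c (minv c) h : cspan (dsum_fil M L p)"
  using u(2) h1(2) cspan_mono[of "dsum_fil M L (k - p) Int NdR" "dsum_fil M L (k - p)"]
   cspan_mono[of "dsum_fil M L p Int NdR" "dsum_fil M L p"] by (auto simp: dsum_act_eq)
 \<comment> \<open>The reality condition for the inverse of \<open>c\<close>. It is used to rewrite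
   the conjugate of the image of \<open>u\<close> as the image of \<open>h\<close> twisted by the
   involution.\<close>
 have cc: "map_mat cnj (minv c) = Fc * minv c"
 proof -
  have "minv (map_mat cnj c) = map_mat cnj (minv c)" by (rule minv_hom_on(2)[OF hom_on_cnj subring_UNIV c_GL]) auto
  moreover have "minv (c * Fc) = Fc * minv c" using GL_mult[OF c_GL Fc_GL(1)] Fc_GL(2) by simp
  ultimately show ?thesis by (simp add: c_Fc)
 qed
 show "dact2 n (mu t) (mu (inverse t)) h = sc (t powi p) h"
 proof
  fix jI :: "nat \<times> tidx"
  obtain j I where jI: "jI = (j, I)" by (cases jI)
  show "dact2 n (mu t) (mu (inverse t)) h jI = sc (t powi p) h jI"
  proof (cases "j < length L")
   case False
   then have nI: "jI ~: dsum_idx n L" by (simp add: jI dsum_idx_def)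
   show ?thesis using coord_spaceD[OF dact2_coord_space[OF hc] nI] coord_spaceD[OF hc nI] by (simp add: fscale_def)
  next
   case True
   let ?h = "%I. h (j, I)"
   obtain r s where rs: "L ! j = (r, s)" by (cases "L ! j")
   have kk: "tens_weight M (r, s) = k" using k True rs by (metis nth_mem)
   have "?h : csp (tens_idx n (r, s))" using hc True rs by (auto simp: dsum_coord_space_iff)
   moreover have "tact2 n c (minv c) ?h : cspan (tens_fil M (r, s) p)"
    using cspan_dsum_fil_component[OF h2 True] unfolding dact2_component rs .
   moreover have "tact2 n c (minv c) (tact2 n Fc Fc ?h) : cspan (tens_fil M (r, s) (tens_weight M (r, s) - p))"
   proof -
    have "tact2 n c (minv c) (tact2 n Fc Fc ?h) = tact2 n (c * Fc) (Fc * minv c) ?h"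
     by (rule tact2_mult[OF c_carrier(1) Fc_carrier c_carrier(2) Fc_carrier, symmetric])
    also have "... = tact2 n (c * Fc) (Fc * minv c) (vconj (%I. u (j, I)))" by (simp add: u(1) vconj_def)
    also have "tact2 n (c * Fc) (Fc * minv c) (vconj (%I. u (j, I))) = vconj (tact2 n c (minv c) (%I. u (j, I)))"
     unfolding cc[symmetric] c_Fc by (rule vconj_tact2[OF c_carrier(1,2)])
    also have "... : cspan (tens_fil M (r, s) (tens_weight M (r, s) - p))"
     using cspan_tens_fil_conj[OF cspan_dsum_fil_component[OF u2 True]] unfolding dact2_component rs kk .
    finally show ?thesis .
   qed
   ultimately have "tact2 n (mu t) (mu (inverse t)) ?h = sc (t powi p) ?h" using t by (rule tact2_mu)
   from fun_cong[OF this, of I] show ?thesis by (simp add: jI dact2_def fscale_def)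
  qed
 qed
qed

text \<open>A sub-object has its own Hodge decomposition, and on each of its pieces the cocharacter
  acts by a scalar.\<close>

lemma dact2_mu:
 assumes y: "(L, NB, NdR) : subobjects S" and x: "x : cspan NB" and t: "t ~= 0"
 shows "dact2 n (mu t) (mu (inverse t)) x : cspan NB"
proof -
 obtain k where k: "ALL rs:set L. tens_weight M rs = k"
  "opposite_fil k (dsum_act n c) NB (%p. dsum_fil M L p Int NdR)"
  using subobject_M[OF y] unfolding subobject_def by (elim conjE exE) (rule that)
 obtain h where h: "ALL p. h p : hodge_piece (dsum_act n c) NB (%p. dsum_fil M L p Int NdR) p (k - p)"
  "x = (SUM p:{p. h p ~= 0}. h p)"
  using bspec[OF k(2)[unfolded opposite_fil_def] x] by (elim ex1E conjE) (rule that)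
 note piece = dact2_mu_piece[OF y k(1) t spec[OF h(1)]]
 have "dact2 n (mu t) (mu (inverse t)) x = (SUM p:{p. h p ~= 0}. sc (t powi p) (h p))"
  by (subst h(2)) (simp only: flinear_sum[OF dact2_flinear] piece(2))
 also have "... : cspan NB"
  by (intro fs.subspace_sum[OF cspan_subspace] fs.subspace_scale[OF cspan_subspace] piece(1))
 finally show ?thesis .
qed

text \<open>An invariant tensor is fixed by the involution and lies in step 0 of a filtration of
  weight 0, hence has type \<open>(0, 0)\<close> and exponent 0.\<close>

lemma mu_GB: "t ~= 0 ==> mu t : GB M S"
proof (rule GB_I)
 assume t: "t ~= 0"
 show "mu t : GL n" using mu_GL[OF t] ..
 have m: "minv (mu t) = mu (inverse t)" using mu_GL[OF t] ..
 show "tact2 n (mu t) (minv (mu t)) (cvec tB) = cvec tB" if x: "(rs, tB, tdR) : tensors S" for rs tB tdR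
 proof -
  obtain r s where rs: "rs = (r, s)" by (cases rs)
  note u = unit_M[OF x, unfolded unit_morphism_def]
  have "tens_act n F tB = tB" using u by blast
  then have F: "tact2 n Fc Fc (cvec tB) = cvec tB"
   unfolding tact2_cvec[OF F_carrier F_carrier] by (simp add: tens_act_eq F_GL(2))
  have "tact2 n c (minv c) (cvec tB) = cvec tdR" "tdR : tens_fil M rs 0" using u by (simp_all add: tens_act_eq)
  then have c: "tact2 n c (minv c) (cvec tB) : cspan (tens_fil M (r, s) 0)" using cvec_in_cspan by (simp add: rs)
  have "tact2 n (mu t) (mu (inverse t)) (cvec tB) = sc (t powi 0) (cvec tB)"
   by (rule tact2_mu[of _ r s]) (use TS.cvec_s[OF x, of False] c F u t in \<open>simp_all add: rs\<close>)
  then show ?thesis by (simp add: m fscale_simps)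
 qed
 show "dact2 n (mu t) (minv (mu t)) x : cspan NB & dact2 n (minv (mu t)) (mu t) x : cspan NB"
  if "(L, NB, NdR) : subobjects S" "x : cspan NB" for L NB NdR x
  using dact2_mu[OF that, of t] dact2_mu[OF that, of "inverse t"] t by (simp add: m)
qed

text \<open>The tensors recording the action of a basis of \<open>E\<close> give the intertwining
  relation on that basis; the rest follows by rational linearity. The three cases are the two groups
  and the torsor.\<close>

lemma E_linear:
 assumes "u = actB M & v = actB M & g : GB M S \<or> u = actB M & v = actdR M & g : torsor M S \<or>
  u = actdR M & v = actdR M & g : GdR M S"
 shows "g * cmat (u e) = cmat (v e) * g"
proof -
 obtain B :: "'e set" where B: "rat_basis B"
  "ALL e:B. ((1, 1), end_tensor (actB M e), end_tensor (actdR M e)) : tensors S"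
  using E_structure unfolding contains_E_structure_def by (elim exE conjE) (rule that)
 have g: "g : GL n" using assms unfolding GB_iso GdR_iso torsor_iso by (auto dest: TS.iso_GL)
 note gc = GL_minv(1)[OF g]
 have uv: "field_module n u" "field_module n v" using assms mB.field_module_axioms mdR.field_module_axioms by auto
 note uc = field_module.rho_carrier[OF uv(1)] and vc = field_module.rho_carrier[OF uv(2)]
 have gen: "g * cmat (u e) = cmat (v e) * g" if "e : B" for e
 proof (rule tens_act_end_tensor[OF g uc vc])
  show "tens_act n g (cvec (end_tensor (u e))) = cvec (end_tensor (v e))"
   using assms bspec[OF B(2) that] unfolding GB_def GdR_def torsor_def by auto
 qed
 have "e : rat_vs.span B" using B(1) by (simp add: rat_basis_def)
 then show ?thesis
 proof (induction rule: rat_vs.span_induct_alt)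
  case base
  have "u 0 = 0 \<cdot>\<^sub>m u 0" "v 0 = 0 \<cdot>\<^sub>m v 0"
   using field_module.rho_of_rat[OF uv(1), of 0 0] field_module.rho_of_rat[OF uv(2), of 0 0] by simp_all
  then have "u 0 = 0\<^sub>m n n" "v 0 = 0\<^sub>m n n"
   using smult_zero_mat[OF uc[of 0]] smult_zero_mat[OF vc[of 0]] by simp_all
  then show ?case using gc by (simp add: cmat_zero)
 next
  case (step a x y)
  have s: "u (of_rat a * x + y) = a \<cdot>\<^sub>m u x + u y" "v (of_rat a * x + y) = a \<cdot>\<^sub>m v x + v y"
   using field_module.rho_simps(2)[OF uv(1), of "of_rat a * x" y] field_module.rho_simps(2)[OF uv(2), of "of_rat a * x" y]
    field_module.rho_of_rat[OF uv(1), of a x] field_module.rho_of_rat[OF uv(2), of a x] by simp_all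
  note cu = cmat_carrier[OF uc] and cv = cmat_carrier[OF vc]
  have "g * cmat (u (of_rat a * x + y)) = of_rat a \<cdot>\<^sub>m (g * cmat (u x)) + g * cmat (u y)"
   unfolding s(1) cmat_add[OF smult_carrier_mat[OF uc] uc] cmat_smult
    mult_add_distrib_mat[OF gc smult_carrier_mat[OF cu] cu] mult_smult_distrib[OF gc cu] ..
  also have "... = cmat (v (of_rat a * x + y)) * g"
   unfolding s(2) cmat_add[OF smult_carrier_mat[OF vc] vc] cmat_smult gen[OF step.hyps(1)] step.IH
    add_mult_distrib_mat[OF smult_carrier_mat[OF cv] cv gc] mult_smult_assoc_mat[OF cv gc] ..
  finally show ?case .
 qed
qed

end

section \<open>Rational polynomials and periods as functions of the isomorphism\<close>

text \<open>The coefficients are rational for the coordinates of the period determinants, which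
  makes these commute with ring homomorphisms, and in \<open>Qbar\<close> for the polynomials that
  separate components.\<close>

inductive_set polys_over :: "complex set => nat => (complex mat => complex) set" for K n where
 const: "q : K ==> (%_. q) : polys_over K n"
| entry: "i < n ==> j < n ==> (%A. A $$ (i, j)) : polys_over K n"
| add: "f : polys_over K n ==> g : polys_over K n ==> (%A. f A + g A) : polys_over K n"
| mult: "f : polys_over K n ==> g : polys_over K n ==> (%A. f A * g A) : polys_over K n"

abbreviation rat_polys :: "nat => (complex mat => complex) set" where
 "rat_polys == polys_over Rats"

lemma polys_over_mat_polys: "f : polys_over K n ==> f : mat_polys n"
 by (induction rule: polys_over.induct) (auto intro: mat_polys.intros)

lemma rat_polys_const: "(%_. of_rat q) : rat_polys n"
 by (rule polys_over.const) simp

lemma rat_polys_sum: "(!!i. i : I ==> f i : rat_polys n) ==> (%A. SUM i:I. f i A) : rat_polys n"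
proof (induction I rule: infinite_finite_induct)
 case (insert x I)
 then show ?case using polys_over.add[of "f x" "Rats" n "%A. SUM i:I. f i A"] by simp
qed (use rat_polys_const[of 0 n] in simp_all)

lemma polys_over_hom_on:
 assumes "f : polys_over K n" and tau: "hom_on R tau" "subring_set R" and K: "K <= R" "!!q. q : K ==> tau q = q"
  and A: "A : Mat n" "elements_mat A <= R"
 shows "f A : R & f (map_mat tau A) = tau (f A)"
 using assms(1)
proof induction
 case (const q)
 then show ?case using K by auto
next
 case (entry i j)
 then show ?case using elements_mat_entry[OF A(1) entry] A by auto
next
 case (add f g)
 then show ?case using hom_onD(3)[OF tau] subring_setD[OF tau(2)] by simp
next
 case (mult f g)
 then show ?case using hom_onD(4)[OF tau] subring_setD[OF tau(2)] by simp
qed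

lemma rat_polys_hom_on:
 assumes "f : rat_polys n" and tau: "hom_on R tau" "subring_set R" and rat: "!!q. of_rat q : R"
  and A: "A : Mat n" "elements_mat A <= R"
 shows "f A : R & f (map_mat tau A) = tau (f A)"
proof (rule polys_over_hom_on[OF assms(1) tau _ _ A])
 show "Rats <= R" using rat by (auto elim: Rats_cases)
 show "q : Rats ==> tau q = q" for q using hom_on_of_rat[OF tau rat] by (auto elim: Rats_cases)
qed

context number_field_basis
begin

definition rat_tensor_fun :: "nat => (complex mat => ('e, complex) qtensor) => bool" where
 "rat_tensor_fun n G \<longleftrightarrow> (ALL bet:B. (%A. kap bet (G A)) : rat_polys n)"

lemma rat_tensor_fun_add: "rat_tensor_fun n G ==> rat_tensor_fun n H ==> rat_tensor_fun n (%A. G A + H A)"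
 unfolding rat_tensor_fun_def by (simp add: kap_simps polys_over.add)

lemma rat_tensor_fun_pure: "f : rat_polys n ==> rat_tensor_fun n (%A. ptens e (f A))"
 unfolding rat_tensor_fun_def using polys_over.mult[OF rat_polys_const] by (simp add: kap_simps)

lemma rat_tensor_fun_mult: "rat_tensor_fun n G ==> rat_tensor_fun n H ==> rat_tensor_fun n (%A. G A * H A)"
 unfolding rat_tensor_fun_def kap_mult
 by (intro ballI rat_polys_sum polys_over.mult[OF rat_polys_const]) (simp add: polys_over.mult)

lemma rat_tensor_fun_const: "rat_tensor_fun n (%A. ptens e (of_rat q))"
 by (rule rat_tensor_fun_pure[OF rat_polys_const])

lemma rat_tensor_fun_sum: "(!!i. i : I ==> rat_tensor_fun n (G i)) ==> rat_tensor_fun n (%A. SUM i:I. G i A)"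
 by (induction I rule: infinite_finite_induct)
  (use rat_tensor_fun_const[of n 0 0] in \<open>simp_all add: pure_tensor_simps rat_tensor_fun_add\<close>)

lemma rat_tensor_fun_prod: "(!!i. i : I ==> rat_tensor_fun n (G i)) ==> rat_tensor_fun n (%A. PROD i:I. G i A)"
 by (induction I rule: infinite_finite_induct)
  (use rat_tensor_fun_const[of n 1 1] in \<open>simp_all add: pure_tensor_simps rat_tensor_fun_mult\<close>)

lemma rat_tensor_fun_det:
 assumes "!!A. G A : carrier_mat m m" "!!i j. i < m ==> j < m ==> rat_tensor_fun n (%A. G A $$ (i, j))"
 shows "rat_tensor_fun n (%A. mdet (G A))"
proof -
 have "rat_tensor_fun n (%A. SUM p:{p. p permutes {0..<m}}. signof p * (PROD i = 0..<m. G A $$ (i, p i)))"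
 proof (intro rat_tensor_fun_sum rat_tensor_fun_mult rat_tensor_fun_prod)
  fix p
  have "signof p = ptens (1 :: 'e) (of_rat (signof p) :: complex)"
  proof -
   have "ptens (1 :: 'e) (1 :: complex) + ptens 1 (- 1) = 0"
    using pure_tensor_simps(2)[of "1 :: 'e" "1 :: complex" "- 1"] by (simp add: pure_tensor_0_right)
   then have "ptens (1 :: 'e) (- 1 :: complex) = - 1" by (simp add: pure_tensor_simps add_eq_0_iff)
   then show ?thesis by (cases "evenperm p") (simp_all add: sign_def pure_tensor_simps)
  qed
  then show "rat_tensor_fun n (%A. signof p)" using rat_tensor_fun_const[of n 1 "of_int (sign p)"] by simp
 next
  fix p i assume "p : {p. p permutes {0..<m}}" "i : {0..<m}"
  then show "rat_tensor_fun n (%A. G A $$ (i, p i))" by (intro assms(2)) (auto simp: permutes_in_image)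
 qed
 then show ?thesis unfolding det_def'[OF assms(1)] .
qed

text \<open>The map \<open>id \<otimes> tau\<close>, written in coordinates since \<open>tau\<close>
  is a homomorphism on a subring only.\<close>

definition tmap :: "(complex => complex) => ('e, complex) qtensor => ('e, complex) qtensor" where
 "tmap tau x = (SUM bet:B. ptens bet (tau (kap bet x)))"

lemma kap_tmap: "bet : B ==> kap bet (tmap tau x) = tau (kap bet x)"
proof -
 assume bet: "bet : B"
 have "kap bet (tmap tau x) = (SUM al:B. of_rat (coef bet al) * tau (kap al x))"
  unfolding tmap_def contract_sum[OF qlinear_coef] by (simp add: kap_simps)
 also have "... = (SUM al:B. if al = bet then tau (kap bet x) else 0)"
  by (intro sum.cong HOL.refl) (simp add: coef_basis)
 finally show ?thesis using bet finite_B by simp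
qed

text \<open>Multiplicativity of \<open>tmap\<close>, in a form that accepts images known only
  through their coordinates.\<close>

lemma kap_hom_on_mult:
 assumes tau: "hom_on R tau" "subring_set R" and rat: "!!q. of_rat q : R"
  and "!!bet. bet : B ==> kap bet x : R" "!!bet. bet : B ==> kap bet y : R"
  and "!!bet. bet : B ==> kap bet x' = tau (kap bet x)" "!!bet. bet : B ==> kap bet y' = tau (kap bet y)" and "gam : B"
 shows "kap gam (x * y) : R & kap gam (x' * y') = tau (kap gam (x * y))"
proof -
 note R = subring_setD[OF tau(2)] and h = hom_onD[OF tau]
 have "tau (kap gam (x * y)) = (SUM al:B. SUM bet:B. tau (of_rat (coef gam (al * bet)) * (kap al x * kap bet y)))"
  unfolding kap_mult using assms(4,5) rat
  by (subst hom_on_sum[OF tau]; (intro subring_set_sum[OF tau(2)] sum.cong HOL.refl hom_on_sum[OF tau])?) (auto intro!: R)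
 also have "... = kap gam (x' * y')"
  unfolding kap_mult using assms(4-7) rat by (intro sum.cong HOL.refl) (simp add: h R hom_on_of_rat[OF tau rat])
 finally have "kap gam (x' * y') = tau (kap gam (x * y))" by simp
 moreover have "kap gam (x * y) : R" unfolding kap_mult
  using assms(4,5) rat by (intro subring_set_sum[OF tau(2)]) (auto intro!: R)
 ultimately show ?thesis by blast
qed

end

section \<open>The period determinants as functions of the isomorphism\<close>

context bdr
begin

definition Bq :: "'e set" where
 "Bq = (SOME B. finite B & rat_basis B)"

lemma Bq: "finite Bq" "rat_basis Bq"
proof -
 have "EX B :: 'e set. finite B & rat_basis B" using number_field by (simp add: number_field_def)
 from someI_ex[OF this] show "finite Bq" "rat_basis Bq" unfolding Bq_def by blast+
qed

sublocale nf: number_field_basis Bq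
 by unfold_locales (rule Bq)+

abbreviation a where "a == w div 2 + 1"
abbreviation Fa where "Fa == fil M a"

lemma flinear_eigen: "flinear (%v. ap A v - sc b (v :: nat => 'k::field))"
 using mapply_flinear[of A] by (simp add: flinear_def fun_eq_iff fscale_def algebra_simps)

lemma eigen_subspace: "module.subspace sc (eigenM M eps)"
 using subspace_preimage[OF flinear_eigen[of F eps] fs.subspace_single_0 coord_space_subspace[of "{..<n}"]]
 unfolding eigenM_def by simp

lemma eigen_act: "v : eigenM M eps ==> ap (actB M e) v : eigenM M eps"
proof -
 assume v: "v : eigenM M eps"
 have "ap F (ap (actB M e) v) = ap (actB M e) (ap F v)"
  using mapply_mult[OF F_carrier mB.rho_carrier, of e v] mapply_mult[OF mB.rho_carrier F_carrier, of e v] F_actB by simp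
 also have "... = sc eps (ap (actB M e) v)"
  using v mapply_flinear[of "actB M e"] by (simp add: eigenM_def flinear_def)
 finally show ?thesis by (simp add: eigenM_def mapply_coord_space[OF mB.rho_carrier])
qed

lemma mapply_0: "ap (A :: 'k::field mat) 0 = 0"
 by (rule flinear_0[OF mapply_flinear])

sublocale eig: E_space Bq n "actB M" "eigenM M eps" "{0}" for eps
proof unfold_locales
 show "eigenM M eps <= csp {..<n}" by (auto simp: eigenM_def)
 show "{0} <= eigenM M eps" using fs.subspace_0[OF eigen_subspace] by simp
 show "ap (actB M e) v : {0}" if "v : {0}" for e v using that mapply_0 by simp
qed (auto intro: eigen_subspace eigen_act fs.subspace_single_0)

sublocale dR: E_space Bq n "actdR M" "Mspace M" Fa
 by unfold_locales (auto intro: coord_space_subspace mapply_coord_space[OF mdR.rho_carrier] fil subsetD[OF fil(2)])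

definition bs :: "rat => (nat => rat) list" where
 "bs eps = (SOME b. E_basis (actB M) (eigenM M eps) {0} b)"
definition ds :: "(nat => rat) list" where
 "ds = (SOME b. E_basis (actdR M) (Mspace M) Fa b)"

lemma bs: "E_basis (actB M) (eigenM M eps) {0} (bs eps)"
 unfolding bs_def by (rule someI_ex[OF eig.E_basis_exists])
lemma ds: "E_basis (actdR M) (Mspace M) Fa ds"
 unfolding ds_def by (rule someI_ex[OF dR.E_basis_exists])

text \<open>Coordinates in \<open>E\<close> of the unit vectors with respect to \<open>ds\<close>,
  modulo the filtration step.\<close>

definition es :: "nat => 'e list" where
 "es l = (SOME e. (%i. if i = l then 1 else 0) - (SUM k<length ds. ap (actdR M (e ! k)) (ds ! k)) : Fa)"

lemma es: "l < n ==> (%i. if i = l then 1 else 0) - (SUM k<length ds. ap (actdR M (es l ! k)) (ds ! k)) : Fa"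
proof -
 assume "l < n"
 then have "(%i. if i = l then 1 else 0 :: rat) : Mspace M" by (auto simp: coord_space_def)
 then have "EX e. (%i. if i = l then 1 else 0) - (SUM k<length ds. ap (actdR M (e ! k)) (ds ! k)) : Fa"
  using ds unfolding E_basis_def by blast
 from someI_ex[OF this] show ?thesis unfolding es_def .
qed

text \<open>The period matrix, written with the fixed coordinates \<open>es\<close> so that its
  entries are visibly linear in the entries of \<open>g\<close>, with coefficients in
  \<open>E\<close>.\<close>

definition Em :: "rat => complex mat => ('e, complex) qtensor mat" where
 "Em eps g = mat (length ds) (length (bs eps)) (%(i, j). SUM l<n. ptens (es l ! i) (ap g (cvec (bs eps ! j)) l))"

lemma Em_carrier [simp]: "Em eps g : carrier_mat (length ds) (length (bs eps))"
 by (simp add: Em_def)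

lemma Em: "g : Mat n ==> E_matrix (actdR M) Fa g (bs eps) ds (Em eps g)"
 unfolding E_matrix_def
proof (intro conjI allI impI Em_carrier)
 fix j assume g: "g : Mat n" and j: "j < length (bs eps)"
 let ?v = "ap g (cvec (bs eps ! j))"
 let ?e = "%l i. if i = l then 1 else 0 :: rat"
 have cve: "cvec (?e l) = (%i. if i = l then 1 else 0)" for l by (auto simp: cvec_def)
 have 1: "?v = (SUM l<n. sc (?v l) (cvec (?e l)))"
  unfolding cve by (rule coord_space_decomp[OF _ mapply_V[OF g]]) simp
 have "(SUM i<length ds. mdR.act (Em eps g $$ (i, j)) (cvec (ds ! i))) =
   (SUM i<length ds. SUM l<n. sc (?v l) (cvec (ap (actdR M (es l ! i)) (ds ! i))))"
  using j by (intro sum.cong HOL.refl) (simp add: Em_def mdR.act_sum mdR.act_pure mapply_cmat_cvec)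
 also have "... = (SUM l<n. SUM i<length ds. sc (?v l) (cvec (ap (actdR M (es l ! i)) (ds ! i))))" by (rule sum.swap)
 also have "... = (SUM l<n. sc (?v l) (cvec (SUM i<length ds. ap (actdR M (es l ! i)) (ds ! i))))"
  by (simp only: cvec_sum fs.scale_sum_right)
 finally have "?v - (SUM i<length ds. mdR.act (Em eps g $$ (i, j)) (cvec (ds ! i))) =
   (SUM l<n. sc (?v l) (cvec (?e l - (SUM i<length ds. ap (actdR M (es l ! i)) (ds ! i)))))"
  using 1 by (simp only: cvec_diff fs.scale_right_diff_distrib sum_subtractf)
 also have "... : cspan Fa"
  by (intro fs.subspace_sum[OF cspan_subspace] fs.subspace_scale[OF cspan_subspace] cvec_in_cspan es) simp
 finally show "?v - (SUM i<length ds. mdR.act (Em eps g $$ (i, j)) (cvec (ds ! i))) : cspan Fa" .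
qed

lemma Em_unique: "E_matrix (actdR M) Fa g (bs eps) ds A ==> g : Mat n ==> A = Em eps g"
 by (rule dR.E_matrix_unique[OF ds _ Em])

lemma E_matrix_cong:
 "E_matrix rho U g bs' ds' A ==> (!!b. b : set bs' ==> ap g (cvec b) - ap h (cvec b) : cspan U) ==> E_matrix rho U h bs' ds' A"
 unfolding E_matrix_def
proof (elim conjE, intro conjI allI impI)
 fix j assume e: "ALL j<length bs'. ap g (cvec (bs' ! j)) - (SUM i<length ds'. tensor_act rho (A $$ (i, j)) (cvec (ds' ! i))) : cspan U"
  and b: "!!b. b : set bs' ==> ap g (cvec b) - ap h (cvec b) : cspan U" and j: "j < length bs'"
 have "ap g (cvec (bs' ! j)) - (SUM i<length ds'. tensor_act rho (A $$ (i, j)) (cvec (ds' ! i))) -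
   (ap g (cvec (bs' ! j)) - ap h (cvec (bs' ! j))) : cspan U"
  by (rule fs.subspace_diff[OF cspan_subspace]) (use e b j in auto)
 then show "ap h (cvec (bs' ! j)) - (SUM i<length ds'. tensor_act rho (A $$ (i, j)) (cvec (ds' ! i))) : cspan U"
  by (simp add: algebra_simps)
qed assumption

text \<open>For these \<open>eps\<close> the projector \<open>(1 + eps F) / 2\<close> is rational,
  so complex eigenvectors come from the rational eigenspace.\<close>

lemma eigen_iff:
 assumes "eps * eps = 1"
 shows "v : cspan (eigenM M eps) \<longleftrightarrow> v : V & ap Fc v = sc (of_rat eps) v"
proof
 assume v: "v : cspan (eigenM M eps)"
 then have vV: "v : V" using cspan_coord_space[OF eig.W(2)] by blast
 have "ap Fc v - sc (of_rat eps) v : {0}"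
 proof (rule flinear_cspan_image[OF _ fs.subspace_single_0 _ v])
  show "flinear (%v. ap Fc v - sc (of_rat eps) v)" by (rule flinear_eigen)
  fix x assume "x : eigenM M eps"
  then show "ap Fc (cvec x) - sc (of_rat eps) (cvec x) : {0}"
   by (simp add: mapply_cmat_cvec eigenM_def cvec_fscale)
 qed
 then show "v : V & ap Fc v = sc (of_rat eps) v" using vV by simp
next
 assume v: "v : V & ap Fc v = sc (of_rat eps) v"
 let ?P = "%v. sc (1/2) (v + sc (of_rat eps) (ap Fc v)) :: nat => complex"
 have "v : cspan (Mspace M)" using v cspan_full[of "{..<n}"] by simp
 then have "?P v : cspan (eigenM M eps)"
 proof (rule flinear_cspan_image[where f="?P", OF _ cspan_subspace, rotated -1])
  show "flinear ?P" using mapply_flinear[of Fc] by (auto simp: flinear_def fun_eq_iff fscale_def algebra_simps add_divide_distrib)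
  fix x :: "nat => rat" assume x: "x : Mspace M"
  let ?y = "sc (1/2) (x + sc eps (ap F x))"
  have "ap F (ap F x) = x" using mapply_mult[OF F_carrier F_carrier, of x] F_square mapply_one[OF x] by simp
  then have "ap F ?y = sc (1/2) (ap F x + sc eps x)"
   using mapply_flinear[of F] unfolding flinear_def by simp
  also have "... = sc eps ?y" using assms by (simp add: fun_eq_iff fscale_def algebra_simps)
  finally have "?y : eigenM M eps" unfolding eigenM_def
   by (intro CollectI conjI fs.subspace_scale[OF coord_space_subspace] fs.subspace_add[OF coord_space_subspace] x
     mapply_coord_space[OF F_carrier])
  from cvec_in_cspan[OF this] show "?P (cvec x) : cspan (eigenM M eps)"
   by (simp only: cvec_fscale cvec_add mapply_cmat_cvec of_rat_divide of_rat_1 of_rat_numeral_eq)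
 qed
 also have "?P v = v"
 proof
  fix i
  have e2: "of_rat eps * of_rat eps = (1 :: complex)" using assms by (metis of_rat_1 of_rat_mult)
  have "?P v i = 1 / 2 * (v i + of_rat eps * (of_rat eps * v i))" unfolding conjunct2[OF v] fscale_def plus_fun_apply ..
  also have "... = v i" unfolding mult.assoc[symmetric] e2 by simp
  finally show "?P v i = v i" .
 qed
 finally show "v : cspan (eigenM M eps)" .
qed

text \<open>Projection to the pieces \<open>H p\<close> with \<open>p < a\<close>; its kernel on
  \<open>V\<close> is \<open>FB a\<close>, so it stands for the quotient. The factor 1 fits the
  shape of \<open>mapply_mat_sum\<close>.\<close>

definition Lo :: "complex mat" where
 "Lo = mat n n (%ij. SUM p:{p:PS. p < a}. 1 * Pm p $$ ij)"

lemma Lo_carrier [simp]: "Lo : Mat n"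
 by (simp add: Lo_def)

lemma mapply_Lo: "v : V ==> ap Lo v = (SUM p:{p:PS. p < a}. dec v p)"
 unfolding Lo_def mapply_mat_sum[OF Pm(1)] by (simp add: Pm(2) fscale_simps)

lemma dec_Lo: "v : V ==> dec (ap Lo v) = (%p. if p < a then dec v p else 0)"
proof (rule dec_unique[of _ _ "{p:PS. p < a}"])
 assume v: "v : V"
 show "(if p < a then dec v p else 0) : H p" for p
  using dec_H[OF v] fs.subspace_0[OF H_subspace] by simp
 show "ap Lo v = (SUM p:{p:PS. p < a}. if p < a then dec v p else 0)"
  unfolding mapply_Lo[OF v] by (rule sum.cong) auto
 show "p ~: {p : PS. p < a} ==> (if p < a then dec v p else 0) = 0" for p using dec_PS[OF v] by auto
qed (auto simp: finite_PS intro: mapply_V)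

lemma FB_iff: "v : FB k \<longleftrightarrow> v : V & (ALL p<k. dec v p = 0)"
 using FB_sum FB_dec by (auto simp: FB_def)

lemma dec_diff: "u : V ==> v : V ==> dec (u - v) = (%p. dec u p - dec v p)"
proof -
 assume uv: "u : V" "v : V"
 have "u - v = u + sc (- 1) v" by (simp add: fun_eq_iff fscale_def)
 then have "dec (u - v) = (%p. dec u p + sc (- 1) (dec v p))"
  using dec_add[OF uv(1) fs.subspace_scale[OF coord_space_subspace uv(2)], of "- 1"] dec_scale[OF uv(2), of "- 1"] by simp
 then show ?thesis by (simp add: fun_eq_iff fscale_def)
qed

lemma dec_eq_0: "v : V ==> (!!p. dec v p = 0) ==> v = 0"
 using dec_sum by (metis (no_types, lifting) sum.neutral)

text \<open>The middle condition enters here: for \<open>p < a\<close> a nonzero component has \<open>w - p >= a\<close>.\<close>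

lemma middle_piece: "v : V ==> p < a ==> w - p < a ==> dec v p = 0"
proof -
 assume v: "v : V" and p: "p < a" "w - p < a"
 \<comment> \<open>As \<open>a\<close> is \<open>w div 2 + 1\<close>, both \<open>p\<close> and
   \<open>w - p\<close> can be below \<open>a\<close> only if they coincide.\<close>
 then have e: "even w" "w div 2 = p" "w - p = p" by presburger+
 have "H p = {0}" using middle[OF e(1)] H_eq[of p] by (simp only: e(2,3))
 then show ?thesis using dec_H[OF v, of p] by simp
qed

lemma Fc_Lo: "v : V ==> ap Fc (ap Lo v) : FB a"
proof -
 assume v: "v : V"
 have "dec (ap Fc (ap Lo v)) p = 0" if "p < a" for p
  using that middle_piece[OF v, of "w - p"] dec_Fc[OF mapply_V[OF Lo_carrier], of v] mapply_0
  by (simp add: dec_Lo[OF v])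
 then show ?thesis by (simp add: FB_iff mapply_V[OF Fc_carrier])
qed

lemma diff_Lo: "v : V ==> v - ap Lo v : FB a"
 unfolding FB_iff using dec_diff[OF _ mapply_V[OF Lo_carrier], of v v] dec_Lo[of v]
  fs.subspace_diff[OF coord_space_subspace _ mapply_V[OF Lo_carrier], of v v] by simp

lemma Lo_FB: "v : FB a ==> ap Lo v = 0"
 by (rule dec_eq_0[OF mapply_V[OF Lo_carrier]]) (simp add: FB_iff dec_Lo)

text \<open>At least one of the indices \<open>p\<close> and \<open>w - p\<close> is below
  \<open>a\<close>. If an eigenvector has no component at one of them it has none at the
  other.\<close>

lemma eigen_FB: "v : FB a ==> ap Fc v = sc b v ==> v = 0"
proof (rule dec_eq_0)
 assume v: "v : FB a" "ap Fc v = sc b v"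
 then show vV: "v : V" by (simp add: FB_iff)
 fix p
 have z: "dec v p = 0" if "p < a" for p using v that by (simp add: FB_iff)
 show "dec v p = 0"
 proof (cases "p < a \<or> w - p < a")
  case False
  then have "a <= p" "a <= w - p" by auto
  then have False by presburger
  then show ?thesis ..
 next
  case True
  moreover have "dec v p = 0" if "w - p < a"
  proof -
   have "ap Fc (dec v p) = dec (ap Fc v) (w - p)" using dec_Fc[OF vV] by simp
   also have "... = 0" unfolding v(2) using dec_scale[OF vV] z[OF that] by (simp add: fscale_simps)
   finally show ?thesis using mapply_Fc_Fc[OF dec_V[OF vV, of p]] mapply_0[of Fc] by simp
  qed
  ultimately show ?thesis using z by blast
 qed
qed

lemma cvec_V: "x : Mspace M ==> cvec x : V"
 by (auto simp: coord_space_def cvec_def)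

lemma mapply_add_vec: "ap (A :: complex mat) (u + v) = ap A u + ap A v"
 using mapply_flinear[of A] by (simp add: flinear_def)

lemma mapply_scale_vec: "ap (A :: complex mat) (sc b v) = sc b (ap A v)"
 using mapply_flinear[of A] by (simp add: flinear_def)

text \<open>The inverse of the period map, made explicit: the part of a vector below
  \<open>a\<close> is completed to an eigenvector by adding \<open>eps\<close> times its image under
  the involution, which lies in \<open>FB a\<close> and disappears in the quotient.\<close>

definition Sec :: "rat => complex mat" where
 "Sec eps = (1\<^sub>m n + of_rat eps \<cdot>\<^sub>m Fc) * Lo * minv c"

lemma Sec_carrier [simp]: "Sec eps : Mat n"
 unfolding Sec_def
 by (intro mult_carrier_mat[of _ n n _ n] add_carrier_mat smult_carrier_mat Fc_carrier Lo_carrier c_carrier)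

lemma mapply_Sec: "v : V ==> ap (Sec eps) v =
  ap Lo (ap (minv c) v) + sc (of_rat eps) (ap Fc (ap Lo (ap (minv c) v)))"
proof -
 let ?A = "1\<^sub>m n + of_rat eps \<cdot>\<^sub>m Fc"
 have A: "?A : Mat n" by (rule add_carrier_mat[OF smult_carrier_mat[OF Fc_carrier]])
 have "ap (Sec eps) v = ap ?A (ap Lo (ap (minv c) v))"
  unfolding Sec_def using mapply_mult[OF mult_carrier_mat[OF A Lo_carrier] c_carrier(2)] mapply_mult[OF A Lo_carrier] by simp
 then show ?thesis
  using mapply_add[OF one_carrier_mat smult_carrier_mat[OF Fc_carrier]] mapply_one[OF mapply_V[OF Lo_carrier]]
  by (simp add: mapply_smult)
qed

text \<open>The difference of the two sides is an eigenvector in \<open>FB a\<close>.\<close>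

lemma Sec_c:
 assumes eps: "eps * eps = 1" and v: "v : cspan (eigenM M eps)"
 shows "ap (Sec eps * c) v = v"
proof -
 have vV: "v : V" and Fv: "ap Fc v = sc (of_rat eps) v" using v eigen_iff[OF eps] by auto
 have "ap (minv c) (ap c v) = v" using mapply_mult[OF c_carrier(2,1), of v] c_carrier(4) mapply_one[OF vV] by simp
 then have s: "ap (Sec eps * c) v = ap Lo v + sc (of_rat eps) (ap Fc (ap Lo v))"
  using mapply_mult[OF Sec_carrier c_carrier(1), of eps v] mapply_Sec[OF mapply_V[OF c_carrier(1)], of eps v] by simp
 let ?x = "(v - ap Lo v) - sc (of_rat eps) (ap Fc (ap Lo v))"
 have x: "?x : FB a"
  by (intro fs.subspace_diff[OF FB_subspace] fs.subspace_scale[OF FB_subspace] diff_Lo Fc_Lo vV)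
 have e2: "of_rat eps * of_rat eps = (1 :: complex)" using eps by (metis of_rat_1 of_rat_mult)
 have "ap Fc ?x = (sc (of_rat eps) v - ap Fc (ap Lo v)) - sc (of_rat eps) (ap Lo v)"
  by (simp only: flinear_diff[OF mapply_flinear] mapply_scale_vec Fv mapply_Fc_Fc[OF mapply_V[OF Lo_carrier]])
 also have "... = sc (of_rat eps) ?x"
  by (simp add: fun_eq_iff fscale_def algebra_simps e2 mult.assoc[symmetric])
 finally have "?x = 0" by (rule eigen_FB[OF x])
 then show ?thesis unfolding s by (simp add: algebra_simps)
qed

lemma Sec_eigen: "eps * eps = 1 ==> v : V ==> ap (Sec eps) v : cspan (eigenM M eps)"
proof -
 assume eps: "eps * eps = 1" and v: "v : V"
 let ?u = "ap Lo (ap (minv c) v)"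
 have e2: "of_rat eps * of_rat eps = (1 :: complex)" using eps by (metis of_rat_1 of_rat_mult)
 have "ap Fc (ap (Sec eps) v) = sc (of_rat eps) (ap (Sec eps) v)"
  unfolding mapply_Sec[OF v] mapply_add_vec mapply_scale_vec mapply_Fc_Fc[OF mapply_V[OF Lo_carrier]]
  by (simp add: fun_eq_iff fscale_def algebra_simps e2 mult.assoc[symmetric])
 then show ?thesis unfolding eigen_iff[OF eps] using mapply_V[OF Sec_carrier] by simp
qed

lemma c_Sec: "v : V ==> ap (c * Sec eps) v - v : cspan Fa"
proof -
 assume v: "v : V"
 let ?m = "ap (minv c) v"
 have mV: "?m : V" by (rule mapply_V[OF c_carrier(2)])
 have cm: "ap c ?m = v" using mapply_mult[OF c_carrier(1,2), of v] c_carrier(3) mapply_one[OF v] by simp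
 let ?y = "sc (of_rat eps) (ap Fc (ap Lo ?m)) - (?m - ap Lo ?m)"
 have "?y : FB a"
  by (intro fs.subspace_diff[OF FB_subspace] fs.subspace_scale[OF FB_subspace] diff_Lo Fc_Lo mV)
 then have "ap c ?y : cspan Fa" by (simp add: FB_def)
 moreover have "ap (c * Sec eps) v - v = ap c ?y"
 proof -
  have "ap (c * Sec eps) v - ap c ?m = ap c (ap (Sec eps) v - ?m)"
   by (simp only: mapply_mult[OF c_carrier(1) Sec_carrier] flinear_diff[OF mapply_flinear])
  also have "ap (Sec eps) v - ?m = ?y" unfolding mapply_Sec[OF v] by (simp add: algebra_simps)
  finally show ?thesis unfolding cm .
 qed
 ultimately show ?thesis by simp
qed

lemma Sec_act: "Sec eps * cmat (actdR M e) = cmat (actB M e) * Sec eps"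
proof (rule mat_eq_of_mapply[of _ n])
 note ca = cmat_carrier[OF mB.rho_carrier] cmat_carrier[OF mdR.rho_carrier]
 show "Sec eps * cmat (actdR M e) : Mat n" by (rule mult_carrier_mat[OF Sec_carrier ca(2)])
 show "cmat (actB M e) * Sec eps : Mat n" by (rule mult_carrier_mat[OF ca(1) Sec_carrier])
 fix v assume v: "v : V"
 let ?R = "cmat (actB M e)"
 have "minv c * cmat (actdR M e) = minv c * (cmat (actdR M e) * (c * minv c))"
  using c_carrier(3) right_mult_one_mat[OF ca(2)] by simp
 also have "... = minv c * (c * ?R * minv c)"
  unfolding c_act using assoc_mult_mat[OF ca(2) c_carrier(1,2)] by simp
 also have "... = ?R * minv c"
  using assoc_mult_mat[OF c_carrier(2) c_carrier(1) mult_carrier_mat[OF ca(1) c_carrier(2)]] assoc_mult_mat[OF c_carrier(1) ca(1) c_carrier(2)]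
   c_carrier(4) left_mult_one_mat[OF mult_carrier_mat[OF ca(1) c_carrier(2)]] by simp
 finally have m: "ap (minv c) (ap (cmat (actdR M e)) v) = ap ?R (ap (minv c) v)"
  using mapply_mult[OF c_carrier(2) ca(2), of e v] mapply_mult[OF ca(1) c_carrier(2), of e v] by simp
 have L: "ap Lo (ap ?R u) = ap ?R (ap Lo u)" if "u : V" for u
  unfolding mapply_Lo[OF mapply_V[OF ca(1)]] mapply_Lo[OF that] dec_act[OF that]
  by (rule flinear_sum[OF mapply_flinear, symmetric])
 have Fr: "ap Fc (ap ?R u) = ap ?R (ap Fc u)" for u
  using mapply_mult[OF Fc_carrier ca(1), of e u] mapply_mult[OF ca(1) Fc_carrier, of e u] Fc_act by simp
 have "ap (Sec eps * cmat (actdR M e)) v = ap (Sec eps) (ap (cmat (actdR M e)) v)" by (rule mapply_mult[OF Sec_carrier ca(2)])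
 also have "... = ap ?R (ap (Sec eps) v)"
  unfolding mapply_Sec[OF mapply_V[OF ca(2)]] mapply_Sec[OF v] m L[OF mapply_V[OF c_carrier(2)]] Fr mapply_add_vec mapply_scale_vec ..
 also have "... = ap (?R * Sec eps) v" by (rule mapply_mult[OF ca(1) Sec_carrier, symmetric])
 finally show "ap (Sec eps * cmat (actdR M e)) v = ap (?R * Sec eps) v" .
qed

text \<open>\<open>Sec\<close> is linear over \<open>E\<close> and inverts the map from the
  eigenspace to the quotient on both sides, so its matrix is inverse to the period matrix. This is
  why the period determinants are units.\<close>

lemma Em_inverse:
 assumes eps: "eps * eps = 1"
 shows "EX B:carrier_mat (length (bs eps)) (length ds). B * Em eps c = 1\<^sub>m (length (bs eps)) & Em eps c * B = 1\<^sub>m (length ds)"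
proof -
 have dsV: "b : set ds ==> cvec b : V" for b using ds cvec_V unfolding E_basis_def by blast
 have bse: "b : set (bs eps) ==> cvec b : cspan (eigenM M eps)" for b using bs cvec_in_cspan unfolding E_basis_def by blast
 then have bsV: "b : set (bs eps) ==> cvec b : V" for b using eigen_iff[OF eps] by blast
 obtain B where B: "E_matrix (actB M) {0} (Sec eps) ds (bs eps) B"
  using eig.E_matrix_exists[OF bs, of ds "Sec eps" eps] Sec_eigen[OF eps dsV] by blast
 have Bc: "B : carrier_mat (length (bs eps)) (length ds)" using B by (simp add: E_matrix_def)
 have Fa0: "ap (Sec eps) (cvec u) : cspan {0}" if u: "u : Fa" for u
 proof -
  have uV: "cvec u : V" using u fil(2) cvec_V by blast
  have "ap Lo (ap (minv c) (cvec u)) = 0" by (rule Lo_FB[OF FB_minv[OF cvec_in_cspan[OF u]]])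
  then show ?thesis unfolding mapply_Sec[OF uV] cspan_zero by (simp only: mapply_0 fscale_simps add_0_left) simp
 qed
 have "E_matrix (actB M) {0} (Sec eps * c) (bs eps) (bs eps) (B * Em eps c)"
  by (rule E_matrix_mult[OF dR.E_space_axioms eig.E_space_axioms Em[OF c_carrier(1)] c_carrier(1) B Sec_carrier Sec_act Fa0])
 moreover have "E_matrix (actB M) {0} (Sec eps * c) (bs eps) (bs eps) (1\<^sub>m (length (bs eps)))"
 proof (rule E_matrix_cong[OF eig.E_matrix_one[OF bs]])
  fix b assume b: "b : set (bs eps)"
  show "ap (1\<^sub>m n) (cvec b) - ap (Sec eps * c) (cvec b) : cspan {0}"
   using Sec_c[OF eps bse[OF b]] mapply_one[OF bsV[OF b]] by (simp add: cspan_zero)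
 qed
 ultimately have 1: "B * Em eps c = 1\<^sub>m (length (bs eps))" by (rule eig.E_matrix_unique[OF bs])
 have "ap c (cvec u) : cspan Fa" if "u : {0}" for u
  using that fs.subspace_0[OF cspan_subspace] by (simp add: cvec_0 mapply_0)
 then have "E_matrix (actdR M) Fa (c * Sec eps) ds ds (Em eps c * B)"
  by (rule E_matrix_mult[OF eig.E_space_axioms[of eps] dR.E_space_axioms B Sec_carrier Em[OF c_carrier(1)] c_carrier(1) c_act])
 moreover have "E_matrix (actdR M) Fa (c * Sec eps) ds ds (1\<^sub>m (length ds))"
 proof (rule E_matrix_cong[OF dR.E_matrix_one[OF ds]])
  fix b assume b: "b : set ds"
  have "- (ap (c * Sec eps) (cvec b) - cvec b) : cspan Fa"
   by (rule fs.subspace_neg[OF cspan_subspace c_Sec[OF dsV[OF b]]])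
  then show "ap (1\<^sub>m n) (cvec b) - ap (c * Sec eps) (cvec b) : cspan Fa"
   using mapply_one[OF dsV[OF b]] by simp
 qed
 ultimately have "Em eps c * B = 1\<^sub>m (length ds)" by (rule dR.E_matrix_unique[OF ds])
 then show ?thesis using 1 Bc by blast
qed

text \<open>The eigenspaces and the quotient have equal rank because the period matrix has a
  two-sided inverse.\<close>

lemma length_bs: "eps * eps = 1 ==> length (bs eps) = length ds"
 using Em_inverse[of eps] rectangular_inverse_le[OF _ Em_carrier] rectangular_inverse_le[OF Em_carrier] by (metis le_antisym)

definition D :: "rat => complex mat => ('e, complex) qtensor" where
 "D eps g = mdet (Em eps g)"

lemma Em_square: "eps * eps = 1 ==> Em eps g : carrier_mat (length ds) (length ds)"
 using Em_carrier[of eps g] by (simp only: length_bs)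

lemma D_unit: "eps * eps = 1 ==> EX y. D eps c * y = 1"
proof -
 assume eps: "eps * eps = 1"
 obtain B where "B : carrier_mat (length ds) (length ds)" "Em eps c * B = 1\<^sub>m (length ds)"
  using Em_inverse[OF eps] length_bs[OF eps] by auto
 then have "D eps c * mdet B = 1" using det_mult[OF Em_square[OF eps]] unfolding D_def by (metis det_one)
 then show ?thesis ..
qed

text \<open>The factor is the determinant of \<open>p\<close> on the quotient by \<open>Fa\<close>;
  it does not depend on \<open>eps\<close>, hence cancels in the ratio.\<close>

lemma D_left:
 assumes p: "p : Mat n" "!!e. p * cmat (actdR M e) = cmat (actdR M e) * p"
  "!!u. u : Fa ==> ap p (cvec u) : cspan Fa"
 shows "EX \<delta>. ALL eps g. eps * eps = 1 --> g : Mat n --> D eps (p * g) = \<delta> * D eps g"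
proof -
 have "ap p (cvec b) : cspan (Mspace M)" for b using mapply_V[OF p(1)] cspan_full[of "{..<n}"] by simp
 then obtain A where A: "E_matrix (actdR M) Fa p ds ds A" using dR.E_matrix_exists[OF ds, of ds p] by blast
 then have Ac: "A : carrier_mat (length ds) (length ds)" by (simp add: E_matrix_def)
 have "D eps (p * g) = mdet A * D eps g" if eps: "eps * eps = 1" and g: "g : Mat n" for eps g
 proof -
  have "E_matrix (actdR M) Fa (p * g) (bs eps) ds (A * Em eps g)"
   by (rule E_matrix_mult[OF dR.E_space_axioms dR.E_space_axioms Em[OF g] g A p(1,2,3)])
  then have "A * Em eps g = Em eps (p * g)" by (rule Em_unique[OF _ mult_carrier_mat[OF p(1) g]])
  then show ?thesis unfolding D_def using det_mult[OF Ac Em_square[OF eps]] by metis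
 qed
 then show ?thesis by blast
qed

lemma eigen_stable:
 assumes eps: "eps * eps = 1" and z: "z : Mat n" "z * Fc = Fc * z" and v: "v : cspan (eigenM M eps)"
 shows "ap z v : cspan (eigenM M eps)"
proof -
 have v': "v : V" "ap Fc v = sc (of_rat eps) v" using v eigen_iff[OF eps] by auto
 have "ap Fc (ap z v) = sc (of_rat eps) (ap z v)"
  using mapply_mult[OF Fc_carrier z(1), of v] mapply_mult[OF z(1) Fc_carrier, of v] z(2) v'(2) by (simp add: mapply_scale_vec)
 then show ?thesis unfolding eigen_iff[OF eps] using mapply_V[OF z(1)] by simp
qed

lemma det_conj:
 fixes P :: "'r::comm_ring_1 mat"
 assumes "P : carrier_mat k k" "Z : carrier_mat k k" "Z' : carrier_mat k k" "P * Z = Z' * P" "mdet P * y = 1"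
 shows "mdet Z = mdet Z'"
proof -
 have "mdet P * mdet Z = mdet P * mdet Z'"
  using arg_cong[OF assms(4), of mdet] det_mult[OF assms(1,2)] det_mult[OF assms(3,1)] by (simp add: mult.commute)
 then have "y * (mdet P * mdet Z) = y * (mdet P * mdet Z')" by simp
 then show ?thesis using assms(5) by (simp add: mult.assoc[symmetric] mult.commute[of y])
qed

lemma pure_unit: "e ~= (0 :: 'e) ==> ptens e 1 * ptens (inverse e) (1 :: complex) = 1"
 by (simp add: pure_tensor_simps)

lemma zero_im: "ap (g :: complex mat) (cvec u) : cspan U" if "u : {0}"
 using that fs.subspace_0[OF cspan_subspace] by (simp add: cvec_0 mapply_0)

text \<open>Passing to another basis conjugates the matrix, so the definite description in
  \<open>chi\<close> is satisfied by exactly one value.\<close>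

lemma chi_matrix:
 assumes eps: "eps * eps = 1" and z: "z : Mat n" "z * Fc = Fc * z" "!!e. z * cmat (actB M e) = cmat (actB M e) * z"
 shows "EX Z. E_matrix (actB M) {0} z (bs eps) (bs eps) Z & chi M eps z = mdet Z"
proof -
 have stable: "ap z (cvec b) : cspan (eigenM M eps)" if "b : set bs'" "E_basis (actB M) (eigenM M eps) {0} bs'" for b bs'
  using eigen_stable[OF eps z(1,2) cvec_in_cspan] that unfolding E_basis_def by blast
 obtain Z where Z: "E_matrix (actB M) {0} z (bs eps) (bs eps) Z" using eig.E_matrix_exists[OF bs stable[OF _ bs]] by blast
 have "mdet Z' = mdet Z"
  if bs': "E_basis (actB M) (eigenM M eps) {0} bs'" and Z': "E_matrix (actB M) {0} z bs' bs' Z'" for bs' Z'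
 proof -
  obtain P e where P: "E_matrix (actB M) {0} (1\<^sub>m n) (bs eps) bs' P" "e ~= 0" "mdet P = ptens e 1"
   and len: "length (bs eps) = length bs'"
   using eig.E_matrix_base_change[OF bs bs'] by (elim conjE exE) (rule that)
  have com: "1\<^sub>m n * cmat (actB M e) = cmat (actB M e) * 1\<^sub>m n" for e
   using left_mult_one_mat[OF cmat_carrier[OF mB.rho_carrier]] right_mult_one_mat[OF cmat_carrier[OF mB.rho_carrier]] by metis
  have "E_matrix (actB M) {0} (1\<^sub>m n * z) (bs eps) bs' (P * Z)"
   by (rule E_matrix_mult[OF eig.E_space_axioms[of eps] eig.E_space_axioms[of eps] Z z(1) P(1) one_carrier_mat com zero_im])
  moreover have "E_matrix (actB M) {0} (z * 1\<^sub>m n) (bs eps) bs' (Z' * P)"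
   by (rule E_matrix_mult[OF eig.E_space_axioms[of eps] eig.E_space_axioms[of eps] P(1) one_carrier_mat Z' z(1,3) zero_im])
  ultimately have "P * Z = Z' * P"
   using eig.E_matrix_unique[OF bs'] z(1) by (simp add: left_mult_one_mat[OF z(1)] right_mult_one_mat[OF z(1)])
  then have "mdet Z = mdet Z'"
   using P(1) Z Z' len pure_unit[OF P(2)] unfolding P(3)[symmetric]
   by (intro det_conj[of P "length bs'"]) (simp_all add: E_matrix_def)
  then show ?thesis ..
 qed
 then have "chi M eps z = mdet Z"
  unfolding chi_def using bs Z by (intro the_equality) blast+
 then show ?thesis using Z by blast
qed

lemma D_right:
 assumes eps: "eps * eps = 1" and z: "z : Mat n" "z * Fc = Fc * z" "!!e. z * cmat (actB M e) = cmat (actB M e) * z"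
  and g: "g : Mat n" "!!e. g * cmat (actB M e) = cmat (actdR M e) * g"
 shows "D eps (g * z) = D eps g * chi M eps z"
proof -
 obtain Z where Z: "E_matrix (actB M) {0} z (bs eps) (bs eps) Z" "chi M eps z = mdet Z"
  using chi_matrix[OF eps z] by blast
 have Zc: "Z : carrier_mat (length ds) (length ds)" using Z(1) length_bs[OF eps] by (simp add: E_matrix_def)
 have "E_matrix (actdR M) Fa (g * z) (bs eps) ds (Em eps g * Z)"
  by (rule E_matrix_mult[OF eig.E_space_axioms[of eps] dR.E_space_axioms Z(1) z(1) Em[OF g(1)] g(1,2) zero_im])
 then have "Em eps g * Z = Em eps (g * z)" by (rule Em_unique[OF _ mult_carrier_mat[OF g(1) z(1)]])
 then show ?thesis unfolding D_def Z(2) using det_mult[OF Em_square[OF eps] Zc] by metis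
qed

lemma D_rat: "eps * eps = 1 ==> EX G. nf.rat_tensor_fun n G & (ALL g:Mat n. D eps g = G g)"
proof -
 assume eps: "eps * eps = 1"
 let ?v = "%g j l. SUM k<n. g $$ (l, k) * cvec (bs eps ! j) k :: complex"
 let ?A = "%g. mat (length ds) (length ds) (%(i, j). SUM l<n. ptens (es l ! i) (?v g j l))"
 have "Em eps g = ?A g" if "g : Mat n" for g
  unfolding Em_def using that length_bs[OF eps] by (intro cong_mat) (simp_all add: mapply_def)
 moreover have "nf.rat_tensor_fun n (%g. mdet (?A g))"
 proof (rule nf.rat_tensor_fun_det[of _ "length ds"])
  fix i j assume "i < length ds" "j < length ds"
  moreover have "nf.rat_tensor_fun n (%g. SUM l<n. ptens (es l ! i) (?v g j l))"
   unfolding cvec_def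
   by (intro nf.rat_tensor_fun_sum nf.rat_tensor_fun_pure rat_polys_sum polys_over.mult[OF polys_over.entry rat_polys_const]) simp_all
  ultimately show "nf.rat_tensor_fun n (%g. ?A g $$ (i, j))" by simp
 qed simp
 ultimately show ?thesis unfolding D_def by (intro exI[of _ "%g. mdet (?A g)"]) simp
qed

lemma D_kap: "eps * eps = 1 ==> bet : Bq ==> EX f:rat_polys n. ALL g:Mat n. nf.kap bet (D eps g) = f g"
proof -
 assume eps: "eps * eps = 1" and bet: "bet : Bq"
 obtain G where G: "nf.rat_tensor_fun n G" "ALL g:Mat n. D eps g = G g" using D_rat[OF eps] by (elim exE conjE) (rule that)
 show ?thesis using G bet unfolding nf.rat_tensor_fun_def by (intro bexI[of _ "%A. nf.kap bet (G A)"]) simp_all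
qed

lemma E_class_mult: "e ~= 0 ==> E_class (x * ptens e 1) = E_class (x :: ('e, complex) qtensor)"
proof -
 assume e: "e ~= 0"
 have "y : E_class (x * ptens e 1) \<longleftrightarrow> y : E_class x" for y
 proof
  assume "y : E_class (x * ptens e 1)"
  then obtain d where "y = x * ptens e 1 * ptens d 1" "d ~= 0" by (auto simp: E_class_def)
  then show "y : E_class x" using e unfolding E_class_def
   by (intro CollectI exI[of _ "e * d"]) (simp add: mult.assoc pure_tensor_simps)
 next
  assume "y : E_class x"
  then obtain d where "y = x * ptens d 1" "d ~= 0" by (auto simp: E_class_def)
  moreover have "ptens e 1 * ptens (inverse e * d) 1 = ptens d (1 :: complex)"
   unfolding pure_tensor_simps(4) using e by (simp add: mult.assoc[symmetric])
  ultimately have "y = x * ptens e 1 * ptens (inverse e * d) 1 & inverse e * d ~= 0"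
   using e by (simp add: mult.assoc)
  then show "y : E_class (x * ptens e 1)" unfolding E_class_def by blast
 qed
 then show ?thesis by blast
qed

text \<open>Changing either basis multiplies the determinant by a unit of \<open>E\<close>, so the
  class can be computed with the chosen \<open>bs\<close> and \<open>ds\<close>.\<close>

lemma period_class_eq: "eps * eps = 1 ==> period_class M eps = E_class (D eps c)"
proof -
 assume eps: "eps * eps = 1"
 have "E_class (mdet A) = E_class (D eps c)"
  if b': "E_basis (actB M) (eigenM M eps) {0} bs'" and d': "E_basis (actdR M) (Mspace M) Fa ds'"
   and len: "length bs' = length ds'" and A: "E_matrix (actdR M) Fa c bs' ds' A" for A bs' ds'
 proof -
  obtain Q e where Q: "E_matrix (actB M) {0} (1\<^sub>m n) bs' (bs eps) Q" "e ~= 0" "mdet Q = ptens e 1"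
   and lb: "length bs' = length (bs eps)"
   using eig.E_matrix_base_change[OF b' bs] by (elim conjE exE) (rule that)
  obtain P d where P: "E_matrix (actdR M) Fa (1\<^sub>m n) ds ds' P" "d ~= 0" "mdet P = ptens d 1"
   and ld: "length ds = length ds'"
   using dR.E_matrix_base_change[OF ds d'] by (elim conjE exE) (rule that)
  have com: "1\<^sub>m n * cmat (actdR M e) = cmat (actdR M e) * 1\<^sub>m n" for e
   using left_mult_one_mat[OF cmat_carrier[OF mdR.rho_carrier]] right_mult_one_mat[OF cmat_carrier[OF mdR.rho_carrier]] by metis
  have 1: "E_matrix (actdR M) Fa (c * 1\<^sub>m n) bs' ds (Em eps c * Q)"
   by (rule E_matrix_mult[OF eig.E_space_axioms[of eps] dR.E_space_axioms Q(1) one_carrier_mat Em[OF c_carrier(1)] c_carrier(1) c_act zero_im])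
  have "E_matrix (actdR M) Fa (1\<^sub>m n * (c * 1\<^sub>m n)) bs' ds' (P * (Em eps c * Q))"
  proof (rule E_matrix_mult[OF dR.E_space_axioms dR.E_space_axioms 1 _ P(1) one_carrier_mat com])
   show "c * 1\<^sub>m n : Mat n" using c_carrier by simp
   show "ap (1\<^sub>m n) (cvec u) : cspan Fa" if "u : Fa" for u
    using that fil(2) mapply_one[OF cvec_V] cvec_in_cspan by (metis subsetD)
  qed
  moreover have "1\<^sub>m n * (c * 1\<^sub>m n) = c" using c_carrier by simp
  ultimately have "A = P * (Em eps c * Q)" using dR.E_matrix_unique[OF d' A] by simp
  then have Am: "A = P * (Em eps c * Q)" "P : carrier_mat (length ds) (length ds)" "Q : carrier_mat (length ds) (length ds)"
   using P(1) Q(1) ld lb length_bs[OF eps] by (simp_all add: E_matrix_def)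
  have "mdet A = ptens d 1 * (D eps c * ptens e 1)"
   unfolding Am(1) det_mult[OF Am(2) mult_carrier_mat[OF Em_square[OF eps] Am(3)]] det_mult[OF Em_square[OF eps] Am(3)] P(3) Q(3) D_def ..
  also have "... = D eps c * (ptens d 1 * ptens e 1)" by (simp only: mult_ac)
  also have "... = D eps c * ptens (d * e) 1" by (simp only: pure_tensor_simps(4) mult_1_right)
  finally show ?thesis using E_class_mult[of "d * e"] P(2) Q(2) by simp
 qed
 note all = this
 show ?thesis
 proof
  show "period_class M eps <= E_class (D eps c)" unfolding period_class_def Let_def using all by blast
  show "E_class (D eps c) <= period_class M eps" unfolding period_class_def Let_def D_def
   using bs[of eps] ds length_bs[OF eps] Em[OF c_carrier(1), of eps] by blast
 qed
qed

text \<open>The chosen \<open>y\<close> is the inverse of \<open>D (- 1) c\<close>, which exists by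
  \<open>D_unit\<close>.\<close>

definition ratio :: "('e, complex) qtensor" where
 "ratio = D 1 c * (SOME y. D (- 1) c * y = 1)"

lemma ratio: "ratio * D (- 1) c = D 1 c"
proof -
 have "EX y. D (- 1) c * y = 1" by (rule D_unit) simp
 from someI_ex[OF this] have 1: "D (- 1) c * (SOME y. D (- 1) c * y = 1) = 1" .
 have "ratio * D (- 1) c = D 1 c * (D (- 1) c * (SOME y. D (- 1) c * y = 1))" unfolding ratio_def by (simp only: mult_ac)
 then show ?thesis unfolding 1 by simp
qed

lemma D_cancel: "D (- 1) c * x = D (- 1) c * y ==> x = y"
proof -
 assume eq: "D (- 1) c * x = D (- 1) c * y"
 obtain z where z: "D (- 1) c * z = 1" using D_unit[of "- 1"] by auto
 have "z * (D (- 1) c * x) = z * (D (- 1) c * y)" unfolding eq ..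
 then show ?thesis using z by (simp add: mult.assoc[symmetric] mult.commute[of z])
qed

lemma period_ratio_eq: "period_ratio M = E_class ratio"
proof (intro equalityI subsetI)
 fix u assume "u : period_ratio M"
 then obtain x y where xy: "x : E_class (D 1 c)" "y : E_class (D (- 1) c)" "u * y = x"
  unfolding period_ratio_def by (auto simp: period_class_eq)
 then obtain d e where de: "x = D 1 c * ptens d 1" "y = D (- 1) c * ptens e 1" "d ~= 0" "e ~= 0" by (auto simp: E_class_def)
 have pd: "ptens d 1 * ptens (inverse e) 1 = ptens (d * inverse e) (1 :: complex)" by (simp add: pure_tensor_simps)
 have "D (- 1) c * u = D (- 1) c * u * (ptens e 1 * ptens (inverse e) 1)" using pure_unit[OF de(4)] by simp
 also have "... = (u * y) * ptens (inverse e) 1" unfolding de(2) by (simp only: mult_ac)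
 also have "... = D 1 c * ptens d 1 * ptens (inverse e) 1" unfolding xy(3) de(1) ..
 also have "... = D (- 1) c * (ratio * ptens (d * inverse e) 1)"
  unfolding ratio[symmetric] pd[symmetric] by (simp only: mult_ac)
 finally have "u = ratio * ptens (d * inverse e) 1" by (rule D_cancel)
 then show "u : E_class ratio" using de(3,4) unfolding E_class_def by (intro CollectI exI[of _ "d * inverse e"]) simp
next
 fix u assume "u : E_class ratio"
 then obtain e where e: "u = ratio * ptens e 1" "e ~= 0" unfolding E_class_def by blast
 have pc: "period_class M 1 = E_class (D 1 c)" "period_class M (- 1) = E_class (D (- 1) c)"
  by (rule period_class_eq, simp)+
 have "D 1 c * ptens e 1 : period_class M 1" unfolding pc E_class_def using e(2) by blast
 moreover have "D (- 1) c * ptens 1 1 : period_class M (- 1)" unfolding pc E_class_def using one_neq_zero by blast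
 moreover have "u * (D (- 1) c * ptens 1 1) = D 1 c * ptens e 1"
  unfolding e(1) ratio[symmetric] pure_tensor_simps(5) mult_1_right by (simp only: mult_ac)
 ultimately show "u : period_ratio M" unfolding period_ratio_def by blast
qed

end

section \<open>The ratio of periods is constant on the component of the comparison\<close>

text \<open>The negative part equals minus the rest, so it has no pole at 0, and in
  \<open>inverse t\<close> it is divisible by \<open>t\<close>. Hence it is constant with value 0;
  at \<open>t = 1\<close> it is the sum in question.\<close>

lemma laurent_negative_part:
 fixes k :: "'i => int" and x :: "'i => complex"
 assumes "finite I" and z: "!!t. t ~= 0 ==> (SUM i:I. t powi k i * x i) = 0"
 shows "(SUM i:{i:I. k i < 0}. x i) = 0"
proof -
 let ?f = "%t. SUM i:{i:I. k i < 0}. x i * t powi k i" and ?g = "%t. SUM i:{i:I. ~ k i < 0}. x i * t powi k i"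
 have "?f t + ?g t = 0" if "t ~= 0" for t
  using z[OF that] assms(1)
  by (subst sum.union_disjoint[symmetric]) (auto simp: mult.commute intro!: sum.cong elim!: HOL.trans[rotated])
 then have fg: "?f t = - 1 * ?g t" if "t ~= 0" for t using that by (simp add: eq_neg_iff_add_eq_0)
 have g: "pord 0 (%t. - 1 * ?g t)"
  by (intro pord_cmult pord_sum) (auto intro!: pord_mono[OF pord_powi])
 then have 1: "pord 0 ?f" using fg unfolding pord_def by simp
 have "pord 1 (%t. SUM i:{i:I. k i < 0}. x i * t powi (- k i))"
  by (intro pord_cmult pord_sum) (auto intro!: pord_mono[OF pord_powi])
 then have 2: "pord 1 (%t. ?f (inverse t))" by (simp add: power_int_minus power_int_inverse)
 have const: "?f t = ?f 1" if "t ~= 0" for t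
  using pord_both[OF 1 _ that] pord_mono[OF 2, of 0] by simp
 obtain P where P: "!!t. t ~= 0 ==> ?f (inverse t) = t * poly P t" using 2 unfolding pord_def by auto
 have "poly ([:0, 1:] * P - [:?f 1:]) t = 0" if "t ~= 0" for t
  using P[OF that] const[of "inverse t"] that by simp
 then have "UNIV - {0} <= {t. poly ([:0, 1:] * P - [:?f 1:]) t = 0}" by auto
 moreover have "infinite (UNIV - {0 :: complex})" by (simp add: infinite_UNIV_char_0)
 ultimately have "[:0, 1:] * P - [:?f 1:] = 0" using poly_roots_finite finite_subset by blast
 from arg_cong[OF this, of "%p. poly p 0"] show ?thesis by simp
qed

lemma conj_entry:
 fixes g B h :: "complex mat"
 assumes "g : Mat n" "B : Mat n" "h : Mat n" "i < n" "j < n"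
 shows "(g * B * h) $$ (i, j) = (SUM p:{..<n} \<times> {..<n}. g $$ (i, fst p) * h $$ (snd p, j) * B $$ p)"
proof -
 have "(g * B * h) $$ (i, j) = (SUM m<n. SUM k<n. g $$ (i, k) * B $$ (k, m) * h $$ (m, j))"
  using mult_mat_entry[OF mult_carrier_mat[OF assms(1,2)] assms(3-5)] mult_mat_entry[OF assms(1,2,4)]
  by (simp add: sum_distrib_right del: index_mult_mat(1))
 also have "... = (SUM k<n. SUM m<n. g $$ (i, k) * B $$ (k, m) * h $$ (m, j))" by (rule sum.swap)
 also have "... = (SUM p:{..<n} \<times> {..<n}. g $$ (i, fst p) * h $$ (snd p, j) * B $$ p)"
  unfolding sum.cartesian_product by (intro sum.cong HOL.refl) (simp only: case_prod_unfold prod.collapse mult_ac)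
 finally show ?thesis .
qed

lemma minus_plus_mat:
 fixes X Y Z :: "complex mat"
 shows "X : Mat n ==> Y : Mat n ==> Z : Mat n ==> X - Y - Z + (Y + Z) = X"
 by (intro eq_matI) auto

lemma tangentD: "X : tangent n G ==> X : Mat n" "X : tangent n G ==> l : conormal n G ==> lin_form n l X = 0"
 by (simp_all add: tangent_def)

lemma tangent_add: "X : tangent n G ==> Y : tangent n G ==> X + Y : tangent n G"
 by (simp add: tangent_def lin_form_add)

lemma tangent_diff: "X : tangent n G ==> Y : tangent n G ==> X - Y : tangent n G"
 by (simp add: tangent_def lin_form_diff minus_carrier_mat)

text \<open>Conjugation pulls equations of \<open>G\<close> back to equations of \<open>G\<close>,
  and being linear it preserves the order of the remainder.\<close>

lemma tangent_conj:
 assumes G: "G <= Mat n" "1\<^sub>m n : G" and g: "g : Mat n" "h : Mat n" "g * h = 1\<^sub>m n"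
  and stable: "!!A. A : G ==> g * A * h : G" and X: "X : tangent n G"
 shows "g * X * h : tangent n G"
 unfolding tangent_def
proof (intro CollectI conjI ballI)
 have Xc: "X : Mat n" by (rule tangentD[OF X])
 show "g * X * h : Mat n" using g Xc by simp
 fix l assume "l : conormal n G"
 then obtain f Q where f: "f : vanishing n G" and Q: "hp n 2 Q"
  "ALL A:Mat n. f A = lin_form n l (A - 1\<^sub>m n) + Q (A, A - 1\<^sub>m n)"
  unfolding conormal_def by (elim CollectE conjE bexE exE) (rule that)
 have ent: "EX e:mat_polys n. ALL A:Mat n. e A = (g * A * h) $$ (i, j)" if "i < n" "j < n" for i j
  by (rule bexI[of _ "%A. SUM p:{..<n} \<times> {..<n}. g $$ (i, fst p) * h $$ (snd p, j) * A $$ p"])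
   (auto simp: conj_entry[OF g(1) _ g(2) that] simp del: index_mult_mat(1) intro!: mat_polys_sum mat_polys_cmult mat_polys.entry)
 have "f : mat_polys n" using f by (simp add: vanishing_def)
 then have "EX f':mat_polys n. ALL A:Mat n. f' A = f (g * A * h)" by (rule mat_polys_subst) (rule ent)
 then obtain f' where f': "f' : mat_polys n" "ALL A:Mat n. f' A = f (g * A * h)"
  by (elim bexE) (rule that)
 have f'v: "f' : vanishing n G" using f' f stable G(1) by (auto simp: vanishing_def)
 let ?D = "Mat n \<times> Mat n"
 have "EX Q'. hp n 2 Q' & (ALL p:?D. Q' p = Q (g * fst p * h, g * snd p * h))"
 proof (rule hp_subst[OF Q(1)])
  fix i j assume ij: "i < n" "j < n"
  show "EX e. hp n 0 e & (ALL p:?D. e p = (g * fst p * h) $$ (i, j))"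
   by (rule exI[of _ "%q. SUM p:{..<n} \<times> {..<n}. g $$ (i, fst p) * h $$ (snd p, j) * fst q $$ p"])
    (auto simp: conj_entry[OF g(1) _ g(2) ij] simp del: index_mult_mat(1) intro!: hp_sum hp_cmult hp.fst)
  show "EX e. hp n 1 e & (ALL p:?D. e p = (g * snd p * h) $$ (i, j))"
   by (rule exI[of _ "%q. SUM p:{..<n} \<times> {..<n}. g $$ (i, fst p) * h $$ (snd p, j) * snd q $$ p"])
    (auto simp: conj_entry[OF g(1) _ g(2) ij] simp del: index_mult_mat(1) intro!: hp_sum hp_cmult hp.snd)
 qed
 then obtain Q' where Q': "hp n 2 Q'" "ALL p:?D. Q' p = Q (g * fst p * h, g * snd p * h)" by (elim exE conjE) (rule that)
 define l' where "l' = (%p. SUM q:{..<n} \<times> {..<n}. l q * (g $$ (fst q, fst p) * h $$ (snd p, snd q)))"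
 have l': "lin_form n l (g * B * h) = lin_form n l' B" if B: "B : Mat n" for B
 proof -
  have "lin_form n l (g * B * h) = (SUM q:{..<n} \<times> {..<n}. SUM p:{..<n} \<times> {..<n}. l q * (g $$ (fst q, fst p) * h $$ (snd p, snd q)) * B $$ p)"
   unfolding lin_form_def
  proof (rule sum.cong[OF HOL.refl])
   fix q :: "nat \<times> nat" assume "q : {..<n} \<times> {..<n}"
   then have q: "fst q < n" "snd q < n" by auto
   show "l q * (g * B * h) $$ q = (SUM p:{..<n} \<times> {..<n}. l q * (g $$ (fst q, fst p) * h $$ (snd p, snd q)) * B $$ p)"
    using conj_entry[OF g(1) B g(2) q] by (simp add: sum_distrib_left mult.assoc del: index_mult_mat(1))
  qed
  also have "... = lin_form n l' B" unfolding lin_form_def l'_def by (subst sum.swap) (simp add: sum_distrib_right)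
  finally show ?thesis .
 qed
 have "f' A = f' (1\<^sub>m n) + lin_form n l' (A - 1\<^sub>m n) + Q' (A, A - 1\<^sub>m n)" if A: "A : Mat n" for A
 proof -
  have A1: "A - 1\<^sub>m n : Mat n" using A by (simp add: minus_carrier_mat)
  have "g * (A - 1\<^sub>m n) * h = g * A * h - 1\<^sub>m n"
   using g A by (simp add: mult_minus_distrib_mat[OF g(1) A one_carrier_mat] minus_mult_distrib_mat[OF mult_carrier_mat[OF g(1) A] g(1) g(2)])
  then have "f (g * A * h) = lin_form n l' (A - 1\<^sub>m n) + Q' (A, A - 1\<^sub>m n)"
   using bspec[OF Q(2), of "g * A * h"] bspec[OF Q'(2), of "(A, A - 1\<^sub>m n)"] l'[OF A1] g A A1 by simp
  moreover have "f' (1\<^sub>m n) = 0" using f'v G(2) by (simp add: vanishing_def)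
  ultimately show ?thesis using bspec[OF f'(2) A] by simp
 qed
 then have "lin_form n l' X = 0" by (intro conormal_of_vanishing[OF f'v G(2) Q'(1) _ X] ballI)
 then show "lin_form n l (g * X * h) = 0" using l'[OF Xc] by simp
qed

section \<open>The tangent space of the structure group\<close>

context bdr
begin

lemma GB_carrier: "GB M S <= Mat n"
 using TS.iso_GL GL_minv(1) unfolding GB_iso by blast

lemma GB_mult: "g : GB M S ==> h : GB M S ==> g * h : GB M S"
 using TS.iso_mult unfolding GB_iso by blast

lemma GB_one: "1\<^sub>m n : GB M S"
 unfolding GB_iso by (rule TS.iso_one)

lemma tangent_conj_GB:
 assumes "g : GB M S" "X : tangent n (GB M S)"
 shows "g * X * minv g : tangent n (GB M S)"
proof -
 have g: "g : GL n" using assms(1) TS.iso_GL unfolding GB_iso by blast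
 have "minv g : GB M S" using assms(1) TS.iso_minv unfolding GB_iso by blast
 then show ?thesis
  using assms by (intro tangent_conj[OF GB_carrier GB_one GL_minv(1-3)[OF g]] GB_mult)
qed

text \<open>The part of \<open>X\<close> that lowers the Hodge degree, which is what obstructs
  stability of the filtration.\<close>

definition lower :: "complex mat => complex mat" where
 "lower X = mat n n (%ij. SUM pq:{pq:PS \<times> PS. fst pq < snd pq}. 1 * (Pm (fst pq) * X * Pm (snd pq)) $$ ij)"

lemma lower_carrier [simp]: "lower X : Mat n"
 by (simp add: lower_def)

lemma Pm_conj_carrier: "X : Mat n ==> Pm p * X * Pm q : Mat n"
 using Pm(1)[of p] Pm(1)[of q] by simp

lemma mapply_Pm_conj: "X : Mat n ==> v : V ==> ap (Pm p * X * Pm q) v = dec (ap X (dec v q)) p"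
 by (simp add: mapply_mult[OF mult_carrier_mat[OF Pm(1)] Pm(1)] mapply_mult[OF Pm(1)] Pm(2) mapply_V)

lemma lin_form_sum:
 "lin_form n l (mat n n (%ij. SUM i:I. x i * A i $$ ij)) = (SUM i:I. x i * lin_form n l (A i))"
proof -
 have "lin_form n l (mat n n (%ij. SUM i:I. x i * A i $$ ij)) = (SUM p:{..<n} \<times> {..<n}. SUM i:I. x i * (l p * A i $$ p))"
  unfolding lin_form_def by (intro sum.cong) (auto simp: sum_distrib_left mult_ac)
 also have "... = (SUM i:I. SUM p:{..<n} \<times> {..<n}. x i * (l p * A i $$ p))" by (rule sum.swap)
 finally show ?thesis unfolding lin_form_def by (simp add: sum_distrib_left)
qed

lemma mu_conj:
 assumes X: "X : Mat n" and t: "t ~= 0"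
 shows "mu t * X * mu (inverse t) = mat n n (%ij. SUM pq:PS \<times> PS. t powi (fst pq - snd pq) * (Pm (fst pq) * X * Pm (snd pq)) $$ ij)"
  (is "?l = ?r")
proof (rule mat_eq_of_mapply[of _ n])
 show "?l : Mat n" by (intro mult_carrier_mat[of _ n n _ n] mu_carrier X)
 show "?r : Mat n" by simp
 fix v assume v: "v : V"
 have "ap ?l v = ap (mu t) (ap X (SUM q:PS. sc (inverse t powi q) (dec v q)))"
  unfolding mapply_mu[OF v, symmetric]
  by (simp add: mapply_mult[OF mult_carrier_mat[OF mu_carrier X] mu_carrier] mapply_mult[OF mu_carrier X])
 also have "... = (SUM q:PS. sc (inverse t powi q) (ap (mu t) (ap X (dec v q))))"
  by (simp only: flinear_sum[OF mapply_flinear] mapply_scale_vec)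
 also have "... = (SUM q:PS. sc (inverse t powi q) (SUM p:PS. sc (t powi p) (dec (ap X (dec v q)) p)))"
  by (intro sum.cong HOL.refl) (simp only: mapply_mu[OF mapply_V[OF X]])
 also have "... = (SUM q:PS. SUM p:PS. sc (t powi (p - q)) (dec (ap X (dec v q)) p))"
  using t by (intro sum.cong HOL.refl) (simp add: fs.scale_sum_right power_int_diff power_int_inverse divide_inverse mult.commute)
 also have "... = (SUM pq:PS \<times> PS. sc (t powi (fst pq - snd pq)) (ap (Pm (fst pq) * X * Pm (snd pq)) v))"
  unfolding mapply_Pm_conj[OF X v] by (subst sum.swap) (simp add: sum.cartesian_product case_prod_unfold)
 also have "... = ap ?r v" by (rule mapply_mat_sum[OF Pm_conj_carrier[OF X], symmetric])
 finally show "ap ?l v = ap ?r v" .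
qed

text \<open>Conjugation by \<open>mu t\<close> keeps \<open>X\<close> tangent and multiplies its
  part from \<open>H q\<close> to \<open>H p\<close> by \<open>t powi (p - q)\<close>. A conormal
  form thus gives a Laurent polynomial that is identically 0, and its negative part belongs to
  \<open>lower X\<close>.\<close>

lemma lower_tangent:
 assumes X: "X : tangent n (GB M S)"
 shows "lower X : tangent n (GB M S)"
 unfolding tangent_def
proof (intro CollectI conjI ballI lower_carrier)
 note Xc = tangentD(1)[OF X]
 fix l assume l: "l : conormal n (GB M S)"
 have "(SUM pq:PS \<times> PS. t powi (fst pq - snd pq) * lin_form n l (Pm (fst pq) * X * Pm (snd pq))) = 0" if t: "t ~= 0" for t
  using tangentD(2)[OF tangent_conj_GB[OF mu_GB[OF t] X] l] mu_GL[OF t] mu_conj[OF Xc t] by (simp only: lin_form_sum)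
 from laurent_negative_part[OF _ this]
 have "(SUM pq:{pq:PS \<times> PS. fst pq - snd pq < 0}. lin_form n l (Pm (fst pq) * X * Pm (snd pq))) = 0"
  using finite_cartesian_product[OF finite_PS finite_PS] by simp
 moreover have "{pq:PS \<times> PS. fst pq - snd pq < 0} = {pq:PS \<times> PS. fst pq < snd pq}" by auto
 ultimately show "lin_form n l (lower X) = 0"
  using lin_form_sum[of l "%_. 1" "%pq. Pm (fst pq) * X * Pm (snd pq)" "{pq:PS \<times> PS. fst pq < snd pq}"]
  by (simp add: lower_def del: index_mult_mat)
qed

lemma mapply_lower:
 assumes X: "X : Mat n" and v: "v : V"
 shows "ap (lower X) v = (SUM pq:{pq:PS \<times> PS. fst pq < snd pq}. dec (ap X (dec v (snd pq))) (fst pq))"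
 unfolding lower_def mapply_mat_sum[OF Pm_conj_carrier[OF X]] by (simp only: mapply_Pm_conj[OF X v] fscale_simps)

lemma dec_lower:
 assumes X: "X : Mat n" and v: "v : V"
 shows "dec (ap (lower X) v) p = (SUM q:{q:PS. p < q}. dec (ap X (dec v q)) p)"
proof -
 let ?h = "%p. SUM q:{q:PS. p < q}. dec (ap X (dec v q)) p"
 have "dec (ap (lower X) v) = ?h"
 proof (rule dec_unique[of _ _ PS])
  show "ap (lower X) v : V" by (rule mapply_V[OF lower_carrier])
  show "?h p : H p" for p by (intro fs.subspace_sum[OF H_subspace] dec_H mapply_V[OF X])
  show "finite PS" by (rule finite_PS)
  show "p ~: PS ==> ?h p = 0" for p by (intro sum.neutral ballI dec_PS mapply_V[OF X])
  have I: "{pq:PS \<times> PS. fst pq < snd pq} = (SIGMA p:PS. {q:PS. p < q})" by auto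
  show "ap (lower X) v = (SUM p:PS. ?h p)"
   unfolding mapply_lower[OF X v] I using finite_PS by (subst sum.Sigma) (simp_all add: case_prod_unfold)
 qed
 then show ?thesis by simp
qed

lemma dec_mapply:
 assumes X: "X : Mat n" and v: "v : V"
 shows "dec (ap X v) p = (SUM q:PS. dec (ap X (dec v q)) p)"
proof -
 have "ap X v = (SUM q:PS. ap X (dec v q))"
  by (subst dec_sum[OF v]) (simp only: flinear_sum[OF mapply_flinear])
 then have "ap (Pm p) (ap X v) = (SUM q:PS. ap (Pm p) (ap X (dec v q)))"
  by (simp only: flinear_sum[OF mapply_flinear])
 then show ?thesis by (simp only: Pm(2)[OF mapply_V[OF X]])
qed

text \<open>The tangent space is the sum of the part preserving the Hodge filtration and of the part fixed
 by the involution, which brings the strictly lower triangular part of \<open>X\<close> back.\<close>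

lemma tangent_decomposition:
 assumes X: "X : tangent n (GB M S)"
 obtains A B where "A : tangent n (GB M S)" "B : tangent n (GB M S)" "A + B = X" "B * Fc = Fc * B"
  "ALL v:FB a. ap A v : FB a"
proof -
 note Xc = tangentD(1)[OF X]
 \<comment> \<open>Conjugation by the involution turns lowering the degree into raising it. So
   \<open>?L + ?T\<close> commutes with the involution, while \<open>X - ?L - ?T\<close> has no part
   left that lowers the degree.\<close>
 let ?L = "lower X" and ?T = "Fc * lower X * Fc"
 have L: "?L : tangent n (GB M S)" by (rule lower_tangent[OF X])
 have T: "?T : tangent n (GB M S)" using tangent_conj_GB[OF Fc_GB L] Fc_GL(2) by simp
 note Lc = tangentD(1)[OF L] and Tc = tangentD(1)[OF T]
 note FL = mult_carrier_mat[OF Fc_carrier Lc] and LF = mult_carrier_mat[OF Lc Fc_carrier]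
 have XL: "X - ?L : Mat n" using Lc by (simp add: minus_carrier_mat)
 show thesis
 proof (rule that[of "X - ?L - ?T" "?L + ?T"])
  show "X - ?L - ?T : tangent n (GB M S)" by (intro tangent_diff X L T)
  show "?L + ?T : tangent n (GB M S)" by (intro tangent_add L T)
  show "X - ?L - ?T + (?L + ?T) = X" by (rule minus_plus_mat[OF Xc Lc Tc])
  have 1: "?T * Fc = Fc * ?L" using assoc_mult_mat[OF FL Fc_carrier Fc_carrier] Fc_square right_mult_one_mat[OF FL] by simp
  have 2: "Fc * ?T = ?L * Fc"
   using assoc_mult_mat[OF Fc_carrier Lc Fc_carrier] assoc_mult_mat[OF Fc_carrier Fc_carrier LF, symmetric] Fc_square left_mult_one_mat[OF LF] by simp
  have "(?L + ?T) * Fc = ?L * Fc + Fc * ?L" using add_mult_distrib_mat[OF Lc Tc Fc_carrier] 1 by simp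
  also have "... = Fc * ?L + ?L * Fc" using FL LF by (intro comm_add_mat)
  also have "... = Fc * (?L + ?T)" using mult_add_distrib_mat[OF Fc_carrier Lc Tc] 2 by simp
  finally show "(?L + ?T) * Fc = Fc * (?L + ?T)" .
  show "ALL v:FB a. ap (X - ?L - ?T) v : FB a"
  proof
  fix v assume v: "v : FB a"
  then have vV: "v : V" and dv: "!!p. p < a ==> dec v p = 0" by (auto simp: FB_iff)
  have Fv: "ap Fc v : V" by (rule mapply_V[OF Fc_carrier])
  have "dec (ap X v - ap ?L v) p = 0" if p: "p < a" for p
  proof -
   have "(SUM q:PS. dec (ap X (dec v q)) p) = (SUM q:{q:PS. p < q}. dec (ap X (dec v q)) p)"
   proof (rule sum.mono_neutral_right[OF finite_PS])
    show "ALL q:PS - {q : PS. p < q}. dec (ap X (dec v q)) p = 0"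
    proof
     fix q assume "q : PS - {q : PS. p < q}"
     then have "dec v q = 0" using p dv by auto
     then have "ap X (dec v q) = 0" by (simp only: mapply_0)
     then show "dec (ap X (dec v q)) p = 0" using dec_scale[OF mapply_V[OF Xc], of 0 "dec v q"] by (simp add: fscale_simps)
    qed
   qed auto
   then show ?thesis unfolding dec_diff[OF mapply_V[OF Xc] mapply_V[OF Lc]] dec_lower[OF Xc vV] dec_mapply[OF Xc vV] by simp
  qed
  then have 3: "ap X v - ap ?L v : FB a"
   unfolding FB_iff using fs.subspace_diff[OF coord_space_subspace mapply_V[OF Xc] mapply_V[OF Lc]] by blast
  have "dec (ap Fc (ap ?L (ap Fc v))) p = 0" if p: "p < a" for p
  proof -
   have "dec (ap ?L (ap Fc v)) (w - p) = 0"
    unfolding dec_lower[OF Xc Fv]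
   proof (intro sum.neutral ballI)
    fix q assume "q : {q : PS. w - p < q}"
    then have "dec v (w - q) = 0" using p by (intro dv) auto
    then have "dec (ap Fc v) q = 0" unfolding dec_Fc[OF vV] by (simp only: mapply_0)
    then have "ap X (dec (ap Fc v) q) = 0" by (simp only: mapply_0)
    then show "dec (ap X (dec (ap Fc v) q)) (w - p) = 0"
     using dec_scale[OF mapply_V[OF Xc], of 0 "dec (ap Fc v) q"] by (simp add: fscale_simps)
   qed
   then show ?thesis unfolding dec_Fc[OF mapply_V[OF Lc]] by (simp only: mapply_0)
  qed
  then have 4: "ap Fc (ap ?L (ap Fc v)) : FB a"
   unfolding FB_iff using mapply_V[OF Fc_carrier] by blast
  have "ap (X - ?L - ?T) v = (ap X v - ap ?L v) - ap Fc (ap ?L (ap Fc v))"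
   using mapply_minus[OF XL Tc] mapply_minus[OF Xc Lc] mapply_mult[OF FL Fc_carrier] mapply_mult[OF Fc_carrier Lc] by simp
  then show "ap (X - ?L - ?T) v : FB a" using fs.subspace_diff[OF FB_subspace 3 4] by simp
  qed
 qed
qed

lemma mexp_GL: "X : Mat n ==> mexp n X t : GL n"
 using GL_I(1)[OF mexp_carrier mexp_carrier mexp_inverse[of X n t]] mexp_inverse[of X n "- t"] by simp

lemma mexp_GB: "X : tangent n (GB M S) ==> mexp n X t : GB M S"
proof -
 assume X: "X : tangent n (GB M S)"
 have "ALL A:GB M S. ALL B:GB M S. A * B : GB M S" using GB_mult by blast
 note v = vanishing_mexp[OF GB_carrier GB_one this X]
 show ?thesis unfolding GB_iso
  by (rule TS.iso_closed[OF mexp_GL[OF tangentD(1)[OF X]]]) (rule v[unfolded GB_iso])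
qed

text \<open>\<open>Lo\<close> has kernel \<open>FB a\<close>, so stability of \<open>FB a\<close>
  under \<open>A\<close> makes \<open>Lo\<close> intertwine \<open>A\<close> with
  \<open>Lo * A\<close>; this passes to exponentials.\<close>

lemma mexp_FB:
 assumes A: "A : Mat n" "!!v. v : FB a ==> ap A v : FB a" and v: "v : FB a"
 shows "ap (mexp n A t) v : FB a"
proof -
 note LA = mult_carrier_mat[OF Lo_carrier A(1)]
 have "Lo * A * Lo = Lo * A"
 proof (rule mat_eq_of_mapply[of _ n])
  fix u :: "nat => complex" assume u: "u : V"
  have "ap Lo (ap A (u - ap Lo u)) = 0" by (intro Lo_FB A(2) diff_Lo u)
  then have "ap Lo (ap A u) - ap Lo (ap A (ap Lo u)) = 0"
   by (simp only: flinear_diff[OF mapply_flinear])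
  then show "ap (Lo * A * Lo) u = ap (Lo * A) u"
   by (simp add: mapply_mult[OF LA Lo_carrier] mapply_mult[OF Lo_carrier A(1)])
 qed (use LA in auto)
 from mexp_intertwine[OF A(1) LA Lo_carrier this, of t]
 have "ap Lo (ap (mexp n A t) v) = ap (mexp n (Lo * A) t) (ap Lo v)"
  using mapply_mult[OF mexp_carrier Lo_carrier, of "Lo * A" t v] mapply_mult[OF Lo_carrier mexp_carrier, of A t v] by simp
 then have "ap Lo (ap (mexp n A t) v) = 0" unfolding Lo_FB[OF v] by (simp only: mapply_0)
 then show ?thesis using diff_Lo[OF mapply_V[OF mexp_carrier], of A t v] by simp
qed

lemma torsor_GL: "g : torsor M S ==> g : GL n"
 using TS.iso_GL unfolding torsor_iso by blast

lemma torsor_mult: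
 "g : torsor M S ==> h : GB M S ==> g * h : torsor M S"
 "p : GdR M S ==> g : torsor M S ==> p * g : torsor M S"
 using TS.iso_mult unfolding torsor_iso GB_iso GdR_iso by blast+

lemma torsor_quotient:
 "g : torsor M S ==> h : torsor M S ==> h * minv g : GdR M S"
 "g : torsor M S ==> h : torsor M S ==> minv g * h : GB M S"
 using TS.iso_mult TS.iso_minv unfolding torsor_iso GB_iso GdR_iso by blast+

lemma torsor_carrier: "torsor M S <= Mat n"
 using torsor_GL GL_minv(1) by blast

lemma D_right_Zfrob:
 "eps * eps = 1 ==> z : Zfrob M S ==> g : torsor M S ==> D eps (g * z) = D eps g * chi M eps z"
proof (rule D_right)
 assume z: "z : Zfrob M S" and g: "g : torsor M S"
 show "z : Mat n" "z * Fc = Fc * z" "g : Mat n"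
  using z GB_carrier g torsor_carrier by (auto simp: Zfrob_def)
 show "z * cmat (actB M e) = cmat (actB M e) * z" for e using z by (intro E_linear) (simp add: Zfrob_def)
 show "g * cmat (actB M e) = cmat (actdR M e) * g" for e using g by (intro E_linear) simp
qed

text \<open>Moved to the left of \<open>c\<close>, the factor \<open>mexp n A t\<close> becomes an
  element preserving \<open>Fa\<close>. The factor \<open>mexp n B t\<close> commutes with the
  involution and is joined to the identity by a curve in \<open>Zfrob\<close>, so only the identity
  component enters.\<close>

lemma D_curve:
 assumes chi: "!!z. z : frob_identity_component M S ==> chi M 1 z = chi M (- 1) z"
  and A: "A : tangent n (GB M S)" "!!v. v : FB a ==> ap A v : FB a"
  and B: "B : tangent n (GB M S)" "B * Fc = Fc * B"
 shows "D 1 (c * (mexp n A t * mexp n B t)) = ratio * D (- 1) (c * (mexp n A t * mexp n B t))"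
proof -
 let ?x = "mexp n A t" and ?z = "%t. mexp n B t"
 note Ac = tangentD(1)[OF A(1)] and Bc = tangentD(1)[OF B(1)]
 let ?p = "c * ?x * minv c"
 have xG: "?x : GB M S" by (rule mexp_GB[OF A(1)])
 have zZ: "?z s : Zfrob M S" for s
  using mexp_GB[OF B(1)] mexp_commute[OF Bc Fc_carrier B(2)] by (simp add: Zfrob_def)
 have Zc: "Zfrob M S <= Mat n" using GB_carrier by (auto simp: Zfrob_def)
 have "continuous_on UNIV (%s. ?z s $$ (i, j))" if "i < n" "j < n" for i j
  using mexp_derivative[OF Bc that] by (intro continuous_at_imp_continuous_on ballI) (blast intro: DERIV_isCont)
 from curve_in_connected_component[OF Zc zZ this, of t 0]
 have "?z t : frob_identity_component M S" unfolding frob_identity_component_def mexp_0[OF Bc] by simp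
 note chit = chi[OF this]
 have pG: "?p : GdR M S" by (intro torsor_quotient(1) c_torsor torsor_mult(1) xG)
 have pc: "?p : Mat n"
  by (intro mult_carrier_mat[of _ n n _ n] c_carrier mexp_carrier)
 have pF: "ap ?p (cvec u) : cspan Fa" if "u : Fa" for u
 proof -
  have "ap ?x (ap (minv c) (cvec u)) : FB a"
   by (intro mexp_FB[OF Ac A(2)] FB_minv cvec_in_cspan that)
  then show ?thesis
   by (simp add: FB_def mapply_mult[OF mult_carrier_mat[OF c_carrier(1) mexp_carrier] c_carrier(2)] mapply_mult[OF c_carrier(1) mexp_carrier])
 qed
 have "?p * cmat (actdR M e) = cmat (actdR M e) * ?p" for e using pG by (intro E_linear) simp
 from D_left[OF pc this pF]
 obtain \<delta> where \<delta>: "!!eps g. eps * eps = 1 ==> g : Mat n ==> D eps (?p * g) = \<delta> * D eps g" by blast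
 have eq: "c * (?x * ?z t) = ?p * (c * ?z t)"
 proof -
  note cx = mult_carrier_mat[OF c_carrier(1) mexp_carrier[of n A t]] and cz = mult_carrier_mat[OF c_carrier(1) mexp_carrier[of n B t]]
  have "?p * (c * ?z t) = c * ?x * (minv c * (c * ?z t))" by (rule assoc_mult_mat[OF cx c_carrier(2) cz])
  also have "minv c * (c * ?z t) = ?z t"
   using assoc_mult_mat[OF c_carrier(2,1) mexp_carrier[of n B t]] c_carrier(4) left_mult_one_mat[OF mexp_carrier[of n B t]] by simp
  finally show ?thesis using assoc_mult_mat[OF c_carrier(1) mexp_carrier mexp_carrier] by simp
 qed
 have "D eps (c * (?x * ?z t)) = \<delta> * (D eps c * chi M eps (?z t))" if "eps * eps = 1" for eps
  unfolding eq using \<delta>[OF that mult_carrier_mat[OF c_carrier(1) mexp_carrier]] D_right_Zfrob[OF that zZ c_torsor] by simp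
 from this[of 1] this[of "- 1"] show ?thesis unfolding ratio[symmetric] chit by (simp add: mult_ac)
qed

section \<open>The defect of proportionality on the component of the comparison\<close>

definition defect :: "complex mat => ('e, complex) qtensor" where
 "defect g = D 1 g - ratio * D (- 1) g"

text \<open>The coefficients involve the coordinates of \<open>ratio\<close>, so the polynomial has
  complex and not just rational coefficients.\<close>

lemma defect_mat_polys: "bet : Bq ==> EX f:mat_polys n. ALL g:Mat n. f g = nf.kap bet (defect g)"
proof -
 assume bet: "bet : Bq"
 obtain f where f: "f : rat_polys n" "ALL g:Mat n. nf.kap bet (D 1 g) = f g"
  using D_kap[OF _ bet, of 1, OF mult_1] by (elim bexE) (rule that)
 have "ALL al. EX h. al : Bq --> h : rat_polys n & (ALL g:Mat n. nf.kap al (D (- 1) g) = h g)"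
  using D_kap[of "- 1"] by (metis mult_minus_left mult_1 minus_minus)
 from choice[OF this] obtain h where h: "ALL al. al : Bq --> h al : rat_polys n & (ALL g:Mat n. nf.kap al (D (- 1) g) = h al g)" ..
 let ?f = "%g. f g - (SUM gam:Bq. SUM al:Bq. of_rat (nf.coef bet (gam * al)) * (nf.kap gam ratio * h al g))"
 have "?f : mat_polys n"
  using h by (intro mat_polys_diff mat_polys_sum mat_polys_cmult polys_over_mat_polys[where K="Rats"] f(1)) simp
 moreover have "?f g = nf.kap bet (defect g)" if "g : Mat n" for g
  using f(2) h that unfolding defect_def contract_minus[OF nf.qlinear_coef] nf.kap_mult by simp
 ultimately show ?thesis by (intro bexI[of _ ?f]) simp_all
qed

lemma defect_local:
 assumes chi: "!!z. z : frob_identity_component M S ==> chi M 1 z = chi M (- 1) z" and bet: "bet : Bq"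
 shows "EX e:mat_polys n. e (1\<^sub>m n) ~= 0 & (ALL A:GB M S. e A * nf.kap bet (defect (c * A)) = 0)"
proof -
 obtain f where f: "f : mat_polys n" "ALL g:Mat n. f g = nf.kap bet (defect g)" using defect_mat_polys[OF bet] by (elim bexE) (rule that)
 obtain b where b: "b : mat_polys n" "ALL A:Mat n. b A = f (c * A)"
  using mat_polys_mult_left[OF f(1) c_carrier(1)] by (elim bexE) (rule that)
 have bA: "b A = nf.kap bet (defect (c * A))" if "A : Mat n" for A
  using bspec[OF b(2) that] bspec[OF f(2) mult_carrier_mat[OF c_carrier(1) that]] by simp
 have "EX e:mat_polys n. e (1\<^sub>m n) ~= 0 & (ALL A:GB M S. e A * b A = 0)"
 proof (rule local_vanishing[OF GB_carrier b(1)])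
  fix X assume "X : tangent n (GB M S)"
  then obtain A B where AB: "A : tangent n (GB M S)" "B : tangent n (GB M S)" "A + B = X" "B * Fc = Fc * B"
   "ALL v:FB a. ap A v : FB a" by (rule tangent_decomposition)
  note A = AB(1) bspec[OF AB(5)] and B = AB(2,4)
  note Ac = tangentD(1)[OF A(1)] and Bc = tangentD(1)[OF B(1)]
  \<comment> \<open>A product of two exponentials, since \<open>mexp n X t\<close> itself need not
    factor into the two subgroups; its derivative at 0 is \<open>A + B\<close>, which is
    \<open>X\<close>.\<close>
  let ?gam = "%t. mexp n A t * mexp n B t"
  have gamc: "?gam t : Mat n" for t by (rule mult_carrier_mat[OF mexp_carrier mexp_carrier])
  show "EX gam. (ALL t. gam t : GB M S & b (gam t) = 0) & gam (0::complex) = 1\<^sub>m n &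
    (ALL i<n. ALL j<n. ((%t. gam t $$ (i, j)) has_field_derivative X $$ (i, j)) (at 0))"
  proof (intro exI[of _ ?gam] conjI allI impI)
   show "?gam t : GB M S" for t by (intro GB_mult mexp_GB A B)
   show "b (?gam t) = 0" for t
    using D_curve[OF chi A B, of t] unfolding bA[OF gamc] defect_def by (simp add: nf.kap_simps)
   show "?gam 0 = 1\<^sub>m n" by (simp add: mexp_0[OF Ac] mexp_0[OF Bc])
   fix i j assume ij: "i < n" "j < n"
   have "((%t. SUM l<n. mexp n A t $$ (i, l) * mexp n B t $$ (l, j)) has_field_derivative
     (SUM l<n. (mexp n A 0 * A) $$ (i, l) * mexp n B 0 $$ (l, j) + (mexp n B 0 * B) $$ (l, j) * mexp n A 0 $$ (i, l))) (at 0)"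
    using ij by (intro DERIV_sum DERIV_mult mexp_derivative Ac Bc) auto
   moreover have "(SUM l<n. (mexp n A 0 * A) $$ (i, l) * mexp n B 0 $$ (l, j) + (mexp n B 0 * B) $$ (l, j) * mexp n A 0 $$ (i, l)) = X $$ (i, j)"
   proof -
    have "(SUM l<n. (mexp n A 0 * A) $$ (i, l) * mexp n B 0 $$ (l, j) + (mexp n B 0 * B) $$ (l, j) * mexp n A 0 $$ (i, l)) =
      (SUM l<n. (if l = j then A $$ (i, l) else 0) + (if l = i then B $$ (l, j) else 0))"
     unfolding mexp_0[OF Ac] mexp_0[OF Bc] left_mult_one_mat[OF Ac] left_mult_one_mat[OF Bc] using ij by (intro sum.cong) auto
    then show ?thesis using ij Ac Bc by (simp add: sum.distrib AB(3)[symmetric])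
   qed
   ultimately show "((%t. ?gam t $$ (i, j)) has_field_derivative X $$ (i, j)) (at 0)"
    using mult_mat_entry[OF mexp_carrier mexp_carrier ij] by (simp del: index_mult_mat(1))
  qed
 qed
 then show ?thesis using bA GB_carrier by (elim bexE conjE, intro bexI conjI ballI) (auto simp: subset_iff)
qed

text \<open>Left translation by \<open>y * minv x\<close>, an element of the de Rham group, takes
  \<open>x\<close> to \<open>y\<close>.\<close>

lemma torsor_homogeneous:
 assumes "x : torsor M S" "y : torsor M S"
 shows "EX h:Mat n. EX k:Mat n.
   k * h = 1\<^sub>m n & h * k = 1\<^sub>m n & h * x = y & (%A. h * A) ` torsor M S <= torsor M S & (%A. k * A) ` torsor M S <= torsor M S"
proof -
 note x = GL_minv[OF torsor_GL[OF assms(1)]] and y = GL_minv[OF torsor_GL[OF assms(2)]]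
 have k: "(u * minv v) * (v * minv u) = 1\<^sub>m n" if "u : torsor M S" "v : torsor M S" for u v
 proof -
  note u = GL_minv[OF torsor_GL[OF that(1)]] and v = GL_minv[OF torsor_GL[OF that(2)]]
  have "(u * minv v) * (v * minv u) = u * (minv v * v * minv u)"
   using assoc_mult_mat[OF u(1) v(2) mult_carrier_mat[OF v(1) u(2)]] assoc_mult_mat[OF v(2,1) u(2)] by simp
  then show ?thesis using u v by simp
 qed
 have "y * minv x * x = y" using assoc_mult_mat[OF y(1) x(2,1)] x(4) right_mult_one_mat[OF y(1)] by simp
 then show ?thesis
  using k[OF assms] k[OF assms(2,1)] torsor_mult(2) torsor_quotient(1)[OF assms] torsor_quotient(1)[OF assms(2,1)] x y
  by (intro bexI[of _ "y * minv x"] bexI[of _ "x * minv y"] conjI) auto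
qed

lemmas torsor_component = homogeneous_zariski_component[OF torsor_carrier torsor_homogeneous]

lemma torsor0_subset: "torsor0 M S <= torsor M S" "c : torsor0 M S"
proof -
 have t: "topspace (subtopology (zariski n) (torsor M S)) = torsor M S"
  using torsor_carrier by (auto simp: topspace_zariski)
 show "torsor0 M S <= torsor M S" unfolding torsor0_def using connected_component_of_subset_topspace[of "subtopology (zariski n) (torsor M S)" c] t by simp
 show "c : torsor0 M S" unfolding torsor0_def using c_torsor t by (simp add: connected_component_of_refl)
qed

text \<open>\<open>defect_local\<close> gives vanishing wherever a certain polynomial, nonzero at
  \<open>c\<close>, does not vanish. On the irreducible component this open set meets every nonempty
  open set, in particular one where the defect is nonzero.\<close>

lemma defect_torsor0:
 assumes chi: "!!z. z : frob_identity_component M S ==> chi M 1 z = chi M (- 1) z" and g: "g : torsor0 M S"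
 shows "D 1 g = ratio * D (- 1) g"
proof -
 have "nf.kap bet (defect g) = 0" if bet: "bet : Bq" for bet
 proof (rule ccontr)
  assume nz: "nf.kap bet (defect g) ~= 0"
  obtain f where f: "f : mat_polys n" "ALL g:Mat n. f g = nf.kap bet (defect g)" using defect_mat_polys[OF bet] by (elim bexE) (rule that)
  obtain e where e: "e : mat_polys n" "e (1\<^sub>m n) ~= 0" "ALL A:GB M S. e A * nf.kap bet (defect (c * A)) = 0"
  proof -
   have "EX e:mat_polys n. e (1\<^sub>m n) ~= 0 & (ALL A:GB M S. e A * nf.kap bet (defect (c * A)) = 0)"
    by (rule defect_local[OF _ bet]) (rule chi)
   then show thesis by (elim bexE conjE) (rule that)
  qed
  obtain e' where e': "e' : mat_polys n" "ALL A:Mat n. e' A = e (minv c * A)"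
   using mat_polys_mult_left[OF e(1) c_carrier(2)] by (elim bexE) (rule that)
  have "e' c ~= 0" using e(2) bspec[OF e'(2) c_carrier(1)] c_carrier(4) by simp
  moreover have "f g ~= 0" using nz bspec[OF f(2), of g] g torsor0_subset torsor_carrier by auto
  ultimately obtain x where x: "x : torsor0 M S" "f x ~= 0" "e' x ~= 0"
   using torsor_component(2)[OF _ _ torsor0_def c_torsor f(1) e'(1) g _ torsor0_subset(2)] by blast
  have xT: "x : torsor M S" "x : Mat n" using x(1) torsor0_subset torsor_carrier by auto
  have "c * (minv c * x) = x" using assoc_mult_mat[OF c_carrier(1,2) xT(2)] c_carrier(3) xT(2) by simp
  then have "e' x * f x = 0"
   using bspec[OF e(3) torsor_quotient(2)[OF c_torsor xT(1)]] bspec[OF e'(2) xT(2)] bspec[OF f(2) xT(2)] by simp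
  then show False using x by simp
 qed
 then have "defect g = 0" by (intro nf.qtensor_eqI) (simp add: nf.kap_simps)
 then show ?thesis by (simp add: defect_def)
qed

lemma frob_identity_component_subset: "frob_identity_component M S <= Zfrob M S"
 unfolding frob_identity_component_def
 using connected_component_of_subset_topspace[of "subtopology (zariski n) (Zfrob M S)" "1\<^sub>m n"] by auto

text \<open>The hypothesis concerns all of \<open>Zfrob\<close> because the translating element
  \<open>z\<close> may lie outside the identity component.\<close>

lemma defect_translates:
 assumes chi: "!!z. z : Zfrob M S ==> chi M 1 z = chi M (- 1) z"
  and "p : PdR M S" "g : torsor0 M S" "z : Zfrob M S"
 shows "D 1 (p * g * z) = ratio * D (- 1) (p * g * z)"
proof -
 have pG: "p : GdR M S" and pfil: "ap p ` cspan Fa = cspan Fa" using assms(2) by (auto simp: PdR_def)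
 have pc: "p : Mat n" using pG TS.iso_GL GL_minv(1) unfolding GdR_iso by blast
 have gT: "g : torsor M S" "g : Mat n" using assms(3) torsor0_subset torsor_carrier by auto
 have "p * cmat (actdR M e) = cmat (actdR M e) * p" for e using pG by (intro E_linear) simp
 moreover have "ap p (cvec u) : cspan Fa" if "u : Fa" for u using pfil cvec_in_cspan[OF that] by blast
 ultimately obtain \<delta> where \<delta>: "!!eps g. eps * eps = 1 ==> g : Mat n ==> D eps (p * g) = \<delta> * D eps g"
  using D_left[OF pc] by blast
 have "D eps (p * g * z) = \<delta> * D eps g * chi M eps z" if "eps * eps = 1" for eps
  using D_right_Zfrob[OF that assms(4) torsor_mult(2)[OF pG gT(1)]] \<delta>[OF that gT(2)] by simp
 from this[of 1] this[of "- 1"] show ?thesis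
  using defect_torsor0[OF chi assms(3)] frob_identity_component_subset chi[OF assms(4)] by (simp add: subset_iff mult_ac)
qed

end

section \<open>Descent\<close>

lemma qbar_representation:
 assumes "f : mat_polys n"
 shows "EX zs. (ALL p:set zs. snd p : polys_over Qbar n) & (ALL A. f A = (\<Sum>p\<leftarrow>zs. fst p * snd p A))"
 using assms
proof induction
 case (const c)
 show ?case using polys_over.const[OF subring_setD(1)[OF subring_Qbar]] by (intro exI[of _ "[(c, %_. 1)]"]) simp
next
 case (entry i j)
 then show ?case using polys_over.entry by (intro exI[of _ "[(1, %A. A $$ (i, j))]"]) simp
next
 case (add f g)
 from add.IH(1) obtain xs where xs: "ALL p:set xs. snd p : polys_over Qbar n" "ALL A. f A = (\<Sum>p\<leftarrow>xs. fst p * snd p A)"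
  by (elim exE conjE) (rule that)
 from add.IH(2) obtain ys where ys: "ALL p:set ys. snd p : polys_over Qbar n" "ALL A. g A = (\<Sum>p\<leftarrow>ys. fst p * snd p A)"
  by (elim exE conjE) (rule that)
 show ?case using xs ys by (intro exI[of _ "xs @ ys"]) (simp add: ball_Un)
next
 case (mult f g)
 from mult.IH(1) obtain xs where xs: "ALL p:set xs. snd p : polys_over Qbar n" "ALL A. f A = (\<Sum>p\<leftarrow>xs. fst p * snd p A)"
  by (elim exE conjE) (rule that)
 from mult.IH(2) obtain ys where ys: "ALL p:set ys. snd p : polys_over Qbar n" "ALL A. g A = (\<Sum>p\<leftarrow>ys. fst p * snd p A)"
  by (elim exE conjE) (rule that)
 define t where "t p q = (fst p * fst q, %A. snd p A * snd q A)" for p q :: "complex \<times> (complex mat => complex)"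
 let ?zs = "concat (map (%p. map (t p) ys) xs)"
 have "(\<Sum>q\<leftarrow>map (t p) ys. fst q * snd q A) = fst p * snd p A * (\<Sum>q\<leftarrow>ys. fst q * snd q A)" for p A
  by (induction ys) (simp_all add: t_def algebra_simps)
 then have "(\<Sum>q\<leftarrow>?zs. fst q * snd q A) = (\<Sum>p\<leftarrow>xs. fst p * snd p A) * (\<Sum>q\<leftarrow>ys. fst q * snd q A)" for A
  by (induction xs) (simp_all add: algebra_simps)
 moreover have "ALL p:set ?zs. snd p : polys_over Qbar n"
  using xs(1) ys(1) by (auto simp: t_def intro: polys_over.mult)
 ultimately show ?case using xs(2) ys(2) by (intro exI[of _ ?zs]) simp
qed

text \<open>A representation with as few terms as possible has coefficients independent over \<open>Qbar\<close>.\<close>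

lemma qbar_decomposition:
 assumes f: "f : mat_polys n"
 shows "EX (I :: nat set) z F. finite I & (ALL i:I. F i : polys_over Qbar n) & (ALL A. f A = (SUM i:I. z i * F i A)) &
  (ALL q. (ALL i:I. q i : Qbar) --> (SUM i:I. z i * q i) = 0 --> (ALL i:I. q i = 0))"
proof -
 define R where "R k \<longleftrightarrow> (EX (I :: nat set) z F. finite I & card I = k & (ALL i:I. F i : polys_over Qbar n) & (ALL A. f A = (SUM i:I. z i * F i A)))" for k
 obtain zs where zs: "ALL p:set zs. snd p : polys_over Qbar n" "ALL A. f A = (\<Sum>p\<leftarrow>zs. fst p * snd p A)"
  using qbar_representation[OF f] by (elim exE conjE) (rule that)
 have "R (length zs)" unfolding R_def
  using zs by (intro exI[of _ "{..<length zs}"] exI[of _ "%i. fst (zs ! i)"] exI[of _ "%i. snd (zs ! i)"])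
   (simp add: sum_list_sum_nth atLeast0LessThan)
 define m where "m = (LEAST k. R k)"
 have min: "R m" unfolding m_def using \<open>R (length zs)\<close> by (rule LeastI)
 obtain I :: "nat set" and z F where I: "finite I" "card I = m" "ALL i:I. F i : polys_over Qbar n"
   "ALL A. f A = (SUM i:I. z i * F i A)"
  using min[unfolded R_def] by (elim exE conjE) (rule that)
 have "q j = 0" if q: "ALL i:I. q i : Qbar" "(SUM i:I. z i * q i) = 0" and j: "j : I" for q j
 proof (rule ccontr)
  assume nz: "q j ~= 0"
  \<comment> \<open>Solving the relation for \<open>z j\<close> expresses it through the other
    coefficients over \<open>Qbar\<close>; substituting removes the term \<open>j\<close>, against
    minimality.\<close>
  let ?r = "%i. - (q i * inverse (q j))"
  have "(SUM i:I. z i * q i) = z j * q j + (SUM i:I - {j}. z i * q i)" using I(1) j by (rule sum.remove)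
  then have "z j * q j = - (SUM i:I - {j}. z i * q i)" using q(2) by (simp add: eq_neg_iff_add_eq_0)
  then have "z j = - (SUM i:I - {j}. z i * q i) * inverse (q j)" using nz by (simp add: field_simps)
  also have "... = (SUM i:I - {j}. z i * ?r i)" by (simp add: sum_distrib_right sum_negf mult.assoc)
  finally have zj: "z j = (SUM i:I - {j}. z i * ?r i)" .
  let ?F = "%i A. F i A + ?r i * F j A"
  have "f A = (SUM i:I - {j}. z i * ?F i A)" for A
  proof -
   have "f A = z j * F j A + (SUM i:I - {j}. z i * F i A)" unfolding spec[OF I(4)] using I(1) j by (rule sum.remove)
   also have "z j * F j A = (SUM i:I - {j}. z i * (?r i * F j A))" unfolding zj by (simp add: sum_distrib_right mult.assoc)
   also have "... + (SUM i:I - {j}. z i * F i A) = (SUM i:I - {j}. z i * ?F i A)"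
    unfolding sum.distrib[symmetric] by (intro sum.cong HOL.refl) (simp add: algebra_simps)
   finally show ?thesis .
  qed
  moreover have "?F i : polys_over Qbar n" if "i : I - {j}" for i
  proof -
   have "?r i : Qbar" using q(1) that j by (intro subring_setD[OF subring_Qbar] inverse_in_Qbar) auto
   then show ?thesis using I(3) that j by (intro polys_over.add polys_over.mult polys_over.const) auto
  qed
  ultimately have "R (card (I - {j}))" unfolding R_def using I(1)
   by (intro exI[of _ "I - {j}"] exI[of _ z] exI[of _ ?F]) simp
  then have "m <= card (I - {j})" unfolding m_def by (rule Least_le)
  then show False using card_Diff1_less[OF I(1) j] I(2) by simp
 qed
 then show ?thesis using I by (intro exI[of _ I] exI[of _ z] exI[of _ F]) simp
qed

lemma polys_over_Qbar_value: "F : polys_over Qbar n ==> A : Mat n ==> elements_mat A <= Qbar ==> F A : Qbar"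
 using polys_over_hom_on[of F Qbar n Qbar "%x. x" A] subring_Qbar by (simp add: hom_on_def)

text \<open>At an algebraic point the values \<open>F i A\<close> lie in \<open>Qbar\<close>, so by
  independence \<open>f\<close> vanishes there only if all \<open>F i\<close> do. At least one
  \<open>F i\<close> is nonzero at \<open>x\<close>, and it does the job.\<close>

lemma qbar_separation:
 assumes f: "f : mat_polys n" "f x ~= 0"
 shows "EX F:polys_over Qbar n. F x ~= 0 & (ALL A:Mat n. elements_mat A <= Qbar --> F A ~= 0 --> f A ~= 0)"
proof -
 obtain I :: "nat set" and z F where I: "finite I" "ALL i:I. F i : polys_over Qbar n" "ALL A. f A = (SUM i:I. z i * F i A)"
   "ALL q. (ALL i:I. q i : Qbar) --> (SUM i:I. z i * q i) = 0 --> (ALL i:I. q i = 0)"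
  using qbar_decomposition[OF f(1)] by (elim exE conjE) (rule that)
 have "EX i:I. F i x ~= 0"
 proof (rule ccontr)
  assume "~ (EX i:I. F i x ~= 0)"
  then have "(SUM i:I. z i * F i x) = 0" by (intro sum.neutral) simp
  then show False using f(2) I(3) by simp
 qed
 then obtain i where i: "i : I" "F i x ~= 0" by (elim bexE) (rule that)
 have "f A ~= 0" if A: "A : Mat n" "elements_mat A <= Qbar" "F i A ~= 0" for A
 proof
  assume "f A = 0"
  then have "(SUM i:I. z i * F i A) = 0" using I(3) by simp
  moreover have "ALL i:I. F i A : Qbar" by (intro ballI polys_over_Qbar_value[OF bspec[OF I(2)] A(1,2)])
  moreover have "(ALL i:I. F i A : Qbar) --> (SUM i:I. z i * F i A) = 0 --> (ALL i:I. F i A = 0)" by (rule spec[OF I(4)])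
  ultimately have "ALL i:I. F i A = 0" by (elim mp[THEN mp])
  then show False using i(1) A(3) by simp
 qed
 then show ?thesis using i I(2) by (intro bexI[of _ "F i"]) simp_all
qed

section \<open>Galois conjugation of polynomials\<close>

lemma galois_hom_on:
 assumes "sig : galois_group"
 shows "hom_on Qbar sig" "sig ` Qbar = Qbar"
proof -
 have b: "bij_betw sig Qbar Qbar" and h: "ALL x:Qbar. ALL y:Qbar. sig (x + y) = sig x + sig y & sig (x * y) = sig x * sig y"
  using assms by (auto simp: galois_group_def)
 note Q = subring_setD(1,2)[OF subring_Qbar]
 have "sig (0 + 0) = sig 0 + sig 0" using h Q by blast
 then have 0: "sig 0 = 0" by simp
 have "sig 1 ~= sig 0" using b Q by (metis bij_betw_inv_into_left zero_neq_one)
 moreover have "sig (1 * 1) = sig 1 * sig 1" using h Q by blast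
 ultimately have "sig 1 = 1" using 0 by simp
 then show "hom_on Qbar sig" using h by (simp add: hom_on_def)
 show "sig ` Qbar = Qbar" using b by (simp add: bij_betw_def)
qed

lemma galois_inverse:
 assumes sig: "sig : galois_group"
 shows "EX rho. hom_on Qbar rho & rho ` Qbar <= Qbar & (ALL x:Qbar. rho (sig x) = x)"
proof -
 have b: "bij_betw sig Qbar Qbar" using sig by (simp add: galois_group_def)
 let ?rho = "inv_into Qbar sig"
 have l: "?rho (sig x) = x" if "x : Qbar" for x by (rule bij_betw_inv_into_left[OF b that])
 have r: "sig (?rho x) = x" "?rho x : Qbar" if "x : Qbar" for x
  using bij_betw_inv_into_right[OF b that] inv_into_into[of x sig Qbar] that galois_hom_on(2)[OF sig] by simp_all
 note h = hom_onD[OF galois_hom_on(1)[OF sig] subring_Qbar] and Q = subring_setD[OF subring_Qbar]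
 have "?rho (x + y) = ?rho x + ?rho y" "?rho (x * y) = ?rho x * ?rho y" if "x : Qbar" "y : Qbar" for x y
  using l[OF Q(4)[OF r(2)[OF that(1)] r(2)[OF that(2)]]] l[OF Q(5)[OF r(2)[OF that(1)] r(2)[OF that(2)]]] r that
  by (simp_all add: h)
 moreover have "?rho 1 = 1" using l[OF Q(1)] h(1) by simp
 ultimately have "hom_on Qbar ?rho" by (simp add: hom_on_def)
 then show ?thesis using l r(2) by blast
qed

text \<open>The polynomial \<open>G\<close> is \<open>F\<close> with \<open>rho\<close> applied to
  its coefficients.\<close>

lemma polys_over_twist:
 assumes "F : polys_over Qbar n" and rho: "hom_on Qbar rho" "rho ` Qbar <= Qbar"
 shows "EX G:polys_over Qbar n. ALL A:Mat n. elements_mat A <= Qbar --> G (map_mat rho A) = rho (F A)"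
 using assms(1)
proof induction
 case (const q)
 then show ?case using rho(2) by (intro bexI[of _ "%_. rho q"] polys_over.const) auto
next
 case (entry i j)
 then show ?case by (intro bexI[of _ "%A. A $$ (i, j)"] polys_over.entry) auto
next
 case (add f g)
 from add.IH(1) obtain f' where f': "f' : polys_over Qbar n" "ALL A:Mat n. elements_mat A <= Qbar --> f' (map_mat rho A) = rho (f A)"
  by (elim bexE) (rule that)
 from add.IH(2) obtain g' where g': "g' : polys_over Qbar n" "ALL A:Mat n. elements_mat A <= Qbar --> g' (map_mat rho A) = rho (g A)"
  by (elim bexE) (rule that)
 show ?case using f' g' polys_over_Qbar_value[OF add.hyps(1)] polys_over_Qbar_value[OF add.hyps(2)]
  by (intro bexI[of _ "%A. f' A + g' A"] polys_over.add) (simp_all add: hom_onD(3)[OF rho(1) subring_Qbar])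
next
 case (mult f g)
 from mult.IH(1) obtain f' where f': "f' : polys_over Qbar n" "ALL A:Mat n. elements_mat A <= Qbar --> f' (map_mat rho A) = rho (f A)"
  by (elim bexE) (rule that)
 from mult.IH(2) obtain g' where g': "g' : polys_over Qbar n" "ALL A:Mat n. elements_mat A <= Qbar --> g' (map_mat rho A) = rho (g A)"
  by (elim bexE) (rule that)
 show ?case using f' g' polys_over_Qbar_value[OF mult.hyps(1)] polys_over_Qbar_value[OF mult.hyps(2)]
  by (intro bexI[of _ "%A. f' A * g' A"] polys_over.mult) (simp_all add: hom_onD(4)[OF rho(1) subring_Qbar])
qed

section \<open>Embeddings that move an irrational number\<close>

abbreviation rpoly :: "rat poly => complex poly" where
 "rpoly == map_poly of_rat"

lemma rpoly_add: "rpoly (p + q) = rpoly p + rpoly q"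
 by (intro poly_eqI) (simp add: coeff_map_poly of_rat_add)

lemma rpoly_mult: "rpoly (p * q) = rpoly p * rpoly q"
 by (intro poly_eqI) (simp add: coeff_map_poly coeff_mult of_rat_sum of_rat_mult)

lemma rpoly_minimal_dvd:
 assumes p: "p ~= 0" "poly (rpoly p) x = 0" and min: "!!q. q ~= 0 ==> poly (rpoly q) x = 0 ==> degree p <= degree q"
  and q: "poly (rpoly q) x = 0"
 shows "p dvd q"
proof (rule ccontr)
 assume "~ p dvd q"
 then have r: "q mod p ~= 0" by (simp add: dvd_eq_mod_eq_0)
 have "poly (rpoly (q mod p)) x = 0"
  using q p(2) rpoly_add[of "q div p * p" "q mod p"] by (simp add: rpoly_mult)
 from min[OF r this] show False using degree_mod_less'[OF p(1) r] by simp
qed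

lemma rpoly_minimal_exists:
 assumes "q ~= 0" "poly (rpoly q) x = 0"
 shows "EX p. p ~= 0 & poly (rpoly p) x = 0 & (ALL q. q ~= 0 --> poly (rpoly q) x = 0 --> degree p <= degree q)"
 using ex_has_least_nat[of "%p. p ~= 0 & poly (rpoly p) x = 0" q degree] assms by auto

lemma rpoly_eq_0_iff: "rpoly p = 0 \<longleftrightarrow> p = 0"
 by (auto simp: poly_eq_iff coeff_map_poly)

lemma rpoly_degree: "degree (rpoly p) = degree p"
 by (rule degree_map_poly) simp

text \<open>A transcendental \<open>x\<close> is paired with \<open>x + 1\<close>, an algebraic
  irrational one with another root of its minimal polynomial, which has degree at least 2 and a
  simple root at \<open>x\<close>.\<close>

lemma conjugate_exists:
 fixes x :: complex
 assumes x: "x ~: Rats"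
 shows "EX x'. x' ~= x & (ALL q. poly (rpoly q) x = 0 \<longleftrightarrow> poly (rpoly q) x' = 0)"
proof (cases "EX q. q ~= 0 & poly (rpoly q) x = 0")
 case False
 have "poly (rpoly q) (x + 1) ~= 0" if "q ~= 0" for q
 proof
  assume z: "poly (rpoly q) (x + 1) = 0"
  \<comment> \<open>A relation for \<open>x + 1\<close> would give one for \<open>x\<close> by
    substitution.\<close>
  have "poly (rpoly q) (x + 1) = poly (rpoly (q \<circ>\<^sub>p [:1, 1:])) x"
  proof (induction q)
   case (pCons b q)
   then show ?case by (simp add: map_poly_pCons pcompose_pCons rpoly_add rpoly_mult algebra_simps)
  qed simp
  moreover have "q \<circ>\<^sub>p [:1, 1:] ~= 0" using that by (simp add: pcompose_eq_0_iff)
  ultimately show False using False z by auto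
 qed
 then show ?thesis using False by (intro exI[of _ "x + 1"]) (metis add_cancel_right_right zero_neq_one map_poly_0 poly_0)
next
 case True
 then obtain p where p: "p ~= 0" "poly (rpoly p) x = 0" "ALL q. q ~= 0 --> poly (rpoly q) x = 0 --> degree p <= degree q"
  using rpoly_minimal_exists by blast
 have dvd: "p dvd q" if "poly (rpoly q) x = 0" for q
  by (rule rpoly_minimal_dvd[OF p(1,2) _ that]) (use p(3) in blast)
 have d0: "degree p ~= 0"
 proof
  assume "degree p = 0"
  then obtain b where "p = [:b:]" by (rule degree_eq_zeroE)
  then show False using p by (simp add: map_poly_pCons)
 qed
 have d1: "degree p ~= 1"
 proof
  assume "degree p = 1"
  then obtain b d where bd: "p = [:b, d:]" "d ~= 0" by (metis One_nat_def degree_eq_zeroE degree_pCons_eq_if nat.inject pCons_cases pCons_eq_0_iff zero_neq_one)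
  then have "of_rat b + x * of_rat d = 0" using p(2) by (simp add: map_poly_pCons)
  then have "x = of_rat (- b / d)" using bd(2) by (simp add: of_rat_divide of_rat_minus field_simps add_eq_0_iff)
  then show False using x by simp
 qed
 have "pderiv p ~= 0" using d0 by (simp add: pderiv_eq_0_iff)
 then have "poly (rpoly (pderiv p)) x = 0 --> degree p <= degree p - 1"
  using spec[OF p(3), of "pderiv p"] degree_pderiv[of p] by simp
 then have "poly (rpoly (pderiv p)) x ~= 0" using d0 by linarith
 moreover have "rpoly (pderiv p) = pderiv (rpoly p)"
  by (intro poly_eqI) (simp add: coeff_map_poly coeff_pderiv of_rat_mult del: of_nat_Suc)
 ultimately have dx: "poly (pderiv (rpoly p)) x ~= 0" by simp
 obtain h where h: "rpoly p = [:- x, 1:] * h" using p(2) poly_eq_0_iff_dvd[of "rpoly p" x] by auto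
 have "poly (pderiv ([:- x, 1:] * h)) x = poly h x"
  unfolding pderiv_mult poly_add poly_mult by (simp add: pderiv_pCons)
 then have "poly h x ~= 0" using dx unfolding h by (simp only: not_False_eq_True)
 have "degree (rpoly p) = Suc (degree h)"
  unfolding h using p(1) h rpoly_eq_0_iff[of p] by (subst degree_mult_eq) auto
 then have "degree h > 0" using d0 d1 by (simp add: rpoly_degree)
 then obtain x' where x': "poly h x' = 0" using exists_complex_root by blast
 have "x' ~= x" using x' \<open>poly h x ~= 0\<close> by auto
 have px': "poly (rpoly p) x' = 0" unfolding h using x' by simp
 \<comment> \<open>To exchange the roles of \<open>x\<close> and \<open>x'\<close>: the minimal
   polynomial \<open>r\<close> of \<open>x'\<close> divides \<open>p\<close>, and its cofactor
   cannot vanish at \<open>x\<close> by minimality of \<open>p\<close>, so \<open>r\<close> vanishes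
   at \<open>x\<close>.\<close>
 obtain r where r: "r ~= 0" "poly (rpoly r) x' = 0" "ALL q. q ~= 0 --> poly (rpoly q) x' = 0 --> degree r <= degree q"
  using rpoly_minimal_exists[OF p(1) px'] by blast
 have rdvd: "r dvd q" if "poly (rpoly q) x' = 0" for q
  by (rule rpoly_minimal_dvd[OF r(1,2) _ that]) (use r(3) in blast)
 obtain s where s: "p = r * s" using rdvd[OF px'] by auto
 have rx: "poly (rpoly r) x = 0"
 proof (rule ccontr)
  assume nz: "poly (rpoly r) x ~= 0"
  then have "poly (rpoly s) x = 0" using p(2) unfolding s rpoly_mult by simp
  then have "degree p <= degree s" using p(1,3) s by auto
  moreover have "degree p = degree r + degree s" using p(1) unfolding s by (intro degree_mult_eq) auto
  ultimately have "degree r = 0" by simp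
  then obtain b where "r = [:b:]" by (rule degree_eq_zeroE)
  then show False using r by (simp add: map_poly_pCons)
 qed
 have "poly (rpoly q) x = 0 \<longleftrightarrow> poly (rpoly q) x' = 0" for q
 proof
  assume "poly (rpoly q) x = 0"
  then obtain t where "q = p * t" using dvd by blast
  then show "poly (rpoly q) x' = 0" using px' by (simp add: rpoly_mult)
 next
  assume "poly (rpoly q) x' = 0"
  then obtain t where "q = r * t" using rdvd by blast
  then show "poly (rpoly q) x = 0" using rx by (simp add: rpoly_mult)
 qed
 then show ?thesis using \<open>x' ~= x\<close> by blast
qed

text \<open>Evaluation at \<open>x'\<close> in place of \<open>x\<close> is well defined and
  injective on the ring generated by \<open>x\<close>. The domain stays this small;
  \<open>torsor_specialization\<close> enlarges it as far as the application requires.\<close>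

lemma moving_hom_exists:
 fixes x :: complex
 assumes x: "x ~: Rats"
 shows "EX A tau. subring_set A & x : A & (ALL q. of_rat q : A) & hom_on A tau & (ALL u:A. u ~= 0 --> tau u ~= 0) & tau x ~= x"
proof -
 obtain x' where x': "x' ~= x" "!!q. poly (rpoly q) x = 0 \<longleftrightarrow> poly (rpoly q) x' = 0" using conjugate_exists[OF x] by blast
 let ?A = "range (%q. poly (rpoly q) x)"
 define tau where "tau u = poly (rpoly (SOME q. poly (rpoly q) x = u)) x'" for u
 have rd: "rpoly (p - q) = rpoly p - rpoly q" for p q
  by (intro poly_eqI) (simp add: coeff_map_poly of_rat_diff)
 have tau: "tau (poly (rpoly q) x) = poly (rpoly q) x'" for q
 proof -
  let ?p = "SOME p. poly (rpoly p) x = poly (rpoly q) x"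
  have "poly (rpoly ?p) x = poly (rpoly q) x" by (rule someI[of _ q]) simp
  then have "poly (rpoly (?p - q)) x = 0" by (simp add: rd)
  then have "poly (rpoly (?p - q)) x' = 0" using x'(2) by blast
  then show ?thesis unfolding tau_def by (simp add: rd)
 qed
 have um: "- poly (rpoly q) x = poly (rpoly (- q)) x" for q using rd[of 0 q] by simp
 have ad: "poly (rpoly p) y + poly (rpoly q) y = poly (rpoly (p + q)) y"
  "poly (rpoly p) y * poly (rpoly q) y = poly (rpoly (p * q)) y" for p q y by (simp_all add: rpoly_add rpoly_mult)
 have one: "1 = poly (rpoly 1) y" for y by (simp add: map_poly_1')
 have "subring_set ?A" unfolding subring_set_def
 proof (intro conjI ballI)
  show "1 : ?A" using one by blast
  fix u assume "u : ?A" then show "- u : ?A" using um by blast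
 next
  fix u v assume "u : ?A" "v : ?A"
  then obtain p q where "u = poly (rpoly p) x" "v = poly (rpoly q) x" by blast
  then show "u + v : ?A" "u * v : ?A" using ad by blast+
 qed
 moreover have "x : ?A" by (rule image_eqI[of _ _ "[:0, 1:]"]) (simp_all add: map_poly_pCons)
 moreover have "of_rat q : ?A" for q by (rule image_eqI[of _ _ "[:q:]"]) (simp_all add: map_poly_pCons)
 moreover have "hom_on ?A tau" unfolding hom_on_def
 proof (intro conjI ballI)
  show "tau 1 = 1" using tau[of 1] one by simp
  fix u v assume "u : ?A" "v : ?A"
  then obtain p q where uv: "u = poly (rpoly p) x" "v = poly (rpoly q) x" by blast
  show "tau (u + v) = tau u + tau v" "tau (u * v) = tau u * tau v" unfolding uv ad tau by simp_all
 qed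
 moreover have "ALL u:?A. u ~= 0 --> tau u ~= 0" using tau x'(2) by auto
 moreover have "tau x ~= x" using tau[of "[:0, 1:]"] x'(1) by (simp add: map_poly_pCons)
 ultimately show ?thesis by blast
qed

lemma finite_elements_mat: "finite (elements_mat A)"
 by (simp add: elements_mat_def)

lemma elements_mat_map: "A : carrier_mat n m ==> elements_mat (map_mat tau A) <= tau ` elements_mat A"
proof
 fix y assume A: "A : carrier_mat n m" and "y : elements_mat (map_mat tau A)"
 then obtain i j where "i < n" "j < m" "y = tau (A $$ (i, j))" by (auto simp: elements_mat_def)
 then show "y : tau ` elements_mat A" using elements_mat_entry[OF A] by blast
qed

lemma det_in_subring:
 assumes R: "subring_set R" and A: "A : carrier_mat m m" "!!i j. i < m ==> j < m ==> A $$ (i, j) : R"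
 shows "mdet A : R"
proof -
 have "signof p : R" for p :: "nat => nat" using subring_setD(1,3)[OF R] by (cases "evenperm p") (simp_all add: sign_def)
 then show ?thesis unfolding det_def'[OF A(1)]
  by (intro subring_set_sum[OF R] subring_setD(5)[OF R] subring_set_prod[OF R] A(2)) (auto simp: permutes_in_image)
qed

lemma minv_in_Qbar:
 assumes A: "A : GL n" "elements_mat A <= Qbar"
 shows "elements_mat (minv A) <= Qbar"
proof
 note A' = GL_minv[OF A(1)]
 have Ae: "i < n ==> j < n ==> A $$ (i, j) : Qbar" for i j using elements_mat_entry[OF A'(1)] A(2) by blast
 fix y assume "y : elements_mat (minv A)"
 then obtain i j where ij: "i < n" "j < n" "y = minv A $$ (i, j)" using A'(2) by (auto simp: elements_mat_def)
 have d: "mdet A ~= 0" "mdet A : Qbar" using A(1) GL_det det_in_subring[OF subring_Qbar A'(1) Ae] by auto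
 have "adj_mat A $$ (i, j) = (-1) ^ (j + i) * mdet (mat_delete A j i)"
  using ij A'(1) by (simp add: adj_mat_def cofactor_def)
 also have "... : Qbar"
 proof (rule subring_setD(5)[OF subring_Qbar])
  show "(- 1) ^ (j + i) : Qbar" using subring_setD(1,3)[OF subring_Qbar] by (cases "even (j + i)") simp_all
  show "mdet (mat_delete A j i) : Qbar"
   by (rule det_in_subring[OF subring_Qbar mat_delete_carrier[OF A'(1)]])
    (use A'(1) in \<open>auto simp: mat_delete_def intro!: Ae\<close>)
 qed
 finally have "mdet A * y : Qbar" using minv_entry[OF A(1) ij(1,2)] ij(3) by simp
 then have "inverse (mdet A) * (mdet A * y) : Qbar"
  by (rule subring_setD(5)[OF subring_Qbar inverse_in_Qbar[OF d(2)]])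
 moreover have "inverse (mdet A) * (mdet A * y) = y" using d(1) by simp
 ultimately show "y : Qbar" by (simp only:)
qed

section \<open>Algebraic points and the Galois action on components\<close>

context bdr
begin

text \<open>The entries of \<open>x\<close> and of its inverse are put into the ring, so the
  specialized matrix again satisfies the equations of the torsor.\<close>

lemma torsor_specialization:
 assumes x: "x : torsor M S" and A: "subring_set A" "!!q. of_rat q : A" and Om: "alg_closed_set Om"
  and tau: "hom_on A tau" "tau ` A <= Om" "!!u. u : A ==> u ~= 0 ==> tau u ~= 0" and X: "finite X"
 obtains R tau' where "subring_set R" "A <= R" "X <= R" "elements_mat x <= R" "hom_on R tau'" "tau' ` R <= Om"
  "ALL a:A. tau' a = tau a" "map_mat tau' x : torsor M S"
proof -
 have "finite (X Un elements_mat x Un elements_mat (minv x))" using X by (simp add: finite_elements_mat)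
 then have "EX R tau'. subring_set R & A <= R & X Un elements_mat x Un elements_mat (minv x) <= R & hom_on R tau' & tau' ` R <= Om &
   (ALL a:A. tau' a = tau a)"
  by (intro specialization_exists[OF A(1) Om tau(1,2)] tau(3))
 then obtain R tau'
  where R: "subring_set R" "A <= R" "X Un elements_mat x Un elements_mat (minv x) <= R" "hom_on R tau'" "tau' ` R <= Om"
   "ALL a:A. tau' a = tau a" by (elim exE conjE) (rule that)
 have "map_mat tau' x : torsor M S"
  using TS.iso_hom_on[OF R(4,1)] R(2,3) A(2) x unfolding torsor_iso by blast
 then show thesis using R by (intro that[of R tau']) auto
qed

text \<open>A polynomial over \<open>Qbar\<close> commutes with \<open>tau\<close>, which is the
  identity on \<open>Qbar\<close>. Putting \<open>inverse (F x)\<close> into \<open>X\<close> makes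
  the value a unit of the ring, hence nonzero after specialization.\<close>

lemma qbar_specialization:
 assumes x: "x : torsor M S" and X: "finite X"
 obtains R tau where "subring_set R" "Qbar <= R" "X <= R" "elements_mat x <= R" "hom_on R tau" "tau ` R <= Qbar"
  "ALL a:Qbar. tau a = a" "map_mat tau x : torsor M S" "elements_mat (map_mat tau x) <= Qbar"
  "ALL F:polys_over Qbar n. F x ~= 0 --> inverse (F x) : X --> F (map_mat tau x) ~= 0"
proof (rule torsor_specialization[OF x subring_Qbar of_rat_in_Qbar alg_closed_Qbar _ _ _ X, of "%x. x"])
 fix R tau assume R: "subring_set R" "Qbar <= R" "X <= R" "elements_mat x <= R" "hom_on R tau" "tau ` R <= Qbar"
  "ALL a:Qbar. tau a = a" "map_mat tau x : torsor M S"
 have "elements_mat (map_mat tau x) <= tau ` elements_mat x" by (rule elements_mat_map) (use x torsor_carrier in blast)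
 then have "elements_mat (map_mat tau x) <= Qbar" using R(4,6) by blast
 moreover have "F (map_mat tau x) ~= 0" if F: "F : polys_over Qbar n" "F x ~= 0" "inverse (F x) : X" for F
 proof
  assume z: "F (map_mat tau x) = 0"
  have xc: "x : Mat n" using x torsor_carrier by blast
  have v: "F x : R" "tau (F x) = 0"
   using polys_over_hom_on[OF F(1) R(5,1,2) _ xc R(4)] R(7) z by simp_all
  have "tau (F x * inverse (F x)) = tau (F x) * tau (inverse (F x))" using hom_onD(4)[OF R(5,1) v(1)] F(3) R(3) by blast
  then show False using F(2) v(2) hom_onD(1)[OF R(5,1)] by simp
 qed
 ultimately show thesis using R by (intro that[of R tau]) simp_all
qed (auto simp: hom_on_def)

lemma torsor_component_cases:
 assumes "X : torsor_components M S"
 obtains x where "x : torsor M S" "x : X" "X <= torsor M S"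
  "X = connected_component_of_set (subtopology (zariski n) (torsor M S)) x"
proof -
 have t: "topspace (subtopology (zariski n) (torsor M S)) = torsor M S"
  using torsor_carrier by (auto simp: topspace_zariski)
 obtain x where x: "x : torsor M S" "X = connected_component_of_set (subtopology (zariski n) (torsor M S)) x"
  using assms unfolding torsor_components_def connected_components_of_def t by blast
 show thesis
  using x t connected_component_of_subset_topspace[of "subtopology (zariski n) (torsor M S)" x]
  by (intro that[of x]) (simp_all add: connected_component_of_refl)
qed

lemma torsor_components_disjoint:
 "X : torsor_components M S ==> Y : torsor_components M S ==> x : X ==> x : Y ==> X = Y"
 unfolding torsor_components_def using pairwise_disjoint_connected_components_of
 by (metis disjnt_iff pairwiseD)

lemma torsor_component_exists: "x : torsor M S ==> EX X:torsor_components M S. x : X"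
proof -
 assume x: "x : torsor M S"
 have t: "topspace (subtopology (zariski n) (torsor M S)) = torsor M S"
  using torsor_carrier by (auto simp: topspace_zariski)
 show ?thesis
  using x t unfolding torsor_components_def connected_components_of_def
  by (intro bexI[of _ "connected_component_of_set (subtopology (zariski n) (torsor M S)) x"])
   (auto simp: connected_component_of_refl)
qed

text \<open>The component is open, hence contains a basic open set around \<open>x\<close>;
  \<open>qbar_separation\<close> exchanges its polynomial for one over \<open>Qbar\<close>, to which
  specialization applies.\<close>

lemma component_separation:
 assumes X: "X : torsor_components M S" and x: "x : X"
 obtains F where "F : polys_over Qbar n" "F x ~= 0"
  "ALL A:torsor M S. elements_mat A <= Qbar --> F A ~= 0 --> A : X"
proof -
 obtain x0 where x0: "x0 : torsor M S" "X = connected_component_of_set (subtopology (zariski n) (torsor M S)) x0"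
  using torsor_component_cases[OF X] by metis
 obtain f where f: "f : mat_polys n" "f x ~= 0" "ALL A:torsor M S. f A ~= 0 --> A : X"
  using torsor_component(1)[OF _ _ x0(2,1) x] by blast
 obtain F where F: "F : polys_over Qbar n" "F x ~= 0"
  "ALL A:Mat n. elements_mat A <= Qbar --> F A ~= 0 --> f A ~= 0"
  using qbar_separation[OF f(1,2)] by (elim bexE conjE) (rule that)
 show thesis
 proof (rule that[OF F(1,2)], intro ballI impI)
  fix A assume A: "A : torsor M S" "elements_mat A <= Qbar" "F A ~= 0"
  then have "f A ~= 0" using bspec[OF F(3), of A] torsor_carrier by blast
  then show "A : X" using f(3) A(1) by blast
 qed
qed

lemma component_irreducible:
 assumes X: "X : torsor_components M S" and f: "f : mat_polys n" "x : X" "f x ~= 0" and g: "g : mat_polys n" "y : X" "g y ~= 0"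
 shows "EX z:X. f z ~= 0 & g z ~= 0"
proof -
 obtain x0 where x0: "x0 : torsor M S" "X = connected_component_of_set (subtopology (zariski n) (torsor M S)) x0"
  using torsor_component_cases[OF X] by metis
 show ?thesis by (rule torsor_component(2)[OF _ _ x0(2,1) f(1) g(1) f(2,3) g(2,3)])
qed

text \<open>Any point of the component is specialized while its separating polynomial is kept
  nonzero, so that the algebraic point obtained stays in the component.\<close>

lemma Qbar_points_nonempty: "X : torsor_components M S ==> EX x. x : Qbar_points X"
proof -
 assume X: "X : torsor_components M S"
 obtain x where x: "x : torsor M S" "x : X" using torsor_component_cases[OF X] by metis
 obtain F where F: "F : polys_over Qbar n" "F x ~= 0"
  "ALL A:torsor M S. elements_mat A <= Qbar --> F A ~= 0 --> A : X"
  by (rule component_separation[OF X x(2)])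
 have "finite {inverse (F x)}" by simp
 from this obtain R tau where R: "subring_set R" "Qbar <= R" "{inverse (F x)} <= R" "elements_mat x <= R" "hom_on R tau" "tau ` R <= Qbar"
  "ALL a:Qbar. tau a = a" "map_mat tau x : torsor M S" "elements_mat (map_mat tau x) <= Qbar"
  "ALL Q:polys_over Qbar n. Q x ~= 0 --> inverse (Q x) : {inverse (F x)} --> Q (map_mat tau x) ~= 0"
  by (rule qbar_specialization[OF x(1)])
 have "map_mat tau x : Qbar_points X"
  unfolding Qbar_points_def using bspec[OF F(3) R(8)] bspec[OF R(10) F(1)] F(2) R(9) by simp
 then show ?thesis ..
qed

lemma galois_torsor:
 assumes "sig : galois_group" "A : torsor M S" "elements_mat A <= Qbar"
 shows "map_mat sig A : torsor M S" "elements_mat (map_mat sig A) <= Qbar"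
proof -
 have A: "A : GL n" by (rule torsor_GL[OF assms(2)])
 show "map_mat sig A : torsor M S"
  using TS.iso_hom_on[OF galois_hom_on(1)[OF assms(1)] subring_Qbar of_rat_in_Qbar _ assms(3) minv_in_Qbar[OF A assms(3)]] assms(2)
  unfolding torsor_iso by blast
 show "elements_mat (map_mat sig A) <= Qbar"
  using elements_mat_map[OF GL_minv(1)[OF A], of sig] assms(3) galois_hom_on(2)[OF assms(1)] by blast
qed

lemma Qbar_pointsD:
 assumes "X : torsor_components M S" "x : Qbar_points X"
 shows "x : X" "x : torsor M S" "x : Mat n" "elements_mat x <= Qbar"
proof -
 show x: "x : X" "elements_mat x <= Qbar" using assms(2) by (simp_all add: Qbar_points_def)
 obtain x0 where "X <= torsor M S" using torsor_component_cases[OF assms(1)] by metis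
 then show "x : torsor M S" "x : Mat n" using x torsor_carrier by blast+
qed

text \<open>The separating polynomial of \<open>Y\<close> is pulled back along \<open>sig\<close>:
  the inverse automorphism is applied to its coefficients.\<close>

lemma galois_separation:
 assumes sig: "sig : galois_group" and x: "x : torsor M S" "elements_mat x <= Qbar"
  and Y: "Y : torsor_components M S" "map_mat sig x : Y"
 obtains G where "G : polys_over Qbar n" "G x ~= 0"
  "ALL A:torsor M S. elements_mat A <= Qbar --> G A ~= 0 --> map_mat sig A : Y"
proof -
 obtain rho where rho: "hom_on Qbar rho" "rho ` Qbar <= Qbar" "ALL x:Qbar. rho (sig x) = x"
  using galois_inverse[OF sig] by (elim exE conjE) (rule that)
 have rho0: "rho u = 0 \<longleftrightarrow> u = 0" if "u : Qbar" for u
 proof -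
  have "u : sig ` Qbar" using that by (simp only: galois_hom_on(2)[OF sig])
  then obtain v where v: "v : Qbar" "u = sig v" by (elim imageE) (rule that)
  then show ?thesis
   using rho(3) hom_onD(2)[OF galois_hom_on(1)[OF sig] subring_Qbar] hom_onD(2)[OF rho(1) subring_Qbar] by metis
 qed
 obtain F where F: "F : polys_over Qbar n" "F (map_mat sig x) ~= 0"
  "ALL A:torsor M S. elements_mat A <= Qbar --> F A ~= 0 --> A : Y"
  by (rule component_separation[OF Y])
 obtain G where G: "G : polys_over Qbar n" "ALL A:Mat n. elements_mat A <= Qbar --> G (map_mat rho A) = rho (F A)"
  using polys_over_twist[OF F(1) rho(1,2)] by (elim bexE) (rule that)
 have GF: "G A = 0 \<longleftrightarrow> F (map_mat sig A) = 0" if A: "A : torsor M S" "elements_mat A <= Qbar" for A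
 proof -
  note sigA = galois_torsor[OF sig A]
  have Ac: "A : Mat n" "map_mat sig A : Mat n" using A(1) sigA(1) torsor_carrier by blast+
  have "rho (sig (A $$ (i, j))) = A $$ (i, j)" if "i < n" "j < n" for i j
   using rho(3) elements_mat_entry[OF Ac(1) that] A(2) by blast
  then have "map_mat rho (map_mat sig A) = A" using Ac(1) by (intro eq_matI) auto
  then show ?thesis using bspec[OF G(2) Ac(2)] sigA(2) rho0[OF polys_over_Qbar_value[OF F(1) Ac(2) sigA(2)]] by simp
 qed
 show thesis
 proof (rule that[OF G(1)])
  show "G x ~= 0" using GF[OF x] F(2) by simp
  show "ALL A:torsor M S. elements_mat A <= Qbar --> G A ~= 0 --> map_mat sig A : Y"
   using GF F(3) galois_torsor[OF sig] by simp
 qed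
qed

text \<open>Galois automorphisms do not act on complex points, so continuity cannot be invoked.
  Irreducibility of \<open>X\<close> yields a point where both pulled back polynomials are nonzero,
  and specializing it gives an algebraic point whose conjugate lies in \<open>Y\<close> and in
  \<open>Y'\<close>.\<close>

lemma galois_same_component:
 assumes sig: "sig : galois_group" and X: "X : torsor_components M S" and x: "x : Qbar_points X" and y: "y : Qbar_points X"
  and Y: "Y : torsor_components M S" "map_mat sig x : Y" and Y': "Y' : torsor_components M S" "map_mat sig y : Y'"
 shows "Y = Y'"
proof -
 note xD = Qbar_pointsD[OF X x] and yD = Qbar_pointsD[OF X y]
 obtain G where G: "G : polys_over Qbar n" "G x ~= 0"
  "ALL A:torsor M S. elements_mat A <= Qbar --> G A ~= 0 --> map_mat sig A : Y" by (rule galois_separation[OF sig xD(2,4) Y])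
 obtain G' where G': "G' : polys_over Qbar n" "G' y ~= 0"
  "ALL A:torsor M S. elements_mat A <= Qbar --> G' A ~= 0 --> map_mat sig A : Y'" by (rule galois_separation[OF sig yD(2,4) Y'])
 obtain z where z: "z : X" "G z ~= 0" "G' z ~= 0"
  using component_irreducible[OF X polys_over_mat_polys[OF G(1)] xD(1) G(2) polys_over_mat_polys[OF G'(1)] yD(1) G'(2)] by blast
 obtain x0 where "X <= torsor M S" using torsor_component_cases[OF X] by metis
 then have zT: "z : torsor M S" using z(1) by blast
 have "finite {inverse (G z), inverse (G' z)}" by simp
 from this obtain R tau where R: "subring_set R" "Qbar <= R" "{inverse (G z), inverse (G' z)} <= R" "elements_mat z <= R" "hom_on R tau" "tau ` R <= Qbar"
  "ALL a:Qbar. tau a = a" "map_mat tau z : torsor M S" "elements_mat (map_mat tau z) <= Qbar"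
  "ALL Q:polys_over Qbar n. Q z ~= 0 --> inverse (Q z) : {inverse (G z), inverse (G' z)} --> Q (map_mat tau z) ~= 0"
  by (rule qbar_specialization[OF zT])
 have "map_mat sig (map_mat tau z) : Y" "map_mat sig (map_mat tau z) : Y'"
  using bspec[OF R(10) G(1)] z(2) bspec[OF R(10) G'(1)] z(3) bspec[OF G(3) R(8)] bspec[OF G'(3) R(8)] R(9) by simp_all
 then show ?thesis by (rule torsor_components_disjoint[OF Y(1) Y'(1)])
qed

text \<open>The definite description in \<open>galois_component\<close> is justified by two facts: a
  component has algebraic points, and their conjugates share one component.\<close>

lemma galois_component:
 assumes sig: "sig : galois_group" and X: "X : torsor_components M S"
 shows "galois_component M S sig X : torsor_components M S & map_mat sig ` Qbar_points X <= galois_component M S sig X"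
proof -
 obtain x where x: "x : Qbar_points X" using Qbar_points_nonempty[OF X] ..
 note xD = Qbar_pointsD[OF X x]
 obtain Y where Y: "Y : torsor_components M S" "map_mat sig x : Y"
  using torsor_component_exists[OF galois_torsor(1)[OF sig xD(2,4)]] by blast
 have sub: "map_mat sig ` Qbar_points X <= Y"
 proof
  fix u assume "u : map_mat sig ` Qbar_points X"
  then obtain y where y: "u = map_mat sig y" "y : Qbar_points X" by blast
  note yD = Qbar_pointsD[OF X y(2)]
  obtain Y' where Y': "Y' : torsor_components M S" "map_mat sig y : Y'"
   using torsor_component_exists[OF galois_torsor(1)[OF sig yD(2,4)]] by blast
  show "u : Y" using galois_same_component[OF sig X x y(2) Y Y'] Y'(2) y(1) by simp
 qed
 show ?thesis unfolding galois_component_def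
 proof (rule theI2)
  show "Y : torsor_components M S & map_mat sig ` Qbar_points X <= Y" using Y(1) sub by blast
  show "Z = Y" if "Z : torsor_components M S & map_mat sig ` Qbar_points X <= Z" for Z
   using torsor_components_disjoint[of Z Y "map_mat sig x"] that Y x by blast
 qed simp
qed

section \<open>The field of definition of the ratio\<close>

lemma D_hom_on:
 assumes eps: "eps * eps = 1" and tau: "hom_on R tau" "subring_set R" and rat: "!!q. of_rat q : R"
  and x: "x : Mat n" "elements_mat x <= R" and bet: "bet : Bq"
 shows "nf.kap bet (D eps x) : R" "nf.kap bet (D eps (map_mat tau x)) = tau (nf.kap bet (D eps x))"
proof -
 obtain f where f: "f : rat_polys n" "ALL g:Mat n. nf.kap bet (D eps g) = f g" using D_kap[OF eps bet] by (elim bexE) (rule that)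
 have "map_mat tau x : Mat n" using x by simp
 then show "nf.kap bet (D eps x) : R" "nf.kap bet (D eps (map_mat tau x)) = tau (nf.kap bet (D eps x))"
  using rat_polys_hom_on[OF f(1) tau rat x] bspec[OF f(2)] x(1) by simp_all
qed

text \<open>Applying \<open>tau\<close> to the relation at \<open>x\<close> gives the relation at
  the image of \<open>x\<close> with \<open>tau\<close> applied to \<open>s\<close>. There it also
  holds with \<open>s\<close> itself, and the determinant that multiplies \<open>s\<close> is a
  unit. Both signs of \<open>eps\<close> occur, for the ratio and for its inverse.\<close>

lemma ratio_fixed:
 assumes eps: "eps * eps = 1" and tau: "hom_on R tau" "subring_set R" and rat: "!!q. of_rat q : R"
  and x: "x : Mat n" "elements_mat x <= R"
  and s: "!!bet. bet : Bq ==> nf.kap bet s : R" "D eps x = s * D (- eps) x" "D eps (map_mat tau x) = s * D (- eps) (map_mat tau x)"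
  and y: "D (- eps) x * y = 1" "!!bet. bet : Bq ==> nf.kap bet y : R" and bet: "bet : Bq"
 shows "tau (nf.kap bet s) = nf.kap bet s"
proof -
 have eps': "- eps * - eps = 1" using eps by simp
 let ?x = "map_mat tau x"
 note Dx = D_hom_on[OF eps' tau rat x] and Dx1 = D_hom_on[OF eps tau rat x]
 have "D (- eps) ?x * nf.tmap tau y = 1"
 proof (rule nf.qtensor_eqI)
  fix gam assume gam: "gam : Bq"
  have "nf.kap gam (D (- eps) ?x * nf.tmap tau y) = tau (nf.kap gam (D (- eps) x * y))"
   using nf.kap_hom_on_mult[OF tau rat Dx(1) y(2) Dx(2) nf.kap_tmap gam] by blast
  also have "... = nf.kap gam 1" unfolding y(1) nf.kap_one by (rule hom_on_of_rat[OF tau rat])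
  finally show "nf.kap gam (D (- eps) ?x * nf.tmap tau y) = nf.kap gam 1" .
 qed
 note unit = this
 have "nf.tmap tau s * D (- eps) ?x = D eps ?x"
 proof (rule nf.qtensor_eqI)
  fix gam assume gam: "gam : Bq"
  have "nf.kap gam (nf.tmap tau s * D (- eps) ?x) = tau (nf.kap gam (s * D (- eps) x))"
   using nf.kap_hom_on_mult[OF tau rat s(1) Dx(1) nf.kap_tmap Dx(2) gam] by blast
  then show "nf.kap gam (nf.tmap tau s * D (- eps) ?x) = nf.kap gam (D eps ?x)" using Dx1(2)[OF gam] s(2) by simp
 qed
 then have "nf.tmap tau s * (D (- eps) ?x * nf.tmap tau y) = s * (D (- eps) ?x * nf.tmap tau y)"
  unfolding s(3) by (simp add: mult.assoc[symmetric])
 then have "nf.tmap tau s = s" unfolding unit by simp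
 then show ?thesis using nf.kap_tmap[OF bet, of tau s] by simp
qed

lemma torsor0_component: "torsor0 M S : torsor_components M S"
proof -
 have t: "topspace (subtopology (zariski n) (torsor M S)) = torsor M S"
  using torsor_carrier by (auto simp: topspace_zariski)
 show ?thesis unfolding torsor_components_def torsor0_def connected_components_of_def t using c_torsor by blast
qed

text \<open>At an algebraic point of the component of \<open>c\<close> the quotient of the
  determinants has algebraic coordinates and equals \<open>s\<close>. A Galois automorphism that
  permutes the components in \<open>\<X>\<close> keeps the conjugate point inside their union, so it
  fixes these coordinates.\<close>

lemma ratio_descent:
 assumes eps: "eps * eps = 1" and X: "\<X> <= torsor_components M S" "torsor0 M S : \<X>"
  and s: "!!X g. X : \<X> ==> g : X ==> D eps g = s * D (- eps) g"
 shows "s : tensor_sub (definition_field M S \<X>)"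
proof (rule nf.kap_in_tensor_sub)
 fix bet assume bet: "bet : Bq"
 have eps': "- eps * - eps = 1" using eps by simp
 obtain u where u: "D (- eps) c * u = 1" using D_unit[OF eps'] ..
 obtain F where F: "F : polys_over Qbar n" "F c ~= 0"
  "ALL A:torsor M S. elements_mat A <= Qbar --> F A ~= 0 --> A : torsor0 M S"
  by (rule component_separation[OF torsor0_component torsor0_subset(2)])
 \<comment> \<open>\<open>inverse (F c)\<close> keeps the specialized point in the component of
   \<open>c\<close>; the coordinates of \<open>u\<close> provide an inverse of the determinant at
   that point.\<close>
 let ?Z = "insert (inverse (F c)) ((%gam. nf.kap gam u) ` Bq)"
 have "finite ?Z" using Bq(1) by simp
 from this obtain R tau where R: "subring_set R" "Qbar <= R" "?Z <= R" "elements_mat c <= R" "hom_on R tau" "tau ` R <= Qbar"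
  "ALL a:Qbar. tau a = a" "map_mat tau c : torsor M S" "elements_mat (map_mat tau c) <= Qbar"
  "ALL Q:polys_over Qbar n. Q c ~= 0 --> inverse (Q c) : ?Z --> Q (map_mat tau c) ~= 0"
  by (rule qbar_specialization[OF c_torsor])
 let ?g = "map_mat tau c" and ?y = "nf.tmap tau u"
 have g0: "?g : torsor0 M S" using bspec[OF F(3) R(8)] R(9) bspec[OF R(10) F(1)] F(2) by simp
 have gc: "?g : Mat n" using c_carrier by simp
 have ratR: "of_rat q : R" for q using R(2) of_rat_in_Qbar by blast
 have uR: "nf.kap gam u : R" if "gam : Bq" for gam using R(3) that by blast
 have y: "D (- eps) ?g * ?y = 1"
 proof (rule nf.qtensor_eqI)
  fix gam assume gam: "gam : Bq"
  note Dc = D_hom_on[OF eps' R(5,1) ratR c_carrier(1) R(4)]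
  have "nf.kap gam (D (- eps) ?g * ?y) = tau (nf.kap gam (D (- eps) c * u))"
   using nf.kap_hom_on_mult[OF R(5,1) ratR Dc(1) uR Dc(2) nf.kap_tmap gam] by blast
  also have "... = nf.kap gam 1" unfolding u nf.kap_one by (rule hom_on_of_rat[OF R(5,1) ratR])
  finally show "nf.kap gam (D (- eps) ?g * ?y) = nf.kap gam 1" .
 qed
 have yQ: "nf.kap gam ?y : Qbar" if "gam : Bq" for gam
  unfolding nf.kap_tmap[OF that] using uR[OF that] R(6) by blast
 have idQ: "hom_on Qbar (%x. x)" by (simp add: hom_on_def)
 have Dg: "D eps ?g = s * D (- eps) ?g" by (rule s[OF X(2) g0])
 have sQ: "nf.kap gam s : Qbar" if gam: "gam : Bq" for gam
 proof -
  have "s = D eps ?g * ?y" using y unfolding Dg by (simp add: mult.assoc)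
  moreover have "nf.kap gam (D eps ?g * ?y) : Qbar & nf.kap gam (D eps ?g * ?y) = nf.kap gam (D eps ?g * ?y)"
   by (rule nf.kap_hom_on_mult[OF idQ subring_Qbar of_rat_in_Qbar
     D_hom_on(1)[OF eps idQ subring_Qbar of_rat_in_Qbar gc R(9)] yQ HOL.refl HOL.refl gam])
  ultimately show ?thesis by simp
 qed
 have "sig (nf.kap bet s) = nf.kap bet s" if sig: "sig : galois_group" "galois_component M S sig ` \<X> = \<X>" for sig
 proof -
  have "map_mat sig ?g : galois_component M S sig (torsor0 M S)"
   using galois_component[OF sig(1) torsor0_component] g0 R(9) by (auto simp: Qbar_points_def)
  moreover have "galois_component M S sig (torsor0 M S) : \<X>" using sig(2) X(2) by blast
  ultimately have "D eps (map_mat sig ?g) = s * D (- eps) (map_mat sig ?g)" using s by blast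
  from ratio_fixed[OF eps galois_hom_on(1)[OF sig(1)] subring_Qbar of_rat_in_Qbar gc R(9) sQ Dg this y yQ bet] show ?thesis .
 qed
 then show "nf.kap bet s : definition_field M S \<X>" unfolding definition_field_def using sQ[OF bet] by blast
qed

text \<open>The inverse of the ratio satisfies the same relations with the signs exchanged, so it
  descends as well.\<close>

lemma ratio_tensor_sub_units:
 assumes X: "\<X> <= torsor_components M S" "torsor0 M S : \<X>"
  and r: "!!X g. X : \<X> ==> g : X ==> D 1 g = ratio * D (- 1) g"
 shows "ratio : tensor_sub_units (definition_field M S \<X>)"
proof -
 obtain u where u: "D 1 c * u = 1" using D_unit[of 1] by auto
 define r' where "r' = D (- 1) c * u"
 have rr: "ratio * r' = 1" unfolding r'_def mult.assoc[symmetric] ratio by (rule u)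
 have "D (- 1) g = r' * D 1 g" if "X : \<X>" "g : X" for X g
  unfolding r[OF that] mult.assoc[symmetric] mult.commute[of r'] rr by simp
 then have "r' : tensor_sub (definition_field M S \<X>)" using ratio_descent[OF _ X, of "- 1" r'] by simp
 moreover have "ratio : tensor_sub (definition_field M S \<X>)" by (rule ratio_descent[of 1, OF _ X]) (simp_all add: r)
 ultimately show ?thesis unfolding tensor_sub_units_def using rr by blast
qed

lemma part_i:
 assumes "ALL z:frob_identity_component M S. chi M 1 z = chi M (- 1) z"
 shows "EX x:tensor_sub_units (K0 M S). period_ratio M = E_class x"
proof -
 have "ratio : tensor_sub_units (K0 M S)" unfolding K0_def
  by (rule ratio_tensor_sub_units) (use torsor0_component defect_torsor0 assms in auto)
 then show ?thesis using period_ratio_eq by blast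
qed

lemma part_ii:
 assumes chi: "ALL z:Zfrob M S. chi M 1 z = chi M (- 1) z"
 shows "EX x:tensor_sub_units (K1 M S). period_ratio M = E_class x"
proof -
 have oneP: "1\<^sub>m n : PdR M S"
 proof -
  have "ap (1\<^sub>m n) v = v" if "v : cspan (fil M p)" for v p
   using that cspan_coord_space[OF fil(2)] by (intro mapply_one) blast
  then have "ap (1\<^sub>m n) ` cspan (fil M p) = cspan (fil M p)" for p by force
  then show ?thesis using TS.iso_one[of True] unfolding PdR_def GdR_iso by blast
 qed
 have oneZ: "1\<^sub>m n : Zfrob M S" unfolding Zfrob_def
  using GB_one left_mult_one_mat[OF Fc_carrier] right_mult_one_mat[OF Fc_carrier] by simp
 have "g = 1\<^sub>m n * g * 1\<^sub>m n" if "g : torsor0 M S" for g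
  using that torsor0_subset(1) torsor_carrier by (simp add: subset_iff left_mult_one_mat[of g n n] right_mult_one_mat[of g n n])
 \<comment> \<open>The component of \<open>c\<close> must belong to the union, since the descent
   starts from a point of it.\<close>
 then have sub: "torsor0 M S <= {p * g * z | p g z. p : PdR M S & g : torsor0 M S & z : Zfrob M S}"
  using oneP oneZ by blast
 have "ratio : tensor_sub_units (K1 M S)" unfolding K1_def
 proof (rule ratio_tensor_sub_units)
  fix X g assume "X : {X : torsor_components M S. X <= {p * g * z | p g z. p : PdR M S & g : torsor0 M S & z : Zfrob M S}}" "g : X"
  then obtain p h z where "g = p * h * z" "p : PdR M S" "h : torsor0 M S" "z : Zfrob M S" by blast
  then show "D 1 g = ratio * D (- 1) g" using defect_translates chi by simp
 qed (use torsor0_component sub in auto)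
 then show ?thesis using period_ratio_eq by blast
qed

text \<open>The torsor is the translate of the group by \<open>c\<close>, hence connected together
  with it.\<close>

lemma torsor0_connected:
 assumes "connectedin (zariski n) (GB M S)"
 shows "torsor0 M S = torsor M S"
proof -
 have "torsor M S = (%A. c * A) ` GB M S"
 proof (intro equalityI subsetI)
  fix g assume g: "g : torsor M S"
  then have gc: "g : Mat n" using torsor_carrier by blast
  have "g = c * (minv c * g)" using assoc_mult_mat[OF c_carrier(1,2) gc] c_carrier(3) left_mult_one_mat[OF gc] by simp
  then show "g : (%A. c * A) ` GB M S" using torsor_quotient(2)[OF c_torsor g] by blast
 qed (use torsor_mult(1)[OF c_torsor] in blast)
 then have "connectedin (zariski n) (torsor M S)"
  using connectedin_continuous_map_image[OF continuous_map_zariski_mult_left[OF c_carrier(1)] assms] by simp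
 then have "connectedin (subtopology (zariski n) (torsor M S)) (torsor M S)" by (simp add: connectedin_subtopology)
 then have "torsor M S <= torsor0 M S" unfolding torsor0_def by (rule connected_component_of_maximal[OF _ c_torsor])
 then show ?thesis using torsor0_subset(1) by blast
qed

text \<open>There is one component only, so every specialization of \<open>c\<close> satisfies the
  same relation. An irrational coordinate of the ratio could be moved by an embedding extended to
  such a specialization, against \<open>ratio_fixed\<close>; with rational coordinates the ratio
  comes from \<open>E\<close>.\<close>

lemma part_ii_connected:
 assumes chi: "ALL z:Zfrob M S. chi M 1 z = chi M (- 1) z" and con: "connectedin (zariski n) (GB M S)"
 shows "period_ratio M = E_class 1"
proof -
 have rel: "D 1 g = ratio * D (- 1) g" if "g : torsor M S" for g
  using defect_torsor0[of g] chi frob_identity_component_subset that torsor0_connected[OF con] by blast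
 have "nf.kap bet ratio : Rats" if bet: "bet : Bq" for bet
 proof (rule ccontr)
  assume "nf.kap bet ratio ~: Rats"
  from moving_hom_exists[OF this] obtain A tau where A: "subring_set A" "nf.kap bet ratio : A" "ALL q. of_rat q : A" "hom_on A tau"
   "ALL u:A. u ~= 0 --> tau u ~= 0" "tau (nf.kap bet ratio) ~= nf.kap bet ratio" by (elim exE conjE) (rule that)
  obtain u where u: "D (- 1) c * u = 1" using D_unit[of "- 1"] by auto
  let ?Z = "(%gam. nf.kap gam u) ` Bq Un (%gam. nf.kap gam ratio) ` Bq"
  have "finite ?Z" using Bq(1) by simp
  then obtain R tau' where R: "subring_set R" "A <= R" "?Z <= R" "elements_mat c <= R" "hom_on R tau'" "tau' ` R <= UNIV"
   "ALL a:A. tau' a = tau a" "map_mat tau' c : torsor M S"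
  proof (rule torsor_specialization[OF c_torsor A(1) _ alg_closed_UNIV A(4) subset_UNIV, rotated 2])
   show "of_rat q : A" for q using A(3) by blast
   show "tau u ~= 0" if "u : A" "u ~= 0" for u using A(5) that by blast
  qed
  have ratR: "of_rat q : R" for q using A(3) R(2) by blast
  have "tau' (nf.kap bet ratio) = nf.kap bet ratio"
   by (rule ratio_fixed[of 1, OF _ R(5,1) ratR c_carrier(1) R(4) _ rel[OF c_torsor] rel[OF R(8)] u _ bet]) (use R(3) in auto)
  then show False using A(2,6) R(7) by simp
 qed
 then have "ALL bet. EX q. bet : Bq --> nf.kap bet ratio = of_rat q" by (metis Rats_cases)
 from choice[OF this] obtain q where q: "ALL bet. bet : Bq --> nf.kap bet ratio = of_rat (q bet)" ..
 define e where "e = (SUM bet:Bq. of_rat (q bet) * bet)"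
 have "ratio = (SUM bet:Bq. ptens bet (of_rat (q bet)))"
  by (subst nf.kap_expand[of ratio]) (use q in \<open>simp cong: sum.cong\<close>)
 also have "... = ptens e 1" unfolding e_def pure_tensor_sum by (simp add: pure_tensor_simps)
 finally have re: "ratio = ptens e 1" .
 have "e ~= 0"
 proof
  assume "e = 0"
  then have "ratio = 0" using re by (simp add: pure_tensor_simps)
  then have "D 1 c = 0" using ratio by simp
  then show False using D_unit[of 1] by simp
 qed
 then show ?thesis using E_class_mult[of e 1] unfolding period_ratio_eq re by simp
qed

end

theorem theorem2p6p1:
  fixes M :: "'e::field_char_0 bdr_system" and S :: mult_structure
  assumes "number_field TYPE('e)"
    and "bdr_system M"
    and "multilinear_structure M S"
    and "contains_E_structure M S"
    and "even (weight M) \<Longrightarrow> hodgeM M (weight M div 2) (weight M div 2) = {0}"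
  shows
    "((\<forall>z\<in>frob_identity_component M S. chi M 1 z = chi M (- 1) z) \<longrightarrow>
        (\<exists>x\<in>tensor_sub_units (K0 M S). period_ratio M = E_class x)) \<and>
     ((\<forall>z\<in>Zfrob M S. chi M 1 z = chi M (- 1) z) \<longrightarrow>
        (\<exists>x\<in>tensor_sub_units (K1 M S). period_ratio M = E_class x) \<and>
        (connectedin (zariski (dim M)) (GB M S) \<longrightarrow> period_ratio M = E_class 1))"
proof -
  interpret bdr M S by unfold_locales (use assms in auto)
  show ?thesis using part_i part_ii part_ii_connected by blast
qed

end
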